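(* The $C_0$-semigroup $\{e^{\mathcal{A}_2t}\}_{t\ge0}$ generated by $\mathcal{A}_2$ on $\mathcal{H}_2$ is exponentially stable: there exist constants $M,\omega>0$ (independent of $t$) such that $$\|e^{\mathcal{A}_2t}\|_{\mathcal{L}(\mathcal{H}_2\to\mathcal{H}_2)}\le Me^{-\omega t}\quad\text{for all }t\ge0.$$
   Context: Let $L>0$, let $\rho,\rho_1,\rho_2,\rho_3,\alpha,\kappa,b,\tau,\sigma,\beta,\gamma>0$ and $m\in\mathbb{R}\setminus\{0\}$ be constants, and let $\mathbb{R}^+=[0,\infty)$. The memory kernel $g\in L^1(\mathbb{R}^+)\cap C^1(\mathbb{R}^+)$ is a nonnegative function such that $\tilde b:=b-b_0>0$, where $b_0=\int_0^\infty g(s)\,ds$, and $g'(s)\le-\kappa_1g(s)$ for all $s\in\mathbb{R}^+$, with a constant $\kappa_1>0$. All functions of $x\in(0,L)$ are complex-valued; $L^2=L^2(0,L)$, $H^1=H^1(0,L)$, $H^2=H^2(0,L)$, $H_0^1=H_0^1(0,L)$; $(\cdot,\cdot)$ and $\|\cdot\|$ denote the inner product and norm of $L^2$. Let $L_*^2=\{\omega\in L^2:\int_0^L\omega\,dx=0\}$, $H_*^1=H^1\cap L_*^2$, and let $L_g^2(\mathbb{R}^+;H_0^1)=\{\omega:\sqrt g\,\omega\in L^2(\mathbb{R}^+;H_0^1)\}$, with norm $\|\omega\|_{L_g^2(\mathbb{R}^+;H_0^1)}^2=\int_0^\infty g(s)\|\omega_x(s)\|^2ds$. Put $$\mathcal{H}_2=H_*^1\times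 L_*^2\times H_*^1\times L_*^2\times H_0^1\times L^2\times L^2\times L^2\times L_g^2(\mathbb{R}^+;H_0^1),$$ with elements $U=(u,v,\varphi,\Phi,\psi,\Psi,\theta,q,\eta)$; it is a Hilbert space with the inner product inducing the norm $$\|U\|_{\mathcal{H}_2}^2=\rho\|v\|^2+\alpha\|u_x\|^2+\rho_1\|\Phi\|^2+\rho_2\|\Psi\|^2+\tilde b\|\psi_x\|^2+\beta\|\varphi-u\|^2+\kappa\|\varphi_x+\psi\|^2+\rho_3\|\theta\|^2+\tau\|q\|^2+\|\eta\|_{L_g^2(\mathbb{R}^+;H_0^1)}^2.$$ The linear operator $\mathcal{A}_2$ has domain $$\mathcal{D}(\mathcal{A}_2)=\Big\{U\in\mathcal{H}_2: v,\Phi\in H_*^1;\ u_x,\varphi_x,\theta,\Psi\in H_0^1;\ \tilde b\psi+\int_0^\infty g(s)\eta(s)\,ds\in H^2;\ q\in H^1;\ \eta_s\in L_g^2(\mathbb{R}^+;H_0^1);\ \eta(\cdot,0)=0\Big\}$$ and is given by $$\mathcal{A}_2U=\begin{pmatrix} v\\ \rho^{-1}[\alpha u_{xx}+\beta(\varphi-u)-\gamma v]\\ \Phi\\ \rho_1^{-1}[\kappa(\varphi_x+\psi)_x-\beta(\varphi-u)-m\theta_x]\\ \Psi\\ \rho_2^{-1}[\tilde b\psi_{xx}-\kappa(\varphi_x+\psi)+\int_0^\infty g(s)\eta_{xx}(s)\,ds+m\theta]\\ \rho_3^{-1}[-q_x-m(\Phi_x+\Psi)]\\ \tau^{-1}(-\sigma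 q-\theta_x)\\ \Psi-\eta_s\end{pmatrix},$$ where $\tilde b\psi_{xx}+\int_0^\infty g(s)\eta_{xx}(s)\,ds$ means $\big(\tilde b\psi+\int_0^\infty g(s)\eta(s)\,ds\big)_{xx}\in L^2$. It generates a $C_0$-semigroup of contractions on $\mathcal{H}_2$.
   Formalization: The memory kernel g is assumed not identically zero; for g ≡ 0, which the stated assumptions literally allow, the memory damping vanishes, the condition η(·,0)=0 loses its meaning, and exponential stability fails for generic coefficients. *)

theory Defs
  imports "HOL-Analysis.Analysis"
begin

text \<open>
  Elements of Lebesgue and Sobolev spaces are given by representatives, and equality in a space
  means that the (semi)norm of the difference vanishes.  All notions below depend only
  on the classes of the representatives; for this it matters that the underlying measures
  are the complete ones.
\<close>

section \<open>Sobolev spaces on an interval\<close>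

definition smooth :: "(real \<Rightarrow> complex) \<Rightarrow> bool" where
  "smooth \<phi> \<longleftrightarrow>
     (\<exists>D. D 0 = \<phi> \<and> (\<forall>k x. (D k has_vector_derivative D (Suc k) x) (at x)))"

definition test_functions :: "real set \<Rightarrow> (real \<Rightarrow> complex) set" where
  "test_functions S =
     {\<phi>. smooth \<phi> \<and> (\<exists>K. compact K \<and> K \<subseteq> S \<and> (\<forall>x. x \<notin> K \<longrightarrow> \<phi> x = 0))}"

abbreviation interval_measure_on :: "real \<Rightarrow> real measure" where
  "interval_measure_on L \<equiv> lebesgue_on {0<..<L}"

abbreviation halfline :: "real measure" where
  "halfline \<equiv> lebesgue_on {0..}"

definition L2 :: "real \<Rightarrow> (real \<Rightarrow> complex) set" where
  "L2 L = {f. f \<in> borel_measurable (interval_measure_on L) \<and>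
              integrable (interval_measure_on L) (\<lambda>x. (cmod (f x))\<^sup>2)}"

definition L2_norm :: "real \<Rightarrow> (real \<Rightarrow> complex) \<Rightarrow> real" where
  "L2_norm L f = sqrt (LINT x|interval_measure_on L. (cmod (f x))\<^sup>2)"

definition has_weak_deriv :: "real \<Rightarrow> (real \<Rightarrow> complex) \<Rightarrow> (real \<Rightarrow> complex) \<Rightarrow> bool" where
  "has_weak_deriv L f h \<longleftrightarrow> f \<in> L2 L \<and> h \<in> L2 L \<and>
     (\<forall>\<phi> \<in> test_functions {0<..<L}.
        (LINT x|interval_measure_on L. f x * vector_derivative \<phi> (at x)) =
        - (LINT x|interval_measure_on L. h x * \<phi> x))"

definition weak_deriv :: "real \<Rightarrow> (real \<Rightarrow> complex) \<Rightarrow> real \<Rightarrow> complex" where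
  "weak_deriv L f = (SOME h. has_weak_deriv L f h)"

definition H1 :: "real \<Rightarrow> (real \<Rightarrow> complex) set" where
  "H1 L = {f. \<exists>h. has_weak_deriv L f h}"

definition H1_norm :: "real \<Rightarrow> (real \<Rightarrow> complex) \<Rightarrow> real" where
  "H1_norm L f = sqrt ((L2_norm L f)\<^sup>2 + (L2_norm L (weak_deriv L f))\<^sup>2)"

definition H2 :: "real \<Rightarrow> (real \<Rightarrow> complex) set" where
  "H2 L = {f \<in> H1 L. weak_deriv L f \<in> H1 L}"

definition H10 :: "real \<Rightarrow> (real \<Rightarrow> complex) set" where
  "H10 L = {f \<in> H1 L. \<exists>\<phi>. (\<forall>n::nat. \<phi> n \<in> test_functions {0<..<L}) \<and>
                         (\<lambda>n. H1_norm L (\<lambda>x. f x - \<phi> n x)) \<longlonglongrightarrow> 0}"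

definition H10_norm :: "real \<Rightarrow> (real \<Rightarrow> complex) \<Rightarrow> real" where
  "H10_norm L f = L2_norm L (weak_deriv L f)"

definition L2_mean0 :: "real \<Rightarrow> (real \<Rightarrow> complex) set" where
  "L2_mean0 L = {f \<in> L2 L. (LINT x|interval_measure_on L. f x) = 0}"

definition H1_mean0 :: "real \<Rightarrow> (real \<Rightarrow> complex) set" where
  "H1_mean0 L = H1 L \<inter> L2_mean0 L"

section \<open>Functions on the half-line with values in \<open>H10 L\<close>\<close>

definition strongly_measurable :: "real \<Rightarrow> (real \<Rightarrow> real \<Rightarrow> complex) \<Rightarrow> bool" where
  "strongly_measurable L F \<longleftrightarrow>
     (AE s in halfline. F s \<in> H10 L) \<and>
     (\<exists>S. (\<forall>n::nat. simple_function halfline (S n) \<and> (\<forall>s\<ge>0. S n s \<in> H10 L)) \<and>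
          (AE s in halfline. (\<lambda>n. H10_norm L (\<lambda>x. F s x - S n s x)) \<longlonglongrightarrow> 0))"

definition simple_integral_H10 :: "(real \<Rightarrow> real \<Rightarrow> complex) \<Rightarrow> real \<Rightarrow> complex" where
  "simple_integral_H10 S =
     (\<lambda>x. \<Sum>y \<in> S ` {0..}. of_real (measure halfline {s \<in> {0..}. S s = y}) * y x)"

text \<open>
  The Bochner integral over the half-line of a function with values in \<open>H10 L\<close>, following
  \<^const>\<open>has_bochner_integral\<close>, which is not applicable because \<open>H10 L\<close> is not a type.  The integral
  is not taken pointwise in \<open>x\<close>, as the representatives of \<open>F s\<close> are unrelated for different \<open>s\<close>.
\<close>

definition has_integral_H10 ::
    "real \<Rightarrow> (real \<Rightarrow> real \<Rightarrow> complex) \<Rightarrow> (real \<Rightarrow> complex) \<Rightarrow> bool" where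
  "has_integral_H10 L F w \<longleftrightarrow> strongly_measurable L F \<and> w \<in> H10 L \<and>
     (\<exists>S. (\<forall>n::nat. simple_function halfline (S n) \<and> (\<forall>s\<ge>0. S n s \<in> H10 L) \<and>
                emeasure halfline {s \<in> {0..}. S n s \<noteq> (\<lambda>x. 0)} \<noteq> \<infinity>) \<and>
          (\<lambda>n. \<integral>\<^sup>+ s. ennreal (H10_norm L (\<lambda>x. F s x - S n s x)) \<partial>halfline) \<longlonglongrightarrow> 0 \<and>
          (\<lambda>n. H10_norm L (\<lambda>x. simple_integral_H10 (S n) x - w x)) \<longlonglongrightarrow> 0)"

definition integral_H10 :: "real \<Rightarrow> (real \<Rightarrow> real \<Rightarrow> complex) \<Rightarrow> real \<Rightarrow> complex" where
  "integral_H10 L F = (SOME w. has_integral_H10 L F w)"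

definition L2_H10 :: "real \<Rightarrow> (real \<Rightarrow> real \<Rightarrow> complex) set" where
  "L2_H10 L = {F. strongly_measurable L F \<and> integrable halfline (\<lambda>s. (H10_norm L (F s))\<^sup>2)}"

definition L2g :: "real \<Rightarrow> (real \<Rightarrow> real) \<Rightarrow> (real \<Rightarrow> real \<Rightarrow> complex) set" where
  "L2g L g = {\<omega>. (\<lambda>s x. of_real (sqrt (g s)) * \<omega> s x) \<in> L2_H10 L}"

definition L2g_norm :: "real \<Rightarrow> (real \<Rightarrow> real) \<Rightarrow> (real \<Rightarrow> real \<Rightarrow> complex) \<Rightarrow> real" where
  "L2g_norm L g \<omega> = sqrt (LINT s|halfline. g s * (H10_norm L (\<omega> s))\<^sup>2)"

text \<open>
  An element of \<open>L2g L g\<close> is determined only where \<open>g > 0\<close>.  For a kernel that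
  vanishes from some point on, the derivative in \<open>s\<close> and the trace at \<open>s = 0\<close> therefore refer to
  the interval \<open>{s. g s > 0}\<close>; for \<open>g > 0\<close> this is the whole half-line.
\<close>

definition has_s_deriv ::
    "real \<Rightarrow> (real \<Rightarrow> real) \<Rightarrow> (real \<Rightarrow> real \<Rightarrow> complex) \<Rightarrow> (real \<Rightarrow> real \<Rightarrow> complex) \<Rightarrow> bool" where
  "has_s_deriv L g \<eta> \<zeta> \<longleftrightarrow> \<eta> \<in> L2g L g \<and> \<zeta> \<in> L2g L g \<and>
     (\<forall>\<phi> \<in> test_functions {s. 0 < s \<and> 0 < g s}. \<exists>w.
        has_integral_H10 L (\<lambda>s x. vector_derivative \<phi> (at s) * \<eta> s x) w \<and>
        has_integral_H10 L (\<lambda>s x. \<phi> s * \<zeta> s x) (\<lambda>x. - w x))"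

definition s_deriv ::
    "real \<Rightarrow> (real \<Rightarrow> real) \<Rightarrow> (real \<Rightarrow> real \<Rightarrow> complex) \<Rightarrow> real \<Rightarrow> real \<Rightarrow> complex" where
  "s_deriv L g \<eta> = (SOME \<zeta>. has_s_deriv L g \<eta> \<zeta>)"

text \<open>\<open>\<eta>(\<cdot>,0) = 0\<close>: the continuous representative of \<open>\<eta>\<close> vanishes at \<open>s = 0\<close>.\<close>

definition zero_initial_trace ::
    "real \<Rightarrow> (real \<Rightarrow> real) \<Rightarrow> (real \<Rightarrow> real \<Rightarrow> complex) \<Rightarrow> bool" where
  "zero_initial_trace L g \<eta> \<longleftrightarrow> (let J = {s. 0 \<le> s \<and> 0 < g s} in
     \<exists>\<zeta>. (\<forall>s\<in>J. \<zeta> s \<in> H10 L) \<and>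
         (AE s in halfline. s \<in> J \<longrightarrow> H10_norm L (\<lambda>x. \<eta> s x - \<zeta> s x) = 0) \<and>
         (\<forall>s\<in>J. ((\<lambda>r. H10_norm L (\<lambda>x. \<zeta> r x - \<zeta> s x)) \<longlongrightarrow> 0) (at s within J)) \<and>
         H10_norm L (\<zeta> 0) = 0)"

section \<open>The energy space and the operator\<close>

text \<open>Order of the components: \<open>(u, v, \<phi>, \<Phi>, \<psi>, \<Psi>, \<theta>, q, \<eta>)\<close>.\<close>

type_synonym state =
  "(real \<Rightarrow> complex) \<times> (real \<Rightarrow> complex) \<times> (real \<Rightarrow> complex) \<times> (real \<Rightarrow> complex) \<times>
   (real \<Rightarrow> complex) \<times> (real \<Rightarrow> complex) \<times> (real \<Rightarrow> complex) \<times> (real \<Rightarrow> complex) \<times>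
   (real \<Rightarrow> real \<Rightarrow> complex)"

fun lincomb :: "complex \<Rightarrow> state \<Rightarrow> complex \<Rightarrow> state \<Rightarrow> state" where
  "lincomb a (u, v, \<phi>, \<Phi>, \<psi>, \<Psi>, \<theta>, q, \<eta>) c (u', v', \<phi>', \<Phi>', \<psi>', \<Psi>', \<theta>', q', \<eta>') =
     (\<lambda>x. a * u x + c * u' x, \<lambda>x. a * v x + c * v' x,
      \<lambda>x. a * \<phi> x + c * \<phi>' x, \<lambda>x. a * \<Phi> x + c * \<Phi>' x,
      \<lambda>x. a * \<psi> x + c * \<psi>' x, \<lambda>x. a * \<Psi> x + c * \<Psi>' x,
      \<lambda>x. a * \<theta> x + c * \<theta>' x, \<lambda>x. a * q x + c * q' x,
      \<lambda>s x. a * \<eta> s x + c * \<eta>' s x)"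

definition kernel_mass :: "(real \<Rightarrow> real) \<Rightarrow> real" where
  "kernel_mass g = (LINT s|halfline. g s)"

definition energy_space :: "real \<Rightarrow> (real \<Rightarrow> real) \<Rightarrow> state set" where
  "energy_space L g = {(u, v, \<phi>, \<Phi>, \<psi>, \<Psi>, \<theta>, q, \<eta>).
     u \<in> H1_mean0 L \<and> v \<in> L2_mean0 L \<and> \<phi> \<in> H1_mean0 L \<and> \<Phi> \<in> L2_mean0 L \<and>
     \<psi> \<in> H10 L \<and> \<Psi> \<in> L2 L \<and> \<theta> \<in> L2 L \<and> q \<in> L2 L \<and> \<eta> \<in> L2g L g}"

fun energy_norm ::
    "real \<Rightarrow> real \<Rightarrow> real \<Rightarrow> real \<Rightarrow> real \<Rightarrow> real \<Rightarrow> real \<Rightarrow> real \<Rightarrow> real \<Rightarrow> real \<Rightarrow>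
     (real \<Rightarrow> real) \<Rightarrow> state \<Rightarrow> real" where
  "energy_norm L \<rho> \<rho>\<^sub>1 \<rho>\<^sub>2 \<rho>\<^sub>3 \<alpha> \<kappa> b \<tau> \<beta> g (u, v, \<phi>, \<Phi>, \<psi>, \<Psi>, \<theta>, q, \<eta>) = sqrt (
     \<rho> * (L2_norm L v)\<^sup>2 + \<alpha> * (L2_norm L (weak_deriv L u))\<^sup>2 +
     \<rho>\<^sub>1 * (L2_norm L \<Phi>)\<^sup>2 + \<rho>\<^sub>2 * (L2_norm L \<Psi>)\<^sup>2 +
     (b - kernel_mass g) * (L2_norm L (weak_deriv L \<psi>))\<^sup>2 +
     \<beta> * (L2_norm L (\<lambda>x. \<phi> x - u x))\<^sup>2 +
     \<kappa> * (L2_norm L (\<lambda>x. weak_deriv L \<phi> x + \<psi> x))\<^sup>2 +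
     \<rho>\<^sub>3 * (L2_norm L \<theta>)\<^sup>2 + \<tau> * (L2_norm L q)\<^sup>2 + (L2g_norm L g \<eta>)\<^sup>2)"

text \<open>\<open>(b - \<integral>g) \<psi> + \<integral> g(s) \<eta>(s) ds\<close>\<close>

definition memory_stress ::
    "real \<Rightarrow> real \<Rightarrow> (real \<Rightarrow> real) \<Rightarrow> (real \<Rightarrow> complex) \<Rightarrow> (real \<Rightarrow> real \<Rightarrow> complex) \<Rightarrow> real \<Rightarrow> complex"
  where
  "memory_stress L b g \<psi> \<eta> =
     (\<lambda>x. of_real (b - kernel_mass g) * \<psi> x + integral_H10 L (\<lambda>s y. of_real (g s) * \<eta> s y) x)"

definition dom_A2 :: "real \<Rightarrow> real \<Rightarrow> (real \<Rightarrow> real) \<Rightarrow> state set" where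
  "dom_A2 L b g = {(u, v, \<phi>, \<Phi>, \<psi>, \<Psi>, \<theta>, q, \<eta>).
     (u, v, \<phi>, \<Phi>, \<psi>, \<Psi>, \<theta>, q, \<eta>) \<in> energy_space L g \<and>
     v \<in> H1_mean0 L \<and> \<Phi> \<in> H1_mean0 L \<and>
     weak_deriv L u \<in> H10 L \<and> weak_deriv L \<phi> \<in> H10 L \<and> \<theta> \<in> H10 L \<and> \<Psi> \<in> H10 L \<and>
     memory_stress L b g \<psi> \<eta> \<in> H2 L \<and> q \<in> H1 L \<and>
     (\<exists>\<zeta>. has_s_deriv L g \<eta> \<zeta>) \<and> zero_initial_trace L g \<eta>}"

fun A2 ::
    "real \<Rightarrow> real \<Rightarrow> real \<Rightarrow> real \<Rightarrow> real \<Rightarrow> real \<Rightarrow> real \<Rightarrow> real \<Rightarrow> real \<Rightarrow> real \<Rightarrow> real \<Rightarrow> real \<Rightarrow> real \<Rightarrow>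
     (real \<Rightarrow> real) \<Rightarrow> state \<Rightarrow> state" where
  "A2 L \<rho> \<rho>\<^sub>1 \<rho>\<^sub>2 \<rho>\<^sub>3 \<alpha> \<kappa> b \<tau> \<sigma> \<beta> \<gamma> m g (u, v, \<phi>, \<Phi>, \<psi>, \<Psi>, \<theta>, q, \<eta>) = (let D = weak_deriv L in
     (v,
      \<lambda>x. (\<alpha> * D (D u) x + \<beta> * (\<phi> x - u x) - \<gamma> * v x) / \<rho>,
      \<Phi>,
      \<lambda>x. (\<kappa> * D (\<lambda>y. D \<phi> y + \<psi> y) x - \<beta> * (\<phi> x - u x) - m * D \<theta> x) / \<rho>\<^sub>1,
      \<Psi>,
      \<lambda>x. (D (D (memory_stress L b g \<psi> \<eta>)) x - \<kappa> * (D \<phi> x + \<psi> x) + m * \<theta> x) / \<rho>\<^sub>2,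
      \<lambda>x. (- D q x - m * (D \<Phi> x + \<Psi> x)) / \<rho>\<^sub>3,
      \<lambda>x. (- \<sigma> * q x - D \<theta> x) / \<tau>,
      \<lambda>s x. \<Psi> x - s_deriv L g \<eta> s x))"

section \<open>Semigroups on a space of states with (semi)norm \<open>N\<close>\<close>

definition state_dist :: "(state \<Rightarrow> real) \<Rightarrow> state \<Rightarrow> state \<Rightarrow> real" where
  "state_dist N U V = N (lincomb 1 U (-1) V)"

definition C0_semigroup ::
    "state set \<Rightarrow> (state \<Rightarrow> real) \<Rightarrow> (real \<Rightarrow> state \<Rightarrow> state) \<Rightarrow> bool" where
  "C0_semigroup X N T \<longleftrightarrow>
     (\<forall>t\<ge>0. \<forall>U\<in>X. T t U \<in> X) \<and>
     (\<forall>t\<ge>0. \<forall>U\<in>X. \<forall>V\<in>X. \<forall>a c.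
        state_dist N (T t (lincomb a U c V)) (lincomb a (T t U) c (T t V)) = 0) \<and>
     (\<forall>t\<ge>0. \<exists>C. \<forall>U\<in>X. N (T t U) \<le> C * N U) \<and>
     (\<forall>U\<in>X. state_dist N (T 0 U) U = 0) \<and>
     (\<forall>r\<ge>0. \<forall>t\<ge>0. \<forall>U\<in>X. state_dist N (T (r + t) U) (T r (T t U)) = 0) \<and>
     (\<forall>U\<in>X. ((\<lambda>t. state_dist N (T t U) U) \<longlongrightarrow> 0) (at_right 0))"

text \<open>The infinitesimal generator of \<open>T\<close> is the operator \<open>A\<close> with domain \<open>D\<close> (as graphs modulo
  null elements).\<close>

definition is_generator ::
    "state set \<Rightarrow> (state \<Rightarrow> real) \<Rightarrow> (real \<Rightarrow> state \<Rightarrow> state) \<Rightarrow> state set \<Rightarrow> (state \<Rightarrow> state) \<Rightarrow> bool"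
  where
  "is_generator X N T D A \<longleftrightarrow> (\<forall>U\<in>X. \<forall>V\<in>X.
     ((\<lambda>t. state_dist N (lincomb (of_real (1/t)) (T t U) (- of_real (1/t)) U) V) \<longlongrightarrow> 0) (at_right 0)
     \<longleftrightarrow> (\<exists>W\<in>D. state_dist N W U = 0 \<and> state_dist N (A W) V = 0))"

definition operator_norm :: "state set \<Rightarrow> (state \<Rightarrow> real) \<Rightarrow> (state \<Rightarrow> state) \<Rightarrow> real" where
  "operator_norm X N S = (SUP U \<in> {U \<in> X. N U \<le> 1}. N (S U))"

end

theory Submission
  imports Defs
begin

text \<open>
  The complex spaces are treated as real Hilbert spaces, and the decay is read off from a bounded bilinear
  form \<open>B\<close> with \<open>B U U \<ge> \<parallel>U\<parallel>\<^sup>2\<close> and \<open>B W (A W) + B (A W) W \<le> - c \<parallel>W\<parallel>\<^sup>2\<close> on the domain.  The energy identity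
  dissipates only \<open>v\<close>, \<open>q\<close> and \<open>\<eta>\<close>.  Pairing \<open>\<Psi>\<close> with a weighted integral of \<open>\<eta>\<close> controls \<open>\<Psi>\<close>, pairing
  \<open>q\<close> with a primitive of \<open>\<theta>\<close> controls \<open>\<theta>\<close>, pairing \<open>\<theta>\<close> with a primitive of \<open>\<Phi>\<close> controls \<open>\<Phi>\<close>, and pairing
  velocities with displacements controls the potential energy; \<open>B\<close> is a large multiple of the energy plus a
  combination of these four forms.  Density of the domain extends the decay to all states.
\<close>

section \<open>Square-integrable functions as a real Hilbert space\<close>

text \<open>The obstacle is that nothing is given pointwise: states are representatives,
  \<open>weak_deriv\<close> and \<open>s_deriv\<close> are arbitrary choices, \<open>N\<close> is a
  seminorm, and the semigroup law holds up to distance zero. Everything is therefore sent by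
  \<open>cl\<close> and \<open>d\<close> into one quotient space \<open>ltwo\<close>, where equality
  is equality of classes and the Bochner integral applies.

  The memory dissipates because \<open>g' \<le> - \<kappa>\<^sub>1 g\<close> bounds the pairing of
  the s-derivative of \<eta> with \<eta> from below; this needs the continuous representative to be
  a genuine primitive of the weak derivative, also when \<open>g\<close> vanishes beyond some point.

  The primitives in the multipliers gain a derivative, so the forms are bounded on the energy space,
  and zero means or zero boundary values remove all boundary terms. The temperature equation
  contains the derivative of \<Phi> itself, so \<Phi> is recovered whatever the wave speeds are. The
  weight of the memory integral is a test function supported away from \<open>s = 0\<close>, onto
  which the weak s-derivative can be moved.\<close>

definition sqint :: "(real \<Rightarrow> complex) \<Rightarrow> bool" where
  "sqint f \<longleftrightarrow> f \<in> borel_measurable lebesgue \<and> integrable lebesgue (\<lambda>x. (cmod (f x))\<^sup>2)"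

lemma sqint_measurable: "sqint f \<Longrightarrow> f \<in> borel_measurable lebesgue"
  by (simp add: sqint_def)

lemma sqint_dominated:
  assumes f: "f \<in> borel_measurable lebesgue" and h: "integrable lebesgue h"
    and le: "\<And>x. (cmod (f x))\<^sup>2 \<le> h x"
  shows "sqint f"
  unfolding sqint_def
proof
  show "integrable lebesgue (\<lambda>x. (cmod (f x))\<^sup>2)"
    using f by (intro Bochner_Integration.integrable_bound[OF h])
      (auto intro!: AE_I2 order_trans[OF le])
qed (fact f)

lemma norm_add_sq_le: "(norm (a + b))\<^sup>2 \<le> 2 * (norm a)\<^sup>2 + 2 * (norm (b :: 'a::real_normed_vector))\<^sup>2"
proof -
  have "(norm (a + b))\<^sup>2 \<le> (norm a + norm b)\<^sup>2"
    by (intro power_mono norm_triangle_ineq) auto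
  also have "\<dots> \<le> 2 * (norm a)\<^sup>2 + 2 * (norm b)\<^sup>2"
    using sum_squares_bound[of "norm a" "norm b"] by (simp add: power2_sum)
  finally show ?thesis .
qed

lemma sqint_zero: "sqint (\<lambda>x. 0)"
  by (simp add: sqint_def)

lemma sqint_add: "sqint f \<Longrightarrow> sqint g \<Longrightarrow> sqint (\<lambda>x. f x + g x)"
  by (rule sqint_dominated[where h = "\<lambda>x. 2 * (cmod (f x))\<^sup>2 + 2 * (cmod (g x))\<^sup>2"])
     (auto simp: sqint_def norm_add_sq_le)

lemma sqint_cmult: "sqint f \<Longrightarrow> sqint (\<lambda>x. c * f x)"
  by (auto simp: sqint_def norm_mult power_mult_distrib)

lemma sqint_scaleR: "sqint f \<Longrightarrow> sqint (\<lambda>x. c *\<^sub>R f x)"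
  using sqint_cmult[of f "of_real c"] by (simp add: scaleR_conv_of_real)

lemma sqint_uminus: "sqint f \<Longrightarrow> sqint (\<lambda>x. - f x)"
  by (auto simp: sqint_def)

lemma sqint_diff: "sqint f \<Longrightarrow> sqint g \<Longrightarrow> sqint (\<lambda>x. f x - g x)"
  using sqint_add[OF _ sqint_uminus] by fastforce

lemma sqint_prod_integrable:
  assumes "sqint f" "sqint g" shows "integrable lebesgue (\<lambda>x. f x * g x)"
proof (rule Bochner_Integration.integrable_bound)
  show "integrable lebesgue (\<lambda>x. (cmod (f x))\<^sup>2 + (cmod (g x))\<^sup>2)"
    using assms by (auto simp: sqint_def)
  have "cmod (f x * g x) \<le> norm ((cmod (f x))\<^sup>2 + (cmod (g x))\<^sup>2)" for x
  proof -
    have "2 * (cmod (f x) * cmod (g x)) \<le> (cmod (f x))\<^sup>2 + (cmod (g x))\<^sup>2"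
      using sum_squares_bound[of "cmod (f x)" "cmod (g x)"] by simp
    moreover have "0 \<le> cmod (f x) * cmod (g x)" by simp
    ultimately have "cmod (f x) * cmod (g x) \<le> (cmod (f x))\<^sup>2 + (cmod (g x))\<^sup>2" by linarith
    then show ?thesis by (simp add: norm_mult)
  qed
  then show "AE x in lebesgue. norm (f x * g x) \<le> norm ((cmod (f x))\<^sup>2 + (cmod (g x))\<^sup>2)"
    by (rule AE_I2)
qed (use assms in \<open>auto simp: sqint_def\<close>)

lemma sqint_cnj: "sqint f \<Longrightarrow> sqint (\<lambda>x. cnj (f x))"
  using borel_measurable_continuous_onI[OF continuous_on_cnj[OF continuous_on_id]]
  by (auto simp: sqint_def intro: measurable_compose)

lemma inner_eq_Re_cnj: "a \<bullet> b = Re (a * cnj b)"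
  by (simp add: inner_complex_def)

lemma sqint_inner_integrable:
  assumes "sqint f" "sqint g" shows "integrable lebesgue (\<lambda>x. f x \<bullet> g x)"
  unfolding inner_eq_Re_cnj
  by (intro integrable_Re sqint_prod_integrable sqint_cnj assms)

\<comment> \<open>A type cannot depend on \<open>L\<close>, so every L2(0,L) lives in this single
  space of functions on the whole line, through extension by zero. A type gives access to the inner
  product classes and, once completeness and separability are shown, to the Bochner integral of
  functions with values in it. The quotient is partial because only square-integrable functions are
  representatives.\<close>
quotient_type ltwo = "real \<Rightarrow> complex" / partial:
    "\<lambda>f g. sqint f \<and> sqint g \<and> (AE x in lebesgue. f x = g x)"
proof (rule part_equivpI)
  show "\<exists>x. sqint x \<and> sqint x \<and> (AE xa in lebesgue. x xa = x xa)"
    using sqint_zero by auto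
qed (auto simp: symp_def transp_def)

instantiation ltwo :: real_inner
begin

lift_definition zero_ltwo :: ltwo is "\<lambda>x. 0" by (simp add: sqint_zero)
lift_definition plus_ltwo :: "ltwo \<Rightarrow> ltwo \<Rightarrow> ltwo" is "\<lambda>f g x. f x + g x"
  by (auto simp: sqint_add)
lift_definition minus_ltwo :: "ltwo \<Rightarrow> ltwo \<Rightarrow> ltwo" is "\<lambda>f g x. f x - g x"
  by (auto simp: sqint_diff)
lift_definition uminus_ltwo :: "ltwo \<Rightarrow> ltwo" is "\<lambda>f x. - f x"
  by (auto simp: sqint_uminus)
lift_definition scaleR_ltwo :: "real \<Rightarrow> ltwo \<Rightarrow> ltwo" is "\<lambda>c f x. c *\<^sub>R f x"
  by (auto simp: sqint_scaleR)
lift_definition inner_ltwo :: "ltwo \<Rightarrow> ltwo \<Rightarrow> real" is "\<lambda>f g. LINT x|lebesgue. f x \<bullet> g x"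
proof -
  fix f f' g g' :: "real \<Rightarrow> complex"
  assume "sqint f \<and> sqint f' \<and> (AE x in lebesgue. f x = f' x)"
    "sqint g \<and> sqint g' \<and> (AE x in lebesgue. g x = g' x)"
  then show "(LINT x|lebesgue. f x \<bullet> g x) = (LINT x|lebesgue. f' x \<bullet> g' x)"
    by (intro integral_cong_AE) (auto simp: sqint_def)
qed

definition norm_ltwo :: "ltwo \<Rightarrow> real" where "norm_ltwo x = sqrt (x \<bullet> x)"
definition sgn_ltwo :: "ltwo \<Rightarrow> ltwo" where "sgn_ltwo x = scaleR (inverse (norm x)) x"
definition dist_ltwo :: "ltwo \<Rightarrow> ltwo \<Rightarrow> real" where "dist_ltwo x y = norm (x - y)"
definition uniformity_ltwo :: "(ltwo \<times> ltwo) filter"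
  where "uniformity_ltwo = (INF e\<in>{0<..}. principal {(x, y). dist x y < e})"
definition open_ltwo :: "ltwo set \<Rightarrow> bool"
  where "open_ltwo U \<longleftrightarrow> (\<forall>x\<in>U. \<forall>\<^sub>F (x', y) in uniformity. x' = x \<longrightarrow> y \<in> U)"

instance
proof
  fix x y z :: ltwo and a b :: real
  show "x + y + z = x + (y + z)" by transfer (auto simp: sqint_add algebra_simps)
  show "x + y = y + x" by transfer (auto simp: sqint_add algebra_simps)
  show "0 + x = x" by transfer (auto simp: sqint_add algebra_simps)
  show "- x + x = 0" by transfer (auto simp: sqint_add sqint_zero sqint_uminus algebra_simps)
  show "x - y = x + - y" by transfer (auto simp: sqint_add sqint_diff sqint_uminus algebra_simps)
  show "a *\<^sub>R (x + y) = a *\<^sub>R x + a *\<^sub>R y"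
    by transfer (auto simp: sqint_add sqint_scaleR scaleR_add_right)
  show "(a + b) *\<^sub>R x = a *\<^sub>R x + b *\<^sub>R x"
    by transfer (auto simp: sqint_add sqint_scaleR scaleR_add_left)
  show "a *\<^sub>R b *\<^sub>R x = (a * b) *\<^sub>R x" by transfer (auto simp: sqint_scaleR)
  show "1 *\<^sub>R x = x" by transfer (auto simp: sqint_scaleR)
  show "sgn x = inverse (norm x) *\<^sub>R x" by (fact sgn_ltwo_def)
  show "dist x y = norm (x - y)" by (fact dist_ltwo_def)
  show "norm x = sqrt (x \<bullet> x)" by (fact norm_ltwo_def)
  show "x \<bullet> y = y \<bullet> x" by transfer (simp add: inner_commute)
  show "(x + y) \<bullet> z = x \<bullet> z + y \<bullet> z"
    by transfer (simp add: inner_add_left sqint_inner_integrable)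
  show "(a *\<^sub>R x) \<bullet> y = a * (x \<bullet> y)"
    by transfer simp
  show "0 \<le> x \<bullet> x" by transfer simp
  show "(x \<bullet> x = 0) = (x = 0)"
  proof transfer
    fix f :: "real \<Rightarrow> complex"
    assume "sqint f \<and> sqint f \<and> (AE x in lebesgue. f x = f x)"
    then have f: "sqint f" by simp
    have "(LINT x|lebesgue. f x \<bullet> f x) = 0 \<longleftrightarrow> (AE x in lebesgue. f x \<bullet> f x = 0)"
      by (rule integral_nonneg_eq_0_iff_AE) (auto intro: sqint_inner_integrable f)
    then show "((LINT x|lebesgue. f x \<bullet> f x) = 0) =
        (sqint f \<and> sqint (\<lambda>x. 0) \<and> (AE x in lebesgue. f x = 0))"
      by (simp add: f sqint_zero)
  qed
  show "uniformity = (INF e\<in>{0<..}. principal {(x::ltwo, y). dist x y < e})"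
    by (fact uniformity_ltwo_def)
  fix U :: "ltwo set"
  show "open U = (\<forall>x\<in>U. \<forall>\<^sub>F (x', y) in uniformity. x' = x \<longrightarrow> y \<in> U)"
    by (fact open_ltwo_def)
qed

end

definition cls :: "(real \<Rightarrow> complex) \<Rightarrow> ltwo" where "cls f = abs_ltwo f"

lemma cls_cases: obtains f where "sqint f" "x = cls f"
proof -
  have "sqint (rep_ltwo x)" using Quotient_rep_reflp[OF Quotient_ltwo, of x] by simp
  moreover have "x = cls (rep_ltwo x)"
    unfolding cls_def by (rule Quotient_abs_rep[OF Quotient_ltwo, symmetric])
  ultimately show ?thesis by (rule that)
qed

lemma cls_eq_iff: "sqint f \<Longrightarrow> sqint g \<Longrightarrow> cls f = cls g \<longleftrightarrow> (AE x in lebesgue. f x = g x)"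
  using Quotient_rel[OF Quotient_ltwo, of f g] by (auto simp: cls_def)

lemma cls_add: "sqint f \<Longrightarrow> sqint g \<Longrightarrow> cls (\<lambda>x. f x + g x) = cls f + cls g"
  unfolding cls_def by (simp add: plus_ltwo.abs_eq)

lemma cls_diff: "sqint f \<Longrightarrow> sqint g \<Longrightarrow> cls (\<lambda>x. f x - g x) = cls f - cls g"
  unfolding cls_def by (simp add: minus_ltwo.abs_eq)

lemma cls_scaleR: "sqint f \<Longrightarrow> cls (\<lambda>x. c *\<^sub>R f x) = c *\<^sub>R cls f"
  unfolding cls_def by (simp add: scaleR_ltwo.abs_eq)

lemma cls_zero: "cls (\<lambda>x. 0) = 0"
  unfolding cls_def by (simp add: zero_ltwo_def)

lemma inner_cls: "sqint f \<Longrightarrow> sqint g \<Longrightarrow> cls f \<bullet> cls g = (LINT x|lebesgue. f x \<bullet> g x)"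
  unfolding cls_def by (simp add: inner_ltwo.abs_eq)

lemma norm_cls: "sqint f \<Longrightarrow> (norm (cls f))\<^sup>2 = (LINT x|lebesgue. (cmod (f x))\<^sup>2)"
  by (simp add: power2_norm_eq_inner inner_cls)

lemma norm_cls_nn: "sqint f \<Longrightarrow> ennreal ((norm (cls f))\<^sup>2) = (\<integral>\<^sup>+x. ennreal ((cmod (f x))\<^sup>2) \<partial>lebesgue)"
  by (simp add: norm_cls sqint_def nn_integral_eq_integral)

text \<open>The limit inherits the bound \<open>h\<close> almost everywhere, so the squared
  differences are dominated by \<open>4 * h\<close>.\<close>

lemma cls_dominated_tendsto:
  assumes f: "f \<in> borel_measurable lebesgue" and F: "\<And>n. F n \<in> borel_measurable lebesgue"
    and h: "integrable lebesgue h" and le: "\<And>n x. (cmod (F n x))\<^sup>2 \<le> h x"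
    and lim: "AE x in lebesgue. (\<lambda>n. F n x) \<longlonglongrightarrow> f x"
  shows "sqint f" "\<And>n. sqint (F n)" "(\<lambda>n. cls (F n)) \<longlonglongrightarrow> cls f"
proof -
  show Fs: "sqint (F n)" for n by (rule sqint_dominated[OF F h le])
  have fle: "AE x in lebesgue. (cmod (f x))\<^sup>2 \<le> h x"
    using lim
  proof eventually_elim
    case (elim x)
    then have "(\<lambda>n. (cmod (F n x))\<^sup>2) \<longlonglongrightarrow> (cmod (f x))\<^sup>2" by (intro tendsto_intros)
    then show ?case by (rule LIMSEQ_le_const2) (use le in auto)
  qed
  show fs: "sqint f"
    unfolding sqint_def
  proof
    show "integrable lebesgue (\<lambda>x. (cmod (f x))\<^sup>2)"
      using f fle by (intro Bochner_Integration.integrable_bound[OF h]) (auto elim!: eventually_mono)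
  qed (fact f)
  have "(\<lambda>n. LINT x|lebesgue. (cmod (F n x - f x))\<^sup>2) \<longlonglongrightarrow> (LINT x|(lebesgue::real measure). 0)"
  proof (rule integral_dominated_convergence)
    show "integrable lebesgue (\<lambda>x. 4 * h x)" using h by simp
    show "AE x in lebesgue. (\<lambda>n. (cmod (F n x - f x))\<^sup>2) \<longlonglongrightarrow> 0"
      using lim
    proof eventually_elim
      case (elim x)
      then have "(\<lambda>n. (cmod (F n x - f x))\<^sup>2) \<longlonglongrightarrow> (cmod (f x - f x))\<^sup>2" by (intro tendsto_intros)
      then show ?case by simp
    qed
    show "AE x in lebesgue. norm ((cmod (F n x - f x))\<^sup>2) \<le> 4 * h x" for n
      using fle
    proof eventually_elim
      case (elim x)
      have "(cmod (F n x - f x))\<^sup>2 \<le> 2 * (cmod (F n x))\<^sup>2 + 2 * (cmod (f x))\<^sup>2"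
        using norm_add_sq_le[of "F n x" "- f x"] by simp
      then show ?case using le[of n x] elim by simp
    qed
  qed (use f F in auto)
  then have "(\<lambda>n. (norm (cls (F n) - cls f))\<^sup>2) \<longlonglongrightarrow> 0"
    using Fs fs by (simp flip: cls_diff add: norm_cls sqint_diff)
  then have "(\<lambda>n. norm (cls (F n) - cls f)) \<longlonglongrightarrow> 0"
    using tendsto_real_sqrt by fastforce
  then show "(\<lambda>n. cls (F n)) \<longlonglongrightarrow> cls f" by (simp add: LIM_zero_iff tendsto_norm_zero_iff)
qed

text \<open>Riesz-Fischer: a fast subsequence converges almost everywhere, and Fatou's lemma shows
  that its pointwise limit is also the limit in norm.\<close>

instance ltwo :: complete_space
proof
  fix X :: "nat \<Rightarrow> ltwo" assume X: "Cauchy X"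
  have "\<exists>N. \<forall>m\<ge>N. \<forall>n\<ge>N. norm (X m - X n) < (1/2)^k" for k
    using X[unfolded Cauchy_def, rule_format, of "(1/2)^k"] by (simp add: dist_norm)
  then obtain N where N: "\<And>k m n. m \<ge> N k \<Longrightarrow> n \<ge> N k \<Longrightarrow> norm (X m - X n) < (1/2)^k"
    by metis
  \<comment> \<open>Adding up all earlier thresholds keeps \<open>r k\<close> beyond each
    \<open>N i\<close> with \<open>i \<le> k\<close>; the summand \<open>k\<close> makes
    \<open>r\<close> strictly increasing.\<close>
  define r where "r k = k + (\<Sum>i\<le>k. N i)" for k :: nat
  have r: "strict_mono r" by (rule strict_monoI_Suc) (simp add: r_def)
  have rN: "N k \<le> r m" if "k \<le> m" for k m
  proof -
    have "N k \<le> (\<Sum>i\<le>m. N i)" using that by (intro member_le_sum) auto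
    then show ?thesis by (simp add: r_def)
  qed
  have "\<forall>k. \<exists>f. sqint f \<and> X (r k) = cls f" by (metis cls_cases)
  then obtain g where g: "\<And>k. sqint (g k)" "\<And>k. X (r k) = cls (g k)" by metis
  have gm[measurable]: "g k \<in> borel_measurable lebesgue" for k
    using g(1) by (rule sqint_measurable)
  have d: "(\<integral>\<^sup>+x. ennreal ((cmod (g m x - g k x))\<^sup>2) \<partial>lebesgue) \<le> ennreal ((1/4)^k)" if "k \<le> m" for k m
  proof -
    have "norm (cls (g m) - cls (g k)) \<le> (1/2)^k"
      using N[of k "r m" "r k"] that rN by (simp add: g(2)[symmetric] less_imp_le)
    then have "(norm (cls (g m) - cls (g k)))\<^sup>2 \<le> ((1/2)^k)\<^sup>2" by (intro power_mono) auto
    also have "((1/2)^k)\<^sup>2 = (1/4::real)^k" by (simp add: power2_eq_square flip: power_mult_distrib)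
    finally have "ennreal ((norm (cls (g m) - cls (g k)))\<^sup>2) \<le> ennreal ((1/4)^k)" by (rule ennreal_leI)
    then show ?thesis
      by (simp flip: cls_diff add: g(1) norm_cls_nn sqint_diff)
  qed
  have "(\<integral>\<^sup>+x. (\<Sum>k. ennreal (2^k * (cmod (g (Suc k) x - g k x))\<^sup>2)) \<partial>lebesgue)
     = (\<Sum>k. \<integral>\<^sup>+x. ennreal (2^k * (cmod (g (Suc k) x - g k x))\<^sup>2) \<partial>lebesgue)"
    by (rule nn_integral_suminf) measurable
  also have "\<dots> = (\<Sum>k. ennreal (2^k) * (\<integral>\<^sup>+x. ennreal ((cmod (g (Suc k) x - g k x))\<^sup>2) \<partial>lebesgue))"
    by (simp add: ennreal_mult nn_integral_cmult)
  also have "\<dots> \<le> (\<Sum>k. ennreal ((1/2)^k))"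
  proof (intro suminf_le allI summableI)
    fix k
    have "ennreal (2^k) * (\<integral>\<^sup>+x. ennreal ((cmod (g (Suc k) x - g k x))\<^sup>2) \<partial>lebesgue)
       \<le> ennreal (2^k) * ennreal ((1/4)^k)" by (intro mult_left_mono d) auto
    also have "\<dots> = ennreal ((1/2)^k)" by (simp flip: ennreal_mult power_mult_distrib)
    finally show "ennreal (2^k) * (\<integral>\<^sup>+x. ennreal ((cmod (g (Suc k) x - g k x))\<^sup>2) \<partial>lebesgue) \<le> ennreal ((1/2)^k)" .
  qed
  also have "\<dots> = ennreal (\<Sum>k. (1/2)^k)" by (intro suminf_ennreal2) auto
  also have "\<dots> < \<infinity>" by simp
  finally have fin: "(\<integral>\<^sup>+x. (\<Sum>k. ennreal (2^k * (cmod (g (Suc k) x - g k x))\<^sup>2)) \<partial>lebesgue) \<noteq> \<infinity>"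
    by simp
  have "AE x in lebesgue. (\<Sum>k. ennreal (2^k * (cmod (g (Suc k) x - g k x))\<^sup>2)) \<noteq> \<infinity>"
    by (rule nn_integral_PInf_AE[OF _ fin]) measurable
  then have conv: "AE x in lebesgue. convergent (\<lambda>k. g k x)"
  proof eventually_elim
    case (elim x)
    have s: "summable (\<lambda>k. 2^k * (cmod (g (Suc k) x - g k x))\<^sup>2)"
      using elim by (intro summable_suminf_not_top) auto
    have "summable (\<lambda>k. g (Suc k) x - g k x)"
    proof (rule summable_comparison_test')
      \<comment> \<open>The squared increments have integral at most \<open>(1/4)^k\<close>, so the
        weight \<open>2^k\<close> leaves an integrable series, and
        \<open>2 a \<le> (1/2)^k + 2^k a^2\<close> then gives absolute convergence of the
        increments.\<close>
      show "summable (\<lambda>k. (1/2)^k + 2^k * (cmod (g (Suc k) x - g k x))\<^sup>2)"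
        by (intro summable_add s) simp
      fix k :: nat
      let ?a = "cmod (g (Suc k) x - g k x)"
      have "0 \<le> 2^k * (?a - (1/2)^k)\<^sup>2" by simp
      also have "\<dots> = 2^k * ?a\<^sup>2 - 2 * ?a * (2^k * (1/2)^k) + (2^k * (1/2)^k) * (1/2)^k"
        by (simp add: power2_diff algebra_simps power2_eq_square)
      also have "2^k * (1/2::real)^k = 1" by (simp flip: power_mult_distrib)
      finally have "2 * ?a \<le> (1/2)^k + 2^k * ?a\<^sup>2" by simp
      moreover have "0 \<le> ?a" by simp
      ultimately show "norm (g (Suc k) x - g k x) \<le> (1/2)^k + 2^k * ?a\<^sup>2" by linarith
    qed
    moreover have "(\<Sum>i<n. g (Suc i) x - g i x) = g n x - g 0 x" for n
      by (induction n) auto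
    ultimately have "convergent (\<lambda>n. g n x - g 0 x)"
      by (simp add: summable_iff_convergent)
    then have "convergent (\<lambda>n. (g n x - g 0 x) + g 0 x)"
      by (intro convergent_add convergent_const)
    then show ?case by simp
  qed
  define f where "f x = lim (\<lambda>k. g k x)" for x
  have fm[measurable]: "f \<in> borel_measurable lebesgue"
    unfolding f_def by (rule borel_measurable_lim_metric) measurable
  have lim: "AE x in lebesgue. (\<lambda>k. g k x) \<longlonglongrightarrow> f x"
    using conv by eventually_elim (simp add: f_def convergent_LIMSEQ_iff)
  \<comment> \<open>The second index stays fixed while \<open>m\<close> tends to infinity, so the
    Cauchy bound \<open>d\<close> survives in the limit.\<close>
  have fat: "(\<integral>\<^sup>+x. ennreal ((cmod (f x - g k x))\<^sup>2) \<partial>lebesgue) \<le> ennreal ((1/4)^k)" for k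
  proof -
    have "(\<integral>\<^sup>+x. ennreal ((cmod (f x - g k x))\<^sup>2) \<partial>lebesgue)
      = (\<integral>\<^sup>+x. liminf (\<lambda>m. ennreal ((cmod (g m x - g k x))\<^sup>2)) \<partial>lebesgue)"
    proof (rule nn_integral_cong_AE)
      show "AE x in lebesgue. ennreal ((cmod (f x - g k x))\<^sup>2) = liminf (\<lambda>m. ennreal ((cmod (g m x - g k x))\<^sup>2))"
        using lim
      proof eventually_elim
        case (elim x)
        then have "(\<lambda>m. ennreal ((cmod (g m x - g k x))\<^sup>2)) \<longlonglongrightarrow> ennreal ((cmod (f x - g k x))\<^sup>2)"
          by (intro tendsto_intros)
        then show ?case by (rule lim_imp_Liminf[OF trivial_limit_sequentially, symmetric])
      qed
    qed
    also have "\<dots> \<le> liminf (\<lambda>m. \<integral>\<^sup>+x. ennreal ((cmod (g m x - g k x))\<^sup>2) \<partial>lebesgue)"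
      by (rule nn_integral_liminf) measurable
    also have "\<dots> \<le> limsup (\<lambda>m. \<integral>\<^sup>+x. ennreal ((cmod (g m x - g k x))\<^sup>2) \<partial>lebesgue)"
      by (rule Liminf_le_Limsup) simp
    also have "\<dots> \<le> ennreal ((1/4)^k)"
      by (rule Limsup_bounded) (auto intro: eventually_sequentiallyI[of k] d)
    finally show ?thesis .
  qed
  have fg: "sqint (\<lambda>x. f x - g k x)" for k
    unfolding sqint_def
  proof
    show "integrable lebesgue (\<lambda>x. (cmod (f x - g k x))\<^sup>2)"
      using fat[of k] by (intro integrableI_bounded) (auto simp: le_less_trans)
  qed measurable
  have fs: "sqint f" using sqint_add[OF fg[of 0] g(1)[of 0]] by simp
  have "norm (X (r k) - cls f) \<le> (1/2)^k" for k
  proof -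
    have "ennreal ((norm (cls f - X (r k)))\<^sup>2) \<le> ennreal ((1/4)^k)"
      using fat[of k] norm_cls_nn[OF fg[of k]] by (simp add: g(2) cls_diff[OF fs g(1)])
    then have "(norm (cls f - X (r k)))\<^sup>2 \<le> (1/4)^k" by (simp add: ennreal_le_iff)
    also have "(1/4::real)^k = ((1/2)^k)\<^sup>2" by (simp add: power2_eq_square flip: power_mult_distrib)
    finally have "norm (cls f - X (r k)) \<le> (1/2)^k" by (rule power2_le_imp_le) simp
    then show ?thesis by (simp add: norm_minus_commute)
  qed
  then have "(\<lambda>k. X (r k) - cls f) \<longlonglongrightarrow> 0"
    by (intro Lim_null_comparison[OF always_eventually LIMSEQ_realpow_zero[of "1/2"]]) auto
  then have "(X \<circ> r) \<longlonglongrightarrow> cls f" by (simp add: LIM_zero_iff o_def)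
  then have "X \<longlonglongrightarrow> cls f"
    using Cauchy_converges_subseq[OF X r] by (auto simp: o_def)
  then show "convergent X" by (rule convergentI)
qed

instance ltwo :: banach ..

section \<open>Density of step functions and separability\<close>

lemma sqint_indicator:
  assumes "A \<in> lmeasurable" shows "sqint (\<lambda>x. indicator A x *\<^sub>R c)"
proof (rule sqint_dominated)
  show "integrable lebesgue (\<lambda>x. indicator A x * (cmod c)\<^sup>2)"
    using assms by (auto simp: fmeasurable_def)
  show "(\<lambda>x. indicator A x *\<^sub>R c) \<in> borel_measurable lebesgue"
    using assms by (auto simp: fmeasurable_def)
qed (auto simp: indicator_def)

text \<open>Only sums, negatives and limits are assumed, so that step functions with rational data
  qualify in the separability proof. From intervals a Dynkin argument reaches the Borel sets,
  modification on a null set the Lebesgue sets, and dominated convergence along simple functions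
  reaches every class.\<close>

lemma closed_subgroup_ltwo_UNIV:
  fixes M :: "ltwo set"
  assumes cl: "closed M" and z: "0 \<in> M" and add: "\<And>x y. x \<in> M \<Longrightarrow> y \<in> M \<Longrightarrow> x + y \<in> M"
    and um: "\<And>x. x \<in> M \<Longrightarrow> - x \<in> M"
    and int: "\<And>a b c. cls (\<lambda>x. indicator {a<..<b} x *\<^sub>R c) \<in> M"
  shows "M = UNIV"
proof -
  \<comment> \<open>Cutting with \<open>I n\<close> keeps every set of finite measure, including the
    complements that arise in the induction over Borel sets.\<close>
  define I where "I n = {- real n<..<real n}" for n
  have I: "I n \<in> lmeasurable" for n by (simp add: I_def)
  have diff: "x - y \<in> M" if "x \<in> M" "y \<in> M" for x y using add[OF that(1) um[OF that(2)]] by simp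
  have lim: "l \<in> M" if "\<And>n. f n \<in> M" "f \<longlonglongrightarrow> l" for f l
    using closed_sequentially[OF cl] that by blast
  have lm: "A \<inter> I n \<in> lmeasurable" if "A \<in> sets lebesgue" for A n
    using fmeasurable_Int_fmeasurable[OF I that] by (simp add: Int_commute)
  note sq = sqint_indicator[OF lm]
  have borel: "cls (\<lambda>x. indicator (A \<inter> I n) x *\<^sub>R c) \<in> M" if "A \<in> sets borel" for A n c
  proof -
    let ?G = "range (\<lambda>(a, b). box a b :: real set)"
    have G: "sigma_sets UNIV ?G = sets borel"
      by (subst borel_eq_box, subst sets_measure_of) auto
    have A: "A \<in> sigma_sets UNIV ?G"
      unfolding G by (rule that)
    have "Int_stable ?G"
    proof (rule Int_stableI, safe)
      fix a b a' b' :: real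
      have "{a<..<b} \<inter> {a'<..<b'} = {max a a'<..<min b b'}" by auto
      then show "box a b \<inter> box a' b' \<in> ?G" by auto
    qed
    moreover have "?G \<subseteq> Pow UNIV" by simp
    ultimately show ?thesis
      using A
    proof (induction A rule: sigma_sets_induct_disjoint)
      case (basic A)
      then obtain a b where "A = {a<..<b}" by auto
      then have "A \<inter> I n = {max a (- real n)<..<min b (real n)}" by (auto simp: I_def)
      then show ?case using int by simp
    next
      case empty then show ?case using z by (simp add: cls_zero)
    next
      case (compl A)
      have "A \<in> sets borel" using compl(1) unfolding G .
      then have A: "A \<in> sets lebesgue" by simp
      have "(\<lambda>x. indicator ((UNIV - A) \<inter> I n) x *\<^sub>R c)
        = (\<lambda>x. indicator (I n) x *\<^sub>R c - indicator (A \<inter> I n) x *\<^sub>R c)"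
        by (auto simp: indicator_def)
      then show ?case
        using compl int[of "- real n" "real n" c] by (simp add: cls_diff sqint_indicator I sq[OF A] diff flip: I_def)
    next
      case (union A)
      have A: "A i \<in> sets lebesgue" for i
        using union(2) unfolding G by (metis sets_completionI_sets sets_lborel rangeI subsetD)
      have fin: "cls (\<lambda>x. indicator ((\<Union>i<k. A i) \<inter> I n) x *\<^sub>R c) \<in> M" for k
      proof (induction k)
        case 0 then show ?case using z by (simp add: cls_zero)
      next
        case (Suc k)
        have "(\<Union>i<k. A i) \<in> sets lebesgue" using A by auto
        moreover have "(\<lambda>x. indicator ((\<Union>i<Suc k. A i) \<inter> I n) x *\<^sub>R c) =
          (\<lambda>x. indicator ((\<Union>i<k. A i) \<inter> I n) x *\<^sub>R c + indicator (A k \<inter> I n) x *\<^sub>R c)"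
        proof -
          have "(\<Union>i<k. A i) \<inter> A k = {}"
          proof -
            have "A i \<inter> A k = {}" if "i < k" for i
              using disjoint_family_onD[OF union(1), of i k] that by auto
            then show ?thesis by auto
          qed
          then show ?thesis by (auto simp: indicator_def fun_eq_iff lessThan_Suc)
        qed
        ultimately show ?case using Suc union(3)[of k] add by (simp add: cls_add sq A)
      qed
      show ?case
      proof (rule lim[OF fin], rule cls_dominated_tendsto(3))
        show "integrable lebesgue (\<lambda>x. indicator (I n) x * (cmod c)\<^sup>2)"
          using I[of n] by (auto simp: fmeasurable_def)
        show "AE x in lebesgue. (\<lambda>k. indicator ((\<Union>i<k. A i) \<inter> I n) x *\<^sub>R c)
            \<longlonglongrightarrow> indicator (\<Union> (range A) \<inter> I n) x *\<^sub>R c"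
        proof (rule AE_I2)
          fix x
          have "\<forall>\<^sub>F k in sequentially. indicator ((\<Union>i<k. A i) \<inter> I n) x *\<^sub>R c = indicator (\<Union> (range A) \<inter> I n) x *\<^sub>R c"
          proof (cases "x \<in> \<Union> (range A)")
            case True
            then obtain j where "x \<in> A j" by auto
            then have "\<forall>k>j. indicator ((\<Union>i<k. A i) \<inter> I n) x *\<^sub>R c = indicator (\<Union> (range A) \<inter> I n) x *\<^sub>R c"
              by (auto simp: indicator_def)
            then show ?thesis by (auto simp: eventually_sequentially intro!: exI[of _ "Suc j"])
          qed (auto simp: indicator_def)
          then show "(\<lambda>k. indicator ((\<Union>i<k. A i) \<inter> I n) x *\<^sub>R c)
            \<longlonglongrightarrow> indicator (\<Union> (range A) \<inter> I n) x *\<^sub>R c" by (rule tendsto_eventually)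
        qed
        show "(\<lambda>x. indicator (\<Union> (range A) \<inter> I n) x *\<^sub>R c) \<in> borel_measurable lebesgue"
          by (rule sqint_measurable, rule sq) (use A in auto)
        show "(\<lambda>x. indicator ((\<Union>i<k. A i) \<inter> I n) x *\<^sub>R c) \<in> borel_measurable lebesgue" for k
          by (rule sqint_measurable, rule sq) (use A in auto)
      qed (auto simp: indicator_def)
    qed
  qed
  have leb: "cls (\<lambda>x. indicator (A \<inter> I n) x *\<^sub>R c) \<in> M" if "A \<in> sets lebesgue" for A n c
  proof -
    from that obtain S N N' where S: "A = S \<union> N" "N \<subseteq> N'" "N' \<in> null_sets lborel" "S \<in> sets lborel"
      by (auto elim: sets_completionE)
    have "AE x in lborel. x \<notin> N'" using S(3) by (rule AE_not_in)
    then have "AE x in lebesgue. x \<notin> N'" by (rule AE_completion)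
    then have "AE x in lebesgue. indicator (A \<inter> I n) x *\<^sub>R c = indicator (S \<inter> I n) x *\<^sub>R c"
      by eventually_elim (use S in \<open>auto simp: indicator_def\<close>)
    then have "cls (\<lambda>x. indicator (A \<inter> I n) x *\<^sub>R c) = cls (\<lambda>x. indicator (S \<inter> I n) x *\<^sub>R c)"
      using S that by (subst cls_eq_iff) (auto intro!: sq)
    then show ?thesis using borel S by simp
  qed
  have "x \<in> M" for x
  proof -
    obtain f where f: "sqint f" "x = cls f" by (rule cls_cases)
    from borel_measurable_implies_sequence_metric[OF sqint_measurable[OF f(1)], of 0]
    obtain F where F: "\<And>i. simple_function lebesgue (F i)" "\<And>x. (\<lambda>i. F i x) \<longlonglongrightarrow> f x"
      "\<And>i x. dist (F i x) 0 \<le> 2 * dist (f x) 0" by auto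
    have A: "F i -` {y} \<in> sets lebesgue" for i y
      using simple_functionD(2)[OF F(1), of i "{y}"] by simp
    have FM: "cls (\<lambda>x. indicator (I i) x *\<^sub>R F i x) \<in> M" for i
    proof -
      have fin: "finite (F i ` UNIV)" using simple_functionD(1)[OF F(1), of i] by simp
      have sum: "sqint (\<lambda>x. \<Sum>y\<in>Y. indicator (F i -` {y} \<inter> I i) x *\<^sub>R y) \<and>
        cls (\<lambda>x. \<Sum>y\<in>Y. indicator (F i -` {y} \<inter> I i) x *\<^sub>R y) \<in> M" if "finite Y" for Y
        using that
      proof induction
        case empty then show ?case using z by (simp add: cls_zero sqint_zero)
      next
        case (insert y Y)
        note IH = conjunct1[OF insert.IH] conjunct2[OF insert.IH]
        show ?case
          unfolding sum.insert[OF insert.hyps]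
        proof
          show "sqint (\<lambda>x. indicator (F i -` {y} \<inter> I i) x *\<^sub>R y + (\<Sum>y\<in>Y. indicator (F i -` {y} \<inter> I i) x *\<^sub>R y))"
            by (rule sqint_add[OF sq[OF A] IH(1)])
          show "cls (\<lambda>x. indicator (F i -` {y} \<inter> I i) x *\<^sub>R y + (\<Sum>y\<in>Y. indicator (F i -` {y} \<inter> I i) x *\<^sub>R y)) \<in> M"
            unfolding cls_add[OF sq[OF A] IH(1)] by (rule add[OF leb[OF A] IH(2)])
        qed
      qed
      have "(\<Sum>y\<in>F i ` UNIV. indicator (F i -` {y} \<inter> I i) x *\<^sub>R y) = indicator (I i) x *\<^sub>R F i x" for x
      proof -
        have "(\<Sum>y\<in>F i ` UNIV. indicator (F i -` {y} \<inter> I i) x *\<^sub>R y)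
          = (\<Sum>y\<in>F i ` UNIV. if y = F i x then indicator (I i) x *\<^sub>R F i x else 0)"
          by (intro sum.cong) (auto simp: indicator_def)
        then show ?thesis using fin by (simp add: sum.delta')
      qed
      then show ?thesis using sum[OF fin] by simp
    qed
    have "(\<lambda>i. cls (\<lambda>x. indicator (I i) x *\<^sub>R F i x)) \<longlonglongrightarrow> cls f"
    proof (rule cls_dominated_tendsto(3))
      show "integrable lebesgue (\<lambda>x. 4 * (cmod (f x))\<^sup>2)" using f by (simp add: sqint_def)
      show "(cmod (indicator (I i) x *\<^sub>R F i x))\<^sup>2 \<le> 4 * (cmod (f x))\<^sup>2" for i x
      proof -
        have "cmod (indicator (I i) x *\<^sub>R F i x) \<le> 2 * cmod (f x)"
          using F(3)[of i x] by (auto simp: indicator_def)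
        then have "(cmod (indicator (I i) x *\<^sub>R F i x))\<^sup>2 \<le> (2 * cmod (f x))\<^sup>2" by (intro power_mono) auto
        then show ?thesis by (simp add: power_mult_distrib)
      qed
      show "AE x in lebesgue. (\<lambda>i. indicator (I i) x *\<^sub>R F i x) \<longlonglongrightarrow> f x"
      proof (rule AE_I2)
        fix x :: real
        obtain k where k: "\<bar>x\<bar> < real k" using reals_Archimedean2 by blast
        have "\<forall>\<^sub>F i in sequentially. F i x = indicator (I i) x *\<^sub>R F i x"
          by (rule eventually_sequentiallyI[of k]) (use k in \<open>auto simp: I_def indicator_def\<close>)
        then show "(\<lambda>i. indicator (I i) x *\<^sub>R F i x) \<longlonglongrightarrow> f x"
          by (rule Lim_transform_eventually[OF F(2)])
      qed
      show "(\<lambda>x. indicator (I i) x *\<^sub>R F i x) \<in> borel_measurable lebesgue" for i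
        using borel_measurable_simple_function[OF F(1)[of i]] I[of i]
        by (intro borel_measurable_scaleR borel_measurable_indicator) (auto simp: fmeasurable_def)
    qed (use f in \<open>auto simp: sqint_def\<close>)
    then show ?thesis using lim[OF FM] f by simp
  qed
  then show ?thesis by auto
qed

lemma second_countable_from_dense:
  fixes D :: "'a::metric_space set"
  assumes "countable D" "closure D = UNIV"
  shows "\<exists>B::'a set set. countable B \<and> open = generate_topology B"
proof (intro exI conjI)
  let ?B = "(\<lambda>(d, n). ball d (1 / Suc n)) ` (D \<times> (UNIV :: nat set))"
  show "countable ?B" using assms(1) by (intro countable_image countable_SIGMA) auto
  have "topological_basis ?B"
  proof (rule topological_basisI)
    fix B' assume "B' \<in> ?B" then show "open B'" by auto
  next
    fix O' and x :: 'a assume "open O'" "x \<in> O'"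
    then obtain e where e: "e > 0" "ball x e \<subseteq> O'" by (auto simp: open_contains_ball)
    then obtain n where n: "1 / real (Suc n) < e / 2" using nat_approx_posE[of "e/2"] by auto
    obtain d where d: "d \<in> D" "dist d x < 1 / real (Suc n)"
      using assms(2) closure_approachable[of x D] by (metis UNIV_I of_nat_0_less_iff zero_less_Suc zero_less_divide_1_iff)
    have "ball d (1 / Suc n) \<subseteq> O'"
    proof
      fix y assume "y \<in> ball d (1 / Suc n)"
      then have "dist d y < e/2" using n by simp
      then have "dist x y < e" using d n dist_triangle2[of x y d] by (simp add: dist_commute)
      then show "y \<in> O'" using e by auto
    qed
    then show "\<exists>B'\<in>?B. x \<in> B' \<and> B' \<subseteq> O'"
      using d by (intro bexI[of _ "ball d (1 / Suc n)"]) auto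
  qed
  then show "open = generate_topology ?B" by (rule topological_basis_imp_subbasis)
qed

lemma rat_sequence: obtains q :: "nat \<Rightarrow> rat" where "(\<lambda>n. real_of_rat (q n)) \<longlonglongrightarrow> x"
proof -
  have "\<exists>q. \<bar>real_of_rat q - x\<bar> < 1 / Suc n" for n
  proof -
    have "x < x + 1 / Suc n" by simp
    then obtain q where q: "x < real_of_rat q" "real_of_rat q < x + 1 / Suc n" using of_rat_dense by blast
    then have "\<bar>real_of_rat q - x\<bar> < 1 / Suc n" by linarith
    then show ?thesis by blast
  qed
  then obtain q where q: "\<And>n. \<bar>real_of_rat (q n) - x\<bar> < 1 / Suc n" by metis
  have "(\<lambda>n. real_of_rat (q n) - x) \<longlonglongrightarrow> 0"
    using q by (intro Lim_null_comparison[OF _ LIMSEQ_inverse_real_of_nat] always_eventually allI)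
      (simp add: inverse_eq_divide less_imp_le)
  then show thesis using that LIM_zero_iff by blast
qed

lemma closure_add:
  fixes T :: "'a::real_normed_vector set"
  assumes T: "\<And>x y. x \<in> T \<Longrightarrow> y \<in> T \<Longrightarrow> x + y \<in> T" and xy: "x \<in> closure T" "y \<in> closure T"
  shows "x + y \<in> closure T"
proof -
  obtain f where f: "\<forall>n. f n \<in> T" "f \<longlonglongrightarrow> x" using xy(1) unfolding closure_sequential by blast
  obtain g where g: "\<forall>n. g n \<in> T" "g \<longlonglongrightarrow> y" using xy(2) unfolding closure_sequential by blast
  have "(\<lambda>n. f n + g n) \<longlonglongrightarrow> x + y" "\<forall>n. f n + g n \<in> T" using f g T by (auto intro: tendsto_add)
  then show ?thesis unfolding closure_sequential by (intro exI[of _ "\<lambda>n. f n + g n"] conjI)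
qed

lemma closure_uminus:
  fixes T :: "'a::real_normed_vector set"
  assumes T: "\<And>x. x \<in> T \<Longrightarrow> - x \<in> T" and x: "x \<in> closure T"
  shows "- x \<in> closure T"
proof -
  obtain f where f: "\<forall>n. f n \<in> T" "f \<longlonglongrightarrow> x" using x unfolding closure_sequential by blast
  have "(\<lambda>n. - f n) \<longlonglongrightarrow> - x" "\<forall>n. - f n \<in> T" using f T by (auto intro: tendsto_minus)
  then show ?thesis unfolding closure_sequential by (intro exI[of _ "\<lambda>n. - f n"] conjI)
qed

text \<open>Finite sums of interval steps with rational end points and rational values form a
  countable dense set, being indexed by lists. Separability opens the Bochner integral to functions
  with values in \<open>ltwo\<close>.\<close>

instance ltwo :: second_countable_topology
proof
  define st :: "(rat \<times> rat) \<times> (rat \<times> rat) \<Rightarrow> ltwo" where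
    "st = (\<lambda>((a, b), (c, d)). cls (\<lambda>x. indicator {real_of_rat a<..<real_of_rat b} x *\<^sub>R Complex (real_of_rat c) (real_of_rat d)))"
  define D where "D = range (\<lambda>l. sum_list (map st l))"
  have cD: "countable D" unfolding D_def by (rule countable_image) simp
  have "closure D = UNIV"
  proof (rule closed_subgroup_ltwo_UNIV)
    have "sum_list (map st []) \<in> D" unfolding D_def by blast
    then show "0 \<in> closure D" using closure_subset by force
    have Da: "x + y \<in> D" if "x \<in> D" "y \<in> D" for x y
    proof -
      from that obtain k l where "x = sum_list (map st k)" "y = sum_list (map st l)" by (auto simp: D_def)
      then have "x + y = sum_list (map st (k @ l))" by simp
      then show ?thesis unfolding D_def by blast
    qed
    show "x + y \<in> closure D" if "x \<in> closure D" "y \<in> closure D" for x y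
      by (rule closure_add[OF Da that])
    have Dm: "- x \<in> D" if "x \<in> D" for x
    proof -
      from that obtain k where k: "x = sum_list (map st k)" by (auto simp: D_def)
      have "- st ((a, b), (c, d)) = st ((a, b), (- c, - d))" for a b c d
      proof -
        have "(\<lambda>x. indicator {real_of_rat a<..<real_of_rat b} x *\<^sub>R Complex (real_of_rat (- c)) (real_of_rat (- d)))
          = (\<lambda>x. (-1) *\<^sub>R (indicator {real_of_rat a<..<real_of_rat b} x *\<^sub>R Complex (real_of_rat c) (real_of_rat d)))"
          by (simp add: fun_eq_iff complex_eq_iff of_rat_minus)
        moreover have "cls (\<lambda>x. (-1) *\<^sub>R (indicator {real_of_rat a<..<real_of_rat b} x *\<^sub>R Complex (real_of_rat c) (real_of_rat d)))
          = (-1) *\<^sub>R st ((a, b), (c, d))"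
          unfolding st_def prod.case by (rule cls_scaleR, rule sqint_indicator) simp
        ultimately have "st ((a, b), (- c, - d)) = (-1) *\<^sub>R st ((a, b), (c, d))"
          unfolding st_def prod.case by metis
        then show ?thesis by simp
      qed
      then have "- st p = st (case p of ((a, b), (c, d)) \<Rightarrow> ((a, b), (- c, - d)))" for p
        by (cases p) auto
      then have "- sum_list (map st l) = sum_list (map st (map (\<lambda>((a, b), (c, d)). ((a, b), (- c, - d))) l))" for l
        by (induction l) auto
      then show ?thesis unfolding D_def k by blast
    qed
    show "- x \<in> closure D" if "x \<in> closure D" for x by (rule closure_uminus[OF Dm that])
    fix a b :: real and c :: complex
    obtain qa qb qc qd where q: "(\<lambda>n. real_of_rat (qa n)) \<longlonglongrightarrow> a" "(\<lambda>n. real_of_rat (qb n)) \<longlonglongrightarrow> b"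
      "(\<lambda>n. real_of_rat (qc n)) \<longlonglongrightarrow> Re c" "(\<lambda>n. real_of_rat (qd n)) \<longlonglongrightarrow> Im c"
      using rat_sequence by metis
    have "Bseq (\<lambda>n. real_of_rat (qa n))" "Bseq (\<lambda>n. real_of_rat (qb n))"
      using q by (auto intro: convergent_imp_Bseq convergentI)
    then obtain Ka Kb where K: "\<And>n. \<bar>real_of_rat (qa n)\<bar> \<le> Ka" "\<And>n. \<bar>real_of_rat (qb n)\<bar> \<le> Kb"
      by (auto simp: Bseq_def)
    have qc: "(\<lambda>n. Complex (real_of_rat (qc n)) (real_of_rat (qd n))) \<longlonglongrightarrow> c"
      using tendsto_Complex[OF q(3,4)] by simp
    then have "Bseq (\<lambda>n. Complex (real_of_rat (qc n)) (real_of_rat (qd n)))"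
      by (auto intro: convergent_imp_Bseq convergentI)
    then obtain Kc where Kc: "\<And>n. cmod (Complex (real_of_rat (qc n)) (real_of_rat (qd n))) \<le> Kc"
      by (auto simp: Bseq_def)
    have "(\<lambda>n. st ((qa n, qb n), (qc n, qd n))) \<longlonglongrightarrow> cls (\<lambda>x. indicator {a<..<b} x *\<^sub>R c)"
      unfolding st_def prod.case
    proof (rule cls_dominated_tendsto(3))
      have "{- Ka..Kb} \<in> lmeasurable" by simp
      then show "integrable lebesgue (\<lambda>x. indicator {- Ka..Kb} x * Kc\<^sup>2)" by (auto simp: fmeasurable_def)
      show "(cmod (indicator {real_of_rat (qa n)<..<real_of_rat (qb n)} x *\<^sub>R Complex (real_of_rat (qc n)) (real_of_rat (qd n))))\<^sup>2
          \<le> indicator {- Ka..Kb} x * Kc\<^sup>2" for n x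
      proof -
        have "- Ka \<le> real_of_rat (qa n)" "real_of_rat (qb n) \<le> Kb"
          using K[of n] by (simp_all only: abs_le_iff) linarith
        then show ?thesis using Kc[of n] by (auto simp: indicator_def intro!: power_mono)
      qed
      \<comment> \<open>Indicators of intervals with converging end points may fail to converge
        exactly at the two limit points.\<close>
      have "AE x in lborel. x \<noteq> a \<and> x \<noteq> b" by (auto intro: AE_lborel_singleton)
      then have "AE x in lebesgue. x \<noteq> a \<and> x \<noteq> b" by (rule AE_completion)
      then show "AE x in lebesgue. (\<lambda>n. indicator {real_of_rat (qa n)<..<real_of_rat (qb n)} x *\<^sub>R Complex (real_of_rat (qc n)) (real_of_rat (qd n)))
          \<longlonglongrightarrow> indicator {a<..<b} x *\<^sub>R c"
      proof eventually_elim
        case (elim x)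
        have "\<forall>\<^sub>F n in sequentially. (real_of_rat (qa n) < x) = (a < x)"
        proof (cases "a < x")
          case True then show ?thesis using order_tendstoD(2)[OF q(1), of x] by (auto elim: eventually_mono)
        next
          case False then show ?thesis using order_tendstoD(1)[OF q(1), of x] elim by (auto elim: eventually_mono)
        qed
        moreover have "\<forall>\<^sub>F n in sequentially. (x < real_of_rat (qb n)) = (x < b)"
        proof (cases "x < b")
          case True then show ?thesis using order_tendstoD(1)[OF q(2), of x] by (auto elim: eventually_mono)
        next
          case False then show ?thesis using order_tendstoD(2)[OF q(2), of x] elim by (auto elim: eventually_mono)
        qed
        ultimately have "\<forall>\<^sub>F n in sequentially. indicator {a<..<b} x = (indicator {real_of_rat (qa n)<..<real_of_rat (qb n)} x :: real)"
          by eventually_elim (auto simp: indicator_def)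
        then have "(\<lambda>n. indicator {real_of_rat (qa n)<..<real_of_rat (qb n)} x :: real) \<longlonglongrightarrow> indicator {a<..<b} x"
          by (intro tendsto_eventually) (auto elim: eventually_mono)
        then show ?case by (intro tendsto_scaleR qc)
      qed
    qed (auto intro!: sqint_measurable sqint_indicator)
    moreover have "st p \<in> D" for p
    proof -
      have "st p = sum_list (map st [p])" by simp
      then show ?thesis unfolding D_def by blast
    qed
    then have "\<forall>n. st ((qa n, qb n), (qc n, qd n)) \<in> closure D"
      using closure_subset by blast
    ultimately show "cls (\<lambda>x. indicator {a<..<b} x *\<^sub>R c) \<in> closure D"
      using closed_sequentially[OF closed_closure, of "\<lambda>n. st ((qa n, qb n), (qc n, qd n))"] by auto
  qed simp
  then show "\<exists>B::ltwo set set. countable B \<and> open = generate_topology B"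
    by (rule second_countable_from_dense[OF cD])
qed

section \<open>Test functions\<close>

text \<open>\<open>smooth\<close> asks for a sequence of all derivatives. In a class where every
  member has a derivative belonging to the class, iterating a choice of derivative supplies it,
  without formulas for higher derivatives.\<close>

lemma smooth_coinduct:
  assumes "P \<phi>" and step: "\<And>f. P f \<Longrightarrow> \<exists>f'. P f' \<and> (\<forall>x. (f has_vector_derivative f' x) (at x))"
  shows "smooth \<phi>"
proof -
  from step obtain d where d: "\<And>f. P f \<Longrightarrow> P (d f)"
    "\<And>f x. P f \<Longrightarrow> (f has_vector_derivative d f x) (at x)" by metis
  have "P ((d ^^ k) \<phi>)" for k by (induction k) (auto simp: assms(1) d(1))
  then show ?thesis
    unfolding smooth_def by (intro exI[of _ "\<lambda>k. (d ^^ k) \<phi>"]) (auto simp: d(2))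
qed

lemma smooth_derivative:
  assumes "smooth f"
  obtains f' where "smooth f'" "\<And>x. (f has_vector_derivative f' x) (at x)"
proof -
  from assms obtain D where "D 0 = f" and D: "\<And>k x. (D k has_vector_derivative D (Suc k) x) (at x)"
    unfolding smooth_def by blast
  moreover have "smooth (D (Suc 0))"
    unfolding smooth_def by (rule exI[of _ "\<lambda>k. D (Suc k)"]) (auto intro: D)
  ultimately show thesis using that by metis
qed

lemma smooth_deriv: "smooth f \<Longrightarrow> smooth (\<lambda>x. vector_derivative f (at x))"
  by (erule smooth_derivative) (metis (no_types, lifting) ext vector_derivative_at)

lemma smooth_has_deriv: "smooth f \<Longrightarrow> (f has_vector_derivative vector_derivative f (at x)) (at x)"
  by (erule smooth_derivative) (metis vector_derivative_at)

lemma smooth_continuous: "smooth f \<Longrightarrow> continuous_on S f"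
  using smooth_has_deriv
  by (metis continuous_at_imp_continuous_on has_vector_derivative_continuous)

lemma smooth_const: "smooth (\<lambda>x. c)"
  by (rule smooth_coinduct[where P = "\<lambda>f. \<exists>c. f = (\<lambda>x. c)"]) (auto intro!: exI[of _ "\<lambda>x. 0"] derivative_eq_intros)

lemma smooth_add:
  assumes "smooth f" "smooth g" shows "smooth (\<lambda>x. f x + g x)"
proof -
  from assms obtain D E where "D 0 = f" "E 0 = g"
    "\<forall>k x. (D k has_vector_derivative D (Suc k) x) (at x)"
    "\<forall>k x. (E k has_vector_derivative E (Suc k) x) (at x)"
    unfolding smooth_def by metis
  then show ?thesis
    unfolding smooth_def
    by (intro exI[of _ "\<lambda>k x. D k x + E k x"]) (auto intro: has_vector_derivative_add)
qed

text \<open>Finite sums of products of smooth functions are closed under differentiation by the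
  product rule; this takes the place of the Leibniz formula.\<close>

inductive prod_span :: "(real \<Rightarrow> complex) \<Rightarrow> bool" where
  prod_span_prod: "smooth f \<Longrightarrow> smooth g \<Longrightarrow> prod_span (\<lambda>x. f x * g x)"
| prod_span_add: "prod_span f \<Longrightarrow> prod_span g \<Longrightarrow> prod_span (\<lambda>x. f x + g x)"

lemma smooth_mult:
  assumes "smooth f" "smooth g" shows "smooth (\<lambda>x. f x * g x)"
proof (rule smooth_coinduct[where P = prod_span])
  show "prod_span (\<lambda>x. f x * g x)" using assms by (rule prod_span_prod)
  fix h assume "prod_span h"
  then show "\<exists>h'. prod_span h' \<and> (\<forall>x. (h has_vector_derivative h' x) (at x))"
  proof induction
    case (prod_span_prod f g)
    then have "prod_span (\<lambda>x. f x * vector_derivative g (at x) + vector_derivative f (at x) * g x)"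
      by (intro prod_span.intros smooth_deriv)
    moreover have "((\<lambda>x. f x * g x) has_vector_derivative
        f x * vector_derivative g (at x) + vector_derivative f (at x) * g x) (at x)" for x
      by (intro has_vector_derivative_mult smooth_has_deriv prod_span_prod)
    ultimately show ?case by blast
  next
    case (prod_span_add f g)
    then obtain f' g' where "prod_span f'" "prod_span g'"
      "\<And>x. (f has_vector_derivative f' x) (at x)" "\<And>x. (g has_vector_derivative g' x) (at x)" by metis
    then show ?case
      by (intro exI[of _ "\<lambda>x. f' x + g' x"]) (auto intro!: prod_span.intros has_vector_derivative_add)
  qed
qed

lemma smooth_cnj:
  assumes "smooth f" shows "smooth (\<lambda>x. cnj (f x))"
proof -
  from assms obtain D where "D 0 = f" "\<forall>k x. (D k has_vector_derivative D (Suc k) x) (at x)"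
    unfolding smooth_def by metis
  then show ?thesis
    unfolding smooth_def
    by (intro exI[of _ "\<lambda>k x. cnj (D k x)"]) (auto intro: has_vector_derivative_cnj)
qed

lemma smooth_of_real_id: "smooth (\<lambda>x. of_real x)"
proof -
  have "((\<lambda>x. of_real x :: complex) has_vector_derivative 1) (at x)" for x
    using has_vector_derivative_of_real[OF DERIV_ident] by simp
  then show ?thesis
    unfolding smooth_def
    by (intro exI[of _ "\<lambda>k x. if k = 0 then of_real x else if k = 1 then 1 else 0"]) auto
qed

lemma smooth_affine:
  assumes "smooth f" shows "smooth (\<lambda>x. f (a * x + b))"
proof (rule smooth_coinduct[where P = "\<lambda>h. \<exists>f c. smooth f \<and> h = (\<lambda>x. c * f (a * x + b))"])
  show "\<exists>fa c. smooth fa \<and> (\<lambda>x. f (a * x + b)) = (\<lambda>x. c * fa (a * x + b))"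
    using assms by (intro exI[of _ f] exI[of _ 1]) auto
  fix h assume "\<exists>f c. smooth f \<and> h = (\<lambda>x. c * f (a * x + b))"
  then obtain f c where f: "smooth f" "h = (\<lambda>x. c * f (a * x + b))" by blast
  have "(h has_vector_derivative (c * of_real a) * vector_derivative f (at (a * x + b))) (at x)" for x
  proof -
    have "((\<lambda>x. a * x + b) has_real_derivative a) (at x)" by (auto intro!: derivative_eq_intros)
    then have "(f \<circ> (\<lambda>x. a * x + b) has_vector_derivative a *\<^sub>R vector_derivative f (at (a * x + b))) (at x)"
      by (intro vector_diff_chain_at smooth_has_deriv f) (simp add: has_real_derivative_iff_has_vector_derivative)
    then have "((\<lambda>x. c * (f \<circ> (\<lambda>x. a * x + b)) x) has_vector_derivative c * (a *\<^sub>R vector_derivative f (at (a * x + b)))) (at x)"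
      by (rule has_vector_derivative_mult_right)
    then show ?thesis by (simp add: f(2) o_def scaleR_conv_of_real mult.assoc)
  qed
  then show "\<exists>f'. (\<exists>f c. smooth f \<and> f' = (\<lambda>x. c * f (a * x + b))) \<and> (\<forall>x. (h has_vector_derivative f' x) (at x))"
    using smooth_deriv[OF f(1)] by blast
qed

text \<open>The classical \<open>exp (- (1/x))\<close>, multiplied by powers of \<open>1/x\<close>
  so that the span of the family is closed under differentiation.\<close>

definition flat :: "nat \<Rightarrow> real \<Rightarrow> real" where
  "flat k x = (if x > 0 then (1/x)^k * exp (- (1/x)) else 0)"

lemma flat_tendsto_0: "(flat k \<longlongrightarrow> 0) (at_right 0)"
proof -
  have "((\<lambda>x::real. x^k / exp x) \<longlongrightarrow> 0) at_top" by (rule tendsto_power_div_exp_0)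
  then have "((\<lambda>x::real. (inverse x)^k / exp (inverse x)) \<longlongrightarrow> 0) (at_right 0)"
    by (rule filterlim_compose[OF _ filterlim_inverse_at_top_right])
  then show ?thesis
    by (rule Lim_transform_eventually)
      (auto simp: eventually_at_right_less flat_def exp_minus field_simps inverse_eq_divide eventually_at_filter)
qed

lemma flat_deriv: "(flat k has_real_derivative - real k * flat (Suc k) x + flat (k + 2) x) (at x)"
proof -
  consider "x > 0" | "x < 0" | "x = 0" by linarith
  then show ?thesis
  proof cases
    case 1
    have "((\<lambda>x. (1/x)^k * exp (- (1/x))) has_real_derivative - real k * flat (Suc k) x + flat (k + 2) x) (at x)"
      using 1 by (auto intro!: derivative_eq_intros simp: flat_def)
        (cases k; simp add: field_simps power2_eq_square)
    then show ?thesis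
      by (rule has_field_derivative_transform_within_open[of _ _ _ "{0<..}"])
        (use 1 in \<open>auto simp: flat_def\<close>)
  next
    case 2
    have "((\<lambda>x. 0) has_real_derivative - real k * flat (Suc k) x + flat (k + 2) x) (at x)"
      using 2 by (simp add: flat_def)
    then show ?thesis
      by (rule has_field_derivative_transform_within_open[of _ _ _ "{..<0}"])
        (use 2 in \<open>auto simp: flat_def\<close>)
  next
    case 3
    \<comment> \<open>To the right of 0 the difference quotient is \<open>flat (Suc k)\<close>, to
      the left it is 0.\<close>
    have "((\<lambda>h. (flat k h - flat k 0) / (h - 0)) \<longlongrightarrow> 0) (at 0)"
      proof (rule filterlim_split_at_real)
      show "((\<lambda>h. (flat k h - flat k 0) / (h - 0)) \<longlongrightarrow> 0) (at_right 0)"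
        by (rule Lim_transform_eventually[OF flat_tendsto_0[of "Suc k"]])
          (auto simp: flat_def eventually_at_filter field_simps)
      show "((\<lambda>h. (flat k h - flat k 0) / (h - 0)) \<longlongrightarrow> 0) (at_left 0)"
        by (rule tendsto_eventually) (auto simp: flat_def eventually_at_filter)
    qed
    then show ?thesis using 3 by (simp add: has_field_derivative_iff flat_def)
  qed
qed

inductive flat_span :: "(real \<Rightarrow> complex) \<Rightarrow> bool" where
  flat_span_base: "flat_span (\<lambda>x. of_real (c * flat k x))"
| flat_span_add: "flat_span f \<Longrightarrow> flat_span g \<Longrightarrow> flat_span (\<lambda>x. f x + g x)"

lemma smooth_flat: "smooth (\<lambda>x. of_real (flat k x))"
proof (rule smooth_coinduct[where P = flat_span])
  show "flat_span (\<lambda>x. of_real (flat k x))" using flat_span_base[of 1] by simp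
  fix h assume "flat_span h"
  then show "\<exists>h'. flat_span h' \<and> (\<forall>x. (h has_vector_derivative h' x) (at x))"
  proof induction
    case (flat_span_base c k)
    have "((\<lambda>x. of_real (c * flat k x)) has_vector_derivative
        (of_real ((c * - real k) * flat (Suc k) x) + of_real (c * flat (k + 2) x))) (at x)" for x
      using has_vector_derivative_of_real[OF DERIV_cmult[OF flat_deriv[of k x, unfolded]], of c] 
      by (simp add: algebra_simps)
    then show ?case using flat_span.intros by blast
  next
    case (flat_span_add f g)
    then obtain f' g' where "flat_span f'" "flat_span g'"
      "\<And>x. (f has_vector_derivative f' x) (at x)" "\<And>x. (g has_vector_derivative g' x) (at x)" by metis
    then show ?case
      by (intro exI[of _ "\<lambda>x. f' x + g' x"]) (auto intro!: flat_span.intros has_vector_derivative_add)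
  qed
qed

text \<open>Supported in [a,b] shrunk by \<open>1 / Suc n\<close> at both ends, with values in
  [0,1], and converging pointwise to the indicator of (a,b). Without normalisation the same family
  serves for dominated approximation and as a positive weight.\<close>

definition bump :: "real \<Rightarrow> real \<Rightarrow> nat \<Rightarrow> real \<Rightarrow> real" where
  "bump a b n x = flat 0 (real (Suc n) * (x - a) - 1) * flat 0 (real (Suc n) * (b - x) - 1)"

lemma flat_0_bounds: "0 \<le> flat 0 x" "flat 0 x \<le> 1"
  by (auto simp: flat_def)

lemma bump_bounds: "0 \<le> bump a b n x" "bump a b n x \<le> 1"
  using flat_0_bounds by (auto simp: bump_def intro!: mult_le_one)

lemma bump_eq_0: "x \<notin> {a + 1/Suc n<..<b - 1/Suc n} \<Longrightarrow> bump a b n x = 0"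
  by (auto simp: bump_def flat_def field_simps)

lemma bump_pos: "x \<in> {a + 1/Suc n<..<b - 1/Suc n} \<Longrightarrow> bump a b n x > 0"
  by (auto simp: bump_def flat_def field_simps)

lemma smooth_bump: "smooth (\<lambda>x. of_real (bump a b n x))"
proof -
  have "smooth (\<lambda>x. of_real (flat 0 (real (Suc n) * x + (- real (Suc n) * a - 1))) *
      of_real (flat 0 ((- real (Suc n)) * x + (real (Suc n) * b - 1))))"
    by (intro smooth_mult smooth_affine[OF smooth_flat])
  moreover have "real (Suc n) * x + (- real (Suc n) * a - 1) = real (Suc n) * (x - a) - 1"
    "(- real (Suc n)) * x + (real (Suc n) * b - 1) = real (Suc n) * (b - x) - 1" for x
    by (simp_all add: algebra_simps)
  ultimately show ?thesis unfolding bump_def of_real_mult by (simp only:)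
qed

lemma flat_0_lim: "c > 0 \<Longrightarrow> (\<lambda>n. flat 0 (real (Suc n) * c - 1)) \<longlonglongrightarrow> 1"
proof -
  assume c: "c > 0"
  have t: "filterlim (\<lambda>n. real (Suc n) * c - 1) at_top sequentially"
    using c by real_asymp
  then have "(\<lambda>n. inverse (real (Suc n) * c - 1)) \<longlonglongrightarrow> 0"
    by (rule filterlim_compose[OF tendsto_inverse_0_at_top, rotated]) (rule filterlim_ident)
  then have "(\<lambda>n. exp (- inverse (real (Suc n) * c - 1))) \<longlonglongrightarrow> exp (- 0)" by (intro tendsto_intros)
  then have "(\<lambda>n. exp (- inverse (real (Suc n) * c - 1))) \<longlonglongrightarrow> 1" by simp
  moreover have "\<forall>\<^sub>F n in sequentially. real (Suc n) * c - 1 > 0"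
    using t unfolding filterlim_at_top_dense by blast
  then have "\<forall>\<^sub>F n in sequentially. exp (- inverse (real (Suc n) * c - 1)) = flat 0 (real (Suc n) * c - 1)"
    by (rule eventually_mono) (simp only: flat_def if_True inverse_eq_divide power_0 mult_1)
  ultimately show ?thesis by (rule Lim_transform_eventually)
qed

lemma bump_lim: "(\<lambda>n. bump a b n x) \<longlonglongrightarrow> indicator {a<..<b} x"
proof (cases "x \<in> {a<..<b}")
  case True
  then show ?thesis
    using tendsto_mult[OF flat_0_lim[of "x - a"] flat_0_lim[of "b - x"]] by (simp add: bump_def)
next
  case False
  have "bump a b n x = 0" for n
  proof (rule bump_eq_0)
    define d where "d = 1 / real (Suc n)"
    have "d > 0" by (simp add: d_def)
    then show "x \<notin> {a + 1/Suc n<..<b - 1/Suc n}" using False unfolding d_def[symmetric] by auto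
  qed
  then show ?thesis using False by simp
qed

lemma test_functions_bump:
  assumes "{a<..<b} \<subseteq> S" shows "(\<lambda>x. of_real (bump a b n x)) \<in> test_functions S"
proof -
  define d where "d = 1 / real (Suc n)"
  have "d > 0" by (simp add: d_def)
  then have "{a + d..b - d} \<subseteq> {a<..<b}" by auto
  then have "{a + 1/Suc n..b - 1/Suc n} \<subseteq> S" using assms unfolding d_def by blast
  moreover have "of_real (bump a b n x) = (0 :: complex)" if "x \<notin> {a + 1/Suc n..b - 1/Suc n}" for x
    using that bump_eq_0[of x a n b] by (auto simp del: of_nat_Suc)
  ultimately show ?thesis
    unfolding test_functions_def using smooth_bump compact_Icc by blast
qed

lemma test_functions_mono: "S \<subseteq> S' \<Longrightarrow> test_functions S \<subseteq> test_functions S'"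
  unfolding test_functions_def by blast

lemma test_functions_add:
  assumes "\<phi> \<in> test_functions S" "\<psi> \<in> test_functions S"
  shows "(\<lambda>x. \<phi> x + \<psi> x) \<in> test_functions S"
proof -
  from assms obtain K K' where K: "smooth \<phi>" "compact K" "K \<subseteq> S" "\<forall>x. x \<notin> K \<longrightarrow> \<phi> x = 0"
    "smooth \<psi>" "compact K'" "K' \<subseteq> S" "\<forall>x. x \<notin> K' \<longrightarrow> \<psi> x = 0"
    unfolding test_functions_def by blast
  then have "smooth \<phi>" "smooth \<psi>" "compact (K \<union> K')" "K \<union> K' \<subseteq> S"
    "\<forall>x. x \<notin> K \<union> K' \<longrightarrow> \<phi> x + \<psi> x = 0"
    by auto
  then show ?thesis unfolding test_functions_def using smooth_add by blast
qed

lemma test_functions_mult_smooth: "smooth f \<Longrightarrow> \<phi> \<in> test_functions S \<Longrightarrow> (\<lambda>x. f x * \<phi> x) \<in> test_functions S"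
  unfolding test_functions_def by (auto intro!: smooth_mult)

lemma test_functions_cmult: "\<phi> \<in> test_functions S \<Longrightarrow> (\<lambda>x. c * \<phi> x) \<in> test_functions S"
  by (intro test_functions_mult_smooth smooth_const)

lemma test_functions_zero: "(\<lambda>x. 0) \<in> test_functions S"
  unfolding test_functions_def by (auto intro!: smooth_const exI[of _ "{}"])

lemma test_functions_cnj: "\<phi> \<in> test_functions S \<Longrightarrow> (\<lambda>x. cnj (\<phi> x)) \<in> test_functions S"
  unfolding test_functions_def by (auto intro!: smooth_cnj)

lemma test_functions_smooth: "\<phi> \<in> test_functions S \<Longrightarrow> smooth \<phi>"
  unfolding test_functions_def by blast

lemma test_functions_outside: "\<phi> \<in> test_functions S \<Longrightarrow> x \<notin> S \<Longrightarrow> \<phi> x = 0"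
  unfolding test_functions_def by blast

lemma test_functions_deriv:
  assumes "\<phi> \<in> test_functions S" shows "(\<lambda>x. vector_derivative \<phi> (at x)) \<in> test_functions S"
proof -
  from assms obtain K where K: "smooth \<phi>" "compact K" "K \<subseteq> S" "\<And>x. x \<notin> K \<Longrightarrow> \<phi> x = 0"
    unfolding test_functions_def by blast
  have "vector_derivative \<phi> (at x) = 0" if "x \<notin> K" for x
  proof (rule vector_derivative_at)
    have "((\<lambda>x. 0) has_vector_derivative 0) (at x)" by simp
    then show "(\<phi> has_vector_derivative 0) (at x)"
      by (rule has_vector_derivative_transform_within_open[of _ _ _ "- K"])
        (use K that compact_imp_closed in auto)
  qed
  then show ?thesis unfolding test_functions_def using K smooth_deriv by blast
qed

lemma test_functions_support:
  assumes "\<phi> \<in> test_functions S" obtains r where "\<And>x. \<bar>x\<bar> > r \<Longrightarrow> \<phi> x = 0" "r > 0"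
proof -
  from assms obtain K where K: "compact K" "\<And>x. x \<notin> K \<Longrightarrow> \<phi> x = 0"
    unfolding test_functions_def by blast
  then obtain r where "r > 0" "\<And>x. x \<in> K \<Longrightarrow> norm x \<le> r"
    using compact_imp_bounded bounded_pos by metis
  then show thesis using that[of r] K by (metis linorder_not_le real_norm_def)
qed

lemma test_functions_bounded:
  assumes "\<phi> \<in> test_functions S" obtains B where "\<And>x. cmod (\<phi> x) \<le> B" "B > 0"
proof -
  obtain r where r: "\<And>x. \<bar>x\<bar> > r \<Longrightarrow> \<phi> x = 0" "r > 0" using test_functions_support[OF assms] by blast
  have "compact (\<phi> ` {-r..r})"
    using smooth_continuous[OF test_functions_smooth[OF assms]] by (intro compact_continuous_image) auto
  then obtain B where B: "B > 0" "\<And>y. y \<in> \<phi> ` {-r..r} \<Longrightarrow> norm y \<le> B"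
    using compact_imp_bounded bounded_pos by metis
  have "cmod (\<phi> x) \<le> B" for x
  proof (cases "\<bar>x\<bar> > r")
    case False
    then have "x \<in> {-r..r}" by auto
    then have "\<phi> x \<in> \<phi> ` {-r..r}" by (rule imageI)
    then show ?thesis by (rule B)
  qed (use B r(1) in simp)
  then show thesis using that B by blast
qed

lemma test_functions_measurable: "\<phi> \<in> test_functions S \<Longrightarrow> \<phi> \<in> borel_measurable lebesgue"
  using borel_measurable_continuous_onI[OF smooth_continuous[OF test_functions_smooth]]
  by (metis measurable_completion measurable_lborel2)

lemma test_functions_sqint:
  assumes "\<phi> \<in> test_functions S" shows "sqint \<phi>"
proof -
  obtain r where r: "\<And>x. \<bar>x\<bar> > r \<Longrightarrow> \<phi> x = 0" using test_functions_support[OF assms] by blast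
  obtain B where B: "\<And>x. cmod (\<phi> x) \<le> B" using test_functions_bounded[OF assms] by blast
  have "{-r..r} \<in> lmeasurable" by simp
  then have "integrable lebesgue (\<lambda>x. indicator {-r..r} x * B\<^sup>2)" by (auto simp: fmeasurable_def)
  then show ?thesis
  proof (rule sqint_dominated[OF test_functions_measurable[OF assms]])
    show "(cmod (\<phi> x))\<^sup>2 \<le> indicator {-r..r} x * B\<^sup>2" for x
      using r[of x] B[of x] by (cases "\<bar>x\<bar> > r") (auto simp: indicator_def intro!: power_mono)
  qed
qed

lemma test_functions_integral_deriv:
  assumes "\<phi> \<in> test_functions S"
  shows "(LINT x|lebesgue. vector_derivative \<phi> (at x)) = 0" "integrable lebesgue (\<lambda>x. vector_derivative \<phi> (at x))"
proof -
  note d = test_functions_deriv[OF assms]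
  obtain r where r: "\<And>x. \<bar>x\<bar> > r \<Longrightarrow> \<phi> x = 0" "r > 0" using test_functions_support[OF assms] by blast
  obtain r' where r': "\<And>x. \<bar>x\<bar> > r' \<Longrightarrow> vector_derivative \<phi> (at x) = 0" "r' > 0" using test_functions_support[OF d] by blast
  \<comment> \<open>The functions are only known to vanish strictly beyond \<open>r\<close> and
    \<open>r'\<close>; the extra 1 puts the end points \<open>R\<close> and \<open>- R\<close> where
    \<phi> is 0.\<close>
  define R where "R = max r r' + 1"
  have "(vector_derivative \<phi> (at x) :: complex) = indicator {-R..R} x *\<^sub>R vector_derivative \<phi> (at x)" for x
    using r'(1)[of x] by (auto simp: R_def indicator_def max_def abs_if split: if_splits)
  then have eq: "(\<lambda>x. vector_derivative \<phi> (at x)) = (\<lambda>x. indicator {-R..R} x *\<^sub>R vector_derivative \<phi> (at x))" by auto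
  have "has_bochner_integral lborel (\<lambda>x. indicator {-R..R} x *\<^sub>R vector_derivative \<phi> (at x)) (\<phi> R - \<phi> (-R))"
    by (rule has_bochner_integral_FTC_Icc)
      (use r r' in \<open>auto simp: R_def smooth_continuous test_functions_smooth[OF d]
        intro!: has_vector_derivative_at_within smooth_has_deriv test_functions_smooth[OF assms]\<close>)
  moreover have "\<phi> R = 0" "\<phi> (- R) = 0" by (rule r; use r r' in \<open>auto simp: R_def\<close>)+
  ultimately have b: "has_bochner_integral lborel (\<lambda>x. vector_derivative \<phi> (at x)) 0" using eq by simp
  then show "(LINT x|lebesgue. vector_derivative \<phi> (at x)) = 0" "integrable lebesgue (\<lambda>x. vector_derivative \<phi> (at x))"
    by (auto simp: has_bochner_integral_iff integral_completion integrable_completion borel_measurable_integrable)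
qed

section \<open>Sobolev functions on an interval\<close>

lemma measurable_indicator_interval:
  "f \<in> borel_measurable lebesgue \<Longrightarrow>
    (\<lambda>x. indicator {a<..<b::real} x *\<^sub>R (f x :: 'a::{real_normed_vector, second_countable_topology})) \<in> borel_measurable lebesgue"
  by (intro borel_measurable_scaleR borel_measurable_indicator) auto

lemma sqint_res: "sqint f \<Longrightarrow> sqint (\<lambda>x. indicator {a<..<b} x *\<^sub>R f x)"
proof (rule sqint_dominated)
  show "(cmod (indicator {a<..<b} x *\<^sub>R f x))\<^sup>2 \<le> (cmod (f x))\<^sup>2" for x
    by (auto simp: indicator_def)
qed (auto simp: sqint_def measurable_indicator_interval)

text \<open>The orthogonal projection onto the functions vanishing outside (a,b); its range is the
  copy of L2(a,b) inside \<open>ltwo\<close>.\<close>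

lift_definition res :: "real \<Rightarrow> real \<Rightarrow> ltwo \<Rightarrow> ltwo" is "\<lambda>a b f x. indicator {a<..<b} x *\<^sub>R f x"
  by (auto simp: sqint_res)

lemma res_cls: "sqint f \<Longrightarrow> res a b (cls f) = cls (\<lambda>x. indicator {a<..<b} x *\<^sub>R f x)"
  unfolding cls_def by (simp add: res.abs_eq)

lemma res_add: "res a b (x + y) = res a b x + res a b y"
  by (rule cls_cases[of x], rule cls_cases[of y])
    (simp add: res_cls sqint_res sqint_add scaleR_add_right flip: cls_add)

lemma res_scaleR: "res a b (c *\<^sub>R x) = c *\<^sub>R res a b x"
  by (rule cls_cases[of x])
    (simp add: res_cls sqint_res sqint_scaleR flip: cls_scaleR, simp add: mult.commute)

lemma norm_res_le: "norm (res a b x) \<le> norm x"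
proof (rule cls_cases[of x])
  fix f assume f: "sqint f" "x = cls f"
  have "(LINT x|lebesgue. (cmod (indicator {a<..<b} x *\<^sub>R f x))\<^sup>2) \<le> (LINT x|lebesgue. (cmod (f x))\<^sup>2)"
  proof (rule integral_mono)
    show "(cmod (indicator {a<..<b} x *\<^sub>R f x))\<^sup>2 \<le> (cmod (f x))\<^sup>2" for x
      by (auto simp: indicator_def)
  qed (use f(1) sqint_res[OF f(1), of a b] in \<open>simp_all only: sqint_def\<close>)
  then have "(norm (res a b x))\<^sup>2 \<le> (norm x)\<^sup>2"
    using f sqint_res[OF f(1), of a b] by (simp only: res_cls norm_cls)
  then show ?thesis by (rule power2_le_imp_le) simp
qed

lemma bounded_linear_res: "bounded_linear (res a b)"
  by (rule bounded_linear_intro[where K = 1]) (auto simp: res_add res_scaleR norm_res_le)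

lemmas linear_res = bounded_linear.linear[OF bounded_linear_res]

lemma indicator_test_function:
  "\<phi> \<in> test_functions {a<..<b} \<Longrightarrow> (\<lambda>x. indicator {a<..<b} x *\<^sub>R \<phi> x) = \<phi>"
  using test_functions_outside[of \<phi> "{a<..<b}"] by (fastforce simp: indicator_def)

text \<open>The preimage of the closure under \<open>res a b\<close> is a closed subgroup, so it
  suffices to treat interval steps, and their restrictions to (a,b) are limits of multiples of
  bumps.\<close>

lemma test_functions_dense: "res a b x \<in> closure (cls ` test_functions {a<..<b})" (is "_ \<in> closure ?T")
proof -
  let ?M = "res a b -` closure ?T"
  have "?M = UNIV"
  proof (rule closed_subgroup_ltwo_UNIV)
    show "closed ?M"
      by (intro closed_vimage closed_closure linear_continuous_on bounded_linear_res)
    have Ta: "x + y \<in> ?T" if "x \<in> ?T" "y \<in> ?T" for x y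
    proof -
      from that obtain f g where fg: "f \<in> test_functions {a<..<b}" "g \<in> test_functions {a<..<b}"
        "x = cls f" "y = cls g" by blast
      then have "x + y = cls (\<lambda>x. f x + g x)" by (simp add: cls_add test_functions_sqint)
      then show ?thesis using test_functions_add[OF fg(1,2)] by blast
    qed
    have Tm: "c *\<^sub>R x \<in> ?T" if "x \<in> ?T" for x c
    proof -
      from that obtain f where f: "f \<in> test_functions {a<..<b}" "x = cls f" by blast
      then have "c *\<^sub>R x = cls (\<lambda>x. of_real c * f x)"
        using cls_scaleR[OF test_functions_sqint[OF f(1)], of c] by (simp add: scaleR_conv_of_real)
      then show ?thesis using test_functions_cmult[OF f(1)] by blast
    qed
    have "cls (\<lambda>x. 0) \<in> ?T" by (intro imageI test_functions_zero)
    from subsetD[OF closure_subset this] have "0 \<in> closure ?T" by (simp add: cls_zero)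
    then show "0 \<in> ?M" by (simp add: linear_0[OF linear_res])
    show "x + y \<in> ?M" if "x \<in> ?M" "y \<in> ?M" for x y
      using closure_add[of ?T, OF Ta] that by (simp add: res_add)
    show "- x \<in> ?M" if "x \<in> ?M" for x
    proof -
      have "- y \<in> ?T" if "y \<in> ?T" for y using Tm[OF that, of "-1"] by simp
      then show ?thesis using closure_uminus[of ?T] that by (simp add: linear_neg[OF linear_res])
    qed
    fix p q c
    define u v where "u = max a p" and "v = min b q"
    have uv: "{u<..<v} \<subseteq> {a<..<b}" by (auto simp: u_def v_def)
    have tf: "(\<lambda>x. c * of_real (bump u v n x)) \<in> test_functions {a<..<b}" for n
      by (intro test_functions_cmult test_functions_bump uv)
    have ind: "sqint (\<lambda>x. indicator {u<..<v} x *\<^sub>R c)" by (rule sqint_indicator) simp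
    have "(\<lambda>n. cls (\<lambda>x. c * of_real (bump u v n x))) \<longlonglongrightarrow> cls (\<lambda>x. indicator {u<..<v} x *\<^sub>R c)"
    proof (rule cls_dominated_tendsto(3))
      have "{u<..<v} \<in> lmeasurable" by simp
      then show "integrable lebesgue (\<lambda>x. indicator {u<..<v} x * (cmod c)\<^sup>2)" by (auto simp: fmeasurable_def)
      show "(cmod (c * of_real (bump u v n x)))\<^sup>2 \<le> indicator {u<..<v} x * (cmod c)\<^sup>2" for n x
      proof (cases "x \<in> {u<..<v}")
        case True
        have "cmod c * bump u v n x \<le> cmod c * 1" using bump_bounds by (intro mult_left_mono) auto
        then have "(cmod c * bump u v n x)\<^sup>2 \<le> (cmod c)\<^sup>2" using bump_bounds by (intro power_mono) auto
        then show ?thesis using True bump_bounds by (simp add: norm_mult)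
      next
        case False
        then have "(of_real (bump u v n x) :: complex) = 0"
          by (rule test_functions_outside[OF test_functions_bump[OF order_refl]])
        then show ?thesis using False by (simp only: norm_zero mult_zero_right) simp
      qed
      show "AE x in lebesgue. (\<lambda>n. c * of_real (bump u v n x)) \<longlonglongrightarrow> indicator {u<..<v} x *\<^sub>R c"
      proof (rule AE_I2)
        fix x
        have "(\<lambda>n. bump u v n x *\<^sub>R c) \<longlonglongrightarrow> indicator {u<..<v} x *\<^sub>R c"
          by (intro tendsto_intros bump_lim)
        then show "(\<lambda>n. c * of_real (bump u v n x)) \<longlonglongrightarrow> indicator {u<..<v} x *\<^sub>R c"
          by (simp add: scaleR_conv_of_real mult.commute)
      qed
    qed (use ind tf in \<open>auto intro: sqint_measurable test_functions_measurable\<close>)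
    moreover have "res a b (cls (\<lambda>x. indicator {p<..<q} x *\<^sub>R c)) = cls (\<lambda>x. indicator {u<..<v} x *\<^sub>R c)"
    proof (subst res_cls)
      show "sqint (\<lambda>x. indicator {p<..<q} x *\<^sub>R c)" by (rule sqint_indicator) simp
      have "(\<lambda>x. indicator {a<..<b} x *\<^sub>R (indicator {p<..<q} x *\<^sub>R c)) = (\<lambda>x. indicator {u<..<v} x *\<^sub>R c)"
        by (auto simp: fun_eq_iff indicator_def u_def v_def)
      then show "cls (\<lambda>x. indicator {a<..<b} x *\<^sub>R (indicator {p<..<q} x *\<^sub>R c)) = cls (\<lambda>x. indicator {u<..<v} x *\<^sub>R c)"
        by (rule arg_cong)
    qed
    moreover have "cls (\<lambda>x. c * of_real (bump u v n x)) \<in> closure ?T" for n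
      by (rule subsetD[OF closure_subset]) (intro imageI tf)
    ultimately show "cls (\<lambda>x. indicator {p<..<q} x *\<^sub>R c) \<in> ?M"
      using closed_sequentially[OF closed_closure, of "\<lambda>n. cls (\<lambda>x. c * of_real (bump u v n x))"]
      by simp
  qed
  then show ?thesis by auto
qed

lemma test_functions_sequence:
  obtains \<phi> where "\<And>n::nat. \<phi> n \<in> test_functions {a<..<b}" "(\<lambda>n. cls (\<phi> n)) \<longlonglongrightarrow> res a b x"
proof -
  obtain f where f: "\<forall>n. f n \<in> cls ` test_functions {a<..<b}" "f \<longlonglongrightarrow> res a b x"
    using test_functions_dense[of a b x] unfolding closure_sequential by blast
  have "\<forall>n. \<exists>\<phi>. \<phi> \<in> test_functions {a<..<b} \<and> f n = cls \<phi>" using f(1) by blast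
  then obtain \<phi> where \<phi>: "\<forall>n. \<phi> n \<in> test_functions {a<..<b} \<and> f n = cls (\<phi> n)"
    by (rule choice[THEN exE])
  then have "f = (\<lambda>n. cls (\<phi> n))" by auto
  then show thesis using that[of \<phi>] \<phi> f(2) by simp
qed

text \<open>Extension by zero makes the class independent of the values outside (0,L). On
  \<open>L2 L\<close>, equality of these classes is equality in L2(0,L).\<close>

definition cl :: "real \<Rightarrow> (real \<Rightarrow> complex) \<Rightarrow> ltwo" where
  "cl L f = cls (\<lambda>x. indicator {0<..<L} x *\<^sub>R f x)"

lemma L2_iff: "f \<in> L2 L \<longleftrightarrow> sqint (\<lambda>x. indicator {0<..<L} x *\<^sub>R f x)"
proof -
  have "(\<lambda>x. (cmod (indicator {0<..<L} x *\<^sub>R f x))\<^sup>2) = (\<lambda>x. indicator {0<..<L} x *\<^sub>R (cmod (f x))\<^sup>2)"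
    by (auto simp: indicator_def)
  then show ?thesis
    by (simp add: L2_def sqint_def borel_measurable_restrict_space_iff integrable_restrict_space)
qed

lemma L2_integral:
  fixes f :: "real \<Rightarrow> 'a::{banach, second_countable_topology}"
  shows "(LINT x|interval_measure_on L. f x) = (LINT x|lebesgue. indicator {0<..<L} x *\<^sub>R f x)"
  by (subst integral_restrict_space) auto

lemma L2_norm_eq: "f \<in> L2 L \<Longrightarrow> L2_norm L f = norm (cl L f)"
proof -
  assume "f \<in> L2 L"
  then have "(norm (cl L f))\<^sup>2 = (LINT x|lebesgue. (cmod (indicator {0<..<L} x *\<^sub>R f x))\<^sup>2)"
    unfolding cl_def by (intro norm_cls) (simp add: L2_iff)
  also have "\<dots> = (LINT x|interval_measure_on L. (cmod (f x))\<^sup>2)"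
    unfolding L2_integral by (intro Bochner_Integration.integral_cong) (auto simp: indicator_def)
  finally show ?thesis unfolding L2_norm_def by (metis norm_ge_zero real_sqrt_unique)
qed

lemma L2_add: "f \<in> L2 L \<Longrightarrow> g \<in> L2 L \<Longrightarrow> (\<lambda>x. f x + g x) \<in> L2 L"
  and cl_add: "f \<in> L2 L \<Longrightarrow> g \<in> L2 L \<Longrightarrow> cl L (\<lambda>x. f x + g x) = cl L f + cl L g"
  by (auto simp: L2_iff cl_def scaleR_add_right sqint_add cls_add)

lemma L2_diff: "f \<in> L2 L \<Longrightarrow> g \<in> L2 L \<Longrightarrow> (\<lambda>x. f x - g x) \<in> L2 L"
  and cl_diff: "f \<in> L2 L \<Longrightarrow> g \<in> L2 L \<Longrightarrow> cl L (\<lambda>x. f x - g x) = cl L f - cl L g"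
  by (auto simp: L2_iff cl_def scaleR_diff_right sqint_diff cls_diff)

lemma L2_cmult: "f \<in> L2 L \<Longrightarrow> (\<lambda>x. c * f x) \<in> L2 L"
  using sqint_cmult[of _ c] by (simp add: L2_iff mult.left_commute scaleR_conv_of_real)

lemma cl_cmult: "f \<in> L2 L \<Longrightarrow> cl L (\<lambda>x. of_real c * f x) = c *\<^sub>R cl L f"
  unfolding L2_iff cl_def
  by (subst cls_scaleR[symmetric]) (auto simp: scaleR_conv_of_real mult.left_commute)

lemma res_cl: "f \<in> L2 L \<Longrightarrow> res 0 L (cl L f) = cl L f"
  unfolding cl_def L2_iff
  by (subst res_cls) (auto intro!: arg_cong[of _ _ cls] simp: fun_eq_iff indicator_def)

lemma cl_cases:
  assumes "res 0 L x = x" obtains f where "f \<in> L2 L" "x = cl L f"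
proof (rule cls_cases[of x])
  fix f assume f: "sqint f" "x = cls f"
  then have "f \<in> L2 L" "x = cl L f" using assms by (auto simp: L2_iff sqint_res cl_def res_cls)
  then show thesis by (rule that)
qed

lemma cl_zero: "cl L (\<lambda>x. 0) = 0" by (simp add: cl_def cls_zero)
lemma L2_zero: "(\<lambda>x. 0) \<in> L2 L" by (simp add: L2_iff sqint_zero)

lemma test_functions_L2: "\<phi> \<in> test_functions {0<..<L} \<Longrightarrow> \<phi> \<in> L2 L"
  by (simp add: L2_iff sqint_res test_functions_sqint)

lemma cl_test_function: "\<phi> \<in> test_functions {0<..<L} \<Longrightarrow> cl L \<phi> = cls \<phi>"
  unfolding cl_def by (simp only: indicator_test_function)

lemma L2_continuous: "continuous_on UNIV f \<Longrightarrow> f \<in> L2 L"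
proof -
  assume f: "continuous_on UNIV f"
  have "compact (f ` {0..L})" by (intro compact_continuous_image continuous_on_subset[OF f]) auto
  then obtain B where B: "B > 0" "\<And>y. y \<in> f ` {0..L} \<Longrightarrow> norm y \<le> B"
    using compact_imp_bounded bounded_pos by metis
  have fm: "f \<in> borel_measurable lebesgue"
    using borel_measurable_continuous_onI[OF f] by (metis measurable_completion measurable_lborel2)
  have "{0<..<L} \<in> lmeasurable" by simp
  then have "integrable lebesgue (\<lambda>x. indicator {0<..<L} x * B\<^sup>2)" by (auto simp: fmeasurable_def)
  then show ?thesis
    unfolding L2_iff
  proof (rule sqint_dominated[rotated])
    show "(cmod (indicator {0<..<L} x *\<^sub>R f x))\<^sup>2 \<le> indicator {0<..<L} x * B\<^sup>2" for x
      using B(2)[of "f x"] by (auto simp: indicator_def intro!: power_mono)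
  qed (rule measurable_indicator_interval[OF fm])
qed

lemma inner_cl: "f \<in> L2 L \<Longrightarrow> g \<in> L2 L \<Longrightarrow> cl L f \<bullet> cl L g = (LINT x|interval_measure_on L. f x \<bullet> g x)"
  unfolding cl_def L2_iff L2_integral
  by (subst inner_cls) (auto intro!: Bochner_Integration.integral_cong simp: indicator_def)

lemma integrable_L2_prod: 
  assumes "f \<in> L2 L" "g \<in> L2 L" shows "integrable (interval_measure_on L) (\<lambda>x. f x * g x)"
proof -
  have "integrable lebesgue (\<lambda>x. (indicator {0<..<L} x *\<^sub>R f x) * (indicator {0<..<L} x *\<^sub>R g x))"
    using assms unfolding L2_iff by (rule sqint_prod_integrable)
  moreover have "(\<lambda>x. (indicator {0<..<L} x *\<^sub>R f x) * (indicator {0<..<L} x *\<^sub>R g x)) = (\<lambda>x. indicator {0<..<L} x *\<^sub>R (f x * g x))"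
    by (auto simp: indicator_def)
  ultimately show ?thesis by (simp add: integrable_restrict_space)
qed

lemma Re_integral_cnj:
  assumes "f \<in> L2 L" "g \<in> L2 L"
  shows "Re (LINT x|interval_measure_on L. f x * g x) = cl L f \<bullet> cl L (\<lambda>x. cnj (g x))"
proof -
  have "(\<lambda>x. cnj (g x)) \<in> L2 L"
    using assms(2) sqint_cnj by (fastforce simp: L2_iff)
  then show ?thesis
    using assms integral_Re[OF integrable_L2_prod[OF assms]]
    by (simp only: inner_cl inner_eq_Re_cnj complex_cnj_cnj)
qed

lemma vector_derivative_cnj_smooth:
  "smooth f \<Longrightarrow> vector_derivative (\<lambda>x. cnj (f x)) (at x) = cnj (vector_derivative f (at x))"
  by (intro vector_derivative_at has_vector_derivative_cnj smooth_has_deriv)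

lemma vector_derivative_cmult_smooth:
  "smooth f \<Longrightarrow> vector_derivative (\<lambda>x. c * f x) (at x) = c * vector_derivative f (at x)"
  by (intro vector_derivative_at has_vector_derivative_mult_right smooth_has_deriv)

text \<open>The weak derivative is defined by complex-bilinear pairings; replacing a test function by its
  conjugate and by its multiple by \<open>\<i>\<close> turns them into the real inner product of \<open>ltwo\<close>.\<close>

lemma has_weak_deriv_iff:
  "has_weak_deriv L f h \<longleftrightarrow> f \<in> L2 L \<and> h \<in> L2 L \<and>
     (\<forall>\<phi>\<in>test_functions {0<..<L}. cl L f \<bullet> cls (\<lambda>x. vector_derivative \<phi> (at x)) = - (cl L h \<bullet> cls \<phi>))"
  (is "?A \<longleftrightarrow> ?B")
proof
  assume A: ?A
  show ?B
  proof (intro conjI ballI)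
    show fh: "f \<in> L2 L" "h \<in> L2 L" using A by (auto simp: has_weak_deriv_def)
    fix \<phi> assume \<phi>: "\<phi> \<in> test_functions {0<..<L}"
    note c = test_functions_cnj[OF \<phi>]
    note d = test_functions_deriv[OF \<phi>]
    have "Re (LINT x|interval_measure_on L. f x * cnj (vector_derivative \<phi> (at x))) =
        - Re (LINT x|interval_measure_on L. h x * cnj (\<phi> x))"
      using A c test_functions_smooth[OF \<phi>] by (auto simp: has_weak_deriv_def vector_derivative_cnj_smooth)
    then show "cl L f \<bullet> cls (\<lambda>x. vector_derivative \<phi> (at x)) = - (cl L h \<bullet> cls \<phi>)"
      using \<phi> c d test_functions_cnj[OF d] fh
      by (simp add: Re_integral_cnj test_functions_L2 cl_test_function)
  qed
next
  assume B: ?B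
  have B': "cl L f \<bullet> cls (\<lambda>x. vector_derivative \<phi> (at x)) = - (cl L h \<bullet> cls \<phi>)"
    if "\<phi> \<in> test_functions {0<..<L}" for \<phi>
    using B that by blast
  have re: "Re (LINT x|interval_measure_on L. f x * vector_derivative \<phi> (at x)) =
      Re (- (LINT x|interval_measure_on L. h x * \<phi> x))" if \<phi>: "\<phi> \<in> test_functions {0<..<L}" for \<phi>
  proof -
    note c = test_functions_cnj[OF \<phi>]
    note d = test_functions_deriv[OF \<phi>]
    show ?thesis
      using B B'[OF c] c d \<phi> test_functions_cnj[OF d]
      by (simp add: Re_integral_cnj test_functions_L2 cl_test_function
          vector_derivative_cnj_smooth test_functions_smooth)
  qed
  show ?A
    unfolding has_weak_deriv_def
  proof (intro conjI ballI)
    fix \<phi> assume \<phi>: "\<phi> \<in> test_functions {0<..<L}"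
    have sm: "smooth \<phi>" using \<phi> by (rule test_functions_smooth)
    have "Re (\<i> * (LINT x|interval_measure_on L. f x * vector_derivative \<phi> (at x))) =
      Re (\<i> * (- (LINT x|interval_measure_on L. h x * \<phi> x)))"
      using re[OF test_functions_cmult[OF \<phi>, of \<i>]]
      by (simp add: vector_derivative_cmult_smooth[OF sm] mult.left_commute)
    then show "(LINT x|interval_measure_on L. f x * vector_derivative \<phi> (at x)) =
      - (LINT x|interval_measure_on L. h x * \<phi> x)"
      using re[OF \<phi>] by (simp add: complex_eq_iff)
  qed (use B in auto)
qed

text \<open>Weak derivatives are unique as classes, so this class is independent of the choice made
  in \<open>weak_deriv\<close> and, on \<open>H1 L\<close>, depends on \<open>f\<close> only through
  \<open>cl L f\<close>.\<close>

definition d :: "real \<Rightarrow> (real \<Rightarrow> complex) \<Rightarrow> ltwo" where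
  "d L f = cl L (weak_deriv L f)"

text \<open>Test functions are dense in the range of \<open>res 0 L\<close>, so the difference of
  the two elements may be tested against itself.\<close>

lemma cl_eqI:
  assumes "x = res 0 L x" "y = res 0 L y"
    and "\<And>\<phi>. \<phi> \<in> test_functions {0<..<L} \<Longrightarrow> x \<bullet> cls \<phi> = y \<bullet> cls \<phi>"
  shows "x = y"
proof -
  obtain \<phi> where \<phi>: "\<And>n. \<phi> n \<in> test_functions {0<..<L}" "(\<lambda>n. cls (\<phi> n)) \<longlonglongrightarrow> res 0 L (x - y)"
    using test_functions_sequence by blast
  have "(\<lambda>n. (x - y) \<bullet> cls (\<phi> n)) \<longlonglongrightarrow> (x - y) \<bullet> res 0 L (x - y)"
    by (intro tendsto_intros \<phi>)
  moreover have "(x - y) \<bullet> cls (\<phi> n) = 0" for n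
    using assms(3)[OF \<phi>(1)] by (simp add: inner_diff_left)
  moreover have "res 0 L (x - y) = x - y"
    using assms(1,2) by (simp add: linear_diff[OF linear_res])
  ultimately show ?thesis by (simp add: LIMSEQ_const_iff)
qed

lemma has_weak_deriv_L2: "has_weak_deriv L f h \<Longrightarrow> f \<in> L2 L" "has_weak_deriv L f h \<Longrightarrow> h \<in> L2 L"
  by (auto simp: has_weak_deriv_def)

lemma has_weak_deriv_unique: 
  assumes "has_weak_deriv L f h" "has_weak_deriv L f' h'" "cl L f = cl L f'"
  shows "cl L h = cl L h'"
proof (rule cl_eqI)
  show "cl L h = res 0 L (cl L h)" "cl L h' = res 0 L (cl L h')"
    using assms by (auto dest: has_weak_deriv_L2 simp: res_cl)
  show "cl L h \<bullet> cls \<phi> = cl L h' \<bullet> cls \<phi>" if "\<phi> \<in> test_functions {0<..<L}" for \<phi>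
    using assms that by (auto simp: has_weak_deriv_iff)
qed

lemma H1_has_weak_deriv: "f \<in> H1 L \<Longrightarrow> has_weak_deriv L f (weak_deriv L f)"
  unfolding H1_def weak_deriv_def using someI_ex[of "has_weak_deriv L f"] by auto

lemma H1I: "has_weak_deriv L f h \<Longrightarrow> f \<in> H1 L"
  unfolding H1_def by blast

lemma d_eq: "has_weak_deriv L f h \<Longrightarrow> d L f = cl L h"
  unfolding d_def using has_weak_deriv_unique H1_has_weak_deriv H1I by metis

lemma H1_L2: "f \<in> H1 L \<Longrightarrow> f \<in> L2 L" "f \<in> H1 L \<Longrightarrow> weak_deriv L f \<in> L2 L"
  using H1_has_weak_deriv has_weak_deriv_L2 by blast+

lemma d_cong: "f \<in> H1 L \<Longrightarrow> g \<in> H1 L \<Longrightarrow> cl L f = cl L g \<Longrightarrow> d L f = d L g"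
  unfolding d_def using has_weak_deriv_unique H1_has_weak_deriv by metis

lemma res_d: "f \<in> H1 L \<Longrightarrow> res 0 L (d L f) = d L f"
  unfolding d_def by (simp add: res_cl H1_L2)

lemma has_weak_deriv_add:
  "has_weak_deriv L f h \<Longrightarrow> has_weak_deriv L f' h' \<Longrightarrow> has_weak_deriv L (\<lambda>x. f x + f' x) (\<lambda>x. h x + h' x)"
  by (simp add: has_weak_deriv_iff L2_add cl_add inner_add_left)

lemma has_weak_deriv_cmult:
  "has_weak_deriv L f h \<Longrightarrow> has_weak_deriv L (\<lambda>x. of_real c * f x) (\<lambda>x. of_real c * h x)"
  by (simp add: has_weak_deriv_iff L2_cmult cl_cmult)

lemma H1_add: "f \<in> H1 L \<Longrightarrow> g \<in> H1 L \<Longrightarrow> (\<lambda>x. f x + g x) \<in> H1 L"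
  and d_add: "f \<in> H1 L \<Longrightarrow> g \<in> H1 L \<Longrightarrow> d L (\<lambda>x. f x + g x) = d L f + d L g"
  using has_weak_deriv_add[OF H1_has_weak_deriv H1_has_weak_deriv, of f L g]
  by (auto simp: H1I d_eq cl_add H1_L2) (simp_all add: d_def)

lemma H1_cmult: "f \<in> H1 L \<Longrightarrow> (\<lambda>x. of_real c * f x) \<in> H1 L"
  and d_cmult: "f \<in> H1 L \<Longrightarrow> d L (\<lambda>x. of_real c * f x) = c *\<^sub>R d L f"
  using has_weak_deriv_cmult[OF H1_has_weak_deriv, of f L c]
  by (auto simp: H1I d_eq cl_cmult H1_L2) (simp_all add: d_def)

lemma H1_diff: "f \<in> H1 L \<Longrightarrow> g \<in> H1 L \<Longrightarrow> (\<lambda>x. f x - g x) \<in> H1 L"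
  and d_diff: "f \<in> H1 L \<Longrightarrow> g \<in> H1 L \<Longrightarrow> d L (\<lambda>x. f x - g x) = d L f - d L g"
  using H1_add[OF _ H1_cmult[of g L "-1"], of f] d_add[OF _ H1_cmult[of g L "-1"], of f] d_cmult[of g L "-1"]
  by auto

lemma has_weak_deriv_smooth:
  assumes "smooth f" shows "has_weak_deriv L f (\<lambda>x. vector_derivative f (at x))"
proof -
  have L2: "f \<in> L2 L" "(\<lambda>x. vector_derivative f (at x)) \<in> L2 L"
    using assms by (auto intro!: L2_continuous smooth_continuous smooth_deriv)
  have "(LINT x|interval_measure_on L. f x * vector_derivative \<phi> (at x)) =
      - (LINT x|interval_measure_on L. vector_derivative f (at x) * \<phi> x)"
    if \<phi>: "\<phi> \<in> test_functions {0<..<L}" for \<phi>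
  proof -
    note sm = test_functions_smooth[OF \<phi>]
    note tf = test_functions_mult_smooth[OF assms \<phi>]
    have deq: "vector_derivative (\<lambda>x. f x * \<phi> x) (at x) = f x * vector_derivative \<phi> (at x) + vector_derivative f (at x) * \<phi> x" for x
      by (intro vector_derivative_at has_vector_derivative_mult smooth_has_deriv assms sm)
    have "0 = (LINT x|lebesgue. vector_derivative (\<lambda>x. f x * \<phi> x) (at x))"
      using test_functions_integral_deriv[OF tf] by simp
    also have "\<dots> = (LINT x|interval_measure_on L. vector_derivative (\<lambda>x. f x * \<phi> x) (at x))"
      unfolding L2_integral by (simp add: indicator_test_function[OF test_functions_deriv[OF tf]])
    also have "\<dots> = (LINT x|interval_measure_on L. f x * vector_derivative \<phi> (at x)) +
        (LINT x|interval_measure_on L. vector_derivative f (at x) * \<phi> x)"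
      unfolding deq
      by (intro Bochner_Integration.integral_add integrable_L2_prod L2 test_functions_L2 \<phi> test_functions_deriv)
    finally show ?thesis by (simp add: eq_neg_iff_add_eq_0)
  qed
  then show ?thesis using L2 by (auto simp: has_weak_deriv_def)
qed

lemma test_functions_H1: "\<phi> \<in> test_functions S \<Longrightarrow> \<phi> \<in> H1 L"
  by (blast intro: H1I has_weak_deriv_smooth test_functions_smooth)

lemma d_test_function: "\<phi> \<in> test_functions {0<..<L} \<Longrightarrow> d L \<phi> = cls (\<lambda>x. vector_derivative \<phi> (at x))"
  by (simp add: d_eq[OF has_weak_deriv_smooth] test_functions_smooth cl_test_function test_functions_deriv)

lemma H1_norm_eq: "f \<in> H1 L \<Longrightarrow> (H1_norm L f)\<^sup>2 = (norm (cl L f))\<^sup>2 + (norm (d L f))\<^sup>2"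
  by (simp add: H1_norm_def L2_norm_eq H1_L2 d_def)

lemma H10_norm_eq: "f \<in> H1 L \<Longrightarrow> H10_norm L f = norm (d L f)"
  by (simp add: H10_norm_def L2_norm_eq H1_L2 d_def)

lemma H10_H1: "f \<in> H10 L \<Longrightarrow> f \<in> H1 L" by (simp add: H10_def)

lemma H10_iff: "f \<in> H10 L \<longleftrightarrow> f \<in> H1 L \<and> (\<exists>\<phi>. (\<forall>n::nat. \<phi> n \<in> test_functions {0<..<L}) \<and>
    (\<lambda>n. cl L (\<phi> n)) \<longlonglongrightarrow> cl L f \<and> (\<lambda>n. d L (\<phi> n)) \<longlonglongrightarrow> d L f)"
proof -
  have "(\<lambda>n. H1_norm L (\<lambda>x. f x - \<phi> n x)) \<longlonglongrightarrow> 0 \<longleftrightarrow> (\<lambda>n. cl L (\<phi> n)) \<longlonglongrightarrow> cl L f \<and> (\<lambda>n. d L (\<phi> n)) \<longlonglongrightarrow> d L f"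
    if f: "f \<in> H1 L" and \<phi>: "\<forall>n::nat. \<phi> n \<in> test_functions {0<..<L}" for \<phi>
  proof -
    have \<phi>H: "\<phi> n \<in> H1 L" for n using \<phi> test_functions_H1 by blast
    have eq: "H1_norm L (\<lambda>x. f x - \<phi> n x) = sqrt ((norm (cl L f - cl L (\<phi> n)))\<^sup>2 + (norm (d L f - d L (\<phi> n)))\<^sup>2)" for n
    proof -
      have "0 \<le> H1_norm L (\<lambda>x. f x - \<phi> n x)" by (simp add: H1_norm_def)
      then have "H1_norm L (\<lambda>x. f x - \<phi> n x) = sqrt ((H1_norm L (\<lambda>x. f x - \<phi> n x))\<^sup>2)" by simp
      also have "(H1_norm L (\<lambda>x. f x - \<phi> n x))\<^sup>2 = (norm (cl L f - cl L (\<phi> n)))\<^sup>2 + (norm (d L f - d L (\<phi> n)))\<^sup>2"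
        using H1_norm_eq[OF H1_diff[OF f \<phi>H]] by (simp add: cl_diff d_diff f \<phi>H H1_L2)
      finally show ?thesis .
    qed
    show ?thesis
    proof
      assume l: "(\<lambda>n. H1_norm L (\<lambda>x. f x - \<phi> n x)) \<longlonglongrightarrow> 0"
      have "(\<lambda>n. cl L f - cl L (\<phi> n)) \<longlonglongrightarrow> 0"
        by (rule Lim_null_comparison[OF _ l]) (auto simp: eq intro: real_le_rsqrt)
      moreover have "(\<lambda>n. d L f - d L (\<phi> n)) \<longlonglongrightarrow> 0"
        by (rule Lim_null_comparison[OF _ l]) (auto simp: eq intro: real_le_rsqrt)
      ultimately show "(\<lambda>n. cl L (\<phi> n)) \<longlonglongrightarrow> cl L f \<and> (\<lambda>n. d L (\<phi> n)) \<longlonglongrightarrow> d L f"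
        using tendsto_diff[OF tendsto_const[of "cl L f"], of _ 0] tendsto_diff[OF tendsto_const[of "d L f"], of _ 0] by fastforce
    next
      assume l: "(\<lambda>n. cl L (\<phi> n)) \<longlonglongrightarrow> cl L f \<and> (\<lambda>n. d L (\<phi> n)) \<longlonglongrightarrow> d L f"
      have "(\<lambda>n. sqrt ((norm (cl L f - cl L (\<phi> n)))\<^sup>2 + (norm (d L f - d L (\<phi> n)))\<^sup>2)) \<longlonglongrightarrow>
         sqrt ((norm (cl L f - cl L f))\<^sup>2 + (norm (d L f - d L f))\<^sup>2)"
        using l by (intro tendsto_intros) auto
      then show "(\<lambda>n. H1_norm L (\<lambda>x. f x - \<phi> n x)) \<longlonglongrightarrow> 0" by (simp add: eq)
    qed
  qed
  then show ?thesis unfolding H10_def by blast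
qed

lemma H10_sequence:
  assumes "f \<in> H10 L"
  obtains \<phi> where "\<And>n::nat. \<phi> n \<in> test_functions {0<..<L}"
    "(\<lambda>n. cl L (\<phi> n)) \<longlonglongrightarrow> cl L f" "(\<lambda>n. d L (\<phi> n)) \<longlonglongrightarrow> d L f"
  using assms unfolding H10_iff by blast

text \<open>For a test function in place of \<open>f\<close> this is the definition of the weak
  derivative of \<open>g\<close>; both sides are continuous along the sequence approximating
  \<open>f\<close>. All boundary terms of the problem are disposed of by this identity.\<close>

lemma integration_by_parts:
  assumes f: "f \<in> H10 L" and g: "g \<in> H1 L"
  shows "d L f \<bullet> cl L g = - (cl L f \<bullet> d L g)"
proof -
  obtain \<phi> where \<phi>: "\<And>n::nat. \<phi> n \<in> test_functions {0<..<L}"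
    "(\<lambda>n. cl L (\<phi> n)) \<longlonglongrightarrow> cl L f" "(\<lambda>n. d L (\<phi> n)) \<longlonglongrightarrow> d L f"
    using H10_sequence[OF f] by blast
  have "d L (\<phi> n) \<bullet> cl L g = - (cl L (\<phi> n) \<bullet> d L g)" for n
    using H1_has_weak_deriv[OF g] \<phi>(1)[of n] d_eq[OF H1_has_weak_deriv[OF g]]
    by (simp add: has_weak_deriv_iff d_test_function cl_test_function inner_commute)
  then have eq: "(\<lambda>n. d L (\<phi> n) \<bullet> cl L g) = (\<lambda>n. - (cl L (\<phi> n) \<bullet> d L g))" by auto
  have "(\<lambda>n. d L (\<phi> n) \<bullet> cl L g) \<longlonglongrightarrow> d L f \<bullet> cl L g" by (intro tendsto_intros \<phi>)
  moreover have "(\<lambda>n. d L (\<phi> n) \<bullet> cl L g) \<longlonglongrightarrow> - (cl L f \<bullet> d L g)"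
    unfolding eq by (intro tendsto_intros \<phi>)
  ultimately show ?thesis by (rule LIMSEQ_unique)
qed

lemma test_functions_H10: "\<phi> \<in> test_functions {0<..<L} \<Longrightarrow> \<phi> \<in> H10 L"
  unfolding H10_iff using test_functions_H1 by (auto intro!: exI[of _ "\<lambda>_. \<phi>"])

lemma H10_cong: "f \<in> H10 L \<Longrightarrow> g \<in> H1 L \<Longrightarrow> cl L f = cl L g \<Longrightarrow> g \<in> H10 L"
  unfolding H10_iff using d_cong[of f L g] by (auto simp: H10_H1)

lemma H10_add:
  assumes "f \<in> H10 L" "g \<in> H10 L" shows "(\<lambda>x. f x + g x) \<in> H10 L"
proof -
  obtain \<phi> where \<phi>: "\<And>n::nat. \<phi> n \<in> test_functions {0<..<L}"
    "(\<lambda>n. cl L (\<phi> n)) \<longlonglongrightarrow> cl L f" "(\<lambda>n. d L (\<phi> n)) \<longlonglongrightarrow> d L f"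
    using H10_sequence[OF assms(1)] by blast
  obtain \<psi> where \<psi>: "\<And>n::nat. \<psi> n \<in> test_functions {0<..<L}"
    "(\<lambda>n. cl L (\<psi> n)) \<longlonglongrightarrow> cl L g" "(\<lambda>n. d L (\<psi> n)) \<longlonglongrightarrow> d L g"
    using H10_sequence[OF assms(2)] by blast
  note H = H10_H1[OF assms(1)] H10_H1[OF assms(2)] test_functions_H1[OF \<phi>(1)] test_functions_H1[OF \<psi>(1)]
  show ?thesis
    unfolding H10_iff
    using H tendsto_add[OF \<phi>(2) \<psi>(2)] tendsto_add[OF \<phi>(3) \<psi>(3)] \<phi>(1) \<psi>(1)
    by (auto intro!: exI[of _ "\<lambda>n x. \<phi> n x + \<psi> n x"] test_functions_add simp: H1_add cl_add d_add H1_L2)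
qed

lemma H10_cmult:
  assumes "f \<in> H10 L" shows "(\<lambda>x. of_real c * f x) \<in> H10 L"
proof -
  obtain \<phi> where \<phi>: "\<And>n::nat. \<phi> n \<in> test_functions {0<..<L}"
    "(\<lambda>n. cl L (\<phi> n)) \<longlonglongrightarrow> cl L f" "(\<lambda>n. d L (\<phi> n)) \<longlonglongrightarrow> d L f"
    using H10_sequence[OF assms(1)] by blast
  note H = H10_H1[OF assms(1)] test_functions_H1[OF \<phi>(1)]
  show ?thesis
    unfolding H10_iff
    using H tendsto_scaleR[OF tendsto_const \<phi>(2)] tendsto_scaleR[OF tendsto_const \<phi>(3)] \<phi>(1)
    by (auto intro!: exI[of _ "\<lambda>n x. of_real c * \<phi> n x"] test_functions_cmult simp: H1_cmult cl_cmult d_cmult H1_L2)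
qed

lemma H10_diff:
  assumes "f \<in> H10 L" "g \<in> H10 L" shows "(\<lambda>x. f x - g x) \<in> H10 L"
  using H10_add[OF assms(1) H10_cmult[OF assms(2), of "-1"]] by simp

lemma H10_zero: "(\<lambda>x. 0) \<in> H10 L"
  by (rule test_functions_H10[OF test_functions_zero])

text \<open>The defining identity consists of inner products with fixed elements, so it survives
  limits in both entries. The limits stay in the range of \<open>res 0 L\<close>, which provides
  representatives for them.\<close>

lemma weak_deriv_graph_closed:
  assumes "\<And>n. has_weak_deriv L (f n) (h n)" "(\<lambda>n. cl L (f n)) \<longlonglongrightarrow> x" "(\<lambda>n. cl L (h n)) \<longlonglongrightarrow> y"
  obtains g where "g \<in> H1 L" "cl L g = x" "d L g = y"
proof -
  have rc: "res 0 L z = z" if "(\<lambda>n. cl L (k n)) \<longlonglongrightarrow> z" "\<And>n. k n \<in> L2 L" for k z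
  proof -
    have "(\<lambda>n. res 0 L (cl L (k n))) \<longlonglongrightarrow> res 0 L z"
      using bounded_linear_res that(1) by (rule bounded_linear.tendsto)
    then show ?thesis using LIMSEQ_unique that by (simp add: res_cl) 
  qed
  obtain g where g: "g \<in> L2 L" "x = cl L g" using cl_cases rc[OF assms(2)] has_weak_deriv_L2[OF assms(1)] by metis
  obtain k where k: "k \<in> L2 L" "y = cl L k" using cl_cases rc[OF assms(3)] has_weak_deriv_L2[OF assms(1)] by metis
  have "has_weak_deriv L g k"
    unfolding has_weak_deriv_iff
  proof (intro conjI ballI g k)
    fix \<phi> assume \<phi>: "\<phi> \<in> test_functions {0<..<L}"
    have eq: "(\<lambda>n. cl L (f n) \<bullet> cls (\<lambda>x. vector_derivative \<phi> (at x))) = (\<lambda>n. - (cl L (h n) \<bullet> cls \<phi>))"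
      using assms(1) \<phi> by (auto simp: has_weak_deriv_iff)
    have "(\<lambda>n. cl L (f n) \<bullet> cls (\<lambda>x. vector_derivative \<phi> (at x))) \<longlonglongrightarrow> x \<bullet> cls (\<lambda>x. vector_derivative \<phi> (at x))"
      by (intro tendsto_intros assms)
    moreover have "(\<lambda>n. cl L (f n) \<bullet> cls (\<lambda>x. vector_derivative \<phi> (at x))) \<longlonglongrightarrow> - (y \<bullet> cls \<phi>)"
      unfolding eq by (intro tendsto_intros assms)
    ultimately show "cl L g \<bullet> cls (\<lambda>x. vector_derivative \<phi> (at x)) = - (cl L k \<bullet> cls \<phi>)"
      using LIMSEQ_unique g k by metis
  qed
  then show thesis using that[of g] g k by (auto simp: H1I d_eq)
qed

text \<open>The derivative of \<open>x |\<phi>|^2\<close> integrates to 0, which expresses the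
  squared norm of \<phi> as minus twice the inner product of \<phi> with x times its derivative.
  Since x lies in (0,L) on the support, Cauchy-Schwarz yields the constant
  \<open>2 * L\<close>.\<close>

lemma poincare_test_function:
  assumes \<phi>: "\<phi> \<in> test_functions {0<..<L}"
  shows "norm (cl L \<phi>) \<le> 2 * L * norm (d L \<phi>)"
proof (cases "L > 0")
  case False
  then have "\<phi> = (\<lambda>x. 0)" using test_functions_outside[OF \<phi>] by auto
  then show ?thesis unfolding d_test_function[OF \<phi>] cl_test_function[OF \<phi>] by (simp add: cls_zero)
next
  case True
  note sm = test_functions_smooth[OF \<phi>]
  let ?\<phi>' = "\<lambda>x. vector_derivative \<phi> (at x)"
  let ?x = "\<lambda>x. of_real x :: complex"
  have tf: "(\<lambda>x. of_real x * (\<phi> x * cnj (\<phi> x))) \<in> test_functions {0<..<L}"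
    by (rule test_functions_mult_smooth[OF smooth_of_real_id
          test_functions_mult_smooth[OF sm test_functions_cnj[OF \<phi>]]])
  have x\<phi>': "(\<lambda>x. of_real x * ?\<phi>' x) \<in> test_functions {0<..<L}"
    by (intro test_functions_mult_smooth smooth_of_real_id test_functions_deriv \<phi>)
  note i\<phi> = test_functions_sqint[OF \<phi>] test_functions_sqint[OF x\<phi>'] test_functions_sqint[OF test_functions_deriv[OF \<phi>]]
  have deq: "vector_derivative (\<lambda>x. of_real x * (\<phi> x * cnj (\<phi> x))) (at x) =
      of_real x * (\<phi> x * cnj (?\<phi>' x) + ?\<phi>' x * cnj (\<phi> x)) + \<phi> x * cnj (\<phi> x)" for x
  proof -
    have "((\<lambda>x. of_real x * (\<phi> x * cnj (\<phi> x))) has_vector_derivative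
      of_real x * (\<phi> x * cnj (?\<phi>' x) + ?\<phi>' x * cnj (\<phi> x)) + 1 * (\<phi> x * cnj (\<phi> x))) (at x)"
      using has_vector_derivative_of_real[OF DERIV_ident]
      by (intro has_vector_derivative_mult has_vector_derivative_cnj smooth_has_deriv sm) simp_all
    then show ?thesis by (simp add: vector_derivative_at)
  qed
  have "Re (vector_derivative (\<lambda>x. of_real x * (\<phi> x * cnj (\<phi> x))) (at x)) = 2 * (\<phi> x \<bullet> (of_real x * ?\<phi>' x)) + \<phi> x \<bullet> \<phi> x" for x
    unfolding deq by (simp add: inner_complex_def algebra_simps)
  then have "0 = (LINT x|lebesgue. 2 * (\<phi> x \<bullet> (of_real x * ?\<phi>' x)) + \<phi> x \<bullet> \<phi> x)"
    using integral_Re[OF test_functions_integral_deriv(2)[OF tf]] test_functions_integral_deriv(1)[OF tf] by simp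
  also have "\<dots> = 2 * (cls \<phi> \<bullet> cls (\<lambda>x. of_real x * ?\<phi>' x)) + cls \<phi> \<bullet> cls \<phi>"
    using i\<phi> by (simp add: sqint_inner_integrable inner_cls)
  finally have "(norm (cls \<phi>))\<^sup>2 = 2 * (cls \<phi> \<bullet> (- cls (\<lambda>x. of_real x * ?\<phi>' x)))"
    by (simp add: power2_norm_eq_inner)
  also have "\<dots> \<le> 2 * (norm (cls \<phi>) * norm (cls (\<lambda>x. of_real x * ?\<phi>' x)))"
    using norm_cauchy_schwarz[of "cls \<phi>" "- cls (\<lambda>x. of_real x * ?\<phi>' x)"] by simp
  also have "\<dots> \<le> 2 * (norm (cls \<phi>) * (L * norm (cls ?\<phi>')))"
  proof -
    have "(norm (cls (\<lambda>x. of_real x * ?\<phi>' x)))\<^sup>2 \<le> (L * norm (cls ?\<phi>'))\<^sup>2"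
    proof -
      have "(LINT x|lebesgue. (cmod (of_real x * ?\<phi>' x))\<^sup>2) \<le> (LINT x|lebesgue. L\<^sup>2 * (cmod (?\<phi>' x))\<^sup>2)"
      proof (rule integral_mono)
        show "(cmod (of_real x * ?\<phi>' x))\<^sup>2 \<le> L\<^sup>2 * (cmod (?\<phi>' x))\<^sup>2" for x
        proof (cases "x \<in> {0<..<L}")
          case True
          then have "x\<^sup>2 \<le> L\<^sup>2" by (intro power_mono) auto
          then show ?thesis by (auto simp: norm_mult power_mult_distrib intro!: mult_right_mono)
        next
          case False
          then have "?\<phi>' x = 0" using test_functions_outside[OF test_functions_deriv[OF \<phi>]] by blast
          then show ?thesis by simp
        qed
      qed (use i\<phi> in \<open>auto simp: sqint_def\<close>)
      then show ?thesis using i\<phi> by (simp add: norm_cls power_mult_distrib)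
    qed
    then have "norm (cls (\<lambda>x. of_real x * ?\<phi>' x)) \<le> L * norm (cls ?\<phi>')"
      by (rule power2_le_imp_le) (use True in simp)
    then show ?thesis by (intro mult_left_mono) auto
  qed
  finally have "norm (cls \<phi>) * norm (cls \<phi>) \<le> norm (cls \<phi>) * (2 * L * norm (cls ?\<phi>'))"
    by (simp add: power2_eq_square algebra_simps)
  then have "norm (cls \<phi>) \<le> 2 * L * norm (cls ?\<phi>')"
    using True by (cases "norm (cls \<phi>) = 0") auto
  then show ?thesis by (simp add: cl_test_function d_test_function \<phi>)
qed

lemma poincare_H10:
  assumes "f \<in> H10 L" shows "norm (cl L f) \<le> 2 * L * norm (d L f)"
proof -
  obtain \<phi> where \<phi>: "\<And>n::nat. \<phi> n \<in> test_functions {0<..<L}"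
    "(\<lambda>n. cl L (\<phi> n)) \<longlonglongrightarrow> cl L f" "(\<lambda>n. d L (\<phi> n)) \<longlonglongrightarrow> d L f"
    using H10_sequence[OF assms] by blast
  have "(\<lambda>n. norm (cl L (\<phi> n))) \<longlonglongrightarrow> norm (cl L f)" "(\<lambda>n. 2 * L * norm (d L (\<phi> n))) \<longlonglongrightarrow> 2 * L * norm (d L f)"
    by (intro tendsto_intros \<phi>)+
  then show ?thesis by (rule LIMSEQ_le) (use poincare_test_function \<phi>(1) in blast)
qed

lemma H10_cl_eq: "f \<in> H10 L \<Longrightarrow> g \<in> H10 L \<Longrightarrow> d L f = d L g \<Longrightarrow> cl L f = cl L g"
  using poincare_H10[OF H10_diff, of f L g] by (simp add: cl_diff d_diff H10_H1 H1_L2)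

lemma Cauchy_transfer:
  fixes x :: "nat \<Rightarrow> 'a::real_normed_vector" and y :: "nat \<Rightarrow> 'b::real_normed_vector"
  assumes "Cauchy y" "\<And>m n. norm (x m - x n) \<le> C * norm (y m - y n)"
  shows "Cauchy x"
  unfolding Cauchy_def
proof safe
  fix e :: real assume e: "e > 0"
  define C' where "C' = max C 1"
  have C': "C' > 0" by (simp add: C'_def)
  have C'2: "norm (x m - x n) \<le> C' * norm (y m - y n)" for m n
    by (rule order_trans[OF assms(2)]) (simp add: C'_def mult_right_mono)
  obtain M where M: "\<forall>m\<ge>M. \<forall>n\<ge>M. dist (y m) (y n) < e / C'"
    using assms(1) e C' unfolding Cauchy_def by (metis divide_pos_pos)
  show "\<exists>M. \<forall>m\<ge>M. \<forall>n\<ge>M. dist (x m) (x n) < e"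
  proof (intro exI[of _ M] allI impI)
    fix m n assume "M \<le> m" "M \<le> n"
    then have "norm (y m - y n) < e / C'" using M by (simp add: dist_norm)
    then have "C' * norm (y m - y n) < e" using C' by (simp add: field_simps)
    then show "dist (x m) (x n) < e" using C'2[of m n] by (simp add: dist_norm)
  qed
qed

text \<open>By Poincare's inequality, convergence of the derivatives forces convergence of the
  functions; test functions within \<open>1 / Suc n\<close> of \<open>f n\<close> then keep the
  limit in \<open>H10 L\<close>. This is completeness of \<open>H10 L\<close> under
  \<open>H10_norm\<close>.\<close>

lemma H10_graph_closed:
  assumes f: "\<And>n. f n \<in> H10 L" and lim: "(\<lambda>n. d L (f n)) \<longlonglongrightarrow> y"
  obtains g where "g \<in> H10 L" "d L g = y" "(\<lambda>n. cl L (f n)) \<longlonglongrightarrow> cl L g"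
proof -
  have H1: "f n \<in> H1 L" for n using f H10_H1 by blast
  have "Cauchy (\<lambda>n. cl L (f n))"
  proof (rule Cauchy_transfer)
    show "Cauchy (\<lambda>n. d L (f n))" using lim by (rule LIMSEQ_imp_Cauchy)
    show "norm (cl L (f m) - cl L (f n)) \<le> 2 * L * norm (d L (f m) - d L (f n))" for m n
      using poincare_H10[OF H10_diff[OF f f], of m n] by (simp add: cl_diff d_diff H1 H1_L2)
  qed
  then obtain x where x: "(\<lambda>n. cl L (f n)) \<longlonglongrightarrow> x" using Cauchy_convergent convergent_def by blast
  obtain g where g: "g \<in> H1 L" "cl L g = x" "d L g = y"
    using weak_deriv_graph_closed[OF H1_has_weak_deriv[OF H1] x] lim unfolding d_def by metis
  have "\<exists>\<phi>\<in>test_functions {0<..<L}. norm (cl L \<phi> - cl L (f n)) < 1 / Suc n \<and> norm (d L \<phi> - d L (f n)) < 1 / Suc n" for n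
  proof -
    obtain \<phi> where \<phi>: "\<And>n::nat. \<phi> n \<in> test_functions {0<..<L}"
      "(\<lambda>k. cl L (\<phi> k)) \<longlonglongrightarrow> cl L (f n)" "(\<lambda>k. d L (\<phi> k)) \<longlonglongrightarrow> d L (f n)"
      using H10_sequence[OF f] by blast
    have "\<forall>\<^sub>F k in sequentially. dist (cl L (\<phi> k)) (cl L (f n)) < 1 / Suc n"
      by (rule tendstoD[OF \<phi>(2)]) simp
    moreover have "\<forall>\<^sub>F k in sequentially. dist (d L (\<phi> k)) (d L (f n)) < 1 / Suc n"
      by (rule tendstoD[OF \<phi>(3)]) simp
    ultimately have "\<forall>\<^sub>F k in sequentially. dist (cl L (\<phi> k)) (cl L (f n)) < 1 / Suc n \<and> dist (d L (\<phi> k)) (d L (f n)) < 1 / Suc n"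
      by (rule eventually_conj)
    then obtain k where "dist (cl L (\<phi> k)) (cl L (f n)) < 1 / Suc n \<and> dist (d L (\<phi> k)) (d L (f n)) < 1 / Suc n"
      by (auto simp: eventually_sequentially)
    then show ?thesis using \<phi>(1)[of k] by (auto simp: dist_norm)
  qed
  then obtain \<phi> where \<phi>: "\<And>n. \<phi> n \<in> test_functions {0<..<L}"
    "\<And>n. norm (cl L (\<phi> n) - cl L (f n)) < 1 / Suc n" "\<And>n. norm (d L (\<phi> n) - d L (f n)) < 1 / Suc n"
    by metis
  have inv: "(\<lambda>n. 1 / real (Suc n)) \<longlonglongrightarrow> 0"
    using LIMSEQ_inverse_real_of_nat by (simp add: inverse_eq_divide)
  have "(\<lambda>n. cl L (\<phi> n) - cl L (f n)) \<longlonglongrightarrow> 0" "(\<lambda>n. d L (\<phi> n) - d L (f n)) \<longlonglongrightarrow> 0"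
    using \<phi>(2,3) by (auto intro!: Lim_null_comparison[OF always_eventually inv] less_imp_le)
  from tendsto_add[OF this(1) x] tendsto_add[OF this(2) lim]
  have "g \<in> H10 L" unfolding H10_iff using g \<phi>(1) by auto
  then show thesis using that g x by blast
qed

section \<open>Primitives and functions of mean zero\<close>

lemma smooth_of_smooth_deriv:
  assumes "smooth f" "\<And>x. (F has_vector_derivative f x) (at x)" shows "smooth F"
proof -
  from assms(1) obtain D where D: "D 0 = f" "\<forall>k x. (D k has_vector_derivative D (Suc k) x) (at x)"
    unfolding smooth_def by blast
  show ?thesis
    unfolding smooth_def
  proof (intro exI conjI allI)
    show "(\<lambda>k. case k of 0 \<Rightarrow> F | Suc k \<Rightarrow> D k) 0 = F" by simp
    fix k x
    show "((case k of 0 \<Rightarrow> F | Suc k \<Rightarrow> D k) has_vector_derivative (case Suc k of 0 \<Rightarrow> F | Suc k \<Rightarrow> D k) x) (at x)"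
      using D assms(2) by (cases k) auto
  qed
qed

lemma test_functions_interval_support:
  assumes "\<phi> \<in> test_functions {a<..<b}" "a < b"
  obtains p q where "a < p" "p < q" "q < b" "\<And>x. x \<notin> {p..q} \<Longrightarrow> \<phi> x = 0"
proof -
  from assms obtain K where K: "compact K" "K \<subseteq> {a<..<b}" "\<And>x. x \<notin> K \<Longrightarrow> \<phi> x = 0"
    unfolding test_functions_def by blast
  show thesis
  proof (cases "K = {}")
    case True
    then show ?thesis using that[of "(2*a + b)/3" "(a + 2*b)/3"] K assms(2) by (simp add: field_simps)
  next
    case False
    obtain s where s: "s \<in> K" "\<And>x. x \<in> K \<Longrightarrow> s \<le> x" using compact_attains_inf[OF K(1) False] by blast
    obtain t where t: "t \<in> K" "\<And>x. x \<in> K \<Longrightarrow> x \<le> t" using compact_attains_sup[OF K(1) False] by blast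
    have "a < s" "t < b" "s \<le> t" using s t K(2) by auto
    obtain q where q: "t < q" "q < b" using dense[OF \<open>t < b\<close>] by blast
    show ?thesis
    proof (rule that[of s q])
      show "\<phi> x = 0" if "x \<notin> {s..q}" for x
        using that s(2)[of x] t(2)[of x] q K(3)[of x] by fastforce
    qed (use \<open>a < s\<close> \<open>s \<le> t\<close> q in auto)
  qed
qed

text \<open>To the right of the support the primitive is constant, equal to the integral of \<phi>;
  mean zero makes this constant 0 and so gives compact support.\<close>

lemma test_function_primitive:
  assumes \<phi>: "\<phi> \<in> test_functions {0<..<L}" and L: "L > 0"
  obtains F where "smooth F" "\<And>x. (F has_vector_derivative \<phi> x) (at x)"
    "(LINT x|lebesgue. \<phi> x) = 0 \<Longrightarrow> F \<in> test_functions {0<..<L}"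
proof -
  note sm = test_functions_smooth[OF \<phi>]
  obtain p q where pq: "0 < p" "p < q" "q < L" "\<And>x. x \<notin> {p..q} \<Longrightarrow> \<phi> x = 0"
    using test_functions_interval_support[OF \<phi> L] by blast
  define F where "F x = integral {0..x} \<phi>" for x
  have F0: "F x = 0" if "x < p" for x
  proof -
    have "integral {0..x} \<phi> = integral {0..x} (\<lambda>_. 0)" by (rule integral_cong) (use pq(4) that in auto)
    then show ?thesis by (simp add: F_def)
  qed
  have Fd: "(F has_vector_derivative \<phi> x) (at x)" for x
  proof (cases "x < p")
    case True
    have "((\<lambda>x. 0) has_vector_derivative \<phi> x) (at x)" using True pq(4)[of x] by simp
    then show ?thesis
      by (rule has_vector_derivative_transform_within_open[of _ _ _ "{..<p}"]) (use True F0 in auto)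
  next
    case False
    then have x: "0 < x" "x < x + 1" using pq by auto
    have "(F has_vector_derivative \<phi> x) (at x within {0..x+1})"
      unfolding F_def
      by (rule integral_has_vector_derivative) (use x smooth_continuous[OF sm] in auto)
    then show ?thesis using x by (simp add: at_within_Icc_at)
  qed
  have Fs: "smooth F" using sm Fd by (rule smooth_of_smooth_deriv)
  have "F \<in> test_functions {0<..<L}" if mean: "(LINT x|lebesgue. \<phi> x) = 0"
  proof -
    have "F x = 0" if "x \<notin> {p..q}" for x
    proof (cases "x < p")
      case False
      then have x: "x > q" using that by auto
      have "has_bochner_integral lborel (\<lambda>y. indicator {0..x} y *\<^sub>R \<phi> y) (F x - F 0)"
        by (rule has_bochner_integral_FTC_Icc) (use x pq Fd smooth_continuous[OF sm] in \<open>auto intro: has_vector_derivative_at_within\<close>)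
      moreover have "(\<lambda>y. indicator {0..x} y *\<^sub>R \<phi> y) = \<phi>"
        using x pq by (force simp: indicator_def)
      ultimately have "(LINT y|lborel. \<phi> y) = F x - F 0" "\<phi> \<in> borel_measurable lborel"
        by (auto simp: has_bochner_integral_iff)
      then have "F x - F 0 = 0" using mean by (simp add: integral_completion)
      then show ?thesis using F0[of 0] pq by simp
    qed (rule F0)
    then show ?thesis
      unfolding test_functions_def using Fs pq by (auto intro!: exI[of _ "{p..q}"])
  qed
  then show thesis using that Fs Fd by blast
qed

lemma smooth_primitive_weak_deriv:
  "smooth F \<Longrightarrow> (\<And>x. (F has_vector_derivative \<phi> x) (at x)) \<Longrightarrow> has_weak_deriv L F \<phi>"
proof -
  assume F: "smooth F" "\<And>x. (F has_vector_derivative \<phi> x) (at x)"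
  then have "(\<lambda>x. vector_derivative F (at x)) = \<phi>" by (auto simp: vector_derivative_at)
  then show ?thesis using has_weak_deriv_smooth[OF F(1), of L] by simp
qed

text \<open>Real and imaginary part of the integral are the inner products with the constants 1 and
  \<open>\<i>\<close>, hence continuous in the class.\<close>

lemma integral_cl_tendsto:
  assumes "\<And>n. f n \<in> L2 L" "g \<in> L2 L" "(\<lambda>n. cl L (f n)) \<longlonglongrightarrow> cl L g"
  shows "(\<lambda>n. LINT x|interval_measure_on L. f n x) \<longlonglongrightarrow> (LINT x|interval_measure_on L. g x)"
proof -
  have c: "(\<lambda>x. c) \<in> L2 L" for c by (rule L2_continuous) simp
  have eq: "(LINT x|interval_measure_on L. f x) = Complex (cl L f \<bullet> cl L (\<lambda>x. 1)) (cl L f \<bullet> cl L (\<lambda>x. \<i>))"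
    if "f \<in> L2 L" for f
  proof -
    have "integrable (interval_measure_on L) f" using integrable_L2_prod[OF that c[of 1]] by simp
    then show ?thesis using that c by (simp add: inner_cl inner_complex_def complex_eq_iff flip: integral_Re integral_Im)
  qed
  have "(\<lambda>n. Complex (cl L (f n) \<bullet> cl L (\<lambda>x. 1)) (cl L (f n) \<bullet> cl L (\<lambda>x. \<i>))) \<longlonglongrightarrow> Complex (cl L g \<bullet> cl L (\<lambda>x. 1)) (cl L g \<bullet> cl L (\<lambda>x. \<i>))"
    by (intro tendsto_Complex tendsto_intros assms)
  then show ?thesis using assms by (simp add: eq)
qed

lemma L2_mean0_iff: "f \<in> L2_mean0 L \<longleftrightarrow> f \<in> L2 L \<and> (LINT x|interval_measure_on L. f x) = 0"
  by (simp add: L2_mean0_def)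

lemma bump_integral_pos:
  assumes k: "2 < real (Suc k) * (b - a)"
  shows "integrable lebesgue (bump a b k)" "0 < (LINT x|lebesgue. bump a b k x)"
proof -
  have "{a..b} \<in> lmeasurable" by simp
  have "(\<lambda>x. of_real (bump a b k x)) \<in> test_functions {a<..<b}" by (rule test_functions_bump) simp
  then have z: "bump a b k x = 0" if "x \<notin> {a<..<b}" for x
    using test_functions_outside that by fastforce
  have cont: "continuous_on UNIV (bump a b k)"
    using continuous_on_Re[OF smooth_continuous[OF smooth_bump[of a b k], of UNIV]] by simp
  have "integrable lborel (\<lambda>x. indicator {a..b} x *\<^sub>R bump a b k x)"
    by (rule borel_integrable_compact) (auto intro: continuous_on_subset[OF cont])
  moreover have "(\<lambda>x. indicator {a..b} x *\<^sub>R bump a b k x) = bump a b k"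
  proof
    fix x show "indicator {a..b} x *\<^sub>R bump a b k x = bump a b k x"
      using z[of x] by (cases "x \<in> {a..b}") auto
  qed
  ultimately show ib: "integrable lebesgue (bump a b k)"
    by (simp add: integrable_completion borel_measurable_integrable)
  have "(LINT x|lebesgue. bump a b k x) \<noteq> 0"
  proof
    assume "(LINT x|lebesgue. bump a b k x) = 0"
    then have "AE x in lebesgue. bump a b k x = 0"
      using ib bump_bounds by (subst (asm) integral_nonneg_eq_0_iff_AE) auto
    then have "AE x in lebesgue. x \<notin> {a + 1/Suc k<..<b - 1/Suc k}"
      by eventually_elim (use bump_pos[of _ a k b] in force)
    moreover have "{x. p < x \<and> x < q} = {p<..<q}" for p q :: real by auto
    ultimately have "emeasure lebesgue {a + 1/real (Suc k)<..<b - 1/real (Suc k)} = 0"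
      by (subst (asm) AE_iff_measurable[OF _ refl]) (auto simp del: of_nat_Suc)
    moreover have "a + 1/real (Suc k) < b - 1/real (Suc k)"
    proof -
      have "2 / real (Suc k) < b - a" using k by (simp only: divide_less_eq mult.commute) simp
      then show ?thesis by simp
    qed
    ultimately show False by (simp del: of_nat_Suc)
  qed
  moreover have "0 \<le> (LINT x|lebesgue. bump a b k x)" using bump_bounds by (intro integral_nonneg_AE) auto
  ultimately show "0 < (LINT x|lebesgue. bump a b k x)" by simp
qed

text \<open>Approximating test functions need not have mean zero. A multiple of one fixed bump
  corrects each of them, and the multiples tend to 0 because the integrals converge to that of
  \<open>h\<close>.\<close>

lemma L2_mean0_sequence:
  assumes h: "h \<in> L2_mean0 L" and L: "L > 0"
  obtains \<phi> where "\<And>n::nat. \<phi> n \<in> test_functions {0<..<L}" "\<And>n. (LINT x|lebesgue. \<phi> n x) = 0"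
    "(\<lambda>n. cl L (\<phi> n)) \<longlonglongrightarrow> cl L h"
proof -
  have hL: "h \<in> L2 L" using h by (simp add: L2_mean0_iff)
  obtain \<psi> where \<psi>: "\<And>n. \<psi> n \<in> test_functions {0<..<L}" "(\<lambda>n. cls (\<psi> n)) \<longlonglongrightarrow> res 0 L (cl L h)"
    using test_functions_sequence by blast
  have \<psi>2: "(\<lambda>n. cl L (\<psi> n)) \<longlonglongrightarrow> cl L h" using \<psi>(2) by (simp add: res_cl hL cl_test_function[OF \<psi>(1)])
  \<comment> \<open>The interval (0,L) shrunk by \<open>1 / Suc k\<close> at both ends must stay
    nonempty for the bump to have a positive integral.\<close>
  obtain k where k: "2 < real (Suc k) * L" using reals_Archimedean3[OF L] by (metis Suc_n_not_le_n lift_Suc_mono_le nat_le_linear less_le_trans mult_right_mono of_nat_mono less_imp_le L)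
  define \<beta> where "\<beta> x = complex_of_real (bump 0 L k x)" for x
  have \<beta>: "\<beta> \<in> test_functions {0<..<L}" unfolding \<beta>_def by (rule test_functions_bump) simp
  define c where "c = (LINT x|lebesgue. bump 0 L k x)"
  have int: "integrable lebesgue \<phi>" and inteq: "(LINT x|lebesgue. \<phi> x) = (LINT x|interval_measure_on L. \<phi> x)"
    if \<phi>: "\<phi> \<in> test_functions {0<..<L}" for \<phi>
  proof -
    have "(\<lambda>x. 1) \<in> L2 L" by (rule L2_continuous) simp
    from integrable_L2_prod[OF test_functions_L2[OF \<phi>] this]
    show "integrable lebesgue \<phi>" by (simp add: integrable_restrict_space indicator_test_function[OF \<phi>])
    show "(LINT x|lebesgue. \<phi> x) = (LINT x|interval_measure_on L. \<phi> x)"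
      by (simp add: L2_integral indicator_test_function[OF \<phi>])
  qed
  note ib = bump_integral_pos[of k L 0, unfolded diff_zero, OF k]
  have c\<beta>: "(LINT x|lebesgue. \<beta> x) = of_real c" unfolding \<beta>_def c_def using ib by simp
  have "c \<noteq> 0" using ib(2) by (simp add: c_def)
  define m where "m n = (LINT x|lebesgue. \<psi> n x) / of_real c" for n
  have "m \<longlonglongrightarrow> 0 / of_real c"
    unfolding m_def inteq[OF \<psi>(1)] using \<open>c \<noteq> 0\<close> integral_cl_tendsto[OF test_functions_L2[OF \<psi>(1)] hL \<psi>2] h
    by (intro tendsto_divide) (auto simp: L2_mean0_iff)
  then have m0: "m \<longlonglongrightarrow> 0" by simp
  have tf: "(\<lambda>x. \<psi> n x + (- m n) * \<beta> x) \<in> test_functions {0<..<L}" for n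
    by (intro test_functions_add \<psi> test_functions_cmult \<beta>)
  have cm: "norm (cl L (\<lambda>x. z * \<beta> x)) = cmod z * norm (cl L \<beta>)" for z
  proof -
    have "(norm (cls (\<lambda>x. z * \<beta> x)))\<^sup>2 = (cmod z * norm (cls \<beta>))\<^sup>2"
      using test_functions_sqint[OF \<beta>] by (simp add: norm_cls sqint_cmult norm_mult power_mult_distrib)
    then show ?thesis by (simp add: cl_test_function \<beta> test_functions_cmult power2_eq_iff_nonneg)
  qed
  have "(\<lambda>n. cl L (\<lambda>x. (- m n) * \<beta> x)) \<longlonglongrightarrow> 0"
  proof (rule tendsto_norm_zero_cancel)
    have "(\<lambda>n. cmod (- m n) * norm (cl L \<beta>)) \<longlonglongrightarrow> cmod (- 0) * norm (cl L \<beta>)" by (intro tendsto_intros m0)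
    then show "(\<lambda>n. norm (cl L (\<lambda>x. (- m n) * \<beta> x))) \<longlonglongrightarrow> 0" unfolding cm by simp
  qed
  from tendsto_add[OF \<psi>2 this] have lim: "(\<lambda>n. cl L (\<lambda>x. \<psi> n x + (- m n) * \<beta> x)) \<longlonglongrightarrow> cl L h"
    unfolding cl_add[OF test_functions_L2[OF \<psi>(1)] test_functions_L2[OF test_functions_cmult[OF \<beta>]]]
    by (simp only: add_0_right)
  have "(LINT x|lebesgue. \<psi> n x + (- m n) * \<beta> x) = 0" for n
    using int[OF \<psi>(1)] int[OF \<beta>] \<open>c \<noteq> 0\<close> by (simp add: c\<beta> m_def)
  from that[OF tf this lim] show thesis .
qed

text \<open>The derivatives of mean-zero test functions' primitives approximate
  \<open>cl L h\<close>, and the closed graph passes to the limit. Together with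
  \<open>integral_d_H10\<close> the range of the derivative on \<open>H10 L\<close> is exactly the
  mean-zero functions.\<close>

lemma H10_primitive:
  assumes h: "h \<in> L2_mean0 L" and L: "L > 0"
  obtains p where "p \<in> H10 L" "d L p = cl L h"
proof -
  obtain \<phi> where \<phi>: "\<And>n::nat. \<phi> n \<in> test_functions {0<..<L}" "\<And>n. (LINT x|lebesgue. \<phi> n x) = 0"
    "(\<lambda>n. cl L (\<phi> n)) \<longlonglongrightarrow> cl L h" using L2_mean0_sequence[OF assms] by blast
  have "\<exists>F. F \<in> H10 L \<and> d L F = cl L (\<phi> n)" for n
  proof -
    obtain F where F: "smooth F" "\<And>x. (F has_vector_derivative \<phi> n x) (at x)"
      "F \<in> test_functions {0<..<L}"
      using test_function_primitive[OF \<phi>(1) L, of n] \<phi>(2)[of n] by blast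
    then show ?thesis
      using test_functions_H10[OF F(3)] d_eq[OF smooth_primitive_weak_deriv[OF F(1,2)]] by blast
  qed
  then obtain F where F: "\<And>n. F n \<in> H10 L" "\<And>n. d L (F n) = cl L (\<phi> n)" by metis
  have "(\<lambda>n. d L (F n)) \<longlonglongrightarrow> cl L h" using \<phi>(3) by (simp add: F(2))
  then show thesis using H10_graph_closed[of F L, OF F(1)] that by blast
qed

text \<open>By duality: \<open>u\<close> is the derivative of some \<open>p\<close> in
  \<open>H10 L\<close>; integrating by parts and applying Poincare's inequality to \<open>p\<close>
  gives the same constant.\<close>

lemma poincare_mean0:
  assumes "u \<in> H1_mean0 L" "L > 0" shows "norm (cl L u) \<le> 2 * L * norm (d L u)"
proof -
  have u: "u \<in> H1 L" "u \<in> L2_mean0 L" using assms by (auto simp: H1_mean0_def)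
  obtain p where p: "p \<in> H10 L" "d L p = cl L u" using H10_primitive[OF u(2) assms(2)] by blast
  have "(norm (cl L u))\<^sup>2 = - (cl L p \<bullet> d L u)"
    using integration_by_parts[OF p(1) u(1)] p(2) by (simp add: power2_norm_eq_inner)
  also have "\<dots> \<le> norm (cl L p) * norm (d L u)" using norm_cauchy_schwarz[of "- cl L p" "d L u"] by simp
  also have "\<dots> \<le> (2 * L * norm (cl L u)) * norm (d L u)"
    using poincare_H10[OF p(1)] p(2) by (intro mult_right_mono) auto
  finally have "norm (cl L u) * norm (cl L u) \<le> norm (cl L u) * (2 * L * norm (d L u))"
    by (simp add: power2_eq_square algebra_simps)
  then show ?thesis using assms(2) by (cases "norm (cl L u) = 0") auto
qed

lemma mean0_primitive:
  assumes \<phi>: "\<phi> \<in> test_functions {0<..<L}" and L: "L > 0"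
  obtains r where "r \<in> H1_mean0 L" "has_weak_deriv L r \<phi>"
proof -
  obtain F where F: "smooth F" "\<And>x. (F has_vector_derivative \<phi> x) (at x)"
    using test_function_primitive[OF \<phi> L] by blast
  have c: "(\<lambda>x. c) \<in> L2 L" for c by (rule L2_continuous) simp
  have FL: "F \<in> L2 L" by (rule L2_continuous[OF smooth_continuous[OF F(1)]])
  have iF: "integrable (interval_measure_on L) F" using integrable_L2_prod[OF FL c[of 1]] by simp
  define m where "m = (LINT x|interval_measure_on L. F x) / of_real L"
  define r where "r x = F x + (- m)" for x
  have r: "smooth r" "\<And>x. (r has_vector_derivative \<phi> x) (at x)"
    unfolding r_def using smooth_add[OF F(1) smooth_const[of "- m"]] F(2)
    by (simp_all add: has_vector_derivative_diff_const)
  have "measure lebesgue {0<..<L} = L" using L by simp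
  then have "(LINT x|interval_measure_on L. (- m)) = - of_real L * m"
    by (simp add: measure_restrict_space scaleR_conv_of_real)
  moreover have "integrable (interval_measure_on L) (\<lambda>x. - m)" using integrable_L2_prod[OF c[of "-m"] c[of 1]] by simp
  ultimately have "(LINT x|interval_measure_on L. r x) = 0"
    unfolding r_def using iF L by (simp add: m_def)
  moreover have "r \<in> L2 L" by (rule L2_continuous[OF smooth_continuous[OF r(1)]])
  moreover have "has_weak_deriv L r \<phi>" by (rule smooth_primitive_weak_deriv[OF r])
  ultimately show thesis using that[of r] by (auto simp: H1_mean0_def L2_mean0_iff H1I)
qed

lemma H1_mean0_diff: "f \<in> H1_mean0 L \<Longrightarrow> g \<in> H1_mean0 L \<Longrightarrow> (\<lambda>x. f x - g x) \<in> H1_mean0 L"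
proof -
  assume fg: "f \<in> H1_mean0 L" "g \<in> H1_mean0 L"
  have c: "(\<lambda>x. 1) \<in> L2 L" by (rule L2_continuous) simp
  have "integrable (interval_measure_on L) f" "integrable (interval_measure_on L) g"
    using integrable_L2_prod[OF _ c, of f] integrable_L2_prod[OF _ c, of g] fg by (auto simp: H1_mean0_def L2_mean0_iff)
  then show ?thesis using fg by (auto simp: H1_mean0_def L2_mean0_iff H1_diff L2_diff)
qed

text \<open>Counterpart of \<open>H10_primitive\<close>: instead of a condition on the mean of the
  data, the free constant is fixed by giving the primitive mean zero, and
  \<open>poincare_mean0\<close> makes the approximating primitives converge.\<close>

lemma H1_mean0_primitive:
  assumes h: "h \<in> L2 L" and L: "L > 0"
  obtains r where "r \<in> H1_mean0 L" "d L r = cl L h"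
proof -
  obtain \<phi> where \<phi>: "\<And>n. \<phi> n \<in> test_functions {0<..<L}" "(\<lambda>n. cls (\<phi> n)) \<longlonglongrightarrow> res 0 L (cl L h)"
    using test_functions_sequence by blast
  have \<phi>2: "(\<lambda>n. cl L (\<phi> n)) \<longlonglongrightarrow> cl L h" using \<phi>(2) by (simp add: res_cl h cl_test_function[OF \<phi>(1)])
  have "\<exists>r. r \<in> H1_mean0 L \<and> has_weak_deriv L r (\<phi> n)" for n
    using mean0_primitive[OF \<phi>(1) L] by metis
  then obtain r where r: "\<And>n. r n \<in> H1_mean0 L" "\<And>n. has_weak_deriv L (r n) (\<phi> n)" by metis
  have H1: "r n \<in> H1 L" "r n \<in> L2 L" for n using r(1) by (auto simp: H1_mean0_def L2_mean0_iff)
  have "Cauchy (\<lambda>n. cl L (r n))"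
  proof (rule Cauchy_transfer)
    show "Cauchy (\<lambda>n. cl L (\<phi> n))" using \<phi>2 by (rule LIMSEQ_imp_Cauchy)
    show "norm (cl L (r m) - cl L (r n)) \<le> 2 * L * norm (cl L (\<phi> m) - cl L (\<phi> n))" for m n
      using poincare_mean0[OF H1_mean0_diff[OF r(1) r(1)] L, of m n]
      by (simp add: cl_diff d_diff H1 d_eq[OF r(2)])
  qed
  then obtain x where x: "(\<lambda>n. cl L (r n)) \<longlonglongrightarrow> x" using Cauchy_convergent convergent_def by blast
  obtain g where g: "g \<in> H1 L" "cl L g = x" "d L g = cl L h"
    using weak_deriv_graph_closed[OF r(2) x \<phi>2] by metis
  have "(\<lambda>n. LINT x|interval_measure_on L. r n x) \<longlonglongrightarrow> (LINT x|interval_measure_on L. g x)"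
    using integral_cl_tendsto[OF H1(2) H1_L2(1)[OF g(1)]] x g by simp
  moreover have "(LINT x|interval_measure_on L. r n x) = 0" for n
    using r(1) by (auto simp: H1_mean0_def L2_mean0_iff)
  ultimately have "(LINT x|interval_measure_on L. g x) = 0" by (simp add: LIMSEQ_const_iff)
  then show thesis using that[of g] g by (auto simp: H1_mean0_def L2_mean0_iff H1_L2)
qed

text \<open>Keeps the range of the operator in the mean-zero components: there the quantities
  \<open>u_x\<close>, \<open>\<phi>_x + \<psi>\<close> and \<theta>, all in \<open>H10 L\<close>,
  are differentiated.\<close>

lemma integral_d_H10:
  assumes "f \<in> H10 L" shows "(LINT x|interval_measure_on L. weak_deriv L f x) = 0"
proof -
  obtain \<phi> where \<phi>: "\<And>n::nat. \<phi> n \<in> test_functions {0<..<L}"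
    "(\<lambda>n. cl L (\<phi> n)) \<longlonglongrightarrow> cl L f" "(\<lambda>n. d L (\<phi> n)) \<longlonglongrightarrow> d L f"
    using H10_sequence[OF assms] by blast
  note t = test_functions_deriv[OF \<phi>(1)]
  have "(\<lambda>n. LINT x|interval_measure_on L. vector_derivative (\<phi> n) (at x)) \<longlonglongrightarrow> (LINT x|interval_measure_on L. weak_deriv L f x)"
    using \<phi>(3) by (intro integral_cl_tendsto test_functions_L2 t H1_L2 H10_H1 assms) (simp add: cl_test_function[OF t] d_test_function[OF \<phi>(1)] d_def[symmetric])
  moreover have "(LINT x|interval_measure_on L. vector_derivative (\<phi> n) (at x)) = 0" for n
    using test_functions_integral_deriv(1)[OF \<phi>(1)] by (simp add: L2_integral indicator_test_function[OF t])
  ultimately show ?thesis by (simp add: LIMSEQ_const_iff)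
qed

section \<open>The memory kernel\<close>

lemma smooth_of_real_has_deriv:
  assumes "smooth (\<lambda>x. of_real (f x))"
  shows "(f has_real_derivative Re (vector_derivative (\<lambda>x. of_real (f x)) (at x))) (at x)"
proof -
  have "((\<lambda>x. Re (of_real (f x))) has_vector_derivative Re (vector_derivative (\<lambda>x. of_real (f x)) (at x))) (at x)"
    by (intro bounded_linear.has_vector_derivative[OF bounded_linear_Re] smooth_has_deriv assms)
  then show ?thesis by (simp add: has_real_derivative_iff_has_vector_derivative)
qed

lemma integrable_L2: "f \<in> L2 L \<Longrightarrow> integrable (interval_measure_on L) f"
  using integrable_L2_prod[OF _ L2_continuous[OF continuous_on_const], of f L 1] by simp

text \<open>Subtracting the mean is an orthogonal projection, so the norm does not grow. It serves
  functions without a boundary condition, such as \<open>q\<close> in the second multiplier.\<close>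

lemma mean_removal:
  assumes q: "q \<in> H1 L" and L: "L > 0"
  obtains c where "(\<lambda>x. q x - c) \<in> H1_mean0 L" "d L (\<lambda>x. q x - c) = d L q" "norm (cl L (\<lambda>x. q x - c)) \<le> norm (cl L q)"
proof -
  have c: "(\<lambda>x. c) \<in> L2 L" for c by (rule L2_continuous) simp
  define m where "m = (LINT x|interval_measure_on L. q x) / of_real L"
  define r where "r x = q x - m" for x
  have qL: "q \<in> L2 L" using q by (rule H1_L2)
  have cw: "has_weak_deriv L (\<lambda>x. m) (\<lambda>x. 0)"
    using has_weak_deriv_smooth[OF smooth_const[of m], of L] by simp
  have rH: "r \<in> H1 L" "d L r = d L q"
    unfolding r_def using H1_diff[OF q H1I[OF cw]] d_diff[OF q H1I[OF cw]] d_eq[OF cw] by (simp_all add: cl_zero)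
  have mi: "(LINT x|interval_measure_on L. m) = of_real L * m"
    using L by (simp add: measure_restrict_space scaleR_conv_of_real)
  have rm: "(LINT x|interval_measure_on L. r x) = 0"
    unfolding r_def using integrable_L2[OF qL] integrable_L2[OF c[of m]] mi L by (simp add: m_def)
  have rL: "r \<in> L2 L" using rH(1) by (rule H1_L2)
  have orth: "cl L r \<bullet> cl L (\<lambda>x. m) = 0"
  proof -
    have "cl L r \<bullet> cl L (\<lambda>x. m) = Re (LINT x|interval_measure_on L. r x * cnj m)"
      using Re_integral_cnj[OF rL c[of "cnj m"]] by simp
    also have "(LINT x|interval_measure_on L. r x * cnj m) = 0" using rm by simp
    finally show ?thesis by simp
  qed
  have "cl L q = cl L r + cl L (\<lambda>x. m)" using cl_add[OF rL c[of m]] by (simp add: r_def)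
  then have "(norm (cl L q))\<^sup>2 = (norm (cl L r))\<^sup>2 + (norm (cl L (\<lambda>x. m)))\<^sup>2"
    using orth by (simp add: power2_norm_eq_inner inner_add_left inner_add_right inner_commute)
  then have "(norm (cl L r))\<^sup>2 \<le> (norm (cl L q))\<^sup>2" by simp
  then have "norm (cl L r) \<le> norm (cl L q)" by (rule power2_le_imp_le) simp
  then show thesis using that[of m] rH rm rL by (auto simp: H1_mean0_def L2_mean0_iff r_def[abs_def])
qed

lemma halfline_integrable:
  fixes f :: "real \<Rightarrow> 'a::{banach, second_countable_topology}"
  shows "integrable halfline f \<longleftrightarrow> integrable lebesgue (\<lambda>s. indicator {0..} s *\<^sub>R f s)"
  by (rule integrable_restrict_space) simp

lemma halfline_integral:
  fixes f :: "real \<Rightarrow> 'a::{banach, second_countable_topology}"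
  shows "(LINT s|halfline. f s) = (LINT s|lebesgue. indicator {0..} s *\<^sub>R f s)"
  by (rule integral_restrict_space) simp

lemma halfline_measurable:
  fixes f :: "real \<Rightarrow> 'a::real_normed_vector"
  shows "f \<in> borel_measurable halfline \<longleftrightarrow> (\<lambda>s. indicator {0..} s *\<^sub>R f s) \<in> borel_measurable lebesgue"
  by (rule borel_measurable_restrict_space_iff) simp

lemma indefinite_integral_continuous:
  fixes W :: "real \<Rightarrow> real"
  assumes "integrable lebesgue (\<lambda>t. indicator {0<..b} t *\<^sub>R W t)"
  shows "continuous_on {0..b} (\<lambda>s. LINT t|lebesgue. indicator {0<..s} t *\<^sub>R W t)"
proof -
  define f where "f t = indicator {0<..b} t *\<^sub>R W t" for t
  have f: "integrable lebesgue f" using assms by (simp add: f_def[abs_def])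
  have si: "set_integrable lebesgue {0..s} f" for s
    unfolding set_integrable_def by (rule integrable_mult_indicator[OF _ f]) simp
  have eq: "(LINT t|lebesgue. indicator {0<..s} t *\<^sub>R W t) = integral {0..s} f" if "s \<in> {0..b}" for s
  proof -
    have "(\<lambda>t. indicator {0<..s} t *\<^sub>R W t) = (\<lambda>t. indicator {0..s} t *\<^sub>R f t)"
      using that by (auto simp: f_def indicator_def fun_eq_iff)
    then show ?thesis using set_lebesgue_integral_eq_integral(2)[OF si[of s]] by (simp add: set_lebesgue_integral_def)
  qed
  have c: "continuous_on {0..b} (\<lambda>s. integral {0..s} f)"
    by (rule indefinite_integral_continuous_1) (rule set_lebesgue_integral_eq_integral(1)[OF si])
  show ?thesis by (rule continuous_on_eq[OF c eq[symmetric]])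
qed

locale kernel =
  fixes g g' :: "real \<Rightarrow> real" and \<kappa>\<^sub>1 :: real
  assumes g_integrable: "integrable halfline g"
    and g_deriv: "\<And>s. s \<ge> 0 \<Longrightarrow> (g has_real_derivative g' s) (at s within {0..})"
    and g'_cont: "continuous_on {0..} g'"
    and g_nonneg: "\<And>s. s \<ge> 0 \<Longrightarrow> g s \<ge> 0"
    and g_nontrivial: "\<exists>s\<ge>0. g s \<noteq> 0"
    and decay: "\<kappa>\<^sub>1 > 0" "\<And>s. s \<ge> 0 \<Longrightarrow> g' s \<le> - \<kappa>\<^sub>1 * g s"
begin

text \<open>The points at which a memory variable is visible. As \<open>g\<close> is nonincreasing
  and continuous with \<open>g 0 > 0\<close>, this is an interval from 0 that is open at its right
  end, bounded or not.\<close>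

definition J :: "real set" where "J = {s. 0 \<le> s \<and> 0 < g s}"

abbreviation "test_J \<equiv> test_functions {s. 0 < s \<and> 0 < g s}"

lemma g_cont: "continuous_on {0..} g"
  using g_deriv by (intro has_derivative_continuous_on) (auto simp: has_field_derivative_def)

lemma g'_nonpos: "s \<ge> 0 \<Longrightarrow> g' s \<le> 0"
  using decay(2)[of s] decay(1) g_nonneg[of s] by (smt (verit) mult_nonneg_nonneg mult_minus_left)

lemma g_FTC:
  assumes "0 \<le> r" "r \<le> s"
  shows "(LINT t|lebesgue. indicator {r<..s} t *\<^sub>R g' t) = g s - g r" "integrable lebesgue (\<lambda>t. indicator {r<..s} t *\<^sub>R g' t)"
proof -
  have F: "has_bochner_integral lborel (\<lambda>x. indicator {r..s} x *\<^sub>R g' x) (g s - g r)"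
    by (rule has_bochner_integral_FTC_Icc)
      (use assms in \<open>auto intro!: continuous_on_subset[OF g'_cont] has_field_derivative_subset[OF g_deriv] simp flip: has_real_derivative_iff_has_vector_derivative\<close>)
  then have L: "integrable lebesgue (\<lambda>x. indicator {r..s} x *\<^sub>R g' x)" "(LINT x|lebesgue. indicator {r..s} x *\<^sub>R g' x) = g s - g r"
    by (auto simp: has_bochner_integral_iff integrable_completion integral_completion borel_measurable_integrable)
  have "integrable lebesgue (\<lambda>x. indicator {r<..s} x *\<^sub>R (indicator {r..s} x *\<^sub>R g' x))"
    by (rule integrable_mult_indicator[OF _ L(1)]) simp
  moreover have "(\<lambda>x. indicator {r<..s} x *\<^sub>R (indicator {r..s} x *\<^sub>R g' x)) = (\<lambda>x. indicator {r<..s} x *\<^sub>R g' x)"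
    by (auto simp: indicator_def)
  ultimately show i: "integrable lebesgue (\<lambda>t. indicator {r<..s} t *\<^sub>R g' t)" by simp
  have "AE x in lborel. x \<noteq> r" by (rule AE_lborel_singleton)
  then have "AE x in lebesgue. x \<noteq> r" by (rule AE_completion)
  then have "AE x in lebesgue. indicator {r<..s} x *\<^sub>R g' x = indicator {r..s} x *\<^sub>R g' x"
    by eventually_elim (auto simp: indicator_def)
  then have "(LINT x|lebesgue. indicator {r<..s} x *\<^sub>R g' x) = (LINT x|lebesgue. indicator {r..s} x *\<^sub>R g' x)"
    using i L(1) by (intro integral_cong_AE) auto
  then show "(LINT t|lebesgue. indicator {r<..s} t *\<^sub>R g' t) = g s - g r" using L(2) by simp
qed

lemma g_antimono: "0 \<le> r \<Longrightarrow> r \<le> s \<Longrightarrow> g s \<le> g r"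
proof -
  assume rs: "0 \<le> r" "r \<le> s"
  have "(LINT t|lebesgue. indicator {r<..s} t *\<^sub>R g' t) \<le> (LINT t|(lebesgue::real measure). 0)"
    using g_FTC(2)[OF rs] rs g'_nonpos by (intro integral_mono) (auto simp: indicator_def)
  then show "g s \<le> g r" using g_FTC(1)[OF rs] by simp
qed

lemma J_down: "s \<in> J \<Longrightarrow> 0 \<le> r \<Longrightarrow> r \<le> s \<Longrightarrow> r \<in> J"
  using g_antimono[of r s] by (auto simp: J_def)

lemma g0_pos: "g 0 > 0"
proof -
  obtain s where "s \<ge> 0" "g s \<noteq> 0" using g_nontrivial by blast
  then show ?thesis using g_antimono[of 0 s] g_nonneg[of s] by simp
qed

lemma J_0: "0 \<in> J" using g0_pos by (simp add: J_def)

lemma J_right: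
  assumes "s \<in> J" obtains s' where "s < s'" "s' \<in> J"
proof -
  have s: "0 \<le> s" "0 < g s" using assms by (auto simp: J_def)
  have "(g \<longlongrightarrow> g s) (at s within {0..})" using g_cont s by (auto simp: continuous_on_def)
  then have "\<forall>\<^sub>F x in at s within {0..}. dist (g x) (g s) < g s" by (rule tendstoD[OF _ s(2)])
  then obtain e where e: "e > 0" "\<And>x. x \<ge> 0 \<Longrightarrow> x \<noteq> s \<Longrightarrow> dist x s < e \<Longrightarrow> dist (g x) (g s) < g s"
    by (auto simp: eventually_at)
  have "dist (g (s + e/2)) (g s) < g s" using e s by (intro e) (auto simp: dist_real_def)
  then have "0 < g (s + e/2)" by (simp add: dist_real_def abs_less_iff)
  then show thesis using that[of "s + e/2"] e s by (auto simp: J_def)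
qed

end

text \<open>On (0,s] the weight is at least \<open>g s > 0\<close>, so weighted square integrability
  becomes local square integrability, and \<open>|z| \<le> 1 + |z|^2\<close> gives
  integrability.\<close>

lemma (in kernel) weighted_integrable_local:
  fixes z :: "real \<Rightarrow> 'a::{banach, second_countable_topology}"
  assumes z: "z \<in> borel_measurable halfline" "integrable halfline (\<lambda>s. g s * (norm (z s))\<^sup>2)" and s: "s \<in> J"
  shows "integrable lebesgue (\<lambda>t. indicator {0<..s} t *\<^sub>R z t)"
proof (rule Bochner_Integration.integrable_bound)
  have s0: "0 \<le> s" "g s > 0" using s by (auto simp: J_def)
  have "integrable lebesgue (\<lambda>t. indicator {0<..s} t :: real)" by (auto simp: emeasure_lborel_Ioc s0)
  moreover have "integrable lebesgue (\<lambda>t. indicator {0..} t *\<^sub>R (g t * (norm (z t))\<^sup>2))"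
    using z(2) by (simp only: halfline_integrable)
  ultimately show "integrable lebesgue (\<lambda>t. indicator {0<..s} t + (indicator {0..} t *\<^sub>R (g t * (norm (z t))\<^sup>2)) / g s)"
    by (intro Bochner_Integration.integrable_add integrable_divide_zero) auto
  have "(\<lambda>t. indicator {0<..s} t *\<^sub>R (indicator {0..} t *\<^sub>R z t)) \<in> borel_measurable lebesgue"
    by (rule borel_measurable_scaleR, rule borel_measurable_indicator) (use z(1) in \<open>simp_all only: halfline_measurable\<close>, simp)
  moreover have "(\<lambda>t. indicator {0<..s} t *\<^sub>R (indicator {0..} t *\<^sub>R z t)) = (\<lambda>t. indicator {0<..s} t *\<^sub>R z t)"
    by (auto simp: indicator_def)
  ultimately show "(\<lambda>t. indicator {0<..s} t *\<^sub>R z t) \<in> borel_measurable lebesgue" by simp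
  show "AE t in lebesgue. norm (indicator {0<..s} t *\<^sub>R z t) \<le>
      norm (indicator {0<..s} t + (indicator {0..} t *\<^sub>R (g t * (norm (z t))\<^sup>2)) / g s)"
  proof (rule AE_I2)
    fix t
    show "norm (indicator {0<..s} t *\<^sub>R z t) \<le> norm (indicator {0<..s} t + (indicator {0..} t *\<^sub>R (g t * (norm (z t))\<^sup>2)) / g s)"
    proof (cases "t \<in> {0<..s}")
      case True
      then have "g s \<le> g t" using g_antimono[of t s] by simp
      then have "(norm (z t))\<^sup>2 \<le> (g t * (norm (z t))\<^sup>2) / g s"
        using s0 by (simp add: field_simps mult_right_mono)
      moreover have "norm (z t) \<le> 1 + (norm (z t))\<^sup>2"
        using zero_le_power2[of "norm (z t) - 1/2"] by (simp add: power2_eq_square algebra_simps)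
      ultimately have "norm (z t) \<le> 1 + (g t * (norm (z t))\<^sup>2) / g s" by linarith
      then show ?thesis using True by simp
    qed simp
  qed
qed

lemma sigma_finite_lebesgue: "sigma_finite_measure (lebesgue :: real measure)"
proof
  obtain A :: "real set set" where A: "countable A" "A \<subseteq> sets lborel" "\<Union>A = space lborel" "\<forall>a\<in>A. emeasure lborel a \<noteq> \<infinity>"
    using lborel.sigma_finite_countable by blast
  then show "\<exists>A. countable A \<and> A \<subseteq> sets lebesgue \<and> \<Union>A = space lebesgue \<and> (\<forall>a\<in>A. emeasure (lebesgue :: real measure) a \<noteq> \<infinity>)"
    by (intro exI[of _ A]) auto
qed

text \<open>Fubini on the square, split along its diagonal.\<close>

lemma product_primitive:
  fixes f h :: "real \<Rightarrow> 'a::{real_inner, banach, second_countable_topology}"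
  assumes f: "integrable lebesgue f" and h: "integrable lebesgue h"
  shows "integrable lebesgue (\<lambda>t. f t \<bullet> (LINT s|lebesgue. indicator {..t} s *\<^sub>R h s))"
    "integrable lebesgue (\<lambda>t. (LINT s|lebesgue. indicator {..t} s *\<^sub>R f s) \<bullet> h t)"
    "(LINT t|lebesgue. f t) \<bullet> (LINT t|lebesgue. h t) =
       (LINT t|lebesgue. f t \<bullet> (LINT s|lebesgue. indicator {..t} s *\<^sub>R h s)) + (LINT t|lebesgue. (LINT s|lebesgue. indicator {..t} s *\<^sub>R f s) \<bullet> h t)"
proof -
  interpret sigma_finite_measure "lebesgue :: real measure" by (rule sigma_finite_lebesgue)
  interpret P: pair_sigma_finite "lebesgue :: real measure" "lebesgue :: real measure" ..
  note [measurable] = borel_measurable_integrable[OF f] borel_measurable_integrable[OF h]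
  have i: "integrable (lebesgue \<Otimes>\<^sub>M lebesgue) (\<lambda>(t, s). f t \<bullet> h s)"
  proof (rule P.Fubini_integrable)
    show "AE t in lebesgue. integrable lebesgue (\<lambda>s. case (t, s) of (t, s) \<Rightarrow> f t \<bullet> h s)" using h by simp
    show "integrable lebesgue (\<lambda>t. LINT s|lebesgue. norm (case (t, s) of (t, s) \<Rightarrow> f t \<bullet> h s))"
    proof (rule Bochner_Integration.integrable_bound)
      show "integrable lebesgue (\<lambda>t. norm (f t) * (LINT s|lebesgue. norm (h s)))" using f by simp
      have "(LINT s|lebesgue. norm (f t \<bullet> h s)) \<le> norm (f t) * (LINT s|lebesgue. norm (h s))" for t
        unfolding integral_mult_right_zero[symmetric] using h by (intro integral_mono) (auto simp: Cauchy_Schwarz_ineq2)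
      then show "AE t in lebesgue. norm (LINT s|lebesgue. norm (case (t, s) of (t, s) \<Rightarrow> f t \<bullet> h s)) \<le> norm (norm (f t) * (LINT s|lebesgue. norm (h s)))"
        by (simp add: abs_mult)
    qed measurable
  qed measurable
  have m: "{x \<in> space (lebesgue \<Otimes>\<^sub>M lebesgue). snd x \<le> fst x} \<in> sets (lebesgue \<Otimes>\<^sub>M (lebesgue :: real measure))"
    "{x \<in> space (lebesgue \<Otimes>\<^sub>M lebesgue). fst x < snd x} \<in> sets (lebesgue \<Otimes>\<^sub>M (lebesgue :: real measure))"
  proof -
    have id: "(\<lambda>x. x) \<in> borel_measurable (lebesgue :: real measure)" by (rule measurable_completion) simp
    note m = measurable_compose[OF measurable_fst id] measurable_compose[OF measurable_snd id]
    show "{x \<in> space (lebesgue \<Otimes>\<^sub>M lebesgue). snd x \<le> fst x} \<in> sets (lebesgue \<Otimes>\<^sub>M (lebesgue :: real measure))"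
      by (rule borel_measurable_le[OF m(2,1)])
    show "{x \<in> space (lebesgue \<Otimes>\<^sub>M lebesgue). fst x < snd x} \<in> sets (lebesgue \<Otimes>\<^sub>M (lebesgue :: real measure))"
      by (rule borel_measurable_less[OF m])
  qed
  have i1: "integrable (lebesgue \<Otimes>\<^sub>M lebesgue) (\<lambda>(t, s). f t \<bullet> (indicator {..t} s *\<^sub>R h s))"
    by (rule Bochner_Integration.integrable_cong[THEN iffD1, OF refl _ integrable_mult_indicator[OF m(1) i]])
      (auto simp: space_pair_measure indicator_def)
  \<comment> \<open>The strict inequality keeps the two triangles disjoint; \<open>a2\<close> then
    replaces it by the non-strict one, since a single point is null.\<close>
  have i2: "integrable (lebesgue \<Otimes>\<^sub>M lebesgue) (\<lambda>(t, s). (indicator {..<s} t *\<^sub>R f t) \<bullet> h s)"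
    by (rule Bochner_Integration.integrable_cong[THEN iffD1, OF refl _ integrable_mult_indicator[OF m(2) i]])
      (auto simp: space_pair_measure indicator_def)
  have a1: "(LINT s|lebesgue. f t \<bullet> (indicator {..t} s *\<^sub>R h s)) = f t \<bullet> (LINT s|lebesgue. indicator {..t} s *\<^sub>R h s)" for t
    by (rule integral_inner_right) (rule integrable_mult_indicator[OF _ h], simp)
  have a2: "(LINT t|lebesgue. (indicator {..<s} t *\<^sub>R f t) \<bullet> h s) = (LINT t|lebesgue. indicator {..s} t *\<^sub>R f t) \<bullet> h s" for s
  proof -
    have ii: "integrable lebesgue (\<lambda>t. indicator {..<s} t *\<^sub>R f t)" "integrable lebesgue (\<lambda>t. indicator {..s} t *\<^sub>R f t)"
      by (intro integrable_mult_indicator[OF _ f]; simp)+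
    have "AE t in lebesgue. t \<noteq> s" by (rule AE_completion) (rule AE_lborel_singleton)
    then have "AE t in lebesgue. indicator {..<s} t *\<^sub>R f t = indicator {..s} t *\<^sub>R f t" by eventually_elim (auto simp: indicator_def)
    then have "(LINT t|lebesgue. indicator {..<s} t *\<^sub>R f t) = (LINT t|lebesgue. indicator {..s} t *\<^sub>R f t)"
      by (rule integral_cong_AE[OF borel_measurable_integrable[OF ii(1)] borel_measurable_integrable[OF ii(2)]])
    then show ?thesis using integral_inner_left[OF ii(1), of "h s"] by simp
  qed
  show "integrable lebesgue (\<lambda>t. f t \<bullet> (LINT s|lebesgue. indicator {..t} s *\<^sub>R h s))" using P.integrable_fst[OF i1] by (simp only: a1)
  show "integrable lebesgue (\<lambda>t. (LINT s|lebesgue. indicator {..t} s *\<^sub>R f s) \<bullet> h t)" using P.integrable_snd[OF i2] by (simp only: a2)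
  have "(LINT t|lebesgue. f t) \<bullet> (LINT t|lebesgue. h t) = integral\<^sup>L (lebesgue \<Otimes>\<^sub>M lebesgue) (\<lambda>(t, s). f t \<bullet> h s)"
    unfolding P.integral_fst[OF i, symmetric] using f h by simp
  also have "\<dots> = integral\<^sup>L (lebesgue \<Otimes>\<^sub>M lebesgue) (\<lambda>x. (case x of (t, s) \<Rightarrow> f t \<bullet> (indicator {..t} s *\<^sub>R h s)) + (case x of (t, s) \<Rightarrow> (indicator {..<s} t *\<^sub>R f t) \<bullet> h s))"
    by (rule Bochner_Integration.integral_cong) (auto simp: indicator_def)
  also have "\<dots> = (LINT t|lebesgue. f t \<bullet> (LINT s|lebesgue. indicator {..t} s *\<^sub>R h s)) + (LINT t|lebesgue. (LINT s|lebesgue. indicator {..t} s *\<^sub>R f s) \<bullet> h t)"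
    unfolding Bochner_Integration.integral_add[OF i1 i2] P.integral_fst[OF i1, symmetric] P.integral_snd[OF i2, symmetric] a1 a2 ..
  finally show "(LINT t|lebesgue. f t) \<bullet> (LINT t|lebesgue. h t) =
      (LINT t|lebesgue. f t \<bullet> (LINT s|lebesgue. indicator {..t} s *\<^sub>R h s)) + (LINT t|lebesgue. (LINT s|lebesgue. indicator {..t} s *\<^sub>R f s) \<bullet> h t)" .
qed

lemma test_functions_Re: 
  assumes "\<phi> \<in> test_functions S" shows "(\<lambda>s. of_real (Re (\<phi> s))) \<in> test_functions S"
proof -
  have "(\<lambda>s. (1 / 2) * (\<phi> s + cnj (\<phi> s))) \<in> test_functions S"
    by (intro test_functions_cmult test_functions_add test_functions_cnj assms)
  then show ?thesis by (simp add: complex_add_cnj)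
qed

text \<open>Extended constantly beyond [0,b], \<open>w\<close> has weak derivative 0. Poincare's
  inequality after removal of the mean makes it constant almost everywhere, and continuity makes it
  constant everywhere.\<close>

lemma du_Bois_Reymond:
  fixes w :: "real \<Rightarrow> real"
  assumes b: "0 < b" and w: "continuous_on {0..b} w"
    and weak: "\<And>\<xi> \<xi>'. (\<lambda>s. of_real (\<xi> s)) \<in> test_functions {0<..<b} \<Longrightarrow> (\<And>s. (\<xi> has_real_derivative \<xi>' s) (at s)) \<Longrightarrow>
      (LINT s|interval_measure_on b. w s * \<xi>' s) = 0"
    and s: "s \<in> {0..b}"
  shows "w s = w 0"
proof -
  define c where "c x = max 0 (min b x)" for x
  define v where "v x = complex_of_real (w (c x))" for x
  have wc: "continuous_on UNIV (\<lambda>x. w (c x))"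
    by (rule continuous_on_compose2[OF w]) (use b in \<open>auto simp: c_def intro!: continuous_intros\<close>)
  have vL: "v \<in> L2 b" unfolding v_def[abs_def] by (rule L2_continuous) (intro continuous_intros wc)
  have hw: "has_weak_deriv b v (\<lambda>x. 0)"
    unfolding has_weak_deriv_iff
  proof (intro conjI vL L2_zero ballI)
    fix \<phi> assume \<phi>: "\<phi> \<in> test_functions {0<..<b}"
    note \<phi>' = test_functions_deriv[OF \<phi>]
    have "((\<lambda>s. Re (\<phi> s)) has_real_derivative Re (vector_derivative \<phi> (at s))) (at s)" for s
      using bounded_linear.has_vector_derivative[OF bounded_linear_Re smooth_has_deriv[OF test_functions_smooth[OF \<phi>]]]
      by (simp add: has_real_derivative_iff_has_vector_derivative)
    note z = weak[OF test_functions_Re[OF \<phi>] this]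
    have "cl b v \<bullet> cl b (\<lambda>x. vector_derivative \<phi> (at x)) = (LINT x|interval_measure_on b. v x \<bullet> vector_derivative \<phi> (at x))"
      by (rule inner_cl[OF vL test_functions_L2[OF \<phi>']])
    also have "\<dots> = (LINT x|interval_measure_on b. w x * Re (vector_derivative \<phi> (at x)))"
      by (rule Bochner_Integration.integral_cong) (auto simp: v_def c_def inner_complex_def)
    finally show "cl b v \<bullet> cls (\<lambda>x. vector_derivative \<phi> (at x)) = - (cl b (\<lambda>x. 0) \<bullet> cls \<phi>)"
      using z by (simp add: cl_test_function[OF \<phi>'] cl_zero)
  qed
  obtain k where k: "(\<lambda>x. v x - k) \<in> H1_mean0 b" "d b (\<lambda>x. v x - k) = d b v"
    using mean_removal[OF H1I[OF hw] b] by blast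
  have kL: "(\<lambda>x. v x - k) \<in> L2 b" using k(1) by (auto simp: H1_mean0_def L2_mean0_iff)
  have "norm (cl b (\<lambda>x. v x - k)) = 0"
    using poincare_mean0[OF k(1) b] k(2) d_eq[OF hw] by (simp add: cl_zero)
  then have "(LINT x|interval_measure_on b. (cmod (v x - k))\<^sup>2) = 0"
    unfolding L2_norm_eq[OF kL, symmetric] L2_norm_def by simp
  then have "AE x in interval_measure_on b. v x = k"
    using kL by (subst (asm) integral_nonneg_eq_0_iff_AE) (auto simp: L2_def)
  then have ae: "AE x\<in>{0<..<b} in lebesgue. x \<in> {x. v x = k}" by (subst (asm) AE_restrict_space_iff) auto
  have cl: "closed {x. v x = k}" unfolding v_def by (intro closed_Collect_eq continuous_intros wc)
  have "{0<..<b} \<subseteq> {x. v x = k}" using mem_closed_if_AE_lebesgue_open[OF open_greaterThanLessThan cl ae] by blast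
  then have "closure {0<..<b} \<subseteq> {x. v x = k}" using cl by (rule closure_minimal)
  then have "v x = k" if "x \<in> {0..b}" for x using b that by auto
  from this[of s] this[of 0] show ?thesis using s b by (auto simp: v_def c_def)
qed

context kernel
begin

text \<open>The superlevel set \<open>K n\<close> is compact and contained in \<open>J\<close>, so
  it has a largest element, and \<open>J\<close> extends beyond that. Every point of
  \<open>J\<close> lies in \<open>K n\<close> for large n, whether or not \<open>J\<close> is
  bounded.\<close>

lemma J_exhaustion:
  obtains b :: "nat \<Rightarrow> real" where "\<And>n. b n \<in> J" "\<And>t. t \<in> J \<Longrightarrow> \<forall>\<^sub>F n in sequentially. t < b n"
proof -
  define K where "K n = {s \<in> {0..real n}. g 0 / real (Suc n) \<le> g s}" for n
  have "\<exists>b\<in>J. \<forall>t\<in>K n. t < b" for n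
  proof -
    have "continuous_on {0..real n} g" by (rule continuous_on_subset[OF g_cont]) auto
    then have "closed ({0..real n} \<inter> g -` {g 0 / real (Suc n)..})" by (rule continuous_closed_preimage) auto
    moreover have "K n = {0..real n} \<inter> g -` {g 0 / real (Suc n)..}" by (auto simp: K_def)
    moreover have "bounded (K n)" by (rule bounded_subset[of "{0..real n}"]) (auto simp: K_def)
    ultimately have "compact (K n)" by (simp add: compact_eq_bounded_closed)
    moreover have "0 \<in> K n" using g0_pos by (simp add: K_def field_simps)
    ultimately obtain s where s: "s \<in> K n" "\<And>t. t \<in> K n \<Longrightarrow> t \<le> s" using compact_attains_sup[of "K n"] by blast
    have "0 < g 0 / real (Suc n)" using g0_pos by simp
    also have "\<dots> \<le> g s" using s(1) unfolding K_def by blast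
    finally have "s \<in> J" using s(1) by (simp add: J_def K_def)
    then obtain b where "s < b" "b \<in> J" using J_right by blast
    then show ?thesis using s(2) by (meson le_less_trans)
  qed
  then obtain b where b: "\<And>n. b n \<in> J" "\<And>n t. t \<in> K n \<Longrightarrow> t < b n" by metis
  show thesis
  proof (rule that[OF b(1)])
    fix t assume "t \<in> J"
    then have t: "0 \<le> t" "0 < g t" by (auto simp: J_def)
    have "\<forall>\<^sub>F n in sequentially. t \<le> real n \<and> g 0 / g t \<le> real n"
      by (intro eventually_conj) (rule eventually_compose_filterlim[OF eventually_ge_at_top filterlim_real_sequentially])+
    then show "\<forall>\<^sub>F n in sequentially. t < b n"
    proof eventually_elim
      case (elim n)
      then have "g 0 / g t \<le> real (Suc n)" by simp
      then have "g 0 \<le> real (Suc n) * g t" using t(2) by (simp only: pos_divide_le_eq)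
      then show ?case using elim t b(2)[of t n] by (simp add: K_def field_simps)
    qed
  qed
qed

text \<open>Formally \<open>z\<close> is the derivative of \<open>p\<close>, so
  \<open>2 * (z s \<bullet> p s)\<close> is the derivative of \<open>|p|^2\<close>. Integration by
  parts over (0,b] against \<open>g\<close> leaves a boundary term
  \<open>g b |p b|^2 \<ge> 0\<close> and \<open>- g' |p|^2 \<ge> \<kappa>\<^sub>1 g |p|^2\<close>;
  then \<open>b\<close> runs to the right end of \<open>J\<close>. Stopping at \<open>b\<close>
  makes the sign of the boundary term sufficient, without any information on its limit.\<close>

lemma memory_dissipation:
  fixes p z :: "real \<Rightarrow> 'a::{real_inner, banach, second_countable_topology}"
  assumes p: "continuous_on J p" and p0: "p 0 = 0"
    and z: "z \<in> borel_measurable halfline" "integrable halfline (\<lambda>s. g s * (norm (z s))\<^sup>2)"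
    and weak: "\<And>\<xi> \<xi>'. (\<lambda>s. of_real (\<xi> s)) \<in> test_J \<Longrightarrow>
        (\<And>s. (\<xi> has_real_derivative \<xi>' s) (at s)) \<Longrightarrow>
        (LINT s|halfline. \<xi>' s *\<^sub>R p s) = - (LINT s|halfline. \<xi> s *\<^sub>R z s)"
    and pi: "integrable halfline (\<lambda>s. g s * (norm (p s))\<^sup>2)" and zp: "integrable halfline (\<lambda>s. g s * (z s \<bullet> p s))"
  shows "\<kappa>\<^sub>1 * (LINT s|halfline. g s * (norm (p s))\<^sup>2) \<le> 2 * (LINT s|halfline. g s * (z s \<bullet> p s))"
proof -
  define Z where "Z b t = indicator {0<..b} t *\<^sub>R z t" for b t :: real
  have Zi: "integrable lebesgue (Z b)" if "b \<in> J" for b unfolding Z_def[abs_def] by (rule weighted_integrable_local[OF z that])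
  \<comment> \<open>The continuous \<open>p\<close> is the primitive of \<open>z\<close> on [0,b]:
    by the weak identity and du Bois-Reymond the difference from the primitive is constant, and
    \<open>p 0 = 0\<close> fixes the constant.\<close>
  have prim: "(LINT t|lebesgue. indicator {..s} t *\<^sub>R Z b t) = p s" if b: "b \<in> J" and s: "s \<in> {0..b}" for b s
  proof (cases "b = 0")
    case True
    then have "Z b = (\<lambda>t. 0)" by (simp add: Z_def fun_eq_iff)
    then show ?thesis using True s p0 by simp
  next
    case False
    then have b0: "0 < b" using s by auto
    have sub: "{0..b} \<subseteq> J" using J_down[OF b] by auto
    have pc: "continuous_on {0..b} p" by (rule continuous_on_subset[OF p sub])
    define P where "P s = (LINT t|lebesgue. indicator {..s} t *\<^sub>R Z b t)" for s
    have Zs: "integrable lebesgue (\<lambda>t. indicator {..s} t *\<^sub>R Z b t)" for s by (rule integrable_mult_indicator[OF _ Zi[OF b]]) simp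
    \<comment> \<open>Testing in the direction of the difference at the single point
      \<open>s\<close> reduces the vector-valued claim to a scalar one and ends with
      \<open>e \<bullet> e = 0\<close>.\<close>
    define e where "e = p s - P s"
    have Pe: "P s \<bullet> e = (LINT t|lebesgue. indicator {..s} t *\<^sub>R (Z b t \<bullet> e))" for s
      unfolding P_def using integral_inner_left[of e lebesgue "\<lambda>t. indicator {..s} t *\<^sub>R Z b t"] Zs by simp
    have Pc: "continuous_on {0..b} (\<lambda>s. P s \<bullet> e)"
    proof (rule continuous_on_eq[OF indefinite_integral_continuous])
      show "integrable lebesgue (\<lambda>t. indicator {0<..b} t *\<^sub>R (z t \<bullet> e))" using Zi[OF b] unfolding Z_def[abs_def] by (simp add: integrable_inner_left flip: inner_scaleR_left)
      show "(LINT t|lebesgue. indicator {0<..s} t *\<^sub>R (z t \<bullet> e)) = P s \<bullet> e" if "s \<in> {0..b}" for s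
        unfolding Pe by (rule Bochner_Integration.integral_cong) (use that in \<open>auto simp: Z_def indicator_def\<close>)
    qed
    have "p s \<bullet> e - P s \<bullet> e = p 0 \<bullet> e - P 0 \<bullet> e"
    proof (rule du_Bois_Reymond[OF b0 _ _ s])
      show "continuous_on {0..b} (\<lambda>s. p s \<bullet> e - P s \<bullet> e)" by (intro continuous_intros pc Pc)
      fix \<xi> \<xi>' assume tf: "(\<lambda>s. complex_of_real (\<xi> s)) \<in> test_functions {0<..<b}" and der: "\<And>s. (\<xi> has_real_derivative \<xi>' s) (at s)"
      have tf': "(\<lambda>s. complex_of_real (\<xi>' s)) \<in> test_functions {0<..<b}"
        using test_functions_deriv[OF tf] by (simp add: vector_derivative_at[OF has_vector_derivative_of_real[OF der]])
      have out: "\<xi> t = 0" "\<xi>' t = 0" if "t \<notin> {0<..<b}" for t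
        using test_functions_outside[OF tf that] test_functions_outside[OF tf' that] by auto
      have \<xi>c: "continuous_on UNIV \<xi>'" using continuous_on_Re[OF smooth_continuous[OF test_functions_smooth[OF tf'], of UNIV]] by simp
      have ind: "indicator {0..b} t *\<^sub>R (\<xi>' t *\<^sub>R x) = \<xi>' t *\<^sub>R x" "indicator {0..} t *\<^sub>R (\<xi>' t *\<^sub>R x) = \<xi>' t *\<^sub>R x" for t and x :: 'a
        by (cases "t \<in> {0<..<b}"; simp add: out(2))+
      have I: "has_bochner_integral lebesgue (\<lambda>t. indicator {..s} t *\<^sub>R \<xi>' t) (\<xi> s)" if "0 \<le> s" for s
      proof -
        have "has_bochner_integral lborel (\<lambda>t. indicator {0..s} t *\<^sub>R \<xi>' t) (\<xi> s - \<xi> 0)"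
          by (rule has_bochner_integral_FTC_Icc) (use that in \<open>auto intro: continuous_on_subset[OF \<xi>c] has_field_derivative_at_within[OF der] simp flip: has_real_derivative_iff_has_vector_derivative\<close>)
        moreover have "(\<lambda>t. indicator {0..s} t *\<^sub>R \<xi>' t) = (\<lambda>t. indicator {..s} t *\<^sub>R \<xi>' t)" using out(2) by (force simp: indicator_def)
        ultimately show ?thesis
          using out(1)[of 0] by (auto simp: has_bochner_integral_iff integrable_completion integral_completion borel_measurable_integrable)
      qed
      have "(\<lambda>t. indicator {..b} t *\<^sub>R \<xi>' t) = \<xi>'" using out(2) by (force simp: indicator_def)
      then have \<xi>i: "integrable lebesgue \<xi>'" "(LINT t|lebesgue. \<xi>' t) = 0" using I[of b] b0 out(1)[of b] by (auto simp: has_bochner_integral_iff)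
      have "integrable lborel (\<lambda>t. indicator {0..b} t *\<^sub>R (\<xi>' t *\<^sub>R p t))"
        by (rule borel_integrable_compact) (intro compact_Icc continuous_intros continuous_on_subset[OF \<xi>c] pc subset_UNIV)+
      then have "integrable lborel (\<lambda>t. \<xi>' t *\<^sub>R p t)" unfolding ind .
      then have pi: "integrable lebesgue (\<lambda>t. \<xi>' t *\<^sub>R p t)" by (simp add: integrable_completion borel_measurable_integrable)
      note Ze = integrable_inner_left[OF Zi[OF b], of e]
      \<comment> \<open>\<open>\<xi>'\<close> has integral 0 and primitive \<xi>, so the Fubini
        identity for \<open>\<xi>'\<close> and \<open>Z b t \<bullet> e\<close> is integration by
        parts of \<open>P\<close> against the test function.\<close>
      have "0 = (LINT t|lebesgue. \<xi>' t * (P t \<bullet> e)) + (LINT t|lebesgue. (LINT s|lebesgue. indicator {..t} s *\<^sub>R \<xi>' s) * (Z b t \<bullet> e))"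
        using product_primitive(3)[OF \<xi>i(1) Ze] \<xi>i(2) by (simp add: Pe)
      also have "(LINT t|lebesgue. (LINT s|lebesgue. indicator {..t} s *\<^sub>R \<xi>' s) * (Z b t \<bullet> e)) = (LINT t|lebesgue. (indicator {0..} t *\<^sub>R (\<xi> t *\<^sub>R z t)) \<bullet> e)"
      proof (rule Bochner_Integration.integral_cong[OF refl])
        fix t show "(LINT s|lebesgue. indicator {..t} s *\<^sub>R \<xi>' s) * (Z b t \<bullet> e) = (indicator {0..} t *\<^sub>R (\<xi> t *\<^sub>R z t)) \<bullet> e"
          using I[of t] out(1)[of t] by (cases "t \<in> {0<..b}") (auto simp: Z_def indicator_def has_bochner_integral_iff)
      qed
      also have "\<dots> = (LINT s|halfline. \<xi> s *\<^sub>R z s) \<bullet> e"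
      proof -
        have eq: "indicator {0..} t *\<^sub>R (\<xi> t *\<^sub>R z t) = \<xi> t *\<^sub>R Z b t" for t by (cases "t \<in> {0<..<b}") (auto simp: Z_def out(1))
        have "integrable lebesgue (\<lambda>t. \<xi> t *\<^sub>R Z b t)"
        proof -
          obtain B where B: "\<And>t. cmod (of_real (\<xi> t)) \<le> B" "B > 0" using test_functions_bounded[OF tf] by blast
          have "\<xi> \<in> borel_measurable lebesgue" using measurable_compose[OF test_functions_measurable[OF tf] borel_measurable_Re] by simp
          then show ?thesis
            by (intro Bochner_Integration.integrable_bound[OF integrable_scaleR_right[OF Zi[OF b], of B]])
              (use B in \<open>auto intro!: AE_I2 mult_right_mono borel_measurable_scaleR borel_measurable_integrable[OF Zi[OF b]]\<close>)
        qed
        then show ?thesis unfolding halfline_integral eq by (intro integral_inner_left)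
      qed
      also have "(LINT s|halfline. \<xi> s *\<^sub>R z s) = - (LINT s|lebesgue. \<xi>' s *\<^sub>R p s)"
      proof -
        have "{0<..<b} \<subseteq> {s. 0 < s \<and> 0 < g s}" using J_down[OF b] by (auto simp: J_def less_imp_le)
        then have "(\<lambda>s. complex_of_real (\<xi> s)) \<in> test_J" using tf test_functions_mono by blast
        from weak[OF this der] show ?thesis unfolding halfline_integral[of "\<lambda>s. \<xi>' s *\<^sub>R p s"] ind by simp
      qed
      finally have zero: "(LINT t|lebesgue. \<xi>' t * (P t \<bullet> e)) = (LINT t|lebesgue. \<xi>' t * (p t \<bullet> e))"
        using integral_inner_left[of e lebesgue "\<lambda>t. \<xi>' t *\<^sub>R p t"] pi by simp
      have "integrable lebesgue (\<lambda>t. \<xi>' t * (P t \<bullet> e))" using product_primitive(1)[OF \<xi>i(1) Ze] by (simp add: Pe)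
      moreover have "integrable lebesgue (\<lambda>t. \<xi>' t * (p t \<bullet> e))" using integrable_inner_left[OF pi, of e] by simp
      ultimately have "(LINT t|lebesgue. (p t \<bullet> e - P t \<bullet> e) * \<xi>' t) = 0" using zero by (simp add: right_diff_distrib mult.commute)
      moreover have "(\<lambda>t. indicator {0<..<b} t *\<^sub>R ((p t \<bullet> e - P t \<bullet> e) * \<xi>' t)) = (\<lambda>t. (p t \<bullet> e - P t \<bullet> e) * \<xi>' t)"
        using out(2) by (auto simp: indicator_def fun_eq_iff)
      ultimately show "(LINT s|interval_measure_on b. (p s \<bullet> e - P s \<bullet> e) * \<xi>' s) = 0" by (simp add: L2_integral)
    qed
    moreover have "(\<lambda>t. indicator {..0} t *\<^sub>R Z b t) = (\<lambda>t. 0)" by (auto simp: Z_def indicator_def)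
    ultimately have "e \<bullet> e = 0" using p0 by (simp add: P_def e_def inner_diff_left)
    then show ?thesis by (simp add: e_def P_def)
  qed
  define k where "k t = 2 * (z t \<bullet> p t)" for t
  define h where "h s = 2 * (g s * (z s \<bullet> p s)) - \<kappa>\<^sub>1 * (g s * (norm (p s))\<^sup>2)" for s
  have hi: "integrable halfline h" unfolding h_def using pi zp by simp
  then have hl: "integrable lebesgue (\<lambda>s. indicator {0..} s *\<^sub>R h s)" by (simp only: halfline_integrable)
  have kint: "has_bochner_integral lebesgue (\<lambda>t. indicator {0<..b} t *\<^sub>R k t) ((norm (p b))\<^sup>2)" if b: "b \<in> J" for b
  proof -
    have "b \<ge> 0" using b by (simp add: J_def)
    moreover have "(\<lambda>t. indicator {..b} t *\<^sub>R Z b t) = Z b" by (auto simp: Z_def indicator_def)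
    ultimately have pb: "(LINT t|lebesgue. Z b t) = p b" using prim[OF b, of b] by simp
    have e: "(\<lambda>t. Z b t \<bullet> (LINT s|lebesgue. indicator {..t} s *\<^sub>R Z b s)) = (\<lambda>t. indicator {0<..b} t *\<^sub>R (z t \<bullet> p t))"
      "(\<lambda>t. (LINT s|lebesgue. indicator {..t} s *\<^sub>R Z b s) \<bullet> Z b t) = (\<lambda>t. indicator {0<..b} t *\<^sub>R (z t \<bullet> p t))"
      using prim[OF b] by (auto simp: Z_def[of b] indicator_def inner_commute fun_eq_iff)
    note P = product_primitive[OF Zi[OF b] Zi[OF b], unfolded e pb]
    have "(\<lambda>t. indicator {0<..b} t *\<^sub>R k t) = (\<lambda>t. 2 * (indicator {0<..b} t *\<^sub>R (z t \<bullet> p t)))" by (simp add: k_def fun_eq_iff)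
    then show ?thesis using P by (simp add: has_bochner_integral_iff power2_norm_eq_inner)
  qed
  have loc: "0 \<le> (LINT t|lebesgue. indicator {0<..b} t *\<^sub>R h t)" if b: "b \<in> J" for b
  proof -
    have b0: "0 \<le> b" "0 < g b" using b by (auto simp: J_def)
    let ?i = "\<lambda>f t. indicator {0<..b} t *\<^sub>R (f t :: real)"
    have g: "integrable lebesgue (?i g')" "(LINT t|lebesgue. ?i g' t) = g b - g 0" using g_FTC[of 0 b] b0 by auto
    have k: "integrable lebesgue (?i k)" "(LINT t|lebesgue. ?i k t) = (norm (p b))\<^sup>2" using kint[OF b] by (auto simp: has_bochner_integral_iff)
    have le: "(LINT s|lebesgue. indicator {..t} s *\<^sub>R ?i f s) = (LINT s|lebesgue. indicator {0<..t} s *\<^sub>R f s)" if "t \<in> {0<..b}" for t and f :: "real \<Rightarrow> real"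
      by (rule Bochner_Integration.integral_cong) (use that in \<open>auto simp: indicator_def\<close>)
    have e1: "(\<lambda>t. ?i g' t \<bullet> (LINT s|lebesgue. indicator {..t} s *\<^sub>R ?i k s)) = ?i (\<lambda>t. g' t * (norm (p t))\<^sup>2)"
    proof
      fix t show "?i g' t \<bullet> (LINT s|lebesgue. indicator {..t} s *\<^sub>R ?i k s) = ?i (\<lambda>t. g' t * (norm (p t))\<^sup>2) t"
      proof (cases "t \<in> {0<..b}")
        case True
        then have "(LINT s|lebesgue. indicator {..t} s *\<^sub>R ?i k s) = (norm (p t))\<^sup>2"
          unfolding le[OF True] using kint[of t] J_down[OF b, of t] by (auto simp: has_bochner_integral_iff)
        then show ?thesis by simp
      qed simp
    qed
    have e2: "(\<lambda>t. (LINT s|lebesgue. indicator {..t} s *\<^sub>R ?i g' s) \<bullet> ?i k t) = ?i (\<lambda>t. (g t - g 0) * k t)"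
    proof
      fix t show "(LINT s|lebesgue. indicator {..t} s *\<^sub>R ?i g' s) \<bullet> ?i k t = ?i (\<lambda>t. (g t - g 0) * k t) t"
        using le[of t g'] g_FTC(1)[of 0 t] by (cases "t \<in> {0<..b}") auto
    qed
    \<comment> \<open>The primitive of \<open>g'\<close> starting at 0 is \<open>g t - g 0\<close>,
      so the identity first holds with this weight. Adding \<open>g 0\<close> times the integral of
      \<open>k\<close> restores \<open>g\<close> and leaves the boundary term with factor
      \<open>g b\<close>, which is dropped as nonnegative.\<close>
    note P = product_primitive[OF g(1) k(1), unfolded e1 e2 g(2) k(2)]
    have gk: "?i (\<lambda>t. g t * k t) = (\<lambda>t. ?i (\<lambda>t. (g t - g 0) * k t) t + g 0 * ?i k t)" by (auto simp: indicator_def algebra_simps)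
    have gki: "integrable lebesgue (?i (\<lambda>t. g t * k t))" unfolding gk using P(2) k(1) by simp
    have "(LINT t|lebesgue. ?i (\<lambda>t. g t * k t) t) = (LINT t|lebesgue. ?i (\<lambda>t. (g t - g 0) * k t) t) + g 0 * (norm (p b))\<^sup>2"
      unfolding gk using P(2) k by simp
    then have "0 \<le> (LINT t|lebesgue. ?i (\<lambda>t. g' t * (norm (p t))\<^sup>2) t) + (LINT t|lebesgue. ?i (\<lambda>t. g t * k t) t)"
      using P(3) mult_nonneg_nonneg[OF less_imp_le[OF b0(2)] zero_le_power2[of "norm (p b)"]] by (simp add: left_diff_distrib)
    also have "\<dots> = (LINT t|lebesgue. ?i (\<lambda>t. g' t * (norm (p t))\<^sup>2) t + ?i (\<lambda>t. g t * k t) t)" using P(1) gki by simp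
    also have "\<dots> \<le> (LINT t|lebesgue. ?i h t)"
    proof (rule integral_mono)
      have "integrable lebesgue (\<lambda>t. indicator {0<..b} t *\<^sub>R (indicator {0..} t *\<^sub>R h t))" by (rule integrable_mult_indicator[OF _ hl]) simp
      moreover have "(\<lambda>t. indicator {0<..b} t *\<^sub>R (indicator {0..} t *\<^sub>R h t)) = ?i h" by (auto simp: indicator_def)
      ultimately show "integrable lebesgue (?i h)" by simp
      fix t show "?i (\<lambda>t. g' t * (norm (p t))\<^sup>2) t + ?i (\<lambda>t. g t * k t) t \<le> ?i h t"
        using mult_right_mono[OF decay(2)[of t], of "(norm (p t))\<^sup>2"] by (auto simp: indicator_def h_def k_def)
    qed (use P(1) gki in simp)
    finally show ?thesis .
  qed
  obtain b where b: "\<And>n. b n \<in> J" "\<And>t. t \<in> J \<Longrightarrow> \<forall>\<^sub>F n in sequentially. t < b n" using J_exhaustion by blast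
  have "(\<lambda>n. LINT t|lebesgue. indicator {0<..b n} t *\<^sub>R (indicator {0..} t *\<^sub>R h t)) \<longlonglongrightarrow> (LINT t|lebesgue. indicator {0..} t *\<^sub>R h t)"
  proof (rule integral_dominated_convergence)
    show "(\<lambda>t. indicator {0<..b n} t *\<^sub>R (indicator {0..} t *\<^sub>R h t)) \<in> borel_measurable lebesgue" for n
      by (rule borel_measurable_scaleR[OF borel_measurable_indicator borel_measurable_integrable[OF hl]]) simp
    show "integrable lebesgue (\<lambda>t. norm (indicator {0..} t *\<^sub>R h t))" using hl by (rule integrable_norm)
    show "AE t in lebesgue. norm (indicator {0<..b n} t *\<^sub>R (indicator {0..} t *\<^sub>R h t)) \<le> norm (indicator {0..} t *\<^sub>R h t)" for n
      by (rule AE_I2) (auto simp: indicator_def)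
    have "AE t in lebesgue. t \<noteq> (0::real)" by (rule AE_completion) (rule AE_lborel_singleton)
    then show "AE t in lebesgue. (\<lambda>n. indicator {0<..b n} t *\<^sub>R (indicator {0..} t *\<^sub>R h t)) \<longlonglongrightarrow> indicator {0..} t *\<^sub>R h t"
    proof eventually_elim
      case (elim t)
      show ?case
      proof (cases "t \<in> J")
        case True
        then show ?thesis using elim by (intro tendsto_eventually eventually_mono[OF b(2)[OF True]]) (simp add: J_def)
      next
        case False
        then have "indicator {0..} t *\<^sub>R h t = 0" using g_nonneg[of t] by (auto simp: J_def h_def indicator_def)
        then show ?thesis by (simp only: scaleR_zero_right) simp
      qed
    qed
  qed (rule borel_measurable_integrable[OF hl])
  moreover have "(\<lambda>t. indicator {0<..b n} t *\<^sub>R (indicator {0..} t *\<^sub>R h t)) = (\<lambda>t. indicator {0<..b n} t *\<^sub>R h t)" for n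
    by (auto simp: indicator_def)
  ultimately have l: "(\<lambda>n. LINT t|lebesgue. indicator {0<..b n} t *\<^sub>R h t) \<longlonglongrightarrow> (LINT t|lebesgue. indicator {0..} t *\<^sub>R h t)" by (simp only:)
  have "0 \<le> (LINT s|halfline. h s)" unfolding halfline_integral by (rule LIMSEQ_le_const[OF l]) (use loc[OF b(1)] in blast)
  then show ?thesis unfolding h_def using pi zp by simp
qed

end

section \<open>Integrals of functions with values in \<open>H10\<close>\<close>

text \<open>Rests on the completeness of Lebesgue measure: every subset of the exceptional null set
  is measurable.\<close>

lemma measurable_AE_halfline:
  fixes f h :: "real \<Rightarrow> 'a::topological_space"
  assumes f: "f \<in> borel_measurable halfline" and ae: "AE s in halfline. f s = h s"
  shows "h \<in> borel_measurable halfline"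
proof (rule measurableI)
  fix A :: "'a set" assume A: "A \<in> sets borel"
  from ae obtain N where N: "{s \<in> space halfline. f s \<noteq> h s} \<subseteq> N" "emeasure halfline N = 0" "N \<in> sets halfline"
    by (rule AE_E)
  have null: "B \<in> sets halfline" if "B \<subseteq> N" for B
  proof -
    have "N \<in> sets lebesgue" "N \<subseteq> {0..}" using N(3) by (auto simp: sets_restrict_space_iff)
    moreover have "emeasure lebesgue N = 0" using N(2) \<open>N \<subseteq> {0..}\<close> by (simp add: emeasure_restrict_space)
    ultimately have "N \<in> null_sets lebesgue" by (simp add: null_sets_def)
    then have "B \<in> null_sets lebesgue" using that by (metis completion.complete2)
    then show ?thesis using that \<open>N \<subseteq> {0..}\<close> by (auto simp: sets_restrict_space_iff null_setsD2)
  qed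
  have "h -` A \<inter> space halfline = ((f -` A \<inter> space halfline) - N) \<union> (h -` A \<inter> N \<inter> space halfline)"
    using N(1) by auto
  moreover have "f -` A \<inter> space halfline \<in> sets halfline" using f A by (rule measurable_sets)
  ultimately show "h -` A \<inter> space halfline \<in> sets halfline"
    using N(3) null[of "h -` A \<inter> N \<inter> space halfline"] by auto
qed simp

lemma measurable_AE_lim_halfline:
  fixes f :: "nat \<Rightarrow> real \<Rightarrow> 'a::real_normed_vector"
  assumes f: "\<And>n. f n \<in> borel_measurable halfline" and ae: "AE s in halfline. (\<lambda>n. f n s) \<longlonglongrightarrow> h s"
  shows "h \<in> borel_measurable halfline"
proof -
  from ae obtain N where N: "{s \<in> space halfline. \<not> (\<lambda>n. f n s) \<longlonglongrightarrow> h s} \<subseteq> N" "emeasure halfline N = 0" "N \<in> sets halfline"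
    by (rule AE_E)
  define F where "F n s = (if s \<in> N then 0 else f n s)" for n s
  define G where "G s = (if s \<in> N then 0 else h s)" for s
  have "F n \<in> borel_measurable halfline" for n
    unfolding F_def using N(3) f by (intro measurable_If_set) auto
  moreover have "(\<lambda>n. F n s) \<longlonglongrightarrow> G s" if "s \<in> space halfline" for s
    using N(1) that by (cases "s \<in> N") (auto simp: F_def G_def)
  ultimately have "G \<in> borel_measurable halfline" by (rule borel_measurable_LIMSEQ_metric)
  moreover have "AE s in halfline. G s = h s"
    using AE_not_in[of N halfline] N by (auto simp: null_sets_def G_def)
  ultimately show ?thesis by (rule measurable_AE_halfline)
qed

lemma H10_norm_diff: "f \<in> H10 L \<Longrightarrow> g \<in> H10 L \<Longrightarrow> H10_norm L (\<lambda>x. f x - g x) = norm (d L f - d L g)"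
  by (simp add: H10_norm_eq H1_diff H10_H1 d_diff)

lemma d_zero: "d L (\<lambda>x. 0) = 0"
  using d_test_function[OF test_functions_zero, of L] by (simp add: cls_zero)

text \<open>Strong measurability transported to \<open>ltwo\<close> by \<open>d L\<close>, which
  carries \<open>H10_norm\<close> to the norm.\<close>

definition simple_approx :: "real \<Rightarrow> (real \<Rightarrow> real \<Rightarrow> complex) \<Rightarrow> (nat \<Rightarrow> real \<Rightarrow> real \<Rightarrow> complex) \<Rightarrow> bool" where
  "simple_approx L F S \<longleftrightarrow> (\<forall>n. simple_function halfline (S n) \<and> (\<forall>s\<ge>0. S n s \<in> H10 L)) \<and>
     (AE s in halfline. (\<lambda>n. d L (S n s)) \<longlonglongrightarrow> d L (F s))"

lemma strongly_measurable_iff: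
  "strongly_measurable L F \<longleftrightarrow> (AE s in halfline. F s \<in> H10 L) \<and> (\<exists>S. simple_approx L F S)"
proof -
  have eq: "(AE s in halfline. (\<lambda>n. H10_norm L (\<lambda>x. F s x - S n s x)) \<longlonglongrightarrow> 0) \<longleftrightarrow> (AE s in halfline. (\<lambda>n. d L (S n s)) \<longlonglongrightarrow> d L (F s))"
    if F: "AE s in halfline. F s \<in> H10 L" and S: "\<forall>n. simple_function halfline (S n) \<and> (\<forall>s\<ge>0. S n s \<in> H10 L)" for S :: "nat \<Rightarrow> real \<Rightarrow> real \<Rightarrow> complex"
  proof -
    have "AE s in halfline. (\<lambda>n. H10_norm L (\<lambda>x. F s x - S n s x)) \<longlonglongrightarrow> 0 \<longleftrightarrow> (\<lambda>n. d L (S n s)) \<longlonglongrightarrow> d L (F s)"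
      using F AE_space
    proof eventually_elim
      case (elim s)
      then have "(\<lambda>n. H10_norm L (\<lambda>x. F s x - S n s x)) = (\<lambda>n. norm (d L (S n s) - d L (F s)))"
        using S by (auto simp: H10_norm_diff norm_minus_commute space_restrict_space)
      then show ?case by (simp add: tendsto_norm_zero_iff LIM_zero_iff)
    qed
    then show ?thesis by (rule eventually_subst)
  qed
  show ?thesis
    unfolding strongly_measurable_def simple_approx_def
  proof (rule conj_cong[OF refl], rule ex_cong1, rule conj_cong[OF refl])
    fix S :: "nat \<Rightarrow> real \<Rightarrow> real \<Rightarrow> complex"
    assume "AE s in halfline. F s \<in> H10 L" "\<forall>n. simple_function halfline (S n) \<and> (\<forall>s\<ge>0. S n s \<in> H10 L)"
    then show "(AE s in halfline. (\<lambda>n. H10_norm L (\<lambda>x. F s x - S n s x)) \<longlonglongrightarrow> 0) = (AE s in halfline. (\<lambda>n. d L (S n s)) \<longlonglongrightarrow> d L (F s))"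
      by (rule eq)
  qed
qed

lemma simple_measurable_d: "simple_function halfline S \<Longrightarrow> (\<lambda>s. d L (S s)) \<in> borel_measurable halfline"
  by (rule borel_measurable_simple_function[OF simple_function_compose1[where g = "d L"]])

lemma strongly_measurable_d: "strongly_measurable L F \<Longrightarrow> (\<lambda>s. d L (F s)) \<in> borel_measurable halfline"
proof -
  assume "strongly_measurable L F"
  then obtain S where S: "simple_approx L F S" by (auto simp: strongly_measurable_iff)
  then have S': "AE s in halfline. (\<lambda>n. d L (S n s)) \<longlonglongrightarrow> d L (F s)" "\<And>n. simple_function halfline (S n)"
    by (auto simp: simple_approx_def)
  show ?thesis by (rule measurable_AE_lim_halfline[OF simple_measurable_d[OF S'(2)] S'(1)])
qed

lemma strongly_measurable_AE: "strongly_measurable L F \<Longrightarrow> AE s in halfline. F s \<in> H10 L"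
  by (simp add: strongly_measurable_def)

lemma strongly_measurable_add:
  assumes "strongly_measurable L F" "strongly_measurable L G"
  shows "strongly_measurable L (\<lambda>s x. F s x + G s x)"
proof -
  from assms obtain S T where S: "simple_approx L F S" and T: "simple_approx L G T"
    and ae: "AE s in halfline. F s \<in> H10 L" "AE s in halfline. G s \<in> H10 L"
    by (auto simp: strongly_measurable_iff)
  have "simple_approx L (\<lambda>s x. F s x + G s x) (\<lambda>n s x. S n s x + T n s x)"
    unfolding simple_approx_def
  proof (intro conjI allI impI)
    show "simple_function halfline (\<lambda>s x. S n s x + T n s x)" for n
      using S T by (intro simple_function_compose2[where h = "\<lambda>f g x. f x + g x"]) (auto simp: simple_approx_def)
    show "(\<lambda>x. S n s x + T n s x) \<in> H10 L" if "s \<ge> 0" for n s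
      using S T that by (intro H10_add) (auto simp: simple_approx_def)
    have "AE s in halfline. (\<lambda>n. d L (S n s)) \<longlonglongrightarrow> d L (F s)" "AE s in halfline. (\<lambda>n. d L (T n s)) \<longlonglongrightarrow> d L (G s)"
      using S T by (auto simp: simple_approx_def)
    then show "AE s in halfline. (\<lambda>n. d L (\<lambda>x. S n s x + T n s x)) \<longlonglongrightarrow> d L (\<lambda>x. F s x + G s x)"
      using ae AE_space
    proof eventually_elim
      case (elim s)
      then have "d L (\<lambda>x. S n s x + T n s x) = d L (S n s) + d L (T n s)" for n
        using S T by (intro d_add) (auto simp: simple_approx_def space_restrict_space H10_H1)
      then show ?case using tendsto_add[OF elim(1,2)] elim by (simp add: d_add H10_H1)
    qed
  qed
  moreover have "AE s in halfline. (\<lambda>x. F s x + G s x) \<in> H10 L"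
    using ae by eventually_elim (rule H10_add)
  ultimately show ?thesis unfolding strongly_measurable_iff by blast
qed

lemma strongly_measurable_mult:
  assumes k: "k \<in> borel_measurable halfline" and F: "strongly_measurable L F"
  shows "strongly_measurable L (\<lambda>s x. of_real (k s) * F s x)"
proof -
  from F obtain S where S: "simple_approx L F S" and ae: "AE s in halfline. F s \<in> H10 L"
    by (auto simp: strongly_measurable_iff)
  from borel_measurable_implies_sequence_metric[OF k, of 0] obtain K :: "nat \<Rightarrow> real \<Rightarrow> real" where
    K: "\<And>n. simple_function halfline (K n)" "\<And>s. s \<in> space halfline \<Longrightarrow> (\<lambda>n. K n s) \<longlonglongrightarrow> k s" by blast
  have "simple_approx L (\<lambda>s x. of_real (k s) * F s x) (\<lambda>n s x. of_real (K n s) * S n s x)"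
    unfolding simple_approx_def
  proof (intro conjI allI impI)
    show "simple_function halfline (\<lambda>s x. of_real (K n s) * S n s x)" for n
      using S K by (intro simple_function_compose2[where h = "\<lambda>c g x. of_real c * g x"]) (auto simp: simple_approx_def)
    show "(\<lambda>x. of_real (K n s) * S n s x) \<in> H10 L" if "s \<ge> 0" for n s
      using S that by (intro H10_cmult) (auto simp: simple_approx_def)
    have "AE s in halfline. (\<lambda>n. d L (S n s)) \<longlonglongrightarrow> d L (F s)"
      using S by (auto simp: simple_approx_def)
    then show "AE s in halfline. (\<lambda>n. d L (\<lambda>x. of_real (K n s) * S n s x)) \<longlonglongrightarrow> d L (\<lambda>x. of_real (k s) * F s x)"
      using ae AE_space
    proof eventually_elim
      case (elim s)
      then have "d L (\<lambda>x. of_real (K n s) * S n s x) = K n s *\<^sub>R d L (S n s)" for n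
        using S by (intro d_cmult) (auto simp: simple_approx_def space_restrict_space H10_H1)
      then show ?case using tendsto_scaleR[OF K(2)[OF elim(3)] elim(1)] elim by (simp add: d_cmult H10_H1)
    qed
  qed
  moreover have "AE s in halfline. (\<lambda>x. of_real (k s) * F s x) \<in> H10 L"
    using ae by eventually_elim (rule H10_cmult)
  ultimately show ?thesis unfolding strongly_measurable_iff by blast
qed

lemma strongly_measurable_const: "y \<in> H10 L \<Longrightarrow> strongly_measurable L (\<lambda>s. y)"
  unfolding strongly_measurable_iff simple_approx_def by (auto intro!: exI[of _ "\<lambda>n s. y"])

lemma strongly_measurable_AE_cong:
  assumes F: "strongly_measurable L F" and G: "AE s in halfline. G s \<in> H10 L" and eq: "AE s in halfline. d L (F s) = d L (G s)"
  shows "strongly_measurable L G"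
proof -
  from F obtain S where S: "simple_approx L F S" by (auto simp: strongly_measurable_iff)
  then have "simple_approx L G S" using eq unfolding simple_approx_def by auto
  then show ?thesis using G unfolding strongly_measurable_iff by blast
qed

text \<open>Discarding the values of norm more than twice the limit makes the convergence dominated.
  Values of norm zero are discarded too, so that the approximants have support of finite measure.\<close>

definition truncate :: "real \<Rightarrow> (real \<Rightarrow> real \<Rightarrow> complex) \<Rightarrow> (real \<Rightarrow> real \<Rightarrow> complex) \<Rightarrow> real \<Rightarrow> real \<Rightarrow> complex" where
  "truncate L F S s = (if norm (d L (S s)) \<le> 2 * norm (d L (F s)) \<and> d L (S s) \<noteq> 0 then S s else (\<lambda>x. 0))"

lemma truncated_approx:
  assumes F: "strongly_measurable L F"
  obtains S where "simple_approx L F S" "\<And>n s. norm (d L (S n s)) \<le> 2 * norm (d L (F s))"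
    "\<And>n s. S n s \<noteq> (\<lambda>x. 0) \<Longrightarrow> d L (S n s) \<noteq> 0"
proof -
  from F obtain S where S: "simple_approx L F S" by (auto simp: strongly_measurable_iff)
  note Fm[measurable] = strongly_measurable_d[OF F]
  have "simple_approx L F (\<lambda>n. truncate L F (S n))"
    unfolding simple_approx_def
  proof (intro conjI allI impI)
    fix n
    have Sn: "simple_function halfline (S n)" using S by (simp add: simple_approx_def)
    note Sm[measurable] = simple_measurable_d[OF Sn]
    show "simple_function halfline (truncate L F (S n))"
      unfolding truncate_def
      by (rule simple_function_If[OF Sn]) (simp, measurable)
    show "truncate L F (S n) s \<in> H10 L" if "s \<ge> 0" for s
      using S that by (auto simp: truncate_def simple_approx_def H10_zero)
  next
    have "AE s in halfline. (\<lambda>n. d L (S n s)) \<longlonglongrightarrow> d L (F s)" using S by (simp add: simple_approx_def)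
    then show "AE s in halfline. (\<lambda>n. d L (truncate L F (S n) s)) \<longlonglongrightarrow> d L (F s)"
    proof eventually_elim
      case (elim s)
      show ?case
      proof (cases "d L (F s) = 0")
        case True
        then show ?thesis by (auto simp: truncate_def d_zero)
      next
        case False
        have n: "(\<lambda>n. norm (d L (S n s))) \<longlonglongrightarrow> norm (d L (F s))" using elim by (rule tendsto_norm)
        have "\<forall>\<^sub>F n in sequentially. norm (d L (S n s)) < 2 * norm (d L (F s))"
          using False by (intro order_tendstoD(2)[OF n]) simp
        moreover have "\<forall>\<^sub>F n in sequentially. 0 < norm (d L (S n s))"
          using False by (intro order_tendstoD(1)[OF n]) simp
        ultimately have "\<forall>\<^sub>F n in sequentially. d L (S n s) = d L (truncate L F (S n) s)"
          by eventually_elim (simp add: truncate_def)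
        then show ?thesis by (rule Lim_transform_eventually[OF elim])
      qed
    qed
  qed
  then show thesis
    by (rule that) (auto simp: truncate_def d_zero)
qed

lemma d_sum:
  assumes "finite A" "\<And>y. y \<in> A \<Longrightarrow> f y \<in> H10 L"
  shows "(\<lambda>x. \<Sum>y\<in>A. f y x) \<in> H10 L" "d L (\<lambda>x. \<Sum>y\<in>A. f y x) = (\<Sum>y\<in>A. d L (f y))"
proof -
  have "(\<lambda>x. \<Sum>y\<in>A. f y x) \<in> H10 L \<and> d L (\<lambda>x. \<Sum>y\<in>A. f y x) = (\<Sum>y\<in>A. d L (f y))"
    using assms by (induction) (auto simp: H10_zero d_zero H10_add d_add H10_H1)
  then show "(\<lambda>x. \<Sum>y\<in>A. f y x) \<in> H10 L" "d L (\<lambda>x. \<Sum>y\<in>A. f y x) = (\<Sum>y\<in>A. d L (f y))" by auto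
qed

text \<open>\<open>d L\<close> is real-linear on \<open>H10 L\<close>, so it turns the sum over the
  values of \<open>S\<close> into the simple Bochner integral. Different values of \<open>S\<close>
  may have the same class, so the integral is regrouped by the values of \<open>S\<close>.\<close>

lemma simple_integral_d:
  assumes S: "simple_function halfline S" "\<And>s. s \<ge> 0 \<Longrightarrow> S s \<in> H10 L"
    and fin: "emeasure halfline {s \<in> {0..}. S s \<noteq> (\<lambda>x. 0)} \<noteq> \<infinity>"
  shows "Bochner_Integration.simple_bochner_integrable halfline (\<lambda>s. d L (S s))"
    "simple_integral_H10 S \<in> H10 L"
    "d L (simple_integral_H10 S) = Bochner_Integration.simple_bochner_integral halfline (\<lambda>s. d L (S s))"
proof -
  have sp: "space halfline = {0..}" by (simp add: space_restrict_space)
  have fin2: "finite (S ` {0..})" using S(1) sp by (simp add: simple_function_def)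
  show i: "Bochner_Integration.simple_bochner_integrable halfline (\<lambda>s. d L (S s))"
  proof (rule simple_bochner_integrable.intros)
    show "simple_function halfline (\<lambda>s. d L (S s))" using S(1) by (rule simple_function_compose1)
    have "{s \<in> {0..}. S s \<noteq> (\<lambda>x. 0)} = S -` {f. f \<noteq> (\<lambda>x. 0)} \<inter> space halfline" by (auto simp: sp)
    then have "{s \<in> {0..}. S s \<noteq> (\<lambda>x. 0)} \<in> sets halfline"
      by (simp only: simple_functionD(2)[OF S(1)])
    then have "emeasure halfline {s \<in> space halfline. d L (S s) \<noteq> 0} \<le> emeasure halfline {s \<in> {0..}. S s \<noteq> (\<lambda>x. 0)}"
      by (intro emeasure_mono) (auto simp: sp d_zero)
    then show "emeasure halfline {s \<in> space halfline. d L (S s) \<noteq> 0} \<noteq> \<infinity>" using fin by (auto simp: top_unique)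
  qed
  have mem: "(\<lambda>x. of_real (measure halfline {s \<in> {0..}. S s = y}) * y x) \<in> H10 L" if "y \<in> S ` {0..}" for y
    using that S(2) by (auto intro: H10_cmult)
  show "simple_integral_H10 S \<in> H10 L"
    unfolding simple_integral_H10_def by (rule d_sum(1)[OF fin2]) (rule mem)
  have "d L (simple_integral_H10 S) = (\<Sum>y\<in>S ` {0..}. measure halfline {s \<in> {0..}. S s = y} *\<^sub>R d L y)"
  proof -
    have "d L (simple_integral_H10 S) = (\<Sum>y\<in>S ` {0..}. d L (\<lambda>x. of_real (measure halfline {s \<in> {0..}. S s = y}) * y x))"
      unfolding simple_integral_H10_def by (rule d_sum(2)[OF fin2]) (rule mem)
    also have "\<dots> = (\<Sum>y\<in>S ` {0..}. measure halfline {s \<in> {0..}. S s = y} *\<^sub>R d L y)"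
      by (rule sum.cong[OF refl], rule d_cmult) (use S(2) H10_H1 in auto)
    finally show ?thesis .
  qed
  also have "\<dots> = Bochner_Integration.simple_bochner_integral halfline (\<lambda>s. d L (S s))"
    using simple_bochner_integral_partition[OF i S(1), of "d L"] by (simp add: sp)
  finally show "d L (simple_integral_H10 S) = Bochner_Integration.simple_bochner_integral halfline (\<lambda>s. d L (S s))" .
qed

text \<open>Through \<open>d L\<close> the simple functions of the definition serve as approximants
  of the Bochner integral in \<open>ltwo\<close>, from which uniqueness and additivity are then
  inherited.\<close>

lemma has_integral_H10_bochner:
  assumes "has_integral_H10 L F w"
  shows "has_bochner_integral halfline (\<lambda>s. d L (F s)) (d L w)"
proof -
  from assms obtain S where F: "strongly_measurable L F" and w: "w \<in> H10 L"
    and S: "\<And>n. simple_function halfline (S n)" "\<And>n s. s \<ge> 0 \<Longrightarrow> S n s \<in> H10 L"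
      "\<And>n. emeasure halfline {s \<in> {0..}. S n s \<noteq> (\<lambda>x. 0)} \<noteq> \<infinity>"
    and l1: "(\<lambda>n. \<integral>\<^sup>+ s. ennreal (H10_norm L (\<lambda>x. F s x - S n s x)) \<partial>halfline) \<longlonglongrightarrow> 0"
    and l2: "(\<lambda>n. H10_norm L (\<lambda>x. simple_integral_H10 (S n) x - w x)) \<longlonglongrightarrow> 0"
    unfolding has_integral_H10_def by blast
  note SI = simple_integral_d[OF S]
  show ?thesis
  proof (rule has_bochner_integral.intros)
    show "(\<lambda>s. d L (F s)) \<in> borel_measurable halfline" by (rule strongly_measurable_d[OF F])
    show "Bochner_Integration.simple_bochner_integrable halfline (\<lambda>s. d L (S i s))" for i by (rule SI(1))
    have "(\<integral>\<^sup>+ s. ennreal (H10_norm L (\<lambda>x. F s x - S n s x)) \<partial>halfline) = (\<integral>\<^sup>+ s. ennreal (norm (d L (F s) - d L (S n s))) \<partial>halfline)" for n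
    proof (rule nn_integral_cong_AE)
      show "AE s in halfline. ennreal (H10_norm L (\<lambda>x. F s x - S n s x)) = ennreal (norm (d L (F s) - d L (S n s)))"
        using strongly_measurable_AE[OF F] AE_space
        by eventually_elim (use S(2) in \<open>auto simp: H10_norm_diff space_restrict_space\<close>)
    qed
    then show "(\<lambda>i. \<integral>\<^sup>+ s. ennreal (norm (d L (F s) - d L (S i s))) \<partial>halfline) \<longlonglongrightarrow> 0" using l1 by simp
    have "(\<lambda>n. norm (Bochner_Integration.simple_bochner_integral halfline (\<lambda>s. d L (S n s)) - d L w)) \<longlonglongrightarrow> 0"
      using l2 by (simp add: H10_norm_diff SI(2) w SI(3))
    then show "(\<lambda>i. Bochner_Integration.simple_bochner_integral halfline (\<lambda>s. d L (S i s))) \<longlonglongrightarrow> d L w"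
      by (simp add: tendsto_norm_zero_iff LIM_zero_iff)
  qed
qed

lemma bochner_approx_H10:
  assumes F: "strongly_measurable L F" and i: "integrable halfline (\<lambda>s. d L (F s))"
  obtains S where "\<And>n. simple_function halfline (S n)" "\<And>n s. s \<ge> 0 \<Longrightarrow> S n s \<in> H10 L"
    "\<And>n::nat. emeasure halfline {s \<in> {0..}. S n s \<noteq> (\<lambda>x. 0)} \<noteq> \<infinity>"
    "(\<lambda>n. \<integral>\<^sup>+ s. ennreal (norm (d L (F s) - d L (S n s))) \<partial>halfline) \<longlonglongrightarrow> 0"
    "(\<lambda>n. d L (simple_integral_H10 (S n))) \<longlonglongrightarrow> (LINT s|halfline. d L (F s))"
proof -
  obtain S where S: "simple_approx L F S" "\<And>n s. norm (d L (S n s)) \<le> 2 * norm (d L (F s))"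
    "\<And>n s. S n s \<noteq> (\<lambda>x. 0) \<Longrightarrow> d L (S n s) \<noteq> 0"
    using truncated_approx[OF F] by blast
  have S1: "simple_function halfline (S n)" "s \<ge> 0 \<Longrightarrow> S n s \<in> H10 L" for n s
    using S(1) by (auto simp: simple_approx_def)
  have lim: "AE s in halfline. (\<lambda>n. d L (S n s)) \<longlonglongrightarrow> d L (F s)" using S(1) by (auto simp: simple_approx_def)
  have Fi: "(\<integral>\<^sup>+ s. ennreal (2 * norm (d L (F s))) \<partial>halfline) < \<infinity>"
    using integrable_norm[OF i] by (simp add: ennreal_mult nn_integral_cmult nn_integral_eq_integral ennreal_mult_less_top)
  have fin: "emeasure halfline {s \<in> {0..}. S n s \<noteq> (\<lambda>x. 0)} \<noteq> \<infinity>" for n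
  proof -
    have "(\<integral>\<^sup>+ s. ennreal (norm (d L (S n s))) \<partial>halfline) \<le> (\<integral>\<^sup>+ s. ennreal (2 * norm (d L (F s))) \<partial>halfline)"
      by (intro nn_integral_mono ennreal_leI S(2))
    also note Fi
    finally have "Bochner_Integration.simple_bochner_integrable halfline (\<lambda>s. d L (S n s))"
      by (rule simple_bochner_integrableI_bounded[OF simple_function_compose1[OF S1(1)]])
    then have "emeasure halfline {s \<in> space halfline. d L (S n s) \<noteq> 0} \<noteq> \<infinity>"
      by (rule simple_bochner_integrable.cases)
    moreover have "{s \<in> space halfline. d L (S n s) \<noteq> 0} = {s \<in> {0..}. S n s \<noteq> (\<lambda>x. 0)}"
      using S(3) by (auto simp: space_restrict_space d_zero)
    ultimately show ?thesis by simp
  qed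
  note SI = simple_integral_d[OF S1 fin]
  have "(\<lambda>n. \<integral>\<^sup>+ s. ennreal (norm (d L (F s) - d L (S n s))) \<partial>halfline) \<longlonglongrightarrow> 0"
  proof (rule nn_integral_dominated_convergence_norm[OF _ _ _ _ Fi lim])
    show "AE s in halfline. norm (d L (S j s)) \<le> 2 * norm (d L (F s))" for j using S(2) by simp
  qed (use i simple_measurable_d[OF S1(1)] in auto)
  moreover have "(\<lambda>n. LINT s|halfline. d L (S n s)) \<longlonglongrightarrow> (LINT s|halfline. d L (F s))"
  proof (rule integral_dominated_convergence[OF _ _ _ lim])
    show "integrable halfline (\<lambda>s. 2 * norm (d L (F s)))" using i by simp
    show "AE s in halfline. norm (d L (S j s)) \<le> 2 * norm (d L (F s))" for j using S(2) by simp
  qed (use i simple_measurable_d[OF S1(1)] in auto)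
  then have "(\<lambda>n. d L (simple_integral_H10 (S n))) \<longlonglongrightarrow> (LINT s|halfline. d L (F s))"
    using SI by (simp add: simple_bochner_integrable_eq_integral)
  ultimately show thesis using that S1 fin by blast
qed

lemma has_integral_H10I:
  assumes F: "strongly_measurable L F" and i: "integrable halfline (\<lambda>s. d L (F s))"
    and w: "w \<in> H10 L" "d L w = (LINT s|halfline. d L (F s))"
  shows "has_integral_H10 L F w"
proof -
  obtain S where S: "\<And>n. simple_function halfline (S n)" "\<And>n s. s \<ge> 0 \<Longrightarrow> S n s \<in> H10 L"
    "\<And>n::nat. emeasure halfline {s \<in> {0..}. S n s \<noteq> (\<lambda>x. 0)} \<noteq> \<infinity>"
    "(\<lambda>n. \<integral>\<^sup>+ s. ennreal (norm (d L (F s) - d L (S n s))) \<partial>halfline) \<longlonglongrightarrow> 0"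
    "(\<lambda>n. d L (simple_integral_H10 (S n))) \<longlonglongrightarrow> (LINT s|halfline. d L (F s))"
    using bochner_approx_H10[OF F i] by blast
  note SI = simple_integral_d[OF S(1,2,3)]
  have "(\<integral>\<^sup>+ s. ennreal (H10_norm L (\<lambda>x. F s x - S n s x)) \<partial>halfline) = (\<integral>\<^sup>+ s. ennreal (norm (d L (F s) - d L (S n s))) \<partial>halfline)" for n
  proof (rule nn_integral_cong_AE)
    show "AE s in halfline. ennreal (H10_norm L (\<lambda>x. F s x - S n s x)) = ennreal (norm (d L (F s) - d L (S n s)))"
      using strongly_measurable_AE[OF F] AE_space
      by eventually_elim (use S(2) in \<open>auto simp: H10_norm_diff space_restrict_space\<close>)
  qed
  then have l1: "(\<lambda>n. \<integral>\<^sup>+ s. ennreal (H10_norm L (\<lambda>x. F s x - S n s x)) \<partial>halfline) \<longlonglongrightarrow> 0" using S(4) by simp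
  have "(\<lambda>n. H10_norm L (\<lambda>x. simple_integral_H10 (S n) x - w x)) = (\<lambda>n. norm (d L (simple_integral_H10 (S n)) - (LINT s|halfline. d L (F s))))"
    by (simp add: H10_norm_diff SI(2) w)
  moreover have "(\<lambda>n. norm (d L (simple_integral_H10 (S n)) - (LINT s|halfline. d L (F s)))) \<longlonglongrightarrow> 0"
    using S(5) by (simp add: tendsto_norm_zero_iff LIM_zero_iff)
  ultimately have l2: "(\<lambda>n. H10_norm L (\<lambda>x. simple_integral_H10 (S n) x - w x)) \<longlonglongrightarrow> 0" by simp
  show ?thesis
    unfolding has_integral_H10_def using F w(1) S(1,2,3) l1 l2 by blast
qed

text \<open>Existence justifies the choice in \<open>integral_H10\<close>: the integrals of the
  simple approximants converge in derivative, and \<open>H10 L\<close> is closed under such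
  limits.\<close>

lemma integral_H10:
  assumes F: "strongly_measurable L F" and i: "integrable halfline (\<lambda>s. d L (F s))"
  shows "integral_H10 L F \<in> H10 L" "d L (integral_H10 L F) = (LINT s|halfline. d L (F s))"
proof -
  obtain S where S: "\<And>n. simple_function halfline (S n)" "\<And>n s. s \<ge> 0 \<Longrightarrow> S n s \<in> H10 L"
    "\<And>n::nat. emeasure halfline {s \<in> {0..}. S n s \<noteq> (\<lambda>x. 0)} \<noteq> \<infinity>"
    "(\<lambda>n. \<integral>\<^sup>+ s. ennreal (norm (d L (F s) - d L (S n s))) \<partial>halfline) \<longlonglongrightarrow> 0"
    "(\<lambda>n. d L (simple_integral_H10 (S n))) \<longlonglongrightarrow> (LINT s|halfline. d L (F s))"
    using bochner_approx_H10[OF F i] by blast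
  obtain w where "w \<in> H10 L" "d L w = (LINT s|halfline. d L (F s))"
    using H10_graph_closed[of "\<lambda>n. simple_integral_H10 (S n)", OF simple_integral_d(2)[OF S(1,2,3)] S(5)] by blast
  then have "has_integral_H10 L F w" using has_integral_H10I[OF F i] by blast
  then have "has_integral_H10 L F (integral_H10 L F)" unfolding integral_H10_def by (rule someI[of "has_integral_H10 L F"])
  then show "integral_H10 L F \<in> H10 L" by (simp add: has_integral_H10_def)
  show "d L (integral_H10 L F) = (LINT s|halfline. d L (F s))"
    by (rule has_bochner_integral_integral_eq[OF has_integral_H10_bochner, symmetric]) fact
qed

section \<open>Lyapunov forms for semigroups\<close>

text \<open>No bound on the semigroup that is locally uniform in \<open>t\<close> is assumed.  Nested intervals give an orbit a
  point of two-sided continuity between any two times, and the semigroup law propagates it to all later times.\<close>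

lemma continuity_point:
  fixes dd :: "real \<Rightarrow> real \<Rightarrow> real"
  assumes tri: "\<And>r s t. dd r t \<le> dd r s + dd s t" and sym: "\<And>s t. dd s t = dd t s"
    and rc: "\<And>t e. t \<ge> 0 \<Longrightarrow> e > 0 \<Longrightarrow> \<exists>\<delta>>0. \<forall>s. t \<le> s \<and> s < t + \<delta> \<longrightarrow> dd s t < e"
    and ab: "0 \<le> a" "a < b"
  obtains t where "a < t" "t < b" "\<And>e. e > 0 \<Longrightarrow> \<exists>\<delta>>0. \<forall>s. \<bar>s - t\<bar> < \<delta> \<longrightarrow> dd s t < e"
proof -
  define P where "P = (\<lambda>(n::nat) x::real \<times> real. a \<le> fst x \<and> fst x < snd x \<and> snd x \<le> b)"
  \<comment> \<open>Each closed interval lies in the interior of the preceding one, so the common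
    point is interior to all of them and continuity there is two-sided.\<close>
  define Q where "Q = (\<lambda>(n::nat) x y::real \<times> real. fst x < fst y \<and> snd y < snd x \<and>
     (\<forall>s s'. fst y \<le> s \<and> s \<le> snd y \<and> fst y \<le> s' \<and> s' \<le> snd y \<longrightarrow> dd s s' < 1 / real (Suc n)))"
  have "\<exists>f. \<forall>n. P n (f n) \<and> Q n (f n) (f (Suc n))"
  proof (rule dependent_nat_choice)
    show "\<exists>x. P 0 x" using ab by (intro exI[of _ "(a, b)"]) (auto simp: P_def)
    fix x n assume x: "P n x"
    let ?e = "1 / real (Suc n)"
    \<comment> \<open>Right continuity is applied at \<open>p\<close>, an interior point of the old
      interval; the new one is [p,q] with \<open>q\<close> close enough to \<open>p\<close>.\<close>
    define p where "p = (2 * fst x + snd x) / 3"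
    have p: "fst x < p" "p < snd x" "0 \<le> p" using x ab by (auto simp: p_def P_def field_simps)
    obtain \<delta> where \<delta>: "\<delta> > 0" "\<And>s. p \<le> s \<Longrightarrow> s < p + \<delta> \<Longrightarrow> dd s p < ?e / 2"
      using rc[OF p(3), of "?e / 2"] by auto
    define q where "q = min (p + \<delta> / 2) ((p + snd x) / 2)"
    have q: "p < q" "q < snd x" "q < p + \<delta>" using p \<delta> by (auto simp: q_def min_def field_simps)
    have "dd s s' < ?e" if "p \<le> s" "s \<le> q" "p \<le> s'" "s' \<le> q" for s s'
    proof -
      have "dd s p < ?e / 2" "dd s' p < ?e / 2" using \<delta>(2) that q by auto
      then show ?thesis using tri[of s s' p] sym[of p s'] by linarith
    qed
    then show "\<exists>y. P (Suc n) y \<and> Q n x y"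
      using p q x by (intro exI[of _ "(p, q)"]) (auto simp: P_def Q_def)
  qed
  then obtain f where f: "\<And>n. P n (f n)" "\<And>n. Q n (f n) (f (Suc n))" by blast
  have inc: "strict_mono (\<lambda>n. fst (f n))" and dec: "strict_mono (\<lambda>n. - snd (f n))"
    using f(2) by (auto intro!: strict_monoI_Suc simp: Q_def)
  have le: "fst (f m) < snd (f n)" for m n
  proof -
    let ?k = "max m n"
    have "fst (f m) \<le> fst (f ?k)" "snd (f ?k) \<le> snd (f n)"
      using strict_mono_less_eq[OF inc, of m ?k] strict_mono_less_eq[OF dec, of n ?k] by auto
    then show ?thesis using f(1)[of ?k] by (auto simp: P_def)
  qed
  define t where "t = (SUP n. fst (f n))"
  have bdd: "bdd_above (range (\<lambda>n. fst (f n)))" using le[of _ 0] by (auto intro!: bdd_aboveI[of _ "snd (f 0)"] less_imp_le)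
  have t1: "fst (f n) < t" for n
  proof -
    have "fst (f n) < fst (f (Suc n))" using inc by (simp add: strict_mono_Suc_iff)
    also have "\<dots> \<le> t" unfolding t_def by (rule cSUP_upper[OF _ bdd]) simp
    finally show ?thesis .
  qed
  have t2: "t < snd (f n)" for n
  proof -
    have "t \<le> snd (f (Suc n))" unfolding t_def using le by (intro cSUP_least) (auto intro: less_imp_le)
    also have "\<dots> < snd (f n)" using dec by (simp add: strict_mono_Suc_iff)
    finally show ?thesis .
  qed
  show thesis
  proof (rule that[of t])
    show "a < t" "t < b" using t1[of 0] t2[of 0] f(1)[of 0] by (auto simp: P_def)
    fix e :: real assume e: "e > 0"
    obtain n where n: "1 / real (Suc n) < e" using nat_approx_posE[OF e] by blast
    let ?\<delta> = "min (t - fst (f (Suc n))) (snd (f (Suc n)) - t)"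
    have "dd s t < e" if "\<bar>s - t\<bar> < ?\<delta>" for s
    proof -
      have "fst (f (Suc n)) \<le> s" "s \<le> snd (f (Suc n))" using that by linarith+
      then have "dd s t < 1 / real (Suc n)"
        using f(2)[of n] t1[of "Suc n"] t2[of "Suc n"] unfolding Q_def by (auto simp: less_imp_le simp del: of_nat_Suc)
      then show ?thesis using n by simp
    qed
    then show "\<exists>\<delta>>0. \<forall>s. \<bar>s - t\<bar> < \<delta> \<longrightarrow> dd s t < e"
      using t1[of "Suc n"] t2[of "Suc n"] by (intro exI[of _ ?\<delta>]) auto
  qed
qed

text \<open>Only right derivatives are at hand, which excludes the mean value theorem. The bound
  \<open>G y \<le> G 0 + e * y\<close> with slack \<open>e\<close> reaches the supremum of its range
  by continuity and passes beyond it because the right derivative is below \<open>e\<close>.\<close>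

lemma right_derivative_nonincreasing:
  fixes G G' :: "real \<Rightarrow> real"
  assumes cont: "continuous_on {0..} G"
    and der: "\<And>t. t \<ge> 0 \<Longrightarrow> ((\<lambda>h. (G (t + h) - G t) / h) \<longlongrightarrow> G' t) (at_right 0)"
    and le: "\<And>t. t \<ge> 0 \<Longrightarrow> G' t \<le> 0" and b: "0 \<le> b"
  shows "G b \<le> G 0"
proof -
  have *: "G b \<le> G 0 + e * b" if e: "e > 0" for e
  proof -
    define E where "E = {x \<in> {0..b}. \<forall>y\<in>{0..x}. G y \<le> G 0 + e * y}"
    have 0: "0 \<in> E" using b by (simp add: E_def)
    have bdd: "bdd_above E" by (auto simp: E_def intro!: bdd_aboveI[of _ b])
    define m where "m = Sup E"
    have mb: "0 \<le> m" "m \<le> b" 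
    proof -
      show "0 \<le> m" unfolding m_def by (rule cSup_upper[OF 0 bdd])
      show "m \<le> b" unfolding m_def using 0 by (intro cSup_least) (auto simp: E_def)
    qed
    have below: "G y \<le> G 0 + e * y" if "0 \<le> y" "y < m" for y
    proof -
      obtain x where "x \<in> E" "y < x" using \<open>y < m\<close> 0 less_cSupD[of E y] unfolding m_def by blast
      then show ?thesis using that by (auto simp: E_def)
    qed
    have mE: "G m \<le> G 0 + e * m"
    proof (cases "m = 0")
      case False
      then have m: "m > 0" using mb by simp
      have "(G \<longlongrightarrow> G m) (at m within {0..})" using cont mb by (auto simp: continuous_on_def)
      then have "(G \<longlongrightarrow> G m) (at m within {0..m})" by (rule tendsto_within_subset) simp
      then have "(G \<longlongrightarrow> G m) (at_left m)" by (simp only: at_within_Icc_at_left[OF m])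
      moreover have "((\<lambda>y. G 0 + e * y) \<longlongrightarrow> G 0 + e * m) (at_left m)" by (intro tendsto_intros)
      moreover have "\<forall>\<^sub>F y in at_left m. G y \<le> G 0 + e * y"
        using eventually_at_left_real[OF m] by eventually_elim (auto intro: below)
      ultimately show ?thesis by (intro tendsto_le[of "at_left m"]) auto
    qed simp
    have "m = b"
    proof (rule ccontr)
      assume "m \<noteq> b"
      then have mb': "m < b" using mb by simp
      have "\<forall>\<^sub>F h in at_right 0. (G (m + h) - G m) / h < e"
        by (rule order_tendstoD(2)[OF der[OF mb(1)]]) (use le[OF mb(1)] e in simp)
      then obtain \<delta> where \<delta>: "\<delta> > 0" "\<And>h. 0 < h \<Longrightarrow> h < \<delta> \<Longrightarrow> (G (m + h) - G m) / h < e"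
        by (auto simp: eventually_at_right_field)
      define x where "x = min b (m + \<delta> / 2)"
      have x: "m < x" "x \<le> b" "x < m + \<delta>" using mb' \<delta> by (auto simp: x_def min_def)
      have "G y \<le> G 0 + e * y" if y: "y \<in> {0..x}" for y
      proof -
        consider "y < m" | "y = m" | "m < y" by linarith
        then show ?thesis
        proof cases
          case 3
          have "(G (m + (y - m)) - G m) / (y - m) < e" using 3 x y by (intro \<delta>(2)) auto
          then have "G y - G m < e * (y - m)" using 3 by (simp add: field_simps)
          then show ?thesis using mE by (simp add: algebra_simps)
        qed (use below mE y in auto)
      qed
      then have "x \<in> E" using x mb by (auto simp: E_def)
      then have "x \<le> m" unfolding m_def by (rule cSup_upper[OF _ bdd])
      then show False using x by simp
    qed
    then show ?thesis using mE by simp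
  qed
  show ?thesis
  proof (cases "b = 0")
    case False
    then have b': "b > 0" using b by simp
    show ?thesis
    proof (rule field_le_epsilon)
      fix e :: real assume "e > 0"
      then show "G b \<le> G 0 + e" using *[of "e / b"] b' by simp
    qed
  qed simp
qed

lemma right_derivative_exp_decay:
  fixes f f' :: "real \<Rightarrow> real"
  assumes cont: "continuous_on {0..} f"
    and der: "\<And>t. t \<ge> 0 \<Longrightarrow> ((\<lambda>h. (f (t + h) - f t) / h) \<longlongrightarrow> f' t) (at_right 0)"
    and le: "\<And>t. t \<ge> 0 \<Longrightarrow> f' t \<le> - c * f t" and t: "0 \<le> t"
  shows "f t \<le> exp (- c * t) * f 0"
proof -
  define G where "G t = exp (c * t) * f t" for t
  have "G t \<le> G 0"
  proof (rule right_derivative_nonincreasing[OF _ _ _ t])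
    show "continuous_on {0..} G" unfolding G_def by (intro continuous_intros cont)
    fix t :: real assume t: "t \<ge> 0"
    have e: "((\<lambda>h. (exp (c * (t + h)) - exp (c * t)) / h) \<longlongrightarrow> c * exp (c * t)) (at_right 0)"
    proof -
      have "((\<lambda>x. exp (c * x)) has_real_derivative c * exp (c * t)) (at t)" by (auto intro!: derivative_eq_intros)
      then have "((\<lambda>h. (exp (c * (t + h)) - exp (c * t)) / h) \<longlongrightarrow> c * exp (c * t)) (at 0)" by (simp add: DERIV_def)
      then show ?thesis by (simp add: filterlim_at_split)
    qed
    have "((\<lambda>h. exp (c * (t + h))) \<longlongrightarrow> exp (c * (t + 0))) (at_right 0)" by (intro tendsto_intros)
    then have ec: "((\<lambda>h. exp (c * (t + h))) \<longlongrightarrow> exp (c * t)) (at_right 0)" by simp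
    have "((\<lambda>h. exp (c * (t + h)) * ((f (t + h) - f t) / h) + (exp (c * (t + h)) - exp (c * t)) / h * f t)
        \<longlongrightarrow> exp (c * t) * f' t + c * exp (c * t) * f t) (at_right 0)"
      by (intro tendsto_intros e ec der t)
    moreover have "(\<lambda>h. exp (c * (t + h)) * ((f (t + h) - f t) / h) + (exp (c * (t + h)) - exp (c * t)) / h * f t)
       = (\<lambda>h. (G (t + h) - G t) / h)"
      by (auto simp: G_def fun_eq_iff algebra_simps diff_divide_distrib)
    ultimately show "((\<lambda>h. (G (t + h) - G t) / h) \<longlongrightarrow> exp (c * t) * f' t + c * exp (c * t) * f t) (at_right 0)" by simp
    have "exp (c * t) * f' t \<le> exp (c * t) * (- c * f t)" by (intro mult_left_mono le t) simp
    then show "exp (c * t) * f' t + c * exp (c * t) * f t \<le> 0" by (simp add: algebra_simps)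
  qed
  then have "exp (c * t) * f t \<le> f 0" by (simp add: G_def)
  then have "exp (- c * t) * (exp (c * t) * f t) \<le> exp (- c * t) * f 0" by (rule mult_left_mono) simp
  then show ?thesis by (simp flip: mult.assoc exp_add)
qed

lemma eventually_at_right_pos: "\<forall>\<^sub>F h::real in at_right 0. h > 0"
  by (simp add: eventually_at_filter)

section \<open>Seminormed spaces of states and their semigroups\<close>

lemma lincomb_cases: obtains u v \<phi> \<Phi> \<psi> \<Psi> \<theta> q \<eta> where "(U::state) = (u, v, \<phi>, \<Phi>, \<psi>, \<Psi>, \<theta>, q, \<eta>)"
  by (cases U) auto

lemma lincomb_lincomb3:
  "lincomb a (lincomb p U q V) c (lincomb r V s W) = lincomb 1 (lincomb (a * p) U (a * q + c * r) V) (c * s) W"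
  by (cases U rule: lincomb_cases; cases V rule: lincomb_cases; cases W rule: lincomb_cases) (simp add: algebra_simps)

lemma lincomb_assoc: "lincomb 1 (lincomb a U 0 V) c W = lincomb a U c W"
  by (cases U rule: lincomb_cases; cases V rule: lincomb_cases; cases W rule: lincomb_cases) simp

text \<open>States are representatives, so \<open>N\<close> is a seminorm, and identities along a
  semigroup become statements that a distance is zero. Linear combinations have real coefficients,
  in line with the real forms used.\<close>

locale state_space =
  fixes X :: "state set" and N :: "state \<Rightarrow> real"
  assumes X_lincomb: "\<And>U V a c. U \<in> X \<Longrightarrow> V \<in> X \<Longrightarrow> lincomb (of_real a) U (of_real c) V \<in> X"
    and N_nonneg: "\<And>U. U \<in> X \<Longrightarrow> 0 \<le> N U"
    and N_lincomb: "\<And>U V a c. U \<in> X \<Longrightarrow> V \<in> X \<Longrightarrow> N (lincomb (of_real a) U (of_real c) V) \<le> \<bar>a\<bar> * N U + \<bar>c\<bar> * N V"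
begin

lemma X_diff: "U \<in> X \<Longrightarrow> V \<in> X \<Longrightarrow> lincomb 1 U (-1) V \<in> X"
  using X_lincomb[of U V 1 "-1"] by simp

lemma dist_nonneg: "U \<in> X \<Longrightarrow> V \<in> X \<Longrightarrow> 0 \<le> state_dist N U V"
  unfolding state_dist_def by (intro N_nonneg X_diff)

lemma dist_triangle3: 
  assumes "U \<in> X" "V \<in> X" "W \<in> X" shows "state_dist N U W \<le> state_dist N U V + state_dist N V W"
proof -
  have "lincomb 1 U (-1) W = lincomb 1 (lincomb 1 U (-1) V) 1 (lincomb 1 V (-1) W)"
    by (simp add: lincomb_lincomb3 lincomb_assoc)
  then show ?thesis
    unfolding state_dist_def using N_lincomb[OF X_diff[OF assms(1,2)] X_diff[OF assms(2,3)], of 1 1] by simp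
qed

lemma dist_sym_le: 
  assumes "U \<in> X" "V \<in> X" shows "state_dist N V U \<le> state_dist N U V"
proof -
  have "lincomb 1 V (-1) U = lincomb (-1) (lincomb 1 U (-1) V) 0 (lincomb 1 U (-1) V)"
    by (cases U rule: lincomb_cases; cases V rule: lincomb_cases) simp
  then show ?thesis
    unfolding state_dist_def using N_lincomb[OF X_diff[OF assms(1,2)] X_diff[OF assms(1,2)], of "-1" 0] by simp
qed

lemma dist_sym: "U \<in> X \<Longrightarrow> V \<in> X \<Longrightarrow> state_dist N V U = state_dist N U V"
  by (intro antisym dist_sym_le)

lemma N_triangle: "U \<in> X \<Longrightarrow> V \<in> X \<Longrightarrow> N U \<le> N V + state_dist N U V"
proof -
  assume UV: "U \<in> X" "V \<in> X"
  have "U = lincomb 1 V 1 (lincomb 1 U (-1) V)"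
    by (cases U rule: lincomb_cases; cases V rule: lincomb_cases) simp
  then show ?thesis
    unfolding state_dist_def using N_lincomb[OF UV(2) X_diff[OF UV], of 1 1] by simp
qed

end

locale state_semigroup = state_space +
  fixes T :: "real \<Rightarrow> state \<Rightarrow> state"
  assumes semigroup: "C0_semigroup X N T"
begin

abbreviation "diff_quotient h U \<equiv> lincomb (of_real (1 / h)) (T h U) (- of_real (1 / h)) U"

lemma T_X: "t \<ge> 0 \<Longrightarrow> U \<in> X \<Longrightarrow> T t U \<in> X"
  using semigroup by (auto simp: C0_semigroup_def)

lemma T_lin: "t \<ge> 0 \<Longrightarrow> U \<in> X \<Longrightarrow> V \<in> X \<Longrightarrow>
    state_dist N (T t (lincomb a U c V)) (lincomb a (T t U) c (T t V)) = 0"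
  using semigroup by (auto simp: C0_semigroup_def)

lemma T_bound: "t \<ge> 0 \<Longrightarrow> \<exists>C\<ge>0. \<forall>U\<in>X. N (T t U) \<le> C * N U"
proof -
  assume "t \<ge> 0"
  then obtain C where C: "\<forall>U\<in>X. N (T t U) \<le> C * N U"
    using semigroup by (auto simp: C0_semigroup_def)
  have "N (T t U) \<le> max C 0 * N U" if "U \<in> X" for U
    using C that mult_right_mono[of C "max C 0" "N U"] N_nonneg[OF that] by fastforce
  then show ?thesis by (intro exI[of _ "max C 0"]) auto
qed

lemma T_0: "U \<in> X \<Longrightarrow> state_dist N (T 0 U) U = 0"
  using semigroup by (auto simp: C0_semigroup_def)

lemma T_add: "r \<ge> 0 \<Longrightarrow> t \<ge> 0 \<Longrightarrow> U \<in> X \<Longrightarrow> state_dist N (T (r + t) U) (T r (T t U)) = 0"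
  using semigroup by (auto simp: C0_semigroup_def)

lemma T_cont0: "U \<in> X \<Longrightarrow> ((\<lambda>t. state_dist N (T t U) U) \<longlongrightarrow> 0) (at_right 0)"
  using semigroup by (auto simp: C0_semigroup_def)

lemma T_Lipschitz: "t \<ge> 0 \<Longrightarrow> \<exists>C\<ge>0. \<forall>U\<in>X. \<forall>V\<in>X. state_dist N (T t U) (T t V) \<le> C * state_dist N U V"
proof -
  assume t: "t \<ge> 0"
  obtain C where C: "C \<ge> 0" "\<And>U. U \<in> X \<Longrightarrow> N (T t U) \<le> C * N U" using T_bound[OF t] by blast
  have "state_dist N (T t U) (T t V) \<le> C * state_dist N U V" if UV: "U \<in> X" "V \<in> X" for U V
  proof -
    note XX = X_diff[OF T_X[OF t UV(1)] T_X[OF t UV(2)]] T_X[OF t X_diff[OF UV]]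
    have "state_dist N (T t U) (T t V) = N (lincomb 1 (T t U) (-1) (T t V))" by (simp add: state_dist_def)
    also have "\<dots> \<le> N (T t (lincomb 1 U (-1) V)) + state_dist N (lincomb 1 (T t U) (-1) (T t V)) (T t (lincomb 1 U (-1) V))"
      by (rule N_triangle[OF XX])
    also have "state_dist N (lincomb 1 (T t U) (-1) (T t V)) (T t (lincomb 1 U (-1) V)) = 0"
      using T_lin[OF t UV, of 1 "-1"] dist_sym[OF XX] by simp
    also have "N (T t (lincomb 1 U (-1) V)) \<le> C * N (lincomb 1 U (-1) V)" by (rule C(2)[OF X_diff[OF UV]])
    finally show ?thesis by (simp add: state_dist_def)
  qed
  then show ?thesis using C(1) by blast
qed

lemma orbit_shift:
  assumes t: "t \<ge> 0" and U: "U \<in> X"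
  shows "\<exists>C\<ge>0. \<forall>r\<ge>0. \<forall>s\<ge>0. state_dist N (T (t + r) U) (T (t + s) U) \<le> C * state_dist N (T r U) (T s U)"
proof -
  obtain C where C: "C \<ge> 0" "\<And>U V. U \<in> X \<Longrightarrow> V \<in> X \<Longrightarrow> state_dist N (T t U) (T t V) \<le> C * state_dist N U V"
    using T_Lipschitz[OF t] by blast
  have "state_dist N (T (t + r) U) (T (t + s) U) \<le> C * state_dist N (T r U) (T s U)" if rs: "r \<ge> 0" "s \<ge> 0" for r s
  proof -
    have in_X: "T (t + r) U \<in> X" "T (t + s) U \<in> X" "T t (T r U) \<in> X" "T t (T s U) \<in> X"
      using t rs U by (auto intro!: T_X)
    show ?thesis
      using dist_triangle3[OF in_X(1,3,2)] dist_triangle3[OF in_X(3,4,2)]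
        T_add[OF t rs(1) U] T_add[OF t rs(2) U] dist_sym[OF in_X(2,4)] C(2)[OF T_X[OF rs(1) U] T_X[OF rs(2) U]]
      by simp
  qed
  then show ?thesis using C(1) by blast
qed

lemma orbit_right_continuous:
  assumes t: "t \<ge> 0" and U: "U \<in> X" and e: "e > 0"
  shows "\<exists>\<delta>>0. \<forall>s. t \<le> s \<and> s < t + \<delta> \<longrightarrow> state_dist N (T s U) (T t U) < e"
proof -
  obtain C where C: "C \<ge> 0" "\<And>r s. r \<ge> 0 \<Longrightarrow> s \<ge> 0 \<Longrightarrow> state_dist N (T (t + r) U) (T (t + s) U) \<le> C * state_dist N (T r U) (T s U)"
    using orbit_shift[OF t U] by blast
  have "\<forall>\<^sub>F h in at_right 0. state_dist N (T h U) U < e / (C + 1)"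
    by (rule order_tendstoD(2)[OF T_cont0[OF U]]) (use e C in simp)
  then obtain \<delta> where \<delta>: "\<delta> > 0" "\<And>h. 0 < h \<Longrightarrow> h < \<delta> \<Longrightarrow> state_dist N (T h U) U < e / (C + 1)"
    by (auto simp: eventually_at_right_field)
  have "state_dist N (T s U) (T t U) < e" if s: "t \<le> s" "s < t + \<delta>" for s
  proof (cases "s = t")
    case True
    have "state_dist N (T t U) (T t U) = N (lincomb 0 (T t U) 0 (T t U))"
      unfolding state_dist_def by (cases "T t U" rule: lincomb_cases) simp
    also have "\<dots> \<le> 0" using N_lincomb[OF T_X[OF t U] T_X[OF t U], of 0 0] by simp
    finally show ?thesis using True e by simp
  next
    case False
    define h where "h = s - t"
    have h: "0 < h" "h < \<delta>" using False s by (auto simp: h_def)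
    have X3: "T h U \<in> X" "T 0 U \<in> X" using h U by (auto intro!: T_X)
    have "state_dist N (T h U) (T 0 U) < e / (C + 1)"
      using dist_triangle3[OF X3(1) U X3(2)] T_0[OF U] dist_sym[OF X3(2) U] \<delta>(2)[OF h] by simp
    then have "(C + 1) * state_dist N (T h U) (T 0 U) < e" using C(1) by (simp add: field_simps)
    moreover have "state_dist N (T (t + h) U) (T (t + 0) U) \<le> C * state_dist N (T h U) (T 0 U)" using C(2)[of h 0] h by simp
    moreover have "0 \<le> state_dist N (T h U) (T 0 U)" by (rule dist_nonneg[OF X3])
    ultimately show ?thesis by (simp add: h_def algebra_simps)
  qed
  then show ?thesis using \<delta>(1) by blast
qed

lemma orbit_continuous:
  assumes U: "U \<in> X" and t: "t > 0" and e: "e > 0"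
  shows "\<exists>\<delta>>0. \<forall>s\<ge>0. \<bar>s - t\<bar> < \<delta> \<longrightarrow> state_dist N (T s U) (T t U) < e"
proof -
  define dd where "dd r s = state_dist N (T (max r 0) U) (T (max s 0) U)" for r s
  obtain t1 where t1: "0 < t1" "t1 < t" "\<And>e. e > 0 \<Longrightarrow> \<exists>\<delta>>0. \<forall>s. \<bar>s - t1\<bar> < \<delta> \<longrightarrow> dd s t1 < e"
  proof (rule continuity_point[of dd 0 t])
    show "dd r t \<le> dd r s + dd s t" for r s t unfolding dd_def by (intro dist_triangle3 T_X U) auto
    show "dd s t = dd t s" for s t unfolding dd_def by (intro dist_sym T_X U) auto
    show "\<exists>\<delta>>0. \<forall>s. t \<le> s \<and> s < t + \<delta> \<longrightarrow> dd s t < e" if "t \<ge> 0" "e > 0" for t e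
      using orbit_right_continuous[OF that(1) U that(2)] that(1) by (auto simp: dd_def max_def)
  qed (use t in auto)
  obtain C where C: "C \<ge> 0" "\<And>r s. r \<ge> 0 \<Longrightarrow> s \<ge> 0 \<Longrightarrow> state_dist N (T ((t - t1) + r) U) (T ((t - t1) + s) U) \<le> C * state_dist N (T r U) (T s U)"
    using orbit_shift[of "t - t1" U] t1 U by auto
  obtain \<delta> where \<delta>: "\<delta> > 0" "\<And>s. \<bar>s - t1\<bar> < \<delta> \<Longrightarrow> dd s t1 < e / (C + 1)"
    using t1(3)[of "e / (C + 1)"] e C by auto
  have "state_dist N (T s U) (T t U) < e" if s: "\<bar>s - t\<bar> < min \<delta> t1" for s
  proof -
    define r where "r = s - (t - t1)"
    have r: "r \<ge> 0" "\<bar>r - t1\<bar> < \<delta>" using s by (auto simp: r_def)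
    have d: "state_dist N (T r U) (T t1 U) < e / (C + 1)" using \<delta>(2)[OF r(2)] r t1 by (simp add: dd_def)
    then have "(C + 1) * state_dist N (T r U) (T t1 U) < e" using C(1) by (simp add: field_simps)
    moreover have "0 \<le> state_dist N (T r U) (T t1 U)" using r t1 U by (intro dist_nonneg T_X) auto
    moreover have "state_dist N (T ((t - t1) + r) U) (T ((t - t1) + t1) U) \<le> C * state_dist N (T r U) (T t1 U)"
      using C(2)[of r t1] r t1 by simp
    ultimately show ?thesis by (simp add: r_def algebra_simps)
  qed
  then show ?thesis using \<delta>(1) t1(1) by (intro exI[of _ "min \<delta> t1"]) auto
qed

end

section \<open>Bounded forms along orbits\<close>

locale state_form = state_space +
  fixes B :: "state \<Rightarrow> state \<Rightarrow> real"
  assumes B_left: "\<And>U V W a c. U \<in> X \<Longrightarrow> V \<in> X \<Longrightarrow> W \<in> X \<Longrightarrow>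
      B (lincomb (of_real a) U (of_real c) V) W = a * B U W + c * B V W"
    and B_right: "\<And>U V W a c. U \<in> X \<Longrightarrow> V \<in> X \<Longrightarrow> W \<in> X \<Longrightarrow>
      B W (lincomb (of_real a) U (of_real c) V) = a * B W U + c * B W V"
    and B_bounded: "\<exists>K. \<forall>U\<in>X. \<forall>V\<in>X. \<bar>B U V\<bar> \<le> K * (N U * N V)"
begin

lemma B_bound: obtains K where "K \<ge> 0" "\<And>U V. U \<in> X \<Longrightarrow> V \<in> X \<Longrightarrow> \<bar>B U V\<bar> \<le> K * (N U * N V)"
proof -
  obtain K where K: "\<forall>U\<in>X. \<forall>V\<in>X. \<bar>B U V\<bar> \<le> K * (N U * N V)" using B_bounded by blast
  show thesis
  proof (rule that[of "max K 0"])
    fix U V assume UV: "U \<in> X" "V \<in> X"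
    have "K * (N U * N V) \<le> max K 0 * (N U * N V)"
      using N_nonneg UV by (intro mult_right_mono) auto
    then show "\<bar>B U V\<bar> \<le> max K 0 * (N U * N V)" using K UV by fastforce
  qed simp
qed

lemma B_diff_left: "U \<in> X \<Longrightarrow> V \<in> X \<Longrightarrow> W \<in> X \<Longrightarrow> B (lincomb 1 U (-1) V) W = B U W - B V W"
  using B_left[of U V W 1 "-1"] by simp

lemma B_diff_right: "U \<in> X \<Longrightarrow> V \<in> X \<Longrightarrow> W \<in> X \<Longrightarrow> B W (lincomb 1 U (-1) V) = B W U - B W V"
  using B_right[of U V W 1 "-1"] by simp

lemma B_tendsto:
  fixes F G :: "real \<Rightarrow> state"
  assumes F: "\<And>h. h > 0 \<Longrightarrow> F h \<in> X" "U \<in> X" "((\<lambda>h. state_dist N (F h) U) \<longlongrightarrow> 0) (at_right 0)"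
    and G: "\<And>h. h > 0 \<Longrightarrow> G h \<in> X" "V \<in> X" "((\<lambda>h. state_dist N (G h) V) \<longlongrightarrow> 0) (at_right 0)"
  shows "((\<lambda>h. B (F h) (G h)) \<longlongrightarrow> B U V) (at_right 0)"
proof -
  obtain K where K: "K \<ge> 0" "\<And>U V. U \<in> X \<Longrightarrow> V \<in> X \<Longrightarrow> \<bar>B U V\<bar> \<le> K * (N U * N V)" using B_bound by blast
  let ?b = "\<lambda>h. K * (state_dist N (F h) U * (N V + state_dist N (G h) V)) + K * (N U * state_dist N (G h) V)"
  have "(?b \<longlongrightarrow> K * (0 * (N V + 0)) + K * (N U * 0)) (at_right 0)"
    by (intro tendsto_intros F G)
  then have b0: "(?b \<longlongrightarrow> 0) (at_right 0)" by simp
  have "\<forall>\<^sub>F h in at_right 0. norm (B (F h) (G h) - B U V) \<le> ?b h"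
  proof (rule eventually_mono[OF eventually_at_right_pos])
    fix h :: real assume elim: "h > 0"
    note FX = F(1)[OF elim] and GX = G(1)[OF elim]
    note dF = X_diff[OF FX F(2)] and dG = X_diff[OF GX G(2)]
    have "B (F h) (G h) - B U V = B (lincomb 1 (F h) (-1) U) (G h) + B U (lincomb 1 (G h) (-1) V)"
      using FX GX F(2) G(2) by (simp add: B_diff_left B_diff_right)
    moreover have "\<bar>B (lincomb 1 (F h) (-1) U) (G h)\<bar> \<le> K * (state_dist N (F h) U * (N V + state_dist N (G h) V))"
    proof -
      have "\<bar>B (lincomb 1 (F h) (-1) U) (G h)\<bar> \<le> K * (state_dist N (F h) U * N (G h))"
        using K(2)[OF dF GX] by (simp add: state_dist_def)
      also have "\<dots> \<le> K * (state_dist N (F h) U * (N V + state_dist N (G h) V))"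
        using N_triangle[OF GX G(2)] dist_nonneg[OF FX F(2)] K(1) by (intro mult_left_mono) auto
      finally show ?thesis .
    qed
    moreover have "\<bar>B U (lincomb 1 (G h) (-1) V)\<bar> \<le> K * (N U * state_dist N (G h) V)"
      using K(2)[OF F(2) dG] by (simp add: state_dist_def)
    ultimately show "norm (B (F h) (G h) - B U V) \<le> ?b h" by simp
  qed
  then have "((\<lambda>h. B (F h) (G h) - B U V) \<longlongrightarrow> 0) (at_right 0)" by (rule Lim_null_comparison[OF _ b0])
  then show ?thesis by (simp add: LIM_zero_iff)
qed

text \<open>Allows a point of an orbit, which is only equivalent to an element of the domain, to be
  replaced by that element.\<close>

lemma B_null:
  assumes "U \<in> X" "U' \<in> X" "V \<in> X" "V' \<in> X" "state_dist N U U' = 0" "state_dist N V V' = 0"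
  shows "B U V = B U' V'"
proof -
  obtain K where K: "K \<ge> 0" "\<And>U V. U \<in> X \<Longrightarrow> V \<in> X \<Longrightarrow> \<bar>B U V\<bar> \<le> K * (N U * N V)" using B_bound by blast
  have "B (lincomb 1 U (-1) U') V = 0" "B U' (lincomb 1 V (-1) V') = 0"
    using K(2)[OF X_diff[OF assms(1,2)] assms(3)] K(2)[OF assms(2) X_diff[OF assms(3,4)]] assms(5,6)
    by (simp_all add: state_dist_def)
  then show ?thesis using assms by (simp add: B_diff_left B_diff_right)
qed

end

locale lyapunov_form = state_semigroup + state_form +
  fixes D :: "state set" and A :: "state \<Rightarrow> state" and k c :: real
  assumes gen: "is_generator X N T D A"
    and DX: "D \<subseteq> X" and AX: "\<And>W. W \<in> D \<Longrightarrow> A W \<in> X"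
    and dense: "\<And>U e. U \<in> X \<Longrightarrow> e > 0 \<Longrightarrow> \<exists>W\<in>D. state_dist N U W < e"
    and k: "k > 0" "\<And>U. U \<in> X \<Longrightarrow> k * (N U)\<^sup>2 \<le> B U U"
    and c: "c > 0" "\<And>W. W \<in> D \<Longrightarrow> B W (A W) + B (A W) W \<le> - c * (N W)\<^sup>2"
begin

lemma self_dist: "U \<in> X \<Longrightarrow> state_dist N U U = 0"
proof -
  assume U: "U \<in> X"
  have "state_dist N U U = N (lincomb 0 U 0 U)"
    unfolding state_dist_def by (cases U rule: lincomb_cases) simp
  also have "\<dots> \<le> 0" using N_lincomb[OF U U, of 0 0] by simp
  finally show ?thesis using dist_nonneg[OF U U] by simp
qed

lemma quotient_X: "U \<in> X \<Longrightarrow> V \<in> X \<Longrightarrow> lincomb (of_real (1 / h)) U (- of_real (1 / h)) V \<in> X"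
  using X_lincomb[of U V "1 / h" "- (1 / h)"] by simp

text \<open>\<open>T h\<close> and \<open>T t\<close> commute up to distance zero, as both products
  agree with \<open>T (h + t)\<close>; linearity up to distance zero does the rest.\<close>

lemma T_quotient:
  assumes h: "h > 0" and t: "t \<ge> 0" and U: "U \<in> X"
  shows "state_dist N (diff_quotient h (T t U))
      (T t (diff_quotient h U)) = 0"
proof -
  let ?a = "complex_of_real (1 / h)"
  have h0: "h \<ge> 0" using h by simp
  note XX = T_X[OF h0 U] T_X[OF t U] T_X[OF h0 T_X[OF t U]] T_X[OF t T_X[OF h0 U]]
  have d0: "state_dist N (T h (T t U)) (T t (T h U)) = 0"
  proof -
    have "T (h + t) U \<in> X" using h0 t U by (intro T_X) auto
    then have "state_dist N (T h (T t U)) (T t (T h U)) \<le> state_dist N (T h (T t U)) (T (h + t) U) + state_dist N (T (h + t) U) (T t (T h U))"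
      using XX by (intro dist_triangle3) auto
    also have "state_dist N (T (h + t) U) (T t (T h U)) = 0" using T_add[OF t h0 U] by (simp add: add.commute)
    also have "state_dist N (T h (T t U)) (T (h + t) U) = 0"
      using T_add[OF h0 t U] dist_sym[OF \<open>T (h + t) U \<in> X\<close> XX(3)] by simp
    finally show ?thesis using dist_nonneg[OF XX(3,4)] by simp
  qed
  have "state_dist N (lincomb ?a (T h (T t U)) (- ?a) (T t U)) (lincomb ?a (T t (T h U)) (- ?a) (T t U)) = 0"
  proof -
    have "lincomb 1 (lincomb ?a (T h (T t U)) (- ?a) (T t U)) (-1) (lincomb ?a (T t (T h U)) (- ?a) (T t U))
        = lincomb (of_real (1 / h)) (lincomb 1 (T h (T t U)) (-1) (T t (T h U))) (of_real 0) (T t U)"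
      by (cases "T h (T t U)" rule: lincomb_cases; cases "T t (T h U)" rule: lincomb_cases; cases "T t U" rule: lincomb_cases)
         (simp add: algebra_simps)
    then have "state_dist N (lincomb ?a (T h (T t U)) (- ?a) (T t U)) (lincomb ?a (T t (T h U)) (- ?a) (T t U))
        \<le> \<bar>1 / h\<bar> * state_dist N (T h (T t U)) (T t (T h U))"
      unfolding state_dist_def using N_lincomb[OF X_diff[OF XX(3,4)] XX(2), of "1/h" 0] by simp
    then show ?thesis using d0 dist_nonneg[OF quotient_X[OF XX(3,2)] quotient_X[OF XX(4,2)], of h h] by simp
  qed
  moreover have "state_dist N (lincomb ?a (T t (T h U)) (- ?a) (T t U)) (T t (lincomb ?a (T h U) (- ?a) U)) = 0"
    using T_lin[OF t XX(1) U, of ?a "- ?a"] dist_sym[OF T_X[OF t quotient_X[OF XX(1) U, of h]] quotient_X[OF XX(4,2), of h]] by simp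
  ultimately show ?thesis
    using dist_triangle3[OF quotient_X[OF XX(3,2), of h] quotient_X[OF XX(4,2), of h] T_X[OF t quotient_X[OF XX(1) U, of h]]]
      dist_nonneg[OF quotient_X[OF XX(3,2), of h] T_X[OF t quotient_X[OF XX(1) U, of h]]] by simp
qed

text \<open>Read through the definition of the generator, this keeps the orbit in the domain up to
  null elements and identifies the generator there with \<open>T t (A U)\<close>.\<close>

lemma orbit_derivative:
  assumes U: "U \<in> D" and t: "t \<ge> 0"
  shows "((\<lambda>h. state_dist N (diff_quotient h (T t U)) (T t (A U))) \<longlongrightarrow> 0) (at_right 0)"
proof -
  have UX: "U \<in> X" "A U \<in> X" using U DX AX by auto
  have 0: "((\<lambda>h. state_dist N (diff_quotient h U) (A U)) \<longlongrightarrow> 0) (at_right 0)"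
    using gen UX U self_dist unfolding is_generator_def by blast
  obtain C where C: "C \<ge> 0" "\<And>U V. U \<in> X \<Longrightarrow> V \<in> X \<Longrightarrow> state_dist N (T t U) (T t V) \<le> C * state_dist N U V"
    using T_Lipschitz[OF t] by blast
  have "((\<lambda>h. C * state_dist N (diff_quotient h U) (A U)) \<longlongrightarrow> C * 0) (at_right 0)"
    by (intro tendsto_intros 0)
  then have l: "((\<lambda>h. C * state_dist N (diff_quotient h U) (A U)) \<longlongrightarrow> 0) (at_right 0)" by simp
  show ?thesis
  proof (rule Lim_null_comparison[OF _ l])
    show "\<forall>\<^sub>F h in at_right 0. norm (state_dist N (diff_quotient h (T t U)) (T t (A U)))
        \<le> C * state_dist N (diff_quotient h U) (A U)"
      using eventually_at_right_pos
    proof eventually_elim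
      case (elim h)
      then have h0: "h \<ge> 0" by simp
      note XX = quotient_X[OF T_X[OF h0 T_X[OF t UX(1)]] T_X[OF t UX(1)], of h] 
        quotient_X[OF T_X[OF h0 UX(1)] UX(1), of h] T_X[OF t UX(2)]
      show ?case
        using dist_triangle3[OF XX(1) T_X[OF t XX(2)] XX(3)] T_quotient[OF elim t UX(1)] C(2)[OF XX(2) UX(2)] dist_nonneg[OF XX(1,3)]
        by simp
    qed
  qed
qed

text \<open>Along the orbit the form has a right derivative bounded by \<open>- c\<close> times the
  squared norm, hence by \<open>- (c / K)\<close> times the form itself; this differential
  inequality gives the exponential.\<close>

lemma decay_domain:
  assumes U: "U \<in> D" and t: "t \<ge> 0" and K: "K > 0" "\<And>U V. U \<in> X \<Longrightarrow> V \<in> X \<Longrightarrow> \<bar>B U V\<bar> \<le> K * (N U * N V)"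
  shows "k * (N (T t U))\<^sup>2 \<le> exp (- (c / K) * t) * (K * (N U)\<^sup>2)"
proof -
  have UX: "U \<in> X" "A U \<in> X" using U DX AX by auto
  define f where "f t = B (T t U) (T t U)" for t
  define f' where "f' t = B (T t (A U)) (T t U) + B (T t U) (T t (A U))" for t
  have rc: "((\<lambda>h. state_dist N (T h (T t U)) (T t U)) \<longlongrightarrow> 0) (at_right 0)" if "t \<ge> 0" for t
    by (rule T_cont0[OF T_X[OF that UX(1)]])
  have der: "((\<lambda>h. (f (t + h) - f t) / h) \<longlongrightarrow> f' t) (at_right 0)" if t: "t \<ge> 0" for t
  proof -
    note TX = T_X[OF t UX(1)]
    let ?Q = "\<lambda>h. diff_quotient h (T t U)"
    \<comment> \<open>The product rule for difference quotients is exact when the second entry of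
      the first term is taken at time \<open>t + h\<close> and the first entry of the second term at
      time \<open>t\<close>.\<close>
    have "((\<lambda>h. B (?Q h) (T h (T t U)) + B (T t U) (?Q h)) \<longlongrightarrow> B (T t (A U)) (T t U) + B (T t U) (T t (A U))) (at_right 0)"
    proof (intro tendsto_add B_tendsto)
      show "((\<lambda>h. state_dist N (?Q h) (T t (A U))) \<longlongrightarrow> 0) (at_right 0)" by (rule orbit_derivative[OF U t])
      then show "((\<lambda>h. state_dist N (?Q h) (T t (A U))) \<longlongrightarrow> 0) (at_right 0)" .
      show "((\<lambda>h. state_dist N (T h (T t U)) (T t U)) \<longlongrightarrow> 0) (at_right 0)" by (rule rc[OF t])
      show "((\<lambda>h. state_dist N (T t U) (T t U)) \<longlongrightarrow> 0) (at_right 0)" by (simp add: self_dist[OF TX])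
    qed (use TX T_X[OF t UX(2)] in \<open>auto intro!: T_X quotient_X simp del: of_real_divide\<close>)
    moreover have "\<forall>\<^sub>F h in at_right 0. B (?Q h) (T h (T t U)) + B (T t U) (?Q h) = (f (t + h) - f t) / h"
      using eventually_at_right_pos
    proof eventually_elim
      case (elim h)
      then have h0: "h \<ge> 0" by simp
      note hX = T_X[OF h0 TX]
      have th: "T (h + t) U \<in> X" using h0 t UX by (intro T_X) auto
      have "f (t + h) = B (T h (T t U)) (T h (T t U))"
        unfolding f_def using T_add[OF h0 t UX(1)] by (intro B_null) (auto simp: add.commute th hX)
      moreover have "B (?Q h) (T h (T t U)) = (1/h) * B (T h (T t U)) (T h (T t U)) + (- (1/h)) * B (T t U) (T h (T t U))"
        using B_left[OF hX TX hX, of "1/h" "- (1/h)"] by simp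
      moreover have "B (T t U) (?Q h) = (1/h) * B (T t U) (T h (T t U)) + (- (1/h)) * B (T t U) (T t U)"
        using B_right[OF hX TX TX, of "1/h" "- (1/h)"] by simp
      ultimately show ?case by (simp add: f_def diff_divide_distrib)
    qed
    ultimately show ?thesis unfolding f'_def by (rule Lim_transform_eventually)
  qed
  have le: "f' t \<le> - (c / K) * f t" if t: "t \<ge> 0" for t
  proof -
    note TX = T_X[OF t UX(1)] T_X[OF t UX(2)]
    \<comment> \<open>The dissipation estimate is available only on the domain, so the orbit point
      is replaced by an equivalent element of it, which the definition of the generator
      provides.\<close>
    obtain W where W: "W \<in> D" "state_dist N W (T t U) = 0" "state_dist N (A W) (T t (A U)) = 0"
      using gen TX orbit_derivative[OF U t] unfolding is_generator_def by blast
    have WX: "W \<in> X" "A W \<in> X" using W DX AX by auto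
    have "f' t = B (A W) W + B W (A W)"
      unfolding f'_def using B_null[OF WX(2) TX(2) WX(1) TX(1)] B_null[OF WX(1) TX(1) WX(2) TX(2)] W by simp
    also have "\<dots> \<le> - c * (N W)\<^sup>2" using c(2)[OF W(1)] by simp
    also have "\<dots> \<le> - (c / K) * f t"
    proof -
      have "f t = B W W" unfolding f_def using B_null[OF WX(1) TX(1) WX(1) TX(1)] W by simp
      then have "f t \<le> K * (N W)\<^sup>2" using K(2)[OF WX(1) WX(1)] by (simp add: power2_eq_square)
      then have "(c / K) * f t \<le> (c / K) * (K * (N W)\<^sup>2)" using K c by (intro mult_left_mono) auto
      then show ?thesis using K by simp
    qed
    finally show ?thesis .
  qed
  have cont: "continuous_on {0..} f"
    unfolding continuous_on_iff
  proof (intro ballI allI impI)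
    fix t e :: real assume t: "t \<in> {0..}" and e: "e > 0"
    then have t0: "t \<ge> 0" by simp
    note TX = T_X[OF t0 UX(1)]
    define n where "n = N (T t U)"
    have n0: "n \<ge> 0" unfolding n_def by (rule N_nonneg[OF TX])
    \<comment> \<open>At distance \<open>x \<le> 1\<close> the form changes by at most
      \<open>x * (K * (2 * n + 1))\<close>; the extra 1 in the denominator keeps it positive and
      makes the final estimate strict.\<close>
    define \<epsilon> where "\<epsilon> = min 1 (e / (K * (2 * n + 1) + 1))"
    have den: "K * (2 * n + 1) + 1 > 0" using K n0 by (simp add: add_pos_pos)
    have \<epsilon>: "\<epsilon> > 0" "\<epsilon> \<le> 1" "\<epsilon> * (K * (2 * n + 1)) < e"
    proof -
      show "\<epsilon> > 0" "\<epsilon> \<le> 1" using e den by (auto simp: \<epsilon>_def)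
      have "\<epsilon> * (K * (2 * n + 1) + 1) \<le> e" using den 
        using den by (simp only: pos_le_divide_eq[symmetric]) (simp add: \<epsilon>_def)
      then show "\<epsilon> * (K * (2 * n + 1)) < e" using \<open>\<epsilon> > 0\<close> by (simp add: algebra_simps)
    qed
    have "\<exists>\<delta>>0. \<forall>s\<ge>0. \<bar>s - t\<bar> < \<delta> \<longrightarrow> state_dist N (T s U) (T t U) < \<epsilon>"
    proof (cases "t = 0")
      case True
      then show ?thesis using orbit_right_continuous[OF t0 UX(1) \<epsilon>(1)] by auto
    next
      case False
      then show ?thesis using t0 by (intro orbit_continuous[OF UX(1) _ \<epsilon>(1)]) auto
    qed
    then obtain \<delta> where \<delta>: "\<delta> > 0" "\<And>s. s \<ge> 0 \<Longrightarrow> \<bar>s - t\<bar> < \<delta> \<Longrightarrow> state_dist N (T s U) (T t U) < \<epsilon>" by blast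
    have "dist (f s) (f t) < e" if s: "s \<in> {0..}" "dist s t < \<delta>" for s
    proof -
      have s0: "s \<ge> 0" using s by simp
      note SX = T_X[OF s0 UX(1)]
      define x where "x = state_dist N (T s U) (T t U)"
      have x: "0 \<le> x" "x < \<epsilon>" using dist_nonneg[OF SX TX] \<delta>(2)[OF s0] s by (auto simp: x_def dist_real_def)
      have ns: "N (T s U) \<le> n + 1" using N_triangle[OF SX TX] x \<epsilon>(2) by (simp add: n_def x_def)
      have "f s - f t = B (lincomb 1 (T s U) (-1) (T t U)) (T s U) + B (T t U) (lincomb 1 (T s U) (-1) (T t U))"
        unfolding f_def using SX TX by (simp add: B_diff_left B_diff_right)
      moreover have "\<bar>B (lincomb 1 (T s U) (-1) (T t U)) (T s U)\<bar> \<le> K * (x * (n + 1))"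
      proof -
        have "\<bar>B (lincomb 1 (T s U) (-1) (T t U)) (T s U)\<bar> \<le> K * (x * N (T s U))"
          using K(2)[OF X_diff[OF SX TX] SX] by (simp add: x_def state_dist_def)
        also have "\<dots> \<le> K * (x * (n + 1))" using ns x K by (intro mult_left_mono) auto
        finally show ?thesis .
      qed
      moreover have "\<bar>B (T t U) (lincomb 1 (T s U) (-1) (T t U))\<bar> \<le> K * (n * x)"
        using K(2)[OF TX X_diff[OF SX TX]] by (simp add: x_def n_def state_dist_def)
      ultimately have "\<bar>f s - f t\<bar> \<le> x * (K * (2 * n + 1))" by (simp add: algebra_simps)
      also have "\<dots> \<le> \<epsilon> * (K * (2 * n + 1))" using x K n0 by (intro mult_right_mono) auto
      finally show ?thesis using \<epsilon>(3) by (simp add: dist_real_def)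
    qed
    then show "\<exists>\<delta>>0. \<forall>s\<in>{0..}. dist s t < \<delta> \<longrightarrow> dist (f s) (f t) < e" using \<delta>(1) by blast
  qed
  have "k * (N (T t U))\<^sup>2 \<le> f t" unfolding f_def by (rule k(2)[OF T_X[OF t UX(1)]])
  also have "f t \<le> exp (- (c / K) * t) * f 0" by (rule right_derivative_exp_decay[OF cont der le t])
  also have "f 0 = B U U"
    unfolding f_def using T_0[OF UX(1)] T_X[OF order_refl UX(1)] by (intro B_null UX) auto
  also have "exp (- (c / K) * t) * B U U \<le> exp (- (c / K) * t) * (K * (N U)\<^sup>2)"
    using K(2)[OF UX(1) UX(1)] by (intro mult_left_mono) (auto simp: power2_eq_square)
  finally show ?thesis .
qed

theorem exponential_stability:
  assumes ne: "X \<noteq> {}"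
  shows "\<exists>M \<omega>. M > 0 \<and> \<omega> > 0 \<and> (\<forall>t\<ge>0. operator_norm X N (T t) \<le> M * exp (- \<omega> * t))"
proof -
  obtain K0 where K0: "K0 \<ge> 0" "\<And>U V. U \<in> X \<Longrightarrow> V \<in> X \<Longrightarrow> \<bar>B U V\<bar> \<le> K0 * (N U * N V)" using B_bound by blast
  define K where "K = K0 + 1"
  have K: "K > 0" "\<And>U V. U \<in> X \<Longrightarrow> V \<in> X \<Longrightarrow> \<bar>B U V\<bar> \<le> K * (N U * N V)"
    using K0 N_nonneg by (auto simp: K_def algebra_simps intro: order_trans add_increasing)
  \<comment> \<open>Square roots of the constants in \<open>decay_domain\<close>, hence also half of
    the rate \<open>c / K\<close>.\<close>
  define M where "M = sqrt (K / k)"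
  define \<omega> where "\<omega> = c / K / 2"
  have M: "M > 0" "\<omega> > 0" using K k c by (auto simp: M_def \<omega>_def)
  have dom: "N (T t U) \<le> M * exp (- \<omega> * t) * N U" if U: "U \<in> D" and t: "t \<ge> 0" for t U
  proof -
    have UX: "U \<in> X" using U DX by auto
    have "(N (T t U))\<^sup>2 \<le> (K / k) * (exp (- (c / K) * t) * (N U)\<^sup>2)"
      using decay_domain[OF U t K] k by (simp add: field_simps)
    also have "\<dots> = (M * exp (- \<omega> * t) * N U)\<^sup>2"
    proof -
      have "exp (- (c / K) * t) = (exp (- \<omega> * t))\<^sup>2" by (simp add: \<omega>_def flip: exp_double)
      moreover have "M\<^sup>2 = K / k" using K k by (simp add: M_def)
      ultimately show ?thesis by (simp add: power_mult_distrib)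
    qed
    finally show ?thesis by (rule power2_le_imp_le) (use M N_nonneg[OF UX] in simp)
  qed
  \<comment> \<open>The Lipschitz constant of \<open>T t\<close> depends on \<open>t\<close>, but it
    only multiplies the distance to the domain, which can be made arbitrarily small for each fixed
    \<open>t\<close>.\<close>
  have all: "N (T t U) \<le> M * exp (- \<omega> * t) * N U" if U: "U \<in> X" and t: "t \<ge> 0" for t U
  proof (rule field_le_epsilon)
    fix e :: real assume e: "e > 0"
    obtain C where C: "C \<ge> 0" "\<And>U V. U \<in> X \<Longrightarrow> V \<in> X \<Longrightarrow> state_dist N (T t U) (T t V) \<le> C * state_dist N U V"
      using T_Lipschitz[OF t] by blast
    define R where "R = C + M * exp (- \<omega> * t)"
    have R: "R > 0" using C M by (auto simp: R_def add_nonneg_pos)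
    obtain W where W: "W \<in> D" "state_dist N U W < e / R" using dense[OF U, of "e / R"] e R by auto
    have WX: "W \<in> X" using W DX by auto
    have "N (T t U) \<le> N (T t W) + state_dist N (T t U) (T t W)" by (intro N_triangle T_X t U WX)
    also have "\<dots> \<le> M * exp (- \<omega> * t) * N W + C * state_dist N U W"
      by (intro add_mono dom W t C U WX)
    also have "\<dots> \<le> M * exp (- \<omega> * t) * (N U + state_dist N U W) + C * state_dist N U W"
      using N_triangle[OF WX U] dist_sym[OF U WX] M C(1) by (intro add_mono mult_left_mono) auto
    also have "\<dots> = M * exp (- \<omega> * t) * N U + R * state_dist N U W" by (simp add: R_def algebra_simps)
    also have "\<dots> \<le> M * exp (- \<omega> * t) * N U + e" using W(2) R by (simp add: field_simps)
    finally show "N (T t U) \<le> M * exp (- \<omega> * t) * N U + e" .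
  qed
  obtain U0 where U0: "U0 \<in> X" using ne by blast
  have Z: "lincomb (of_real 0) U0 (of_real 0) U0 \<in> {U \<in> X. N U \<le> 1}"
    using X_lincomb[OF U0 U0, of 0 0] N_lincomb[OF U0 U0, of 0 0] by simp
  have "operator_norm X N (T t) \<le> M * exp (- \<omega> * t)" if t: "t \<ge> 0" for t
    unfolding operator_norm_def
  proof (rule cSUP_least)
    show "{U \<in> X. N U \<le> 1} \<noteq> {}" using Z by blast
    fix U assume "U \<in> {U \<in> X. N U \<le> 1}"
    then have U: "U \<in> X" "N U \<le> 1" by auto
    have "N (T t U) \<le> M * exp (- \<omega> * t) * N U" by (rule all[OF U(1) t])
    also have "\<dots> \<le> M * exp (- \<omega> * t) * 1" using U M by (intro mult_left_mono) auto
    finally show "N (T t U) \<le> M * exp (- \<omega> * t)" by simp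
  qed
  then show ?thesis using M by blast
qed

end

section \<open>The memory space\<close>

text \<open>The discriminant argument behind the Cauchy-Schwarz inequality, shared by integrals and
  the energy form.\<close>

lemma quadratic_discriminant:
  fixes P Q R :: real
  assumes quad: "\<And>s t. 0 \<le> s\<^sup>2 * P + 2 * (s * t) * R + t\<^sup>2 * Q" shows "R\<^sup>2 \<le> P * Q"
proof -
  have pq: "P \<ge> 0" "Q \<ge> 0" using quad[of 1 0] quad[of 0 1] by auto
  show ?thesis
  proof (cases "Q = 0")
    case False
    have "0 \<le> Q * (Q * P - R\<^sup>2)" using quad[of Q "- R"] by (simp add: power2_eq_square algebra_simps)
    then show ?thesis using False pq by (simp add: zero_le_mult_iff mult.commute)
  next
    case True
    have "R = 0"
    proof (rule ccontr)
      assume "R \<noteq> 0"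
      \<comment> \<open>With \<open>Q = 0\<close> the quadratic expression is affine in
        \<open>t\<close> for \<open>s = 1\<close>; this \<open>t\<close> gives it the value
        -1.\<close>
      have "0 \<le> P + 2 * (- (P + 1) / (2 * R)) * R" using quad[of 1 "- (P + 1) / (2 * R)"] True by simp
      then show False using \<open>R \<noteq> 0\<close> by (simp add: field_simps)
    qed
    then show ?thesis using True by simp
  qed
qed

lemma Cauchy_Schwarz_integral:
  fixes f h :: "'a \<Rightarrow> real"
  assumes f: "f \<in> borel_measurable M" "integrable M (\<lambda>x. (f x)\<^sup>2)"
    and h: "h \<in> borel_measurable M" "integrable M (\<lambda>x. (h x)\<^sup>2)"
  shows "integrable M (\<lambda>x. f x * h x)" "\<bar>LINT x|M. f x * h x\<bar> \<le> sqrt (LINT x|M. (f x)\<^sup>2) * sqrt (LINT x|M. (h x)\<^sup>2)"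
proof -
  have b: "\<bar>x * y\<bar> \<le> (x\<^sup>2 + y\<^sup>2) / 2" for x y :: real
    using sum_squares_bound[of "\<bar>x\<bar>" "\<bar>y\<bar>"] by (simp add: abs_mult)
  show i: "integrable M (\<lambda>x. f x * h x)"
  proof (rule Bochner_Integration.integrable_bound)
    show "integrable M (\<lambda>x. ((f x)\<^sup>2 + (h x)\<^sup>2) / 2)" using f h by simp
    show "AE x in M. norm (f x * h x) \<le> norm (((f x)\<^sup>2 + (h x)\<^sup>2) / 2)"
    proof (rule AE_I2)
      fix x show "norm (f x * h x) \<le> norm (((f x)\<^sup>2 + (h x)\<^sup>2) / 2)"
        using b[of "f x" "h x"] by simp
    qed
  qed (use f h in measurable)
  define P Q R where "P = (LINT x|M. (f x)\<^sup>2)" and "Q = (LINT x|M. (h x)\<^sup>2)" and "R = (LINT x|M. f x * h x)"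
  have quad: "0 \<le> s\<^sup>2 * P + 2 * (s * t) * R + t\<^sup>2 * Q" for s t :: real
  proof -
    have "0 \<le> (LINT x|M. (s * f x + t * h x)\<^sup>2)" by (rule integral_nonneg_AE) simp
    also have "(\<lambda>x. (s * f x + t * h x)\<^sup>2) = (\<lambda>x. s\<^sup>2 * (f x)\<^sup>2 + 2 * (s * t) * (f x * h x) + t\<^sup>2 * (h x)\<^sup>2)"
      by (auto simp: power2_eq_square algebra_simps)
    also have "(LINT x|M. s\<^sup>2 * (f x)\<^sup>2 + 2 * (s * t) * (f x * h x) + t\<^sup>2 * (h x)\<^sup>2) = s\<^sup>2 * P + 2 * (s * t) * R + t\<^sup>2 * Q"
      unfolding P_def Q_def R_def using f h i by simp
    finally show ?thesis .
  qed
  have "R\<^sup>2 \<le> P * Q" by (rule quadratic_discriminant[OF quad])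
  then have "sqrt (R\<^sup>2) \<le> sqrt (P * Q)" by (rule real_sqrt_le_mono)
  then show "\<bar>LINT x|M. f x * h x\<bar> \<le> sqrt (LINT x|M. (f x)\<^sup>2) * sqrt (LINT x|M. (h x)\<^sup>2)"
    by (simp add: P_def Q_def R_def real_sqrt_mult)
qed

lemma H10_cmult_iff: "c \<noteq> 0 \<Longrightarrow> (\<lambda>x. of_real c * f x) \<in> H10 L \<longleftrightarrow> f \<in> H10 L"
  using H10_cmult[of "\<lambda>x. of_real c * f x" L "1 / c"] H10_cmult[of f L c] by auto

context kernel
begin

text \<open>Absorbing the root of the weight turns \<open>L2g\<close> into an ordinary L2 space of
  functions with values in \<open>ltwo\<close>; where \<open>g\<close> vanishes the value is 0,
  whatever \<eta> is there.\<close>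

definition dg :: "real \<Rightarrow> (real \<Rightarrow> real \<Rightarrow> complex) \<Rightarrow> real \<Rightarrow> ltwo" where
  "dg L \<eta> s = d L (\<lambda>x. of_real (sqrt (g s)) * \<eta> s x)"

lemma g_measurable: "g \<in> borel_measurable halfline"
  using g_integrable by auto

lemma sqrt_g_measurable: "(\<lambda>s. sqrt (g s)) \<in> borel_measurable halfline"
  by (rule measurable_compose[OF g_measurable borel_measurable_sqrt])

lemma halfline_space: "s \<in> space halfline \<longleftrightarrow> 0 \<le> s"
  by (simp add: space_restrict_space)

lemma AE_halfline_pos: "AE s in halfline. 0 \<le> s"
  by (rule AE_I2) (simp add: halfline_space)

lemma L2g_iff: "\<eta> \<in> L2g L g \<longleftrightarrow> strongly_measurable L (\<lambda>s x. of_real (sqrt (g s)) * \<eta> s x) \<and>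
    integrable halfline (\<lambda>s. (norm (dg L \<eta> s))\<^sup>2)"
proof -
  have "integrable halfline (\<lambda>s. (H10_norm L (\<lambda>x. of_real (sqrt (g s)) * \<eta> s x))\<^sup>2) \<longleftrightarrow> integrable halfline (\<lambda>s. (norm (dg L \<eta> s))\<^sup>2)"
    if sm: "strongly_measurable L (\<lambda>s x. of_real (sqrt (g s)) * \<eta> s x)"
  proof -
    have m: "(\<lambda>s. (norm (dg L \<eta> s))\<^sup>2) \<in> borel_measurable halfline"
      using strongly_measurable_d[OF sm] unfolding dg_def by measurable
    have ae: "AE s in halfline. (norm (dg L \<eta> s))\<^sup>2 = (H10_norm L (\<lambda>x. of_real (sqrt (g s)) * \<eta> s x))\<^sup>2"
      using strongly_measurable_AE[OF sm] by eventually_elim (simp add: dg_def H10_norm_eq H10_H1)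
    show ?thesis
      using integrable_cong_AE[OF m measurable_AE_halfline[OF m ae] ae] by simp
  qed
  then show ?thesis by (auto simp: L2g_def L2_H10_def)
qed

lemma L2g_sm: "\<eta> \<in> L2g L g \<Longrightarrow> strongly_measurable L (\<lambda>s x. of_real (sqrt (g s)) * \<eta> s x)"
  and dg_sq_integrable: "\<eta> \<in> L2g L g \<Longrightarrow> integrable halfline (\<lambda>s. (norm (dg L \<eta> s))\<^sup>2)"
  by (auto simp: L2g_iff)

lemma dg_measurable: "\<eta> \<in> L2g L g \<Longrightarrow> dg L \<eta> \<in> borel_measurable halfline"
  using strongly_measurable_d[OF L2g_sm] unfolding dg_def[abs_def] .

lemma dg_zero: "g s = 0 \<Longrightarrow> dg L \<eta> s = 0"
  by (simp add: dg_def d_zero)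

lemma L2g_AE: "\<eta> \<in> L2g L g \<Longrightarrow> AE s in halfline. g s > 0 \<longrightarrow> \<eta> s \<in> H10 L \<and> dg L \<eta> s = sqrt (g s) *\<^sub>R d L (\<eta> s)"
proof -
  assume "\<eta> \<in> L2g L g"
  from strongly_measurable_AE[OF L2g_sm[OF this]] show ?thesis
  proof eventually_elim
    case (elim s)
    then show ?case using H10_cmult_iff[of "sqrt (g s)" "\<eta> s" L] by (auto simp: dg_def d_cmult H10_H1)
  qed
qed

lemma L2g_norm_eq:
  assumes "\<eta> \<in> L2g L g" shows "(L2g_norm L g \<eta>)\<^sup>2 = (LINT s|halfline. (norm (dg L \<eta> s))\<^sup>2)"
proof -
  have m: "(\<lambda>s. (norm (dg L \<eta> s))\<^sup>2) \<in> borel_measurable halfline"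
    using dg_measurable[OF assms] by measurable
  have ae: "AE s in halfline. (norm (dg L \<eta> s))\<^sup>2 = g s * (H10_norm L (\<eta> s))\<^sup>2"
    using L2g_AE[OF assms] AE_halfline_pos
  proof eventually_elim
    case (elim s)
    show ?case
    proof (cases "g s = 0")
      case False
      then have "g s > 0" using g_nonneg[of s] elim by simp
      then show ?thesis using elim by (simp add: H10_norm_eq H10_H1 power_mult_distrib)
    qed (simp add: dg_zero)
  qed
  have "(LINT s|halfline. (norm (dg L \<eta> s))\<^sup>2) = (LINT s|halfline. g s * (H10_norm L (\<eta> s))\<^sup>2)"
    by (rule integral_cong_AE[OF m measurable_AE_halfline[OF m ae] ae])
  moreover have "0 \<le> (LINT s|halfline. (norm (dg L \<eta> s))\<^sup>2)" by (rule integral_nonneg_AE) simp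
  ultimately show ?thesis by (simp add: L2g_norm_def)
qed

lemma dg_lincomb:
  assumes "\<eta> \<in> L2g L g" "\<zeta> \<in> L2g L g"
  shows "AE s in halfline. dg L (\<lambda>s x. of_real a * \<eta> s x + of_real c * \<zeta> s x) s = a *\<^sub>R dg L \<eta> s + c *\<^sub>R dg L \<zeta> s"
    "(\<lambda>s x. of_real a * \<eta> s x + of_real c * \<zeta> s x) \<in> L2g L g"
proof -
  note sm = L2g_sm[OF assms(1)] L2g_sm[OF assms(2)]
  have c: "(\<lambda>s. a) \<in> borel_measurable halfline" for a :: real by simp
  note sm' = strongly_measurable_add[OF strongly_measurable_mult[OF c sm(1), of a] strongly_measurable_mult[OF c sm(2), of c]]
  have eq: "(\<lambda>s x. complex_of_real a * (of_real (sqrt (g s)) * \<eta> s x) + of_real c * (of_real (sqrt (g s)) * \<zeta> s x))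
    = (\<lambda>s x. of_real (sqrt (g s)) * (of_real a * \<eta> s x + of_real c * \<zeta> s x))"
    by (simp add: fun_eq_iff algebra_simps)
  note sm'' = sm'[unfolded eq]
  show ae: "AE s in halfline. dg L (\<lambda>s x. of_real a * \<eta> s x + of_real c * \<zeta> s x) s = a *\<^sub>R dg L \<eta> s + c *\<^sub>R dg L \<zeta> s"
    using strongly_measurable_AE[OF sm(1)] strongly_measurable_AE[OF sm(2)]
  proof eventually_elim
    case (elim s)
    have "dg L (\<lambda>s x. of_real a * \<eta> s x + of_real c * \<zeta> s x) s
      = d L (\<lambda>x. of_real a * (of_real (sqrt (g s)) * \<eta> s x) + of_real c * (of_real (sqrt (g s)) * \<zeta> s x))"
      unfolding dg_def using fun_cong[OF eq, of s] by simp
    also have "\<dots> = a *\<^sub>R dg L \<eta> s + c *\<^sub>R dg L \<zeta> s"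
      unfolding dg_def using elim by (simp add: d_add d_cmult H1_cmult H10_H1)
    finally show ?case .
  qed
  have m: "(\<lambda>s. (norm (dg L (\<lambda>s x. of_real a * \<eta> s x + of_real c * \<zeta> s x) s))\<^sup>2) \<in> borel_measurable halfline"
    using strongly_measurable_d[OF sm''] unfolding dg_def by measurable
  have "integrable halfline (\<lambda>s. (norm (dg L (\<lambda>s x. of_real a * \<eta> s x + of_real c * \<zeta> s x) s))\<^sup>2)"
  proof (rule Bochner_Integration.integrable_bound[OF _ m])
    show "integrable halfline (\<lambda>s. 2 * (a\<^sup>2 * (norm (dg L \<eta> s))\<^sup>2) + 2 * (c\<^sup>2 * (norm (dg L \<zeta> s))\<^sup>2))"
      using dg_sq_integrable[OF assms(1)] dg_sq_integrable[OF assms(2)] by simp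
    show "AE s in halfline. norm ((norm (dg L (\<lambda>s x. of_real a * \<eta> s x + of_real c * \<zeta> s x) s))\<^sup>2) \<le> norm (2 * (a\<^sup>2 * (norm (dg L \<eta> s))\<^sup>2) + 2 * (c\<^sup>2 * (norm (dg L \<zeta> s))\<^sup>2))"
      using ae
    proof eventually_elim
      case (elim s)
      show ?case unfolding elim using norm_add_sq_le[of "a *\<^sub>R dg L \<eta> s" "c *\<^sub>R dg L \<zeta> s"]
        by (simp add: power_mult_distrib)
    qed
  qed
  then show "(\<lambda>s x. of_real a * \<eta> s x + of_real c * \<zeta> s x) \<in> L2g L g"
    using sm'' by (simp add: L2g_iff)
qed

definition G :: "real \<Rightarrow> (real \<Rightarrow> real \<Rightarrow> complex) \<Rightarrow> (real \<Rightarrow> real \<Rightarrow> complex) \<Rightarrow> real" where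
  "G L \<eta> \<zeta> = (LINT s|halfline. dg L \<eta> s \<bullet> dg L \<zeta> s)"

lemma dg_inner_integrable:
  assumes "\<eta> \<in> L2g L g" "\<zeta> \<in> L2g L g" shows "integrable halfline (\<lambda>s. dg L \<eta> s \<bullet> dg L \<zeta> s)"
proof (rule Bochner_Integration.integrable_bound)
  show "integrable halfline (\<lambda>s. norm (dg L \<eta> s) * norm (dg L \<zeta> s))"
    using dg_measurable[OF assms(1)] dg_measurable[OF assms(2)] dg_sq_integrable[OF assms(1)] dg_sq_integrable[OF assms(2)]
    by (intro Cauchy_Schwarz_integral(1)) (auto intro: measurable_compose[OF _ borel_measurable_norm])
  show "(\<lambda>s. dg L \<eta> s \<bullet> dg L \<zeta> s) \<in> borel_measurable halfline"
    using dg_measurable[OF assms(1)] dg_measurable[OF assms(2)] by (rule borel_measurable_inner)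
  show "AE s in halfline. norm (dg L \<eta> s \<bullet> dg L \<zeta> s) \<le> norm (norm (dg L \<eta> s) * norm (dg L \<zeta> s))"
    by (rule AE_I2) (simp add: Cauchy_Schwarz_ineq2)
qed

lemma G_sym: "G L \<eta> \<zeta> = G L \<zeta> \<eta>" by (simp add: G_def inner_commute)

lemma G_lincomb:
  assumes "\<eta> \<in> L2g L g" "\<zeta> \<in> L2g L g" "\<xi> \<in> L2g L g"
  shows "G L (\<lambda>s x. of_real a * \<eta> s x + of_real c * \<zeta> s x) \<xi> = a * G L \<eta> \<xi> + c * G L \<zeta> \<xi>"
proof -
  have "G L (\<lambda>s x. of_real a * \<eta> s x + of_real c * \<zeta> s x) \<xi> = (LINT s|halfline. a * (dg L \<eta> s \<bullet> dg L \<xi> s) + c * (dg L \<zeta> s \<bullet> dg L \<xi> s))"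
    unfolding G_def
  proof (rule integral_cong_AE)
    show "AE s in halfline. dg L (\<lambda>s x. of_real a * \<eta> s x + of_real c * \<zeta> s x) s \<bullet> dg L \<xi> s = a * (dg L \<eta> s \<bullet> dg L \<xi> s) + c * (dg L \<zeta> s \<bullet> dg L \<xi> s)"
      using dg_lincomb(1)[OF assms(1,2), of a c] by eventually_elim (simp add: inner_add_left)
    show "(\<lambda>s. dg L (\<lambda>s x. of_real a * \<eta> s x + of_real c * \<zeta> s x) s \<bullet> dg L \<xi> s) \<in> borel_measurable halfline"
      by (rule borel_measurable_integrable[OF dg_inner_integrable[OF dg_lincomb(2)[OF assms(1,2)] assms(3)]])
    show "(\<lambda>s. a * (dg L \<eta> s \<bullet> dg L \<xi> s) + c * (dg L \<zeta> s \<bullet> dg L \<xi> s)) \<in> borel_measurable halfline"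
      using dg_inner_integrable[OF assms(1,3)] dg_inner_integrable[OF assms(2,3)] by auto
  qed
  also have "\<dots> = a * G L \<eta> \<xi> + c * G L \<zeta> \<xi>"
    unfolding G_def using dg_inner_integrable[OF assms(1,3)] dg_inner_integrable[OF assms(2,3)] by simp
  finally show ?thesis .
qed

lemma G_self: "\<eta> \<in> L2g L g \<Longrightarrow> G L \<eta> \<eta> = (L2g_norm L g \<eta>)\<^sup>2"
  by (simp add: G_def L2g_norm_eq power2_norm_eq_inner)

lemma L2g_norm_nonneg: "0 \<le> L2g_norm L g \<eta>"
  unfolding L2g_norm_def
proof (intro real_sqrt_ge_zero integral_nonneg_AE)
  show "AE s in halfline. 0 \<le> g s * (H10_norm L (\<eta> s))\<^sup>2"
    using AE_halfline_pos by eventually_elim (simp add: g_nonneg)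
qed

text \<open>By the Cauchy--Schwarz inequality these are weights for which the weighted integral of a memory
  variable is a bounded operation on \<open>L2g\<close>.\<close>

definition admissible :: "(real \<Rightarrow> real) \<Rightarrow> bool" where
  "admissible k \<longleftrightarrow> k \<in> borel_measurable halfline \<and> (\<forall>s\<ge>0. g s = 0 \<longrightarrow> k s = 0) \<and>
     integrable halfline (\<lambda>s. (k s / sqrt (g s))\<^sup>2)"

definition wint :: "real \<Rightarrow> (real \<Rightarrow> real) \<Rightarrow> (real \<Rightarrow> real \<Rightarrow> complex) \<Rightarrow> real \<Rightarrow> complex" where
  "wint L k \<eta> = integral_H10 L (\<lambda>s x. of_real (k s) * \<eta> s x)"

lemma admissible_g: "admissible g"
proof -
  have ae: "AE s in halfline. g s = (g s / sqrt (g s))\<^sup>2"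
    using AE_halfline_pos by eventually_elim (use g_nonneg in \<open>auto simp: power_divide power2_eq_square\<close>)
  have "integrable halfline (\<lambda>s. (g s / sqrt (g s))\<^sup>2)"
    using integrable_cong_AE[OF g_measurable measurable_AE_halfline[OF g_measurable ae] ae] g_integrable by simp
  then show ?thesis by (auto simp: admissible_def g_measurable)
qed

text \<open>All claims come from writing \<open>k \<eta>\<close> as \<open>k / sqrt g\<close> times
  \<open>sqrt g \<eta>\<close> and from Cauchy-Schwarz. At zeros of \<open>g\<close> the quotient is
  0 by convention, which is consistent because \<open>k\<close> vanishes there too.\<close>

lemma admissible_mult:
  assumes k: "admissible k" and \<eta>: "\<eta> \<in> L2g L g"
  shows "AE s in halfline. (\<lambda>x. of_real (k s) * \<eta> s x) \<in> H10 L \<and> d L (\<lambda>x. of_real (k s) * \<eta> s x) = (k s / sqrt (g s)) *\<^sub>R dg L \<eta> s"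
    "strongly_measurable L (\<lambda>s x. of_real (k s) * \<eta> s x)"
    "integrable halfline (\<lambda>s. d L (\<lambda>x. of_real (k s) * \<eta> s x))"
    "integrable halfline (\<lambda>s. (k s / sqrt (g s)) *\<^sub>R dg L \<eta> s)"
    "(LINT s|halfline. d L (\<lambda>x. of_real (k s) * \<eta> s x)) = (LINT s|halfline. (k s / sqrt (g s)) *\<^sub>R dg L \<eta> s)"
    "norm (LINT s|halfline. (k s / sqrt (g s)) *\<^sub>R dg L \<eta> s) \<le> sqrt (LINT s|halfline. (k s / sqrt (g s))\<^sup>2) * L2g_norm L g \<eta>"
proof -
  have kg: "(\<lambda>s. k s / sqrt (g s)) \<in> borel_measurable halfline"
    using k sqrt_g_measurable by (auto simp: admissible_def)
  have k2: "integrable halfline (\<lambda>s. (k s / sqrt (g s))\<^sup>2)" using k by (simp add: admissible_def)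
  have eq: "(\<lambda>x. of_real (k s) * \<eta> s x) = (\<lambda>x. of_real (k s / sqrt (g s)) * (of_real (sqrt (g s)) * \<eta> s x))" if "s \<ge> 0" for s
    using k that g_nonneg[OF that] by (cases "g s = 0") (auto simp: admissible_def fun_eq_iff)
  show ae: "AE s in halfline. (\<lambda>x. of_real (k s) * \<eta> s x) \<in> H10 L \<and> d L (\<lambda>x. of_real (k s) * \<eta> s x) = (k s / sqrt (g s)) *\<^sub>R dg L \<eta> s"
    using strongly_measurable_AE[OF L2g_sm[OF \<eta>]] AE_halfline_pos
  proof eventually_elim
    case (elim s)
    then show ?case unfolding eq[OF elim(2)] dg_def by (auto simp only: H10_cmult d_cmult H10_H1)
  qed
  have sm: "strongly_measurable L (\<lambda>s x. of_real (k s / sqrt (g s)) * (of_real (sqrt (g s)) * \<eta> s x))"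
    by (rule strongly_measurable_mult[OF kg L2g_sm[OF \<eta>]])
  show sm': "strongly_measurable L (\<lambda>s x. of_real (k s) * \<eta> s x)"
  proof (rule strongly_measurable_AE_cong[OF sm])
    show "AE s in halfline. (\<lambda>x. of_real (k s) * \<eta> s x) \<in> H10 L" using ae by eventually_elim simp
    show "AE s in halfline. d L (\<lambda>x. of_real (k s / sqrt (g s)) * (of_real (sqrt (g s)) * \<eta> s x)) = d L (\<lambda>x. of_real (k s) * \<eta> s x)"
      using AE_halfline_pos by eventually_elim (simp only: eq)
  qed
  have am: "(\<lambda>s. \<bar>k s / sqrt (g s)\<bar>) \<in> borel_measurable halfline"
    using kg by (rule borel_measurable_abs)
  have a2: "integrable halfline (\<lambda>s. \<bar>k s / sqrt (g s)\<bar>\<^sup>2)" using k2 by (simp only: power2_abs)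
  note bnd = Cauchy_Schwarz_integral[OF am a2 measurable_compose[OF dg_measurable[OF \<eta>] borel_measurable_norm] dg_sq_integrable[OF \<eta>]]
  show i: "integrable halfline (\<lambda>s. (k s / sqrt (g s)) *\<^sub>R dg L \<eta> s)"
  proof (rule Bochner_Integration.integrable_bound[OF bnd(1)])
    show "(\<lambda>s. (k s / sqrt (g s)) *\<^sub>R dg L \<eta> s) \<in> borel_measurable halfline"
      using kg dg_measurable[OF \<eta>] by (rule borel_measurable_scaleR)
  qed (rule AE_I2, simp)
  have m: "(\<lambda>s. d L (\<lambda>x. of_real (k s) * \<eta> s x)) \<in> borel_measurable halfline" by (rule strongly_measurable_d[OF sm'])
  have ae': "AE s in halfline. (k s / sqrt (g s)) *\<^sub>R dg L \<eta> s = d L (\<lambda>x. of_real (k s) * \<eta> s x)"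
    using ae by eventually_elim simp
  show "integrable halfline (\<lambda>s. d L (\<lambda>x. of_real (k s) * \<eta> s x))"
    using integrable_cong_AE[OF borel_measurable_integrable[OF i] m ae'] i by simp
  show "(LINT s|halfline. d L (\<lambda>x. of_real (k s) * \<eta> s x)) = (LINT s|halfline. (k s / sqrt (g s)) *\<^sub>R dg L \<eta> s)"
    by (rule integral_cong_AE[OF borel_measurable_integrable[OF i] m ae', symmetric])
  have "norm (LINT s|halfline. (k s / sqrt (g s)) *\<^sub>R dg L \<eta> s) \<le> (LINT s|halfline. norm ((k s / sqrt (g s)) *\<^sub>R dg L \<eta> s))"
    by (rule integral_norm_bound)
  also have "\<dots> \<le> sqrt (LINT s|halfline. (k s / sqrt (g s))\<^sup>2) * sqrt (LINT s|halfline. (norm (dg L \<eta> s))\<^sup>2)"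
    using bnd(2) by (simp only: power2_abs norm_scaleR abs_le_iff)
  also have "sqrt (LINT s|halfline. (norm (dg L \<eta> s))\<^sup>2) = L2g_norm L g \<eta>"
    unfolding L2g_norm_eq[OF \<eta>, symmetric] using L2g_norm_nonneg by simp
  finally show "norm (LINT s|halfline. (k s / sqrt (g s)) *\<^sub>R dg L \<eta> s) \<le> sqrt (LINT s|halfline. (k s / sqrt (g s))\<^sup>2) * L2g_norm L g \<eta>" .
qed

lemma wint:
  assumes "admissible k" "\<eta> \<in> L2g L g"
  shows "wint L k \<eta> \<in> H10 L" "d L (wint L k \<eta>) = (LINT s|halfline. (k s / sqrt (g s)) *\<^sub>R dg L \<eta> s)"
  unfolding wint_def using integral_H10[OF admissible_mult(2,3)[OF assms]] admissible_mult(5)[OF assms] by auto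

lemma wint_bound:
  assumes "admissible k" "\<eta> \<in> L2g L g"
  shows "norm (d L (wint L k \<eta>)) \<le> sqrt (LINT s|halfline. (k s / sqrt (g s))\<^sup>2) * L2g_norm L g \<eta>"
  using admissible_mult(6)[OF assms] wint(2)[OF assms] by simp

lemma wint_lincomb:
  assumes k: "admissible k" and \<eta>: "\<eta> \<in> L2g L g" "\<zeta> \<in> L2g L g"
  shows "d L (wint L k (\<lambda>s x. of_real a * \<eta> s x + of_real c * \<zeta> s x)) = a *\<^sub>R d L (wint L k \<eta>) + c *\<^sub>R d L (wint L k \<zeta>)"
proof -
  note i = admissible_mult(4)[OF k \<eta>(1)] admissible_mult(4)[OF k \<eta>(2)]
  have "d L (wint L k (\<lambda>s x. of_real a * \<eta> s x + of_real c * \<zeta> s x)) =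
      (LINT s|halfline. a *\<^sub>R ((k s / sqrt (g s)) *\<^sub>R dg L \<eta> s) + c *\<^sub>R ((k s / sqrt (g s)) *\<^sub>R dg L \<zeta> s))"
    unfolding wint(2)[OF k dg_lincomb(2)[OF \<eta>]]
  proof (rule integral_cong_AE)
    show "AE s in halfline. (k s / sqrt (g s)) *\<^sub>R dg L (\<lambda>s x. of_real a * \<eta> s x + of_real c * \<zeta> s x) s = a *\<^sub>R ((k s / sqrt (g s)) *\<^sub>R dg L \<eta> s) + c *\<^sub>R ((k s / sqrt (g s)) *\<^sub>R dg L \<zeta> s)"
      using dg_lincomb(1)[OF \<eta>, of a c] by eventually_elim (simp add: scaleR_add_right mult.commute)
    show "(\<lambda>s. a *\<^sub>R ((k s / sqrt (g s)) *\<^sub>R dg L \<eta> s) + c *\<^sub>R ((k s / sqrt (g s)) *\<^sub>R dg L \<zeta> s)) \<in> borel_measurable halfline"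
      using i by (intro borel_measurable_integrable Bochner_Integration.integrable_add integrable_scaleR_right)
  qed (rule borel_measurable_integrable[OF admissible_mult(4)[OF k dg_lincomb(2)[OF \<eta>]]])
  also have "\<dots> = (LINT s|halfline. a *\<^sub>R ((k s / sqrt (g s)) *\<^sub>R dg L \<eta> s)) + (LINT s|halfline. c *\<^sub>R ((k s / sqrt (g s)) *\<^sub>R dg L \<zeta> s))"
    by (intro Bochner_Integration.integral_add integrable_scaleR_right i)
  also have "\<dots> = a *\<^sub>R d L (wint L k \<eta>) + c *\<^sub>R d L (wint L k \<zeta>)"
    unfolding wint(2)[OF k \<eta>(1)] wint(2)[OF k \<eta>(2)] by (simp only: integral_scaleR_right)
  finally show ?thesis .
qed

lemma L2g_const:
  assumes "y \<in> H10 L" shows "(\<lambda>s. y) \<in> L2g L g" "s \<ge> 0 \<Longrightarrow> dg L (\<lambda>s. y) s = sqrt (g s) *\<^sub>R d L y"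
proof -
  show dg: "dg L (\<lambda>s. y) s = sqrt (g s) *\<^sub>R d L y" for s
    using assms by (simp add: dg_def d_cmult H10_H1)
  have ae: "AE s in halfline. g s * (norm (d L y))\<^sup>2 = (norm (dg L (\<lambda>s. y) s))\<^sup>2"
    using AE_halfline_pos by eventually_elim (simp add: dg power_mult_distrib g_nonneg)
  have i: "integrable halfline (\<lambda>s. g s * (norm (d L y))\<^sup>2)" using g_integrable by simp
  have "integrable halfline (\<lambda>s. (norm (dg L (\<lambda>s. y) s))\<^sup>2)"
    using integrable_cong_AE[OF borel_measurable_integrable[OF i] measurable_AE_halfline[OF borel_measurable_integrable[OF i] ae] ae] i by simp
  moreover have "strongly_measurable L (\<lambda>s x. of_real (sqrt (g s)) * y x)"
    by (rule strongly_measurable_mult[OF sqrt_g_measurable strongly_measurable_const[OF assms]])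
  ultimately show "(\<lambda>s. y) \<in> L2g L g" by (simp add: L2g_iff)
qed

end

context kernel
begin

text \<open>The compact support lies where \<open>g > 0\<close>, so \<open>g\<close> is bounded away
  from 0 on it and the square of \<open>k / sqrt g\<close> is continuous there.\<close>

lemma admissible_test:
  assumes tf: "(\<lambda>s. of_real (k s)) \<in> test_J"
  shows "admissible k"
proof -
  obtain K where K: "compact K" "K \<subseteq> {s. 0 < s \<and> 0 < g s}" "\<And>s. s \<notin> K \<Longrightarrow> of_real (k s) = (0::complex)"
    using tf unfolding test_functions_def by blast
  have kz: "k s = 0" if "s \<notin> K" for s using K(3)[OF that] by simp
  have cont: "continuous_on UNIV k"
    using continuous_on_Re[OF smooth_continuous[OF test_functions_smooth[OF tf], of UNIV]] by simp
  have km: "k \<in> borel_measurable halfline"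
  proof -
    have "k \<in> borel_measurable lebesgue"
      using borel_measurable_continuous_onI[OF cont] by (metis measurable_completion measurable_lborel2)
    then show ?thesis by (rule measurable_restrict_space1)
  qed
  have Kc: "continuous_on K (\<lambda>s. (k s / sqrt (g s))\<^sup>2)"
    using K(2) by (intro continuous_intros continuous_on_subset[OF cont] continuous_on_subset[OF g_cont]) auto
  have "integrable lborel (\<lambda>s. indicator K s *\<^sub>R (k s / sqrt (g s))\<^sup>2)"
    by (rule borel_integrable_compact[OF K(1) Kc])
  moreover have "(\<lambda>s. indicator K s *\<^sub>R (k s / sqrt (g s))\<^sup>2) = (\<lambda>s. indicator {0..} s *\<^sub>R (k s / sqrt (g s))\<^sup>2)"
  proof
    fix s show "indicator K s *\<^sub>R (k s / sqrt (g s))\<^sup>2 = indicator {0..} s *\<^sub>R (k s / sqrt (g s))\<^sup>2"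
      using kz[of s] K(2) by (cases "s \<in> K") (auto simp: indicator_def)
  qed
  ultimately have "integrable halfline (\<lambda>s. (k s / sqrt (g s))\<^sup>2)"
    by (simp add: halfline_integrable integrable_completion borel_measurable_integrable)
  moreover have "k s = 0" if "g s = 0" for s using kz[of s] K(2) that by (cases "s \<in> K") auto
  ultimately show ?thesis using km by (simp add: admissible_def)
qed

text \<open>The witness \<open>w\<close> in the definition is matched with the chosen integral
  \<open>wint\<close> by uniqueness of the Bochner integral of the derivatives.\<close>

lemma weak_s_derivative:
  assumes sd: "has_s_deriv L g \<eta> \<zeta>" and tf: "(\<lambda>s. of_real (k s)) \<in> test_J"
    and k': "\<And>s. (k has_real_derivative k' s) (at s)"
  shows "admissible k'" "d L (wint L k' \<eta>) = - d L (wint L k \<zeta>)"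
proof -
  have vd: "vector_derivative (\<lambda>s. of_real (k s)) (at s) = complex_of_real (k' s)" for s
    by (rule vector_derivative_at[OF has_vector_derivative_of_real[OF k']])
  have "(\<lambda>s. complex_of_real (k' s)) \<in> test_J"
    using test_functions_deriv[OF tf] by (simp add: vd)
  then show ak': "admissible k'" by (rule admissible_test)
  have ak: "admissible k" by (rule admissible_test[OF tf])
  have \<eta>: "\<eta> \<in> L2g L g" "\<zeta> \<in> L2g L g" using sd by (auto simp: has_s_deriv_def)
  obtain w where w: "has_integral_H10 L (\<lambda>s x. of_real (k' s) * \<eta> s x) w"
    "has_integral_H10 L (\<lambda>s x. of_real (k s) * \<zeta> s x) (\<lambda>x. - w x)"
    using sd tf unfolding has_s_deriv_def by (auto simp: vd dest!: bspec)
  have wH: "w \<in> H10 L" using w by (auto simp: has_integral_H10_def)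
  have "d L w = (LINT s|halfline. d L (\<lambda>x. of_real (k' s) * \<eta> s x))"
    by (rule has_bochner_integral_integral_eq[OF has_integral_H10_bochner[OF w(1)], symmetric])
  moreover have "d L (\<lambda>x. - w x) = (LINT s|halfline. d L (\<lambda>x. of_real (k s) * \<zeta> s x))"
    by (rule has_bochner_integral_integral_eq[OF has_integral_H10_bochner[OF w(2)], symmetric])
  ultimately have "d L (wint L k' \<eta>) = d L w" "d L (wint L k \<zeta>) = d L (\<lambda>x. - w x)"
    using wint(2)[OF ak' \<eta>(1)] wint(2)[OF ak \<eta>(2)] admissible_mult(5)[OF ak' \<eta>(1)] admissible_mult(5)[OF ak \<eta>(2)] by simp_all
  moreover have "d L (\<lambda>x. - w x) = - d L w" using d_cmult[of w L "-1"] wH by (simp add: H10_H1)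
  ultimately show "d L (wint L k' \<eta>) = - d L (wint L k \<zeta>)" by simp
qed

text \<open>The integral of this weight becomes, up to a density, the coefficient of the squared
  norm of \<Psi> in the first multiplier, so it must be positive. \<open>J\<close> contains an
  interval (0,s0) on which a bump can be placed.\<close>

lemma positive_weight:
  obtains k where "(\<lambda>s. of_real (k s)) \<in> test_J" "0 < (LINT s|halfline. k s)" "integrable halfline k"
proof -
  obtain s0 where s0: "0 < s0" "s0 \<in> J" using J_right[OF J_0] by blast
  obtain n :: nat where "2 / s0 < real n" using reals_Archimedean2 by blast
  then have "2 < real n * s0" using s0 by (simp add: field_simps)
  also have "\<dots> \<le> real (Suc n) * s0" using s0 by (intro mult_right_mono) auto
  finally have n: "2 < real (Suc n) * (s0 - 0)" by simp
  have sub: "{0<..<s0} \<subseteq> {s. 0 < s \<and> 0 < g s}" using J_down[OF s0(2)] by (force simp: J_def)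
  have tf: "(\<lambda>s. of_real (bump 0 s0 n s)) \<in> test_J" by (rule test_functions_bump[OF sub])
  have eq: "(\<lambda>s. indicator {0..} s *\<^sub>R bump 0 s0 n s) = bump 0 s0 n"
  proof
    fix s
    have "(of_real (bump 0 s0 n s) :: complex) = 0" if "s < 0" using test_functions_outside[OF tf, of s] that by auto
    then show "indicator {0..} s *\<^sub>R bump 0 s0 n s = bump 0 s0 n s" by (cases "s < 0") auto
  qed
  show thesis
    using that[OF tf] bump_integral_pos[OF n] by (simp add: halfline_integral halfline_integrable eq del: real_scaleR_def)
qed

lemma wint_const:
  assumes tf: "(\<lambda>s. of_real (k s)) \<in> test_J" and k: "integrable halfline k" and y: "y \<in> H10 L"
  shows "d L (wint L k (\<lambda>s. y)) = (LINT s|halfline. k s) *\<^sub>R d L y"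
proof -
  note ak = admissible_test[OF tf]
  have "d L (wint L k (\<lambda>s. y)) = (LINT s|halfline. d L (\<lambda>x. of_real (k s) * y x))"
    using wint(2)[OF ak L2g_const(1)[OF y]] admissible_mult(5)[OF ak L2g_const(1)[OF y]] by simp
  also have "\<dots> = (LINT s|halfline. k s *\<^sub>R d L y)" using y by (simp add: d_cmult H10_H1)
  finally show ?thesis using k by simp
qed

text \<open>The abstract inequality is applied to the derivative of the continuous representative
  from \<open>zero_initial_trace\<close> and to the s-derivative with its weight divided out. On the
  half-line outside \<open>J\<close> both are 0, for the quotient because division by 0 gives
  0.\<close>

lemma memory_dissipative:
  assumes sd: "has_s_deriv L g \<eta> \<zeta>" and tr: "zero_initial_trace L g \<eta>"
  shows "\<kappa>\<^sub>1 * G L \<eta> \<eta> \<le> 2 * G L \<zeta> \<eta>"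
proof -
  have \<eta>: "\<eta> \<in> L2g L g" "\<zeta> \<in> L2g L g" using sd by (auto simp: has_s_deriv_def)
  have Jeq: "{s. 0 \<le> s \<and> 0 < g s} = J" by (simp add: J_def)
  obtain e where e: "\<And>s. s \<in> J \<Longrightarrow> e s \<in> H10 L"
    "AE s in halfline. s \<in> J \<longrightarrow> H10_norm L (\<lambda>x. \<eta> s x - e s x) = 0"
    "\<And>s. s \<in> J \<Longrightarrow> ((\<lambda>r. H10_norm L (\<lambda>x. e r x - e s x)) \<longlongrightarrow> 0) (at s within J)" "H10_norm L (e 0) = 0"
    using tr unfolding zero_initial_trace_def Let_def Jeq by blast
  define p where "p s = (if s \<in> J then d L (e s) else 0)" for s
  define z where "z s = (1 / sqrt (g s)) *\<^sub>R dg L \<zeta> s" for s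
  have Jiff: "s \<in> J \<longleftrightarrow> g s \<noteq> 0" if "0 \<le> s" for s using g_nonneg[OF that] that by (auto simp: J_def)
  have pae: "AE s in halfline. s \<in> J \<longrightarrow> dg L \<eta> s = sqrt (g s) *\<^sub>R p s"
    using L2g_AE[OF \<eta>(1)] e(2)
  proof eventually_elim
    case (elim s)
    show ?case
    proof
      assume s: "s \<in> J"
      then have "\<eta> s \<in> H10 L" "dg L \<eta> s = sqrt (g s) *\<^sub>R d L (\<eta> s)" "norm (d L (\<eta> s) - d L (e s)) = 0"
        using elim e(1)[OF s] H10_norm_diff[of "\<eta> s" L "e s"] by (auto simp: J_def)
      then show "dg L \<eta> s = sqrt (g s) *\<^sub>R p s" using s by (simp add: p_def)
    qed
  qed
  have pae': "AE s in halfline. dg L \<eta> s = sqrt (g s) *\<^sub>R p s"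
    using pae AE_halfline_pos by eventually_elim (use Jiff in \<open>auto simp: dg_zero\<close>)
  have zae: "AE s in halfline. dg L \<zeta> s = sqrt (g s) *\<^sub>R z s"
    using AE_halfline_pos by eventually_elim (auto simp: z_def dg_zero)
  have zm: "z \<in> borel_measurable halfline"
    unfolding z_def using sqrt_g_measurable dg_measurable[OF \<eta>(2)] by (intro borel_measurable_scaleR) auto
  have ae1: "AE s in halfline. (norm (dg L \<zeta> s))\<^sup>2 = g s * (norm (z s))\<^sup>2"
    using zae AE_halfline_pos by eventually_elim (simp add: power_mult_distrib g_nonneg)
  have ae2: "AE s in halfline. (norm (dg L \<eta> s))\<^sup>2 = g s * (norm (p s))\<^sup>2"
    using pae' AE_halfline_pos by eventually_elim (simp add: power_mult_distrib g_nonneg)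
  have ae3: "AE s in halfline. dg L \<zeta> s \<bullet> dg L \<eta> s = g s * (z s \<bullet> p s)"
    using pae' zae AE_halfline_pos by eventually_elim (simp add: g_nonneg)
  note i = dg_sq_integrable[OF \<eta>(2)] dg_sq_integrable[OF \<eta>(1)] dg_inner_integrable[OF \<eta>(2,1)]
  have tr: "integrable halfline f' \<and> (LINT s|halfline. f s) = (LINT s|halfline. f' s)"
    if "integrable halfline f" "AE s in halfline. f s = f' s" for f f' :: "real \<Rightarrow> real"
  proof -
    note m = borel_measurable_integrable[OF that(1)]
    note m' = measurable_AE_halfline[OF m that(2)]
    show ?thesis using integrable_cong_AE[OF m m' that(2)] integral_cong_AE[OF m m' that(2)] that(1) by simp
  qed
  have "\<kappa>\<^sub>1 * (LINT s|halfline. g s * (norm (p s))\<^sup>2) \<le> 2 * (LINT s|halfline. g s * (z s \<bullet> p s))"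
  proof (rule memory_dissipation[OF _ _ zm])
    show "continuous_on J p"
      unfolding continuous_on_def
    proof
      fix s assume s: "s \<in> J"
      have "((\<lambda>r. p r - p s) \<longlongrightarrow> 0) (at s within J)"
      proof (rule tendsto_norm_zero_cancel, rule Lim_transform_eventually[OF e(3)[OF s]])
        show "\<forall>\<^sub>F r in at s within J. H10_norm L (\<lambda>x. e r x - e s x) = norm (p r - p s)"
          using e(1) s by (auto simp: eventually_at_filter p_def H10_norm_diff)
      qed
      then show "(p \<longlongrightarrow> p s) (at s within J)" by (simp add: LIM_zero_iff)
    qed
    show "p 0 = 0" using e(4) e(1)[OF J_0] J_0 by (simp add: p_def H10_norm_eq H10_H1)
    show "integrable halfline (\<lambda>s. g s * (norm (z s))\<^sup>2)" "integrable halfline (\<lambda>s. g s * (norm (p s))\<^sup>2)"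
      "integrable halfline (\<lambda>s. g s * (z s \<bullet> p s))"
      using tr[OF i(1) ae1] tr[OF i(2) ae2] tr[OF i(3) ae3] by auto
    fix \<xi> \<xi>' :: "real \<Rightarrow> real"
    assume tf: "(\<lambda>s. complex_of_real (\<xi> s)) \<in> test_J"
      and der: "\<And>s. (\<xi> has_real_derivative \<xi>' s) (at s)"
    note W = weak_s_derivative[OF sd tf der]
    note ak = admissible_test[OF tf]
    have "(LINT s|halfline. \<xi>' s *\<^sub>R p s) = (LINT s|halfline. (\<xi>' s / sqrt (g s)) *\<^sub>R dg L \<eta> s)"
    proof (rule integral_cong_AE[symmetric])
      show m: "(\<lambda>s. (\<xi>' s / sqrt (g s)) *\<^sub>R dg L \<eta> s) \<in> borel_measurable halfline"
        by (rule borel_measurable_integrable[OF admissible_mult(4)[OF W(1) \<eta>(1)]])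
      show ae: "AE s in halfline. (\<xi>' s / sqrt (g s)) *\<^sub>R dg L \<eta> s = \<xi>' s *\<^sub>R p s"
        using pae' AE_halfline_pos
      proof eventually_elim
        case (elim s)
        then show ?case using W(1) by (cases "g s = 0") (auto simp: admissible_def)
      qed
      show "(\<lambda>s. \<xi>' s *\<^sub>R p s) \<in> borel_measurable halfline" by (rule measurable_AE_halfline[OF m ae])
    qed
    also have "\<dots> = - d L (wint L \<xi> \<zeta>)" using W(2) wint(2)[OF W(1) \<eta>(1)] by simp
    also have "d L (wint L \<xi> \<zeta>) = (LINT s|halfline. \<xi> s *\<^sub>R z s)"
      unfolding wint(2)[OF ak \<eta>(2)] by (simp add: z_def)
    finally show "(LINT s|halfline. \<xi>' s *\<^sub>R p s) = - (LINT s|halfline. \<xi> s *\<^sub>R z s)" .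
  qed
  then show ?thesis
    unfolding G_def using tr[OF i(2) ae2] tr[OF i(3) ae3] by (simp add: power2_norm_eq_inner)
qed

end

text \<open>The inverse of \<open>d L\<close> on \<open>H10 L\<close>, and in \<open>mprim\<close>
  on \<open>H1_mean0 L\<close>, as maps of classes. Both gain one derivative, which keeps the
  multipliers built from them bounded in the energy norm.\<close>

definition prim :: "real \<Rightarrow> ltwo \<Rightarrow> ltwo" where
  "prim L h = cl L (SOME p. p \<in> H10 L \<and> d L p = h)"

definition mprim :: "real \<Rightarrow> ltwo \<Rightarrow> ltwo" where
  "mprim L h = cl L (SOME r. r \<in> H1_mean0 L \<and> d L r = h)"

lemma prim_eq: "p \<in> H10 L \<Longrightarrow> d L p = h \<Longrightarrow> prim L h = cl L p"
  unfolding prim_def by (rule someI2[of _ p]) (auto intro: H10_cl_eq)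

lemma mprim_eq: 
  assumes "r \<in> H1_mean0 L" "d L r = h" "L > 0" shows "mprim L h = cl L r"
  unfolding mprim_def
proof (rule someI2[of _ r])
  fix r' assume r': "r' \<in> H1_mean0 L \<and> d L r' = h"
  then show "cl L r' = cl L r"
    using poincare_mean0[OF H1_mean0_diff[of r' L r] assms(3)] assms
    by (auto simp: cl_diff d_diff H1_mean0_def H1_L2)
qed (use assms in auto)

lemma L2_mean0_lincomb: "f \<in> L2_mean0 L \<Longrightarrow> g \<in> L2_mean0 L \<Longrightarrow> (\<lambda>x. a * f x + c * g x) \<in> L2_mean0 L"
  by (simp add: L2_mean0_iff L2_add L2_cmult integrable_L2)

lemma H1_mean0_lincomb: "f \<in> H1_mean0 L \<Longrightarrow> g \<in> H1_mean0 L \<Longrightarrow> (\<lambda>x. of_real a * f x + of_real c * g x) \<in> H1_mean0 L"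
  by (simp add: H1_mean0_def L2_mean0_lincomb H1_add H1_cmult)

lemma prim_lincomb:
  assumes "f \<in> L2_mean0 L" "g \<in> L2_mean0 L" "L > 0"
  shows "prim L (a *\<^sub>R cl L f + c *\<^sub>R cl L g) = a *\<^sub>R prim L (cl L f) + c *\<^sub>R prim L (cl L g)"
proof -
  obtain p where p: "p \<in> H10 L" "d L p = cl L f" using H10_primitive[OF assms(1,3)] by blast
  obtain q where q: "q \<in> H10 L" "d L q = cl L g" using H10_primitive[OF assms(2,3)] by blast
  have "prim L (a *\<^sub>R cl L f + c *\<^sub>R cl L g) = cl L (\<lambda>x. of_real a * p x + of_real c * q x)"
    using p q by (intro prim_eq) (auto intro: H10_add H10_cmult simp: d_add d_cmult H1_cmult H10_H1)
  also have "\<dots> = a *\<^sub>R cl L p + c *\<^sub>R cl L q"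
    using p q by (simp add: cl_add cl_cmult L2_cmult H10_H1 H1_L2)
  finally show ?thesis using prim_eq[OF p] prim_eq[OF q] by simp
qed

lemma mprim_lincomb:
  assumes "f \<in> L2 L" "g \<in> L2 L" "L > 0"
  shows "mprim L (a *\<^sub>R cl L f + c *\<^sub>R cl L g) = a *\<^sub>R mprim L (cl L f) + c *\<^sub>R mprim L (cl L g)"
proof -
  obtain p where p: "p \<in> H1_mean0 L" "d L p = cl L f" using H1_mean0_primitive[OF assms(1,3)] by blast
  obtain q where q: "q \<in> H1_mean0 L" "d L q = cl L g" using H1_mean0_primitive[OF assms(2,3)] by blast
  have H1: "p \<in> H1 L" "q \<in> H1 L" using p q by (auto simp: H1_mean0_def)
  have "mprim L (a *\<^sub>R cl L f + c *\<^sub>R cl L g) = cl L (\<lambda>x. of_real a * p x + of_real c * q x)"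
    using p q H1 by (intro mprim_eq H1_mean0_lincomb assms(3)) (auto simp: d_add d_cmult H1_cmult)
  also have "\<dots> = a *\<^sub>R cl L p + c *\<^sub>R cl L q"
    using H1 by (simp add: cl_add cl_cmult L2_cmult H1_L2)
  finally show ?thesis using mprim_eq[OF p assms(3)] mprim_eq[OF q assms(3)] by simp
qed

lemma norm_prim: "f \<in> L2_mean0 L \<Longrightarrow> L > 0 \<Longrightarrow> norm (prim L (cl L f)) \<le> 2 * L * norm (cl L f)"
  by (metis H10_primitive poincare_H10 prim_eq)

lemma norm_mprim: "f \<in> L2 L \<Longrightarrow> L > 0 \<Longrightarrow> norm (mprim L (cl L f)) \<le> 2 * L * norm (cl L f)"
  by (metis H1_mean0_primitive poincare_mean0 mprim_eq)

section \<open>The energy form and the multipliers\<close>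

locale beam = kernel g g' \<kappa>\<^sub>1 for g g' :: "real \<Rightarrow> real" and \<kappa>\<^sub>1 :: real +
  fixes L \<rho> \<rho>\<^sub>1 \<rho>\<^sub>2 \<rho>\<^sub>3 \<alpha> \<kappa> b \<tau> \<sigma> \<beta> \<gamma> m :: real
  assumes pos: "L > 0" "\<rho> > 0" "\<rho>\<^sub>1 > 0" "\<rho>\<^sub>2 > 0" "\<rho>\<^sub>3 > 0" "\<alpha> > 0" "\<kappa> > 0"
    "\<tau> > 0" "\<sigma> > 0" "\<beta> > 0" "\<gamma> > 0" "m \<noteq> 0"
    and b_tilde: "b - kernel_mass g > 0"
begin

abbreviation "bt \<equiv> b - kernel_mass g"
abbreviation "X \<equiv> energy_space L g"
abbreviation "N \<equiv> energy_norm L \<rho> \<rho>\<^sub>1 \<rho>\<^sub>2 \<rho>\<^sub>3 \<alpha> \<kappa> b \<tau> \<beta> g"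
abbreviation "Dom \<equiv> dom_A2 L b g"
abbreviation "A \<equiv> A2 L \<rho> \<rho>\<^sub>1 \<rho>\<^sub>2 \<rho>\<^sub>3 \<alpha> \<kappa> b \<tau> \<sigma> \<beta> \<gamma> m g"

text \<open>Components and first derivatives as classes turn the forms into expressions in inner
  products of \<open>ltwo\<close>. Only \<eta> is kept as a function, since its class lives in
  \<open>L2g\<close>.\<close>

fun sv :: "state \<Rightarrow> ltwo" where "sv (u, v, \<phi>, \<Phi>, \<psi>, \<Psi>, \<theta>, q, \<eta>) = cl L v"
fun su :: "state \<Rightarrow> ltwo" where "su (u, v, \<phi>, \<Phi>, \<psi>, \<Psi>, \<theta>, q, \<eta>) = cl L u"
fun sdu :: "state \<Rightarrow> ltwo" where "sdu (u, v, \<phi>, \<Phi>, \<psi>, \<Psi>, \<theta>, q, \<eta>) = d L u"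
fun sphi :: "state \<Rightarrow> ltwo" where "sphi (u, v, \<phi>, \<Phi>, \<psi>, \<Psi>, \<theta>, q, \<eta>) = cl L \<phi>"
fun sdphi :: "state \<Rightarrow> ltwo" where "sdphi (u, v, \<phi>, \<Phi>, \<psi>, \<Psi>, \<theta>, q, \<eta>) = d L \<phi>"
fun sPhi :: "state \<Rightarrow> ltwo" where "sPhi (u, v, \<phi>, \<Phi>, \<psi>, \<Psi>, \<theta>, q, \<eta>) = cl L \<Phi>"
fun spsi :: "state \<Rightarrow> ltwo" where "spsi (u, v, \<phi>, \<Phi>, \<psi>, \<Psi>, \<theta>, q, \<eta>) = cl L \<psi>"
fun sdpsi :: "state \<Rightarrow> ltwo" where "sdpsi (u, v, \<phi>, \<Phi>, \<psi>, \<Psi>, \<theta>, q, \<eta>) = d L \<psi>"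
fun sPsi :: "state \<Rightarrow> ltwo" where "sPsi (u, v, \<phi>, \<Phi>, \<psi>, \<Psi>, \<theta>, q, \<eta>) = cl L \<Psi>"
fun sth :: "state \<Rightarrow> ltwo" where "sth (u, v, \<phi>, \<Phi>, \<psi>, \<Psi>, \<theta>, q, \<eta>) = cl L \<theta>"
fun sq :: "state \<Rightarrow> ltwo" where "sq (u, v, \<phi>, \<Phi>, \<psi>, \<Psi>, \<theta>, q, \<eta>) = cl L q"
fun se :: "state \<Rightarrow> real \<Rightarrow> real \<Rightarrow> complex" where "se (u, v, \<phi>, \<Phi>, \<psi>, \<Psi>, \<theta>, q, \<eta>) = \<eta>"

lemmas proj_simps = sv.simps su.simps sdu.simps sphi.simps sdphi.simps sPhi.simps spsi.simps sdpsi.simps sPsi.simps sth.simps sq.simps se.simps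

lemma X_iff: "(u, v, \<phi>, \<Phi>, \<psi>, \<Psi>, \<theta>, q, \<eta>) \<in> X \<longleftrightarrow>
     u \<in> H1_mean0 L \<and> v \<in> L2_mean0 L \<and> \<phi> \<in> H1_mean0 L \<and> \<Phi> \<in> L2_mean0 L \<and>
     \<psi> \<in> H10 L \<and> \<Psi> \<in> L2 L \<and> \<theta> \<in> L2 L \<and> q \<in> L2 L \<and> \<eta> \<in> L2g L g"
  by (simp add: energy_space_def)

lemma mem_simps: "f \<in> H1_mean0 L \<Longrightarrow> f \<in> H1 L" "f \<in> H1_mean0 L \<Longrightarrow> f \<in> L2_mean0 L" "f \<in> L2_mean0 L \<Longrightarrow> f \<in> L2 L"
  by (auto simp: H1_mean0_def L2_mean0_iff)

lemma cl_lincomb: "f \<in> L2 L \<Longrightarrow> h \<in> L2 L \<Longrightarrow> cl L (\<lambda>x. of_real a * f x + of_real c * h x) = a *\<^sub>R cl L f + c *\<^sub>R cl L h"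
  by (simp add: cl_add cl_cmult L2_cmult)

lemma d_lincomb: "f \<in> H1 L \<Longrightarrow> h \<in> H1 L \<Longrightarrow> d L (\<lambda>x. of_real a * f x + of_real c * h x) = a *\<^sub>R d L f + c *\<^sub>R d L h"
  by (simp add: d_add d_cmult H1_cmult)

lemma proj_lincomb:
  assumes "U \<in> X" "V \<in> X"
  shows "sv (lincomb (of_real a) U (of_real c) V) = a *\<^sub>R sv U + c *\<^sub>R sv V"
    "su (lincomb (of_real a) U (of_real c) V) = a *\<^sub>R su U + c *\<^sub>R su V"
    "sdu (lincomb (of_real a) U (of_real c) V) = a *\<^sub>R sdu U + c *\<^sub>R sdu V"
    "sphi (lincomb (of_real a) U (of_real c) V) = a *\<^sub>R sphi U + c *\<^sub>R sphi V"
    "sdphi (lincomb (of_real a) U (of_real c) V) = a *\<^sub>R sdphi U + c *\<^sub>R sdphi V"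
    "sPhi (lincomb (of_real a) U (of_real c) V) = a *\<^sub>R sPhi U + c *\<^sub>R sPhi V"
    "spsi (lincomb (of_real a) U (of_real c) V) = a *\<^sub>R spsi U + c *\<^sub>R spsi V"
    "sdpsi (lincomb (of_real a) U (of_real c) V) = a *\<^sub>R sdpsi U + c *\<^sub>R sdpsi V"
    "sPsi (lincomb (of_real a) U (of_real c) V) = a *\<^sub>R sPsi U + c *\<^sub>R sPsi V"
    "sth (lincomb (of_real a) U (of_real c) V) = a *\<^sub>R sth U + c *\<^sub>R sth V"
    "sq (lincomb (of_real a) U (of_real c) V) = a *\<^sub>R sq U + c *\<^sub>R sq V"
    "se (lincomb (of_real a) U (of_real c) V) = (\<lambda>s x. of_real a * se U s x + of_real c * se V s x)"
  using assms
  by (cases U rule: lincomb_cases; cases V rule: lincomb_cases;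
      simp add: X_iff proj_simps cl_lincomb d_lincomb mem_simps H10_H1 H1_L2)+

lemma se_L2g: "U \<in> X \<Longrightarrow> se U \<in> L2g L g"
  by (cases U rule: lincomb_cases) (simp add: X_iff proj_simps)

lemma X_lincomb: "U \<in> X \<Longrightarrow> V \<in> X \<Longrightarrow> lincomb (of_real a) U (of_real c) V \<in> X"
  by (cases U rule: lincomb_cases; cases V rule: lincomb_cases)
    (simp add: X_iff H1_mean0_lincomb L2_mean0_lincomb H10_add H10_cmult L2_add L2_cmult dg_lincomb(2))

definition E :: "state \<Rightarrow> state \<Rightarrow> real" where
  "E U V = \<rho> * (sv U \<bullet> sv V) + \<alpha> * (sdu U \<bullet> sdu V) + \<rho>\<^sub>1 * (sPhi U \<bullet> sPhi V) + \<rho>\<^sub>2 * (sPsi U \<bullet> sPsi V)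
    + bt * (sdpsi U \<bullet> sdpsi V) + \<beta> * ((sphi U - su U) \<bullet> (sphi V - su V))
    + \<kappa> * ((sdphi U + spsi U) \<bullet> (sdphi V + spsi V)) + \<rho>\<^sub>3 * (sth U \<bullet> sth V) + \<tau> * (sq U \<bullet> sq V)
    + G L (se U) (se V)"

lemma E_sym: "E U V = E V U"
  unfolding E_def by (simp add: inner_commute G_sym)

lemma E_left:
  assumes "U \<in> X" "V \<in> X" "W \<in> X"
  shows "E (lincomb (of_real a) U (of_real c) V) W = a * E U W + c * E V W"
  unfolding E_def proj_lincomb[OF assms(1,2)] G_lincomb[OF se_L2g[OF assms(1)] se_L2g[OF assms(2)] se_L2g[OF assms(3)]]
  by (simp add: inner_add_left inner_diff_left algebra_simps)

lemma E_right: "U \<in> X \<Longrightarrow> V \<in> X \<Longrightarrow> W \<in> X \<Longrightarrow> E W (lincomb (of_real a) U (of_real c) V) = a * E W U + c * E W V"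
  using E_left[of U V W a c] by (simp add: E_sym[of W])

lemma E_self: "U \<in> X \<Longrightarrow> E U U = \<rho> * (norm (sv U))\<^sup>2 + \<alpha> * (norm (sdu U))\<^sup>2 + \<rho>\<^sub>1 * (norm (sPhi U))\<^sup>2 + \<rho>\<^sub>2 * (norm (sPsi U))\<^sup>2
    + bt * (norm (sdpsi U))\<^sup>2 + \<beta> * (norm (sphi U - su U))\<^sup>2 + \<kappa> * (norm (sdphi U + spsi U))\<^sup>2
    + \<rho>\<^sub>3 * (norm (sth U))\<^sup>2 + \<tau> * (norm (sq U))\<^sup>2 + (L2g_norm L g (se U))\<^sup>2"
  unfolding E_def by (simp add: power2_norm_eq_inner G_self se_L2g)

lemma N_eq: "U \<in> X \<Longrightarrow> N U = sqrt (E U U)"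
  unfolding E_self
  by (cases U rule: lincomb_cases)
    (simp add: X_iff proj_simps L2_norm_eq mem_simps H10_H1 H1_L2 cl_diff cl_add L2_add L2_diff d_def)

lemma E_nonneg: "U \<in> X \<Longrightarrow> 0 \<le> E U U"
  unfolding E_self using pos b_tilde by (simp add: less_imp_le)

lemma N_sq: "U \<in> X \<Longrightarrow> (N U)\<^sup>2 = E U U"
  by (simp add: N_eq E_nonneg)

lemma E_CS: assumes "U \<in> X" "V \<in> X" shows "\<bar>E U V\<bar> \<le> N U * N V"
proof -
  have "(E U V)\<^sup>2 \<le> E U U * E V V"
  proof (rule quadratic_discriminant)
    fix s t :: real
    have L: "lincomb (of_real s) U (of_real t) V \<in> X" using assms by (rule X_lincomb)
    have "0 \<le> E (lincomb (of_real s) U (of_real t) V) (lincomb (of_real s) U (of_real t) V)" by (rule E_nonneg[OF L])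
    also have "\<dots> = s\<^sup>2 * E U U + 2 * (s * t) * E U V + t\<^sup>2 * E V V"
      using assms L by (simp add: E_left E_right E_sym[of V U] power2_eq_square algebra_simps)
    finally show "0 \<le> s\<^sup>2 * E U U + 2 * (s * t) * E U V + t\<^sup>2 * E V V" .
  qed
  then have "sqrt ((E U V)\<^sup>2) \<le> sqrt (E U U * E V V)" by (rule real_sqrt_le_mono)
  then show ?thesis using assms by (simp add: N_eq real_sqrt_mult)
qed

sublocale S: state_space X N
proof
  fix U V :: state and a c :: real
  assume UV: "U \<in> X" "V \<in> X"
  show L: "lincomb (of_real a) U (of_real c) V \<in> X" using UV by (rule X_lincomb)
  show N0: "0 \<le> N U" using UV by (simp add: N_eq E_nonneg)
  have N0': "0 \<le> N V" using UV by (simp add: N_eq E_nonneg)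
  have "(N (lincomb (of_real a) U (of_real c) V))\<^sup>2 = a\<^sup>2 * (N U)\<^sup>2 + 2 * (a * c * E U V) + c\<^sup>2 * (N V)\<^sup>2"
    unfolding N_sq[OF L] N_sq[OF UV(1)] N_sq[OF UV(2)]
    using UV L by (simp add: E_left E_right E_sym[of V U] power2_eq_square algebra_simps)
  also have "\<dots> \<le> a\<^sup>2 * (N U)\<^sup>2 + 2 * (\<bar>a\<bar> * \<bar>c\<bar> * (N U * N V)) + c\<^sup>2 * (N V)\<^sup>2"
  proof -
    have "a * c * E U V \<le> \<bar>a * c\<bar> * \<bar>E U V\<bar>" by (metis abs_ge_self abs_mult)
    also have "\<dots> \<le> \<bar>a * c\<bar> * (N U * N V)" by (intro mult_left_mono E_CS UV) simp
    finally show ?thesis by (simp add: abs_mult)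
  qed
  also have "\<dots> = (\<bar>a\<bar> * N U + \<bar>c\<bar> * N V)\<^sup>2"
    by (simp add: power2_sum power_mult_distrib algebra_simps)
  finally show "N (lincomb (of_real a) U (of_real c) V) \<le> \<bar>a\<bar> * N U + \<bar>c\<bar> * N V"
    by (rule power2_le_imp_le) (use N0 N0' in simp)
qed

text \<open>Real-linear maps bounded by the energy norm. Each multiplier is a combination of inner
  products of two such maps, so \<open>bform_inner\<close> yields its bilinearity and boundedness at
  once.\<close>

definition blm :: "(state \<Rightarrow> ltwo) \<Rightarrow> bool" where
  "blm p \<longleftrightarrow> (\<forall>U\<in>X. \<forall>V\<in>X. \<forall>a c. p (lincomb (of_real a) U (of_real c) V) = a *\<^sub>R p U + c *\<^sub>R p V) \<and>
     (\<exists>C. \<forall>U\<in>X. norm (p U) \<le> C * N U)"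

definition bform :: "(state \<Rightarrow> state \<Rightarrow> real) \<Rightarrow> bool" where
  "bform B \<longleftrightarrow> (\<forall>U\<in>X. \<forall>V\<in>X. \<forall>W\<in>X. \<forall>a c. B (lincomb (of_real a) U (of_real c) V) W = a * B U W + c * B V W \<and>
       B W (lincomb (of_real a) U (of_real c) V) = a * B W U + c * B W V) \<and>
     (\<exists>K\<ge>0. \<forall>U\<in>X. \<forall>V\<in>X. \<bar>B U V\<bar> \<le> K * (N U * N V))"

lemma bformI:
  assumes "\<And>U V W a c. U \<in> X \<Longrightarrow> V \<in> X \<Longrightarrow> W \<in> X \<Longrightarrow> B (lincomb (of_real a) U (of_real c) V) W = a * B U W + c * B V W"
    "\<And>U V W a c. U \<in> X \<Longrightarrow> V \<in> X \<Longrightarrow> W \<in> X \<Longrightarrow> B W (lincomb (of_real a) U (of_real c) V) = a * B W U + c * B W V"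
    "K \<ge> 0" "\<And>U V. U \<in> X \<Longrightarrow> V \<in> X \<Longrightarrow> \<bar>B U V\<bar> \<le> K * (N U * N V)"
  shows "bform B"
  unfolding bform_def using assms by blast

lemma bform_left: "bform B \<Longrightarrow> U \<in> X \<Longrightarrow> V \<in> X \<Longrightarrow> W \<in> X \<Longrightarrow> B (lincomb (of_real a) U (of_real c) V) W = a * B U W + c * B V W"
  and bform_right: "bform B \<Longrightarrow> U \<in> X \<Longrightarrow> V \<in> X \<Longrightarrow> W \<in> X \<Longrightarrow> B W (lincomb (of_real a) U (of_real c) V) = a * B W U + c * B W V"
  unfolding bform_def by blast+

lemma bform_bound:
  assumes "bform B" obtains K where "K \<ge> 0" "\<And>U V. U \<in> X \<Longrightarrow> V \<in> X \<Longrightarrow> \<bar>B U V\<bar> \<le> K * (N U * N V)"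
  using assms unfolding bform_def by blast

lemma bform_E: "bform E"
  by (rule bformI[of _ 1]) (simp_all add: E_left E_right E_CS)

lemma bform_cmult: assumes "bform B" shows "bform (\<lambda>U V. r * B U V)"
proof -
  obtain K where K: "K \<ge> 0" "\<And>U V. U \<in> X \<Longrightarrow> V \<in> X \<Longrightarrow> \<bar>B U V\<bar> \<le> K * (N U * N V)" by (rule bform_bound[OF assms], rule that)
  show ?thesis
  proof (rule bformI[of _ "\<bar>r\<bar> * K"])
    fix U V assume "U \<in> X" "V \<in> X"
    then show "\<bar>r * B U V\<bar> \<le> (\<bar>r\<bar> * K) * (N U * N V)"
      using mult_left_mono[OF K(2), of U V "\<bar>r\<bar>"] by (simp add: abs_mult mult.assoc)
  qed (use K(1) in \<open>simp_all add: bform_left[OF assms] bform_right[OF assms] algebra_simps\<close>)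
qed

lemma bform_add: assumes "bform B" "bform B'" shows "bform (\<lambda>U V. B U V + B' U V)"
proof -
  obtain K where K: "K \<ge> 0" "\<And>U V. U \<in> X \<Longrightarrow> V \<in> X \<Longrightarrow> \<bar>B U V\<bar> \<le> K * (N U * N V)" by (rule bform_bound[OF assms(1)], rule that)
  obtain K' where K': "K' \<ge> 0" "\<And>U V. U \<in> X \<Longrightarrow> V \<in> X \<Longrightarrow> \<bar>B' U V\<bar> \<le> K' * (N U * N V)" by (rule bform_bound[OF assms(2)], rule that)
  show ?thesis
  proof (rule bformI[of _ "K + K'"])
    fix U V assume UV: "U \<in> X" "V \<in> X"
    show "\<bar>B U V + B' U V\<bar> \<le> (K + K') * (N U * N V)"
      using K(2)[OF UV] K'(2)[OF UV] by (simp add: distrib_right)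
  qed (use K(1) K'(1) in \<open>simp_all add: bform_left[OF assms(1)] bform_left[OF assms(2)] bform_right[OF assms(1)] bform_right[OF assms(2)] algebra_simps\<close>)
qed

lemma bform_inner:
  assumes "blm p" "blm r" shows "bform (\<lambda>U V. p U \<bullet> r V)"
proof -
  obtain C1 where C1: "\<forall>U\<in>X. norm (p U) \<le> C1 * N U" using assms unfolding blm_def by blast
  obtain C2 where C2: "\<forall>U\<in>X. norm (r U) \<le> C2 * N U" using assms unfolding blm_def by blast
  have "\<bar>p U \<bullet> r V\<bar> \<le> (\<bar>C1\<bar> * \<bar>C2\<bar>) * (N U * N V)" if UV: "U \<in> X" "V \<in> X" for U V
  proof -
    have n: "0 \<le> N U" "0 \<le> N V" using UV by (auto simp: S.N_nonneg)
    have "norm (p U) \<le> \<bar>C1\<bar> * N U" using C1 UV mult_right_mono[OF abs_ge_self n(1)] by (blast intro: order_trans)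
    moreover have "norm (r V) \<le> \<bar>C2\<bar> * N V" using C2 UV mult_right_mono[OF abs_ge_self n(2)] by (blast intro: order_trans)
    ultimately have "norm (p U) * norm (r V) \<le> (\<bar>C1\<bar> * N U) * (\<bar>C2\<bar> * N V)"
      using n by (intro mult_mono) auto
    then show ?thesis using Cauchy_Schwarz_ineq2[of "p U" "r V"] by (simp add: algebra_simps)
  qed
  note b = this
  have l: "p (lincomb (of_real a) U (of_real c) V) = a *\<^sub>R p U + c *\<^sub>R p V" "r (lincomb (of_real a) U (of_real c) V) = a *\<^sub>R r U + c *\<^sub>R r V"
    if "U \<in> X" "V \<in> X" for U V a c using assms that unfolding blm_def by blast+
  show ?thesis
    by (rule bformI[of _ "\<bar>C1\<bar> * \<bar>C2\<bar>"]) (simp_all add: l b inner_add_left inner_add_right)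
qed

lemma le_divide_sqrt:
  fixes x y c :: real
  assumes "c > 0" "c * x\<^sup>2 \<le> y\<^sup>2" "0 \<le> y" shows "x \<le> (1 / sqrt c) * y"
proof -
  have "x\<^sup>2 \<le> y\<^sup>2 / c" using assms(1,2) by (simp add: field_simps)
  also have "\<dots> = ((1 / sqrt c) * y)\<^sup>2" using assms(1) by (simp add: power_mult_distrib power_divide)
  finally show ?thesis by (rule power2_le_imp_le) (use assms in simp)
qed

lemma comp_bounds:
  assumes U: "U \<in> X"
  shows "norm (sv U) \<le> (1 / sqrt \<rho>) * N U" "norm (sdu U) \<le> (1 / sqrt \<alpha>) * N U" "norm (sPhi U) \<le> (1 / sqrt \<rho>\<^sub>1) * N U"
    "norm (sPsi U) \<le> (1 / sqrt \<rho>\<^sub>2) * N U" "norm (sdpsi U) \<le> (1 / sqrt bt) * N U"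
    "norm (sphi U - su U) \<le> (1 / sqrt \<beta>) * N U" "norm (sdphi U + spsi U) \<le> (1 / sqrt \<kappa>) * N U"
    "norm (sth U) \<le> (1 / sqrt \<rho>\<^sub>3) * N U" "norm (sq U) \<le> (1 / sqrt \<tau>) * N U" "L2g_norm L g (se U) \<le> N U"
    "norm (su U) \<le> 2 * L * norm (sdu U)" "norm (spsi U) \<le> 2 * L * norm (sdpsi U)"
proof -
  have nn: "0 \<le> \<rho> * (norm (sv U))\<^sup>2" "0 \<le> \<alpha> * (norm (sdu U))\<^sup>2" "0 \<le> \<rho>\<^sub>1 * (norm (sPhi U))\<^sup>2" "0 \<le> \<rho>\<^sub>2 * (norm (sPsi U))\<^sup>2"
    "0 \<le> bt * (norm (sdpsi U))\<^sup>2" "0 \<le> \<beta> * (norm (sphi U - su U))\<^sup>2" "0 \<le> \<kappa> * (norm (sdphi U + spsi U))\<^sup>2"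
    "0 \<le> \<rho>\<^sub>3 * (norm (sth U))\<^sup>2" "0 \<le> \<tau> * (norm (sq U))\<^sup>2" "0 \<le> (L2g_norm L g (se U))\<^sup>2"
    using pos b_tilde by simp_all
  note e = N_sq[OF U, unfolded E_self[OF U]]
  show "norm (sv U) \<le> (1 / sqrt \<rho>) * N U" by (rule le_divide_sqrt[OF pos(2) _ S.N_nonneg[OF U]]) (use nn e in linarith)
  show "norm (sdu U) \<le> (1 / sqrt \<alpha>) * N U" by (rule le_divide_sqrt[OF pos(6) _ S.N_nonneg[OF U]]) (use nn e in linarith)
  show "norm (sPhi U) \<le> (1 / sqrt \<rho>\<^sub>1) * N U" by (rule le_divide_sqrt[OF pos(3) _ S.N_nonneg[OF U]]) (use nn e in linarith)
  show "norm (sPsi U) \<le> (1 / sqrt \<rho>\<^sub>2) * N U" by (rule le_divide_sqrt[OF pos(4) _ S.N_nonneg[OF U]]) (use nn e in linarith)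
  show "norm (sdpsi U) \<le> (1 / sqrt bt) * N U" by (rule le_divide_sqrt[OF b_tilde _ S.N_nonneg[OF U]]) (use nn e in linarith)
  show "norm (sphi U - su U) \<le> (1 / sqrt \<beta>) * N U" by (rule le_divide_sqrt[OF pos(10) _ S.N_nonneg[OF U]]) (use nn e in linarith)
  show "norm (sdphi U + spsi U) \<le> (1 / sqrt \<kappa>) * N U" by (rule le_divide_sqrt[OF pos(7) _ S.N_nonneg[OF U]]) (use nn e in linarith)
  show "norm (sth U) \<le> (1 / sqrt \<rho>\<^sub>3) * N U" by (rule le_divide_sqrt[OF pos(5) _ S.N_nonneg[OF U]]) (use nn e in linarith)
  show "norm (sq U) \<le> (1 / sqrt \<tau>) * N U" by (rule le_divide_sqrt[OF pos(8) _ S.N_nonneg[OF U]]) (use nn e in linarith)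
  show "L2g_norm L g (se U) \<le> N U"
    by (rule power2_le_imp_le[OF _ S.N_nonneg[OF U]]) (use nn e in linarith)
  show "norm (su U) \<le> 2 * L * norm (sdu U)" "norm (spsi U) \<le> 2 * L * norm (sdpsi U)"
    using U pos(1) by (cases U rule: lincomb_cases; simp add: X_iff proj_simps poincare_mean0 poincare_H10)+
qed

lemma blm_sv: "blm sv"
  unfolding blm_def using proj_lincomb(1) comp_bounds(1) by blast

lemma blm_sPhi: "blm sPhi"
  unfolding blm_def using proj_lincomb(6) comp_bounds(3) by blast

lemma blm_sPsi: "blm sPsi"
  unfolding blm_def using proj_lincomb(9) comp_bounds(4) by blast

lemma blm_sth: "blm sth"
  unfolding blm_def using proj_lincomb(10) comp_bounds(8) by blast

lemma blm_sq: "blm sq"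
  unfolding blm_def using proj_lincomb(11) comp_bounds(9) by blast

lemma blm_su: "blm su"
proof -
  have "norm (su U) \<le> (2 * L * (1 / sqrt \<alpha>)) * N U" if "U \<in> X" for U
    using comp_bounds(11)[OF that] mult_left_mono[OF comp_bounds(2)[OF that], of "2 * L"] pos by simp
  then show ?thesis unfolding blm_def using proj_lincomb(2) by blast
qed

lemma blm_spsi: "blm spsi"
proof -
  have "norm (spsi U) \<le> (2 * L * (1 / sqrt bt)) * N U" if "U \<in> X" for U
    using comp_bounds(12)[OF that] mult_left_mono[OF comp_bounds(5)[OF that], of "2 * L"] pos by simp
  then show ?thesis unfolding blm_def using proj_lincomb(7) by blast
qed

text \<open>The energy contains neither \<phi> nor its derivative alone. The difference from
  \<open>u\<close> is in the energy, and \<open>u\<close> itself is controlled by Poincare's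
  inequality.\<close>

lemma blm_sphi: "blm sphi"
proof -
  obtain C where C: "\<forall>U\<in>X. norm (su U) \<le> C * N U" using blm_su unfolding blm_def by blast
  have "norm (sphi U) \<le> (1 / sqrt \<beta> + C) * N U" if "U \<in> X" for U
    using comp_bounds(6)[OF that] C that norm_triangle_ineq[of "sphi U - su U" "su U"] by (simp add: distrib_right) (smt (verit))
  then show ?thesis unfolding blm_def using proj_lincomb(4) by blast
qed

lemma sPhi_cases: "U \<in> X \<Longrightarrow> \<exists>f\<in>L2_mean0 L. sPhi U = cl L f"
  by (cases U rule: lincomb_cases) (auto simp: X_iff proj_simps)

lemma sth_cases: "U \<in> X \<Longrightarrow> \<exists>f\<in>L2 L. sth U = cl L f"
  by (cases U rule: lincomb_cases) (auto simp: X_iff proj_simps)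

lemma blm_prim: "blm (\<lambda>U. prim L (sPhi U))"
  unfolding blm_def
proof (intro conjI ballI allI exI[of _ "2 * L * (1 / sqrt \<rho>\<^sub>1)"])
  fix U V :: state and a c :: real assume UV: "U \<in> X" "V \<in> X"
  obtain f h where fh: "f \<in> L2_mean0 L" "sPhi U = cl L f" "h \<in> L2_mean0 L" "sPhi V = cl L h"
    using sPhi_cases UV by blast
  show "prim L (sPhi (lincomb (of_real a) U (of_real c) V)) = a *\<^sub>R prim L (sPhi U) + c *\<^sub>R prim L (sPhi V)"
    unfolding proj_lincomb[OF UV] fh(2,4) by (rule prim_lincomb[OF fh(1,3) pos(1)])
next
  fix U assume U: "U \<in> X"
  obtain f where f: "f \<in> L2_mean0 L" "sPhi U = cl L f" using sPhi_cases U by blast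
  have "norm (prim L (sPhi U)) \<le> 2 * L * norm (sPhi U)" unfolding f(2) by (rule norm_prim[OF f(1) pos(1)])
  also have "\<dots> \<le> 2 * L * ((1 / sqrt \<rho>\<^sub>1) * N U)" using comp_bounds(3)[OF U] pos by (intro mult_left_mono) auto
  finally show "norm (prim L (sPhi U)) \<le> 2 * L * (1 / sqrt \<rho>\<^sub>1) * N U" by simp
qed

lemma blm_mprim: "blm (\<lambda>U. mprim L (sth U))"
  unfolding blm_def
proof (intro conjI ballI allI exI[of _ "2 * L * (1 / sqrt \<rho>\<^sub>3)"])
  fix U V :: state and a c :: real assume UV: "U \<in> X" "V \<in> X"
  obtain f h where fh: "f \<in> L2 L" "sth U = cl L f" "h \<in> L2 L" "sth V = cl L h"
    using sth_cases UV by blast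
  show "mprim L (sth (lincomb (of_real a) U (of_real c) V)) = a *\<^sub>R mprim L (sth U) + c *\<^sub>R mprim L (sth V)"
    unfolding proj_lincomb[OF UV] fh(2,4) by (rule mprim_lincomb[OF fh(1,3) pos(1)])
next
  fix U assume U: "U \<in> X"
  obtain f where f: "f \<in> L2 L" "sth U = cl L f" using sth_cases U by blast
  have "norm (mprim L (sth U)) \<le> 2 * L * norm (sth U)" unfolding f(2) by (rule norm_mprim[OF f(1) pos(1)])
  also have "\<dots> \<le> 2 * L * ((1 / sqrt \<rho>\<^sub>3) * N U)" using comp_bounds(8)[OF U] pos by (intro mult_left_mono) auto
  finally show "norm (mprim L (sth U)) \<le> 2 * L * (1 / sqrt \<rho>\<^sub>3) * N U" by simp
qed

definition wbound :: "(real \<Rightarrow> real) \<Rightarrow> real" where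
  "wbound k = sqrt (LINT s|halfline. (k s / sqrt (g s))\<^sup>2)"

lemma wbound_nonneg: "0 \<le> wbound k"
  unfolding wbound_def by (intro real_sqrt_ge_zero integral_nonneg_AE) simp

lemma wint_norms:
  assumes "admissible k" "\<eta> \<in> L2g L g"
  shows "norm (d L (wint L k \<eta>)) \<le> wbound k * L2g_norm L g \<eta>" "norm (cl L (wint L k \<eta>)) \<le> 2 * L * (wbound k * L2g_norm L g \<eta>)"
proof -
  show 1: "norm (d L (wint L k \<eta>)) \<le> wbound k * L2g_norm L g \<eta>"
    unfolding wbound_def by (rule wint_bound[OF assms])
  show "norm (cl L (wint L k \<eta>)) \<le> 2 * L * (wbound k * L2g_norm L g \<eta>)"
    using mult_left_mono[OF 1, of "2 * L"] pos by (intro order_trans[OF poincare_H10[OF wint(1)[OF assms]]]) simp_all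
qed

lemma cl_wint_lincomb:
  assumes k: "admissible k" and \<eta>: "\<eta> \<in> L2g L g" "\<zeta> \<in> L2g L g"
  shows "cl L (wint L k (\<lambda>s x. of_real a * \<eta> s x + of_real c * \<zeta> s x)) = a *\<^sub>R cl L (wint L k \<eta>) + c *\<^sub>R cl L (wint L k \<zeta>)"
proof -
  note w = wint(1)[OF k \<eta>(1)] wint(1)[OF k \<eta>(2)]
  have "cl L (wint L k (\<lambda>s x. of_real a * \<eta> s x + of_real c * \<zeta> s x)) = cl L (\<lambda>x. of_real a * wint L k \<eta> x + of_real c * wint L k \<zeta> x)"
    using w wint(1)[OF k dg_lincomb(2)[OF \<eta>]] wint_lincomb[OF k \<eta>]
    by (intro H10_cl_eq) (auto simp: d_lincomb H10_H1 intro: H10_add H10_cmult)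
  then show ?thesis using w by (simp add: cl_lincomb H10_H1 H1_L2)
qed

lemma blm_wint: "admissible k \<Longrightarrow> blm (\<lambda>U. cl L (wint L k (se U)))"
  unfolding blm_def
proof (intro conjI ballI allI exI[of _ "2 * L * wbound k"])
  fix U V :: state and a c :: real assume k: "admissible k" and UV: "U \<in> X" "V \<in> X"
  show "cl L (wint L k (se (lincomb (of_real a) U (of_real c) V))) = a *\<^sub>R cl L (wint L k (se U)) + c *\<^sub>R cl L (wint L k (se V))"
    unfolding proj_lincomb[OF UV] by (rule cl_wint_lincomb[OF k se_L2g[OF UV(1)] se_L2g[OF UV(2)]])
next
  fix U assume k: "admissible k" and U: "U \<in> X"
  have "norm (cl L (wint L k (se U))) \<le> 2 * L * (wbound k * L2g_norm L g (se U))" by (rule wint_norms(2)[OF k se_L2g[OF U]])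
  also have "\<dots> \<le> 2 * L * (wbound k * N U)"
    using comp_bounds(10)[OF U] wbound_nonneg pos by (intro mult_left_mono) auto
  finally show "norm (cl L (wint L k (se U))) \<le> 2 * L * wbound k * N U" by (simp add: mult.assoc)
qed

end

section \<open>The operator on its domain and the energy identity\<close>

locale beam_dom = beam +
  fixes u v \<phi> \<Phi> \<psi> \<Psi> \<theta> q :: "real \<Rightarrow> complex" and \<eta> :: "real \<Rightarrow> real \<Rightarrow> complex"
  assumes dom: "(u, v, \<phi>, \<Phi>, \<psi>, \<Psi>, \<theta>, q, \<eta>) \<in> Dom"
begin

abbreviation "W \<equiv> (u, v, \<phi>, \<Phi>, \<psi>, \<Psi>, \<theta>, q, \<eta>)"
abbreviation "stress \<equiv> memory_stress L b g \<psi> \<eta>"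
abbreviation "\<zeta> \<equiv> s_deriv L g \<eta>"

lemma mem: "u \<in> H1_mean0 L" "v \<in> H1_mean0 L" "\<phi> \<in> H1_mean0 L" "\<Phi> \<in> H1_mean0 L" "\<psi> \<in> H10 L" "\<Psi> \<in> H10 L" "\<theta> \<in> H10 L"
  "q \<in> H1 L" "\<eta> \<in> L2g L g" "weak_deriv L u \<in> H10 L" "weak_deriv L \<phi> \<in> H10 L" "stress \<in> H1 L" "weak_deriv L stress \<in> H1 L"
  "zero_initial_trace L g \<eta>"
  using dom by (auto simp: dom_A2_def X_iff H2_def)

lemma sd: "has_s_deriv L g \<eta> \<zeta>"
proof -
  have "\<exists>\<zeta>. has_s_deriv L g \<eta> \<zeta>" using dom by (simp add: dom_A2_def)
  then show ?thesis unfolding s_deriv_def by (rule someI_ex)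
qed

lemma \<zeta>_L2g: "\<zeta> \<in> L2g L g"
  using sd by (simp add: has_s_deriv_def)

lemma mem_H1: "u \<in> H1 L" "v \<in> H1 L" "\<phi> \<in> H1 L" "\<Phi> \<in> H1 L" "\<psi> \<in> H1 L" "\<Psi> \<in> H1 L" "\<theta> \<in> H1 L"
  "weak_deriv L u \<in> H1 L" "weak_deriv L \<phi> \<in> H1 L"
  using mem by (auto simp: H1_mean0_def intro: H10_H1)

lemma mem_L2: "u \<in> L2 L" "v \<in> L2 L" "\<phi> \<in> L2 L" "\<Phi> \<in> L2 L" "\<psi> \<in> L2 L" "\<Psi> \<in> L2 L" "\<theta> \<in> L2 L" "q \<in> L2 L"
  "weak_deriv L \<phi> \<in> L2 L" "weak_deriv L \<Phi> \<in> L2 L" "weak_deriv L \<theta> \<in> L2 L" "weak_deriv L q \<in> L2 L"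
  "weak_deriv L (weak_deriv L u) \<in> L2 L" "weak_deriv L (weak_deriv L stress) \<in> L2 L"
  using mem_H1 mem(8,13) by (auto intro: H1_L2)

lemma strain_H10: "(\<lambda>y. weak_deriv L \<phi> y + \<psi> y) \<in> H10 L"
  using mem by (intro H10_add)

lemma strain_L2: "weak_deriv L (\<lambda>y. weak_deriv L \<phi> y + \<psi> y) \<in> L2 L"
  by (rule H1_L2(2)[OF H10_H1[OF strain_H10]])

lemma W_X: "W \<in> X"
  using dom by (simp add: dom_A2_def)

lemma mean_zero: "(LINT x|interval_measure_on L. u x) = 0" "(LINT x|interval_measure_on L. v x) = 0"
  "(LINT x|interval_measure_on L. \<phi> x) = 0" "(LINT x|interval_measure_on L. weak_deriv L (weak_deriv L u) x) = 0"
  "(LINT x|interval_measure_on L. weak_deriv L \<theta> x) = 0"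
  "(LINT x|interval_measure_on L. weak_deriv L (\<lambda>y. weak_deriv L \<phi> y + \<psi> y) x) = 0"
  using mem by (auto simp: H1_mean0_def L2_mean0_iff intro: integral_d_H10 strain_H10)

lemma L2_divide: "f \<in> L2 L \<Longrightarrow> (\<lambda>x. f x / c) \<in> L2 L"
  using L2_cmult[of f L "1 / c"] by simp

lemma cl_divide: "f \<in> L2 L \<Longrightarrow> cl L (\<lambda>x. f x / of_real c) = (1 / c) *\<^sub>R cl L f"
  using cl_cmult[of f L "1 / c"] by simp

lemma L2_minus: "f \<in> L2 L \<Longrightarrow> (\<lambda>x. - f x) \<in> L2 L"
  using L2_cmult[of f L "- 1"] by simp

lemma cl_minus: "f \<in> L2 L \<Longrightarrow> cl L (\<lambda>x. - f x) = - cl L f"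
  using cl_cmult[of f L "- 1"] by simp

lemmas L2_ops = L2_divide L2_minus L2_add L2_diff L2_cmult
lemmas cl_ops = cl_divide cl_minus cl_add cl_diff cl_cmult

definition "AW = A W"

lemma \<zeta>': "(\<lambda>s x. \<Psi> x - \<zeta> s x) = (\<lambda>s x. of_real 1 * \<Psi> x + of_real (- 1) * \<zeta> s x)"
  by simp

lemma AW_L2g: "(\<lambda>s x. \<Psi> x - \<zeta> s x) \<in> L2g L g"
  unfolding \<zeta>' by (rule dg_lincomb(2)[OF L2g_const(1)[OF mem(6)] \<zeta>_L2g])

lemma AW_X: "AW \<in> X"
  unfolding AW_def A2.simps Let_def X_iff
  using mem mem_L2 strain_L2 mean_zero integrable_L2 AW_L2g
  by (simp add: L2_ops L2_mean0_iff)

lemma AW_proj: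
  "su AW = cl L v" "sdu AW = d L v" "sphi AW = cl L \<Phi>" "sdphi AW = d L \<Phi>" "spsi AW = cl L \<Psi>" "sdpsi AW = d L \<Psi>"
  "se AW = (\<lambda>s x. \<Psi> x - \<zeta> s x)"
  by (simp_all add: AW_def Let_def proj_simps)

lemma AW_eqs:
  "\<rho> *\<^sub>R sv AW = \<alpha> *\<^sub>R d L (weak_deriv L u) + \<beta> *\<^sub>R (cl L \<phi> - cl L u) - \<gamma> *\<^sub>R cl L v"
  "\<rho>\<^sub>1 *\<^sub>R sPhi AW = \<kappa> *\<^sub>R d L (\<lambda>y. weak_deriv L \<phi> y + \<psi> y) - \<beta> *\<^sub>R (cl L \<phi> - cl L u) - m *\<^sub>R d L \<theta>"
  "\<rho>\<^sub>2 *\<^sub>R sPsi AW = d L (weak_deriv L stress) - \<kappa> *\<^sub>R (d L \<phi> + cl L \<psi>) + m *\<^sub>R cl L \<theta>"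
  "\<rho>\<^sub>3 *\<^sub>R sth AW = - d L q - m *\<^sub>R (d L \<Phi> + cl L \<Psi>)"
  "\<tau> *\<^sub>R sq AW = - (\<sigma> *\<^sub>R cl L q) - d L \<theta>"
  using pos mem_L2 strain_L2 by (simp_all add: AW_def Let_def proj_simps cl_ops L2_ops d_def del: of_real_minus)

lemma d_stress: "d L stress = bt *\<^sub>R d L \<psi> + d L (wint L g \<eta>)"
proof -
  have "stress = (\<lambda>x. of_real bt * \<psi> x + wint L g \<eta> x)" by (simp add: memory_stress_def wint_def fun_eq_iff)
  then show ?thesis using mem_H1 wint(1)[OF admissible_g mem(9)] by (simp add: d_add d_cmult H1_cmult H10_H1 del: of_real_diff)
qed

lemma cl_d: "cl L (weak_deriv L f) = d L f"
  by (simp add: d_def)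

text \<open>In every line one factor lies in \<open>H10 L\<close>: the one that is differentiated
  for \<open>u_x\<close>, \<open>\<phi>_x + \<psi>\<close> and \<theta>, and the test factor
  \<open>f\<close> for the stress derivative and for \<open>q\<close>, which satisfy no boundary
  condition.\<close>

lemma ibp:
  "f \<in> H1 L \<Longrightarrow> d L (weak_deriv L u) \<bullet> cl L f = - (d L u \<bullet> d L f)"
  "f \<in> H1 L \<Longrightarrow> d L (\<lambda>y. weak_deriv L \<phi> y + \<psi> y) \<bullet> cl L f = - ((d L \<phi> + cl L \<psi>) \<bullet> d L f)"
  "f \<in> H10 L \<Longrightarrow> d L (weak_deriv L stress) \<bullet> cl L f = - (d L stress \<bullet> d L f)"
  "f \<in> H1 L \<Longrightarrow> d L \<theta> \<bullet> cl L f = - (cl L \<theta> \<bullet> d L f)"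
  "f \<in> H10 L \<Longrightarrow> d L q \<bullet> cl L f = - (cl L q \<bullet> d L f)"
proof -
  show "f \<in> H1 L \<Longrightarrow> d L (weak_deriv L u) \<bullet> cl L f = - (d L u \<bullet> d L f)"
    using integration_by_parts[OF mem(10)] by (simp add: cl_d)
  show "f \<in> H1 L \<Longrightarrow> d L (\<lambda>y. weak_deriv L \<phi> y + \<psi> y) \<bullet> cl L f = - ((d L \<phi> + cl L \<psi>) \<bullet> d L f)"
    using integration_by_parts[OF strain_H10] mem_L2 by (simp add: cl_add cl_d)
  show "f \<in> H10 L \<Longrightarrow> d L (weak_deriv L stress) \<bullet> cl L f = - (d L stress \<bullet> d L f)"
    using integration_by_parts[OF _ mem(13), of f] by (simp add: cl_d inner_commute)
  show "f \<in> H1 L \<Longrightarrow> d L \<theta> \<bullet> cl L f = - (cl L \<theta> \<bullet> d L f)"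
    by (rule integration_by_parts[OF mem(7)])
  show "f \<in> H10 L \<Longrightarrow> d L q \<bullet> cl L f = - (cl L q \<bullet> d L f)"
    using integration_by_parts[OF _ mem(8), of f] by (simp add: inner_commute)
qed

text \<open>A history constant in \<open>s\<close> pairs with \<eta> through the memory part of the
  stress. In the energy identity this cancels the memory term of the \<Psi> equation.\<close>

lemma G_const: "y \<in> H10 L \<Longrightarrow> G L \<eta> (\<lambda>s. y) = d L (wint L g \<eta>) \<bullet> d L y"
proof -
  assume y: "y \<in> H10 L"
  have eq: "dg L \<eta> s \<bullet> dg L (\<lambda>s. y) s = ((g s / sqrt (g s)) *\<^sub>R dg L \<eta> s) \<bullet> d L y" if "s \<in> space halfline" for s
    using that g_nonneg[of s] by (simp add: L2g_const(2)[OF y] halfline_space real_div_sqrt)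
  have "G L \<eta> (\<lambda>s. y) = (LINT s|halfline. ((g s / sqrt (g s)) *\<^sub>R dg L \<eta> s) \<bullet> d L y)"
    unfolding G_def by (rule Bochner_Integration.integral_cong[OF refl eq])
  also have "\<dots> = d L (wint L g \<eta>) \<bullet> d L y"
    unfolding wint(2)[OF admissible_g mem(9)] by (rule integral_inner_left) (rule admissible_mult(4)[OF admissible_g mem(9)])
  finally show ?thesis .
qed

text \<open>All couplings are skew: after integration by parts each occurs in two equations with
  opposite signs. Only the damping of \<open>v\<close> and \<open>q\<close> and the transport term
  in \<open>s\<close> remain.\<close>

lemma dissipation: "E W AW = - \<gamma> * (norm (cl L v))\<^sup>2 - \<sigma> * (norm (cl L q))\<^sup>2 - G L \<zeta> \<eta>"
proof -
  have "E W AW = (\<rho> *\<^sub>R sv AW) \<bullet> cl L v + \<alpha> * (d L u \<bullet> d L v) + (\<rho>\<^sub>1 *\<^sub>R sPhi AW) \<bullet> cl L \<Phi>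
      + (\<rho>\<^sub>2 *\<^sub>R sPsi AW) \<bullet> cl L \<Psi> + bt * (d L \<psi> \<bullet> d L \<Psi>) + \<beta> * ((cl L \<phi> - cl L u) \<bullet> (cl L \<Phi> - cl L v))
      + \<kappa> * ((d L \<phi> + cl L \<psi>) \<bullet> (d L \<Phi> + cl L \<Psi>)) + (\<rho>\<^sub>3 *\<^sub>R sth AW) \<bullet> cl L \<theta> + (\<tau> *\<^sub>R sq AW) \<bullet> cl L q
      + G L \<eta> (\<lambda>s x. \<Psi> x - \<zeta> s x)"
    unfolding E_def AW_proj by (simp add: proj_simps inner_commute)
  also have "G L \<eta> (\<lambda>s x. \<Psi> x - \<zeta> s x) = d L (wint L g \<eta>) \<bullet> d L \<Psi> - G L \<zeta> \<eta>"
    using G_lincomb[OF L2g_const(1)[OF mem(6)] \<zeta>_L2g mem(9), of 1 "- 1"] G_const[OF mem(6)]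
    by (simp add: G_sym[of L \<eta>])
  finally show ?thesis
    unfolding AW_eqs
    by (simp only: inner_add_left inner_diff_left inner_minus_left inner_scaleR_left ibp(1-4) mem_H1 mem d_stress)
      (simp add: inner_add_left inner_diff_left inner_diff_right inner_add_right power2_norm_eq_inner inner_commute algebra_simps)
qed

end

section \<open>The four multipliers\<close>

lemma abs_inner_le:
  fixes x y :: "'a::real_inner"
  assumes "norm x \<le> a" "norm y \<le> c" shows "\<bar>x \<bullet> y\<bar> \<le> a * c"
  using order_trans[OF Cauchy_Schwarz_ineq2 mult_mono[OF assms order_trans[OF norm_ge_zero assms(1)] norm_ge_zero]] .

lemma abs_mult_inner_le:
  fixes x y :: "'a::real_inner"
  assumes "norm x \<le> a" "norm y \<le> c" shows "r * (x \<bullet> y) \<le> \<bar>r\<bar> * (a * c)"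
  using mult_left_mono[OF abs_inner_le[OF assms], of "\<bar>r\<bar>"] abs_ge_self[of "r * (x \<bullet> y)"] by (simp add: abs_mult)

context beam
begin

text \<open>The root of twice the potential energy without the memory part, which is kept apart as
  \<open>h\<close>. In the next definition a sum of reciprocal roots gives one constant for all four
  component bounds.\<close>

definition "pot U = sqrt (\<alpha> * (norm (sdu U))\<^sup>2 + bt * (norm (sdpsi U))\<^sup>2 + \<beta> * (norm (sphi U - su U))\<^sup>2 + \<kappa> * (norm (sdphi U + spsi U))\<^sup>2)"
definition "cp = 1 / sqrt \<alpha> + 1 / sqrt bt + 1 / sqrt \<beta> + 1 / sqrt \<kappa>"

lemma pot_sq: "(pot U)\<^sup>2 = \<alpha> * (norm (sdu U))\<^sup>2 + bt * (norm (sdpsi U))\<^sup>2 + \<beta> * (norm (sphi U - su U))\<^sup>2 + \<kappa> * (norm (sdphi U + spsi U))\<^sup>2"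
  unfolding pot_def using pos b_tilde by (simp add: less_imp_le)

lemma pot_nonneg: "0 \<le> pot U"
  unfolding pot_def using pos b_tilde by (simp add: less_imp_le)

lemma cp_nonneg: "0 \<le> cp"
  unfolding cp_def using pos b_tilde by (simp add: less_imp_le)

lemma norm_le_pot:
  assumes c: "c > 0" "1 / sqrt c \<le> cp" and le: "c * (norm (x::ltwo))\<^sup>2 \<le> (pot U)\<^sup>2" shows "norm x \<le> cp * pot U"
  by (rule order_trans[OF le_divide_sqrt[OF c(1) le pot_nonneg] mult_right_mono[OF c(2) pot_nonneg]])

lemma pot_bounds:
  shows "norm (sdu U) \<le> cp * pot U" "norm (sdpsi U) \<le> cp * pot U" "norm (sphi U - su U) \<le> cp * pot U" "norm (sdphi U + spsi U) \<le> cp * pot U"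
proof -
  have nn: "0 \<le> \<alpha> * (norm (sdu U))\<^sup>2" "0 \<le> bt * (norm (sdpsi U))\<^sup>2" "0 \<le> \<beta> * (norm (sphi U - su U))\<^sup>2" "0 \<le> \<kappa> * (norm (sdphi U + spsi U))\<^sup>2"
    "0 \<le> 1 / sqrt \<alpha>" "0 \<le> 1 / sqrt bt" "0 \<le> 1 / sqrt \<beta>" "0 \<le> 1 / sqrt \<kappa>"
    using pos b_tilde by (simp_all add: less_imp_le)
  show "norm (sdu U) \<le> cp * pot U" by (rule norm_le_pot[OF pos(6)]) (use nn pot_sq[of U] cp_def in linarith)+
  show "norm (sdpsi U) \<le> cp * pot U" by (rule norm_le_pot[OF b_tilde]) (use nn pot_sq[of U] cp_def in linarith)+
  show "norm (sphi U - su U) \<le> cp * pot U" by (rule norm_le_pot[OF pos(10)]) (use nn pot_sq[of U] cp_def in linarith)+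
  show "norm (sdphi U + spsi U) \<le> cp * pot U" by (rule norm_le_pot[OF pos(7)]) (use nn pot_sq[of U] cp_def in linarith)+
qed

text \<open>The derivatives of \<open>F1\<close>, \<open>F2\<close>, \<open>F3\<close> and \<open>F4\<close> recover \<open>\<Psi>\<close> from the memory, \<open>\<theta>\<close> from the heat flux,
  \<open>\<Phi>\<close> from the temperature, and the potential energy by equipartition.\<close>

definition "F1 \<xi> U V = sPsi U \<bullet> cl L (wint L \<xi> (se V))"
definition "F2 U V = sq U \<bullet> mprim L (sth V)"
definition "F3 U V = sth U \<bullet> prim L (sPhi V)"
definition "F4 U V = \<rho>\<^sub>1 * (sPhi U \<bullet> sphi V) + (\<rho> * (sv U \<bullet> su V) + \<rho>\<^sub>2 * (sPsi U \<bullet> spsi V))"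

end

context beam_dom
begin

abbreviation "p \<equiv> pot W"
abbreviation "h \<equiv> L2g_norm L g \<eta>"

lemma pot_W: "norm (d L u) \<le> cp * p" "norm (d L \<psi>) \<le> cp * p" "norm (cl L \<phi> - cl L u) \<le> cp * p" "norm (d L \<phi> + cl L \<psi>) \<le> cp * p"
  using pot_bounds[of W] by (simp_all add: proj_simps)

lemma pot_W_sq: "p\<^sup>2 = \<alpha> * (norm (d L u))\<^sup>2 + bt * (norm (d L \<psi>))\<^sup>2 + \<beta> * (norm (cl L \<phi> - cl L u))\<^sup>2 + \<kappa> * (norm (d L \<phi> + cl L \<psi>))\<^sup>2"
  by (simp add: pot_sq proj_simps)

text \<open>Under the operator the weighted memory becomes the integral of \<open>\<xi>\<close>
  times \<Psi> minus the s-derivative of \<eta>. The first part is a positive multiple of \<Psi> for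
  a weight of positive integral; in the second the derivative moves to \<open>\<xi>\<close>, with no
  term at \<open>s = 0\<close> because \<open>\<xi>\<close> vanishes nearby. Every error term
  contains \<eta>, which is dissipated.\<close>

lemma multiplier1:
  assumes tf: "(\<lambda>s. of_real (\<xi> s)) \<in> test_J" and \<xi>: "integrable halfline \<xi>"
    and \<xi>': "\<And>s. (\<xi> has_real_derivative \<xi>' s) (at s)"
  shows "- \<rho>\<^sub>2 * (F1 \<xi> AW W + F1 \<xi> W AW) \<le> - \<rho>\<^sub>2 * (LINT s|halfline. \<xi> s) * (norm (cl L \<Psi>))\<^sup>2
      + (wbound \<xi> * bt * cp + 2 * \<kappa> * L * wbound \<xi> * cp) * (h * p) + (wbound \<xi> * wbound g) * h\<^sup>2
      + (2 * \<bar>m\<bar> * L * wbound \<xi>) * (h * norm (cl L \<theta>)) + (2 * \<rho>\<^sub>2 * L * wbound \<xi>') * (h * norm (cl L \<Psi>))"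
proof -
  note ak = admissible_test[OF tf] and wd = weak_s_derivative[OF sd tf \<xi>']
  let ?w = "wint L \<xi> \<eta>" and ?w' = "wint L \<xi>' \<eta>" and ?c = "LINT s|halfline. \<xi> s"
  note C = L2g_const(1)[OF mem(6)]
  note wH = wint(1)[OF ak mem(9)] and w'H = wint(1)[OF wd(1) mem(9)]
  have "d L (wint L \<xi> (\<lambda>s. \<Psi>)) = d L (\<lambda>x. of_real ?c * \<Psi> x)"
    using wint_const[OF tf \<xi> mem(6)] mem_H1 by (simp add: d_cmult)
  then have w1: "cl L (wint L \<xi> (\<lambda>s. \<Psi>)) = ?c *\<^sub>R cl L \<Psi>"
    using H10_cl_eq[OF wint(1)[OF ak C] H10_cmult[OF mem(6)]] mem_L2 by (simp add: cl_cmult)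
  have "d L ?w' = d L (\<lambda>x. of_real (- 1) * wint L \<xi> \<zeta> x)"
    using wd(2) d_cmult[OF H10_H1[OF wint(1)[OF ak \<zeta>_L2g]], of "- 1"] by simp
  then have w2: "cl L ?w' = - cl L (wint L \<xi> \<zeta>)"
    using H10_cl_eq[OF w'H H10_cmult[OF wint(1)[OF ak \<zeta>_L2g], of "- 1"]] cl_cmult[OF H1_L2(1)[OF H10_H1[OF wint(1)[OF ak \<zeta>_L2g]]], of "- 1"] by simp
  have w3: "cl L (wint L \<xi> (\<lambda>s x. \<Psi> x - \<zeta> s x)) = ?c *\<^sub>R cl L \<Psi> + cl L ?w'"
    unfolding \<zeta>' cl_wint_lincomb[OF ak C \<zeta>_L2g] w1 w2 by simp
  have "- \<rho>\<^sub>2 * (F1 \<xi> AW W + F1 \<xi> W AW) = - ((\<rho>\<^sub>2 *\<^sub>R sPsi AW) \<bullet> cl L ?w) - \<rho>\<^sub>2 * (cl L \<Psi> \<bullet> (?c *\<^sub>R cl L \<Psi> + cl L ?w'))"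
    unfolding F1_def AW_proj proj_simps w3 by (simp add: algebra_simps)
  also have "\<dots> = - \<rho>\<^sub>2 * ?c * (norm (cl L \<Psi>))\<^sup>2 + (bt * (d L \<psi> \<bullet> d L ?w) + 1 * (d L (wint L g \<eta>) \<bullet> d L ?w)
      + \<kappa> * ((d L \<phi> + cl L \<psi>) \<bullet> cl L ?w) + (- m) * (cl L \<theta> \<bullet> cl L ?w) + (- \<rho>\<^sub>2) * (cl L \<Psi> \<bullet> cl L ?w'))"
    unfolding AW_eqs by (simp only: inner_add_left inner_diff_left inner_scaleR_left ibp(3)[OF wH] d_stress)
      (simp add: inner_add_right power2_norm_eq_inner algebra_simps)
  also have "\<dots> \<le> - \<rho>\<^sub>2 * ?c * (norm (cl L \<Psi>))\<^sup>2 + (\<bar>bt\<bar> * ((cp * p) * (wbound \<xi> * h)) + \<bar>1\<bar> * ((wbound g * h) * (wbound \<xi> * h))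
      + \<bar>\<kappa>\<bar> * ((cp * p) * (2 * L * (wbound \<xi> * h))) + \<bar>- m\<bar> * (norm (cl L \<theta>) * (2 * L * (wbound \<xi> * h)))
      + \<bar>- \<rho>\<^sub>2\<bar> * (norm (cl L \<Psi>) * (2 * L * (wbound \<xi>' * h))))"
    by (intro add_left_mono add_mono abs_mult_inner_le pot_W wint_norms ak wd(1) admissible_g mem(9) order_refl)
  finally show ?thesis using pos b_tilde by (simp add: power2_eq_square algebra_simps)
qed

text \<open>Pairing the \<open>q\<close> equation with the primitive of \<theta> turns the
  derivative of \<theta> into its squared norm. The primitive evolves by the integrated temperature
  equation, so \<open>q\<close> meets \<open>q\<close>, \<Phi> and a primitive of \<Psi>; every
  error term carries the dissipated factor \<open>q\<close>.\<close>

lemma multiplier2: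
  "- (\<rho>\<^sub>3 * \<tau>) * (F2 AW W + F2 W AW) \<le> - \<rho>\<^sub>3 * (norm (cl L \<theta>))\<^sup>2 + (2 * \<rho>\<^sub>3 * \<sigma> * L) * (norm (cl L q) * norm (cl L \<theta>))
      + \<tau> * (norm (cl L q))\<^sup>2 + (\<tau> * \<bar>m\<bar>) * (norm (cl L q) * norm (cl L \<Phi>)) + (2 * \<tau> * \<bar>m\<bar> * L) * (norm (cl L q) * norm (cl L \<Psi>))"
proof -
  obtain R where R: "R \<in> H1_mean0 L" "d L R = cl L \<theta>" using H1_mean0_primitive[OF mem_L2(7) pos(1)] by blast
  obtain S where S: "S \<in> H1_mean0 L" "d L S = cl L \<Psi>" using H1_mean0_primitive[OF mem_L2(6) pos(1)] by blast
  \<comment> \<open>Integrating the derivative of \<open>q\<close> returns \<open>q\<close> only up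
    to a constant, as \<open>q\<close> has no boundary condition; the mean-zero primitive selects
    \<open>q\<close> minus its mean.\<close>
  obtain k where k: "(\<lambda>x. q x - k) \<in> H1_mean0 L" "d L (\<lambda>x. q x - k) = d L q" "norm (cl L (\<lambda>x. q x - k)) \<le> norm (cl L q)"
    using mean_removal[OF mem(8) pos(1)] by blast
  define r where "r = (\<lambda>x. q x - k)"
  note r = k[folded r_def]
  have H: "R \<in> H1 L" "S \<in> H1 L" "r \<in> H1 L" using R S r by (auto simp: H1_mean0_def)
  have nR: "norm (cl L R) \<le> 2 * L * norm (cl L \<theta>)" "norm (cl L S) \<le> 2 * L * norm (cl L \<Psi>)"
    using poincare_mean0[OF R(1) pos(1)] poincare_mean0[OF S(1) pos(1)] R S by simp_all
  \<comment> \<open>The primitive of the temperature component of \<open>AW\<close>, written down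
    explicitly so that \<open>mprim\<close> can be evaluated on it.\<close>
  define z where "z x = of_real (- 1 / \<rho>\<^sub>3) * r x + of_real (- m / \<rho>\<^sub>3) * (of_real 1 * \<Phi> x + of_real 1 * S x)" for x
  have zH: "z \<in> H1_mean0 L" unfolding z_def[abs_def] by (intro H1_mean0_lincomb r S mem pos)
  have "d L z = (- 1 / \<rho>\<^sub>3) *\<^sub>R d L r + (- m / \<rho>\<^sub>3) *\<^sub>R (1 *\<^sub>R d L \<Phi> + 1 *\<^sub>R d L S)"
    unfolding z_def[abs_def] using H mem_H1 by (simp only: d_lincomb H1_add H1_cmult)
  also have "\<dots> = (1 / \<rho>\<^sub>3) *\<^sub>R (\<rho>\<^sub>3 *\<^sub>R sth AW)" unfolding AW_eqs r S by (simp add: scaleR_diff_right)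
  finally have "d L z = sth AW" using pos by simp
  then have mz: "mprim L (sth AW) = cl L z" by (intro mprim_eq zH pos)
  have "cl L z = (- 1 / \<rho>\<^sub>3) *\<^sub>R cl L r + (- m / \<rho>\<^sub>3) *\<^sub>R (1 *\<^sub>R cl L \<Phi> + 1 *\<^sub>R cl L S)"
    unfolding z_def[abs_def] using H[THEN H1_L2(1)] mem_L2 by (simp only: cl_lincomb L2_add L2_cmult)
  then have z: "\<rho>\<^sub>3 *\<^sub>R cl L z = - cl L r - m *\<^sub>R (cl L \<Phi> + cl L S)" using pos by (simp add: scaleR_add_right scaleR_diff_right)
  have "- (\<rho>\<^sub>3 * \<tau>) * (F2 AW W + F2 W AW) = - \<rho>\<^sub>3 * ((\<tau> *\<^sub>R sq AW) \<bullet> cl L R) - \<tau> * (cl L q \<bullet> (\<rho>\<^sub>3 *\<^sub>R cl L z))"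
    unfolding F2_def proj_simps mz mprim_eq[OF R pos(1)] by (simp add: algebra_simps)
  also have "\<dots> = - \<rho>\<^sub>3 * (norm (cl L \<theta>))\<^sup>2 + ((\<rho>\<^sub>3 * \<sigma>) * (cl L q \<bullet> cl L R) + \<tau> * (cl L q \<bullet> cl L r)
      + (\<tau> * m) * (cl L q \<bullet> cl L \<Phi>) + (\<tau> * m) * (cl L q \<bullet> cl L S))"
    unfolding AW_eqs z by (simp only: inner_add_left inner_diff_left inner_scaleR_left inner_minus_left ibp(4)[OF H(1)] R)
      (simp add: inner_add_right inner_diff_right power2_norm_eq_inner algebra_simps)
  also have "\<dots> \<le> - \<rho>\<^sub>3 * (norm (cl L \<theta>))\<^sup>2 + (\<bar>\<rho>\<^sub>3 * \<sigma>\<bar> * (norm (cl L q) * (2 * L * norm (cl L \<theta>))) + \<bar>\<tau>\<bar> * (norm (cl L q) * norm (cl L q))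
      + \<bar>\<tau> * m\<bar> * (norm (cl L q) * norm (cl L \<Phi>)) + \<bar>\<tau> * m\<bar> * (norm (cl L q) * (2 * L * norm (cl L \<Psi>))))"
    by (intro add_left_mono add_mono abs_mult_inner_le nR r(3) order_refl)
  finally show ?thesis using pos by (simp add: power2_eq_square abs_mult algebra_simps)
qed

text \<open>Against the primitive \<open>P\<close> of \<Phi>, the term of the temperature equation
  with the derivative of \<Phi> becomes the squared norm of \<Phi>; the factor \<open>m\<close> in
  the multiplier makes the sign independent of that of \<open>m\<close>. Integrating the \<Phi>
  equation once leaves the shear strain without a derivative, so it is merely paired with \<theta>,
  whatever the wave speeds.\<close>

lemma multiplier3:
  "- (m * \<rho>\<^sub>1 * \<rho>\<^sub>3) * (F3 AW W + F3 W AW) \<le> - (m\<^sup>2 * \<rho>\<^sub>1) * (norm (cl L \<Phi>))\<^sup>2 + (\<bar>m\<bar> * \<rho>\<^sub>1) * (norm (cl L q) * norm (cl L \<Phi>))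
      + (2 * m\<^sup>2 * \<rho>\<^sub>1 * L) * (norm (cl L \<Psi>) * norm (cl L \<Phi>)) + (\<bar>m\<bar> * \<rho>\<^sub>3 * (\<kappa> * cp + 2 * \<beta> * L * cp)) * (norm (cl L \<theta>) * p)
      + (\<rho>\<^sub>3 * m\<^sup>2) * (norm (cl L \<theta>))\<^sup>2"
proof -
  have \<Phi>0: "\<Phi> \<in> L2_mean0 L" "(\<lambda>x. \<phi> x - u x) \<in> L2_mean0 L" using mem mem_simps H1_mean0_diff by blast+
  obtain P where P: "P \<in> H10 L" "d L P = cl L \<Phi>" using H10_primitive[OF \<Phi>0(1) pos(1)] by blast
  \<comment> \<open>The integrated \<Phi> equation contains a primitive of \<phi> - u; it exists in
    \<open>H10 L\<close> because \<phi> and u both have mean zero.\<close>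
  obtain Q where Q: "Q \<in> H10 L" "d L Q = cl L (\<lambda>x. \<phi> x - u x)" using H10_primitive[OF \<Phi>0(2) pos(1)] by blast
  have dQ: "d L Q = cl L \<phi> - cl L u" using Q mem_L2 by (simp add: cl_diff)
  have nP: "norm (cl L P) \<le> 2 * L * norm (cl L \<Phi>)" using poincare_H10[OF P(1)] P by simp
  have nQ: "norm (cl L Q) \<le> 2 * L * (cp * p)"
    using order_trans[OF poincare_H10[OF Q(1)] mult_left_mono[OF pot_W(3)[folded dQ]]] pos by simp
  define z where "z x = of_real (1 / \<rho>\<^sub>1) * (of_real \<kappa> * (weak_deriv L \<phi> x + \<psi> x) + of_real (- \<beta>) * Q x) + of_real (- m / \<rho>\<^sub>1) * \<theta> x" for x
  have zH: "z \<in> H10 L" unfolding z_def[abs_def] by (intro H10_add H10_cmult mem Q)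
  note H = mem_H1 H10_H1[OF Q(1)] H10_H1[OF strain_H10]
  have "d L z = (1 / \<rho>\<^sub>1) *\<^sub>R (\<kappa> *\<^sub>R d L (\<lambda>x. weak_deriv L \<phi> x + \<psi> x) + (- \<beta>) *\<^sub>R d L Q) + (- m / \<rho>\<^sub>1) *\<^sub>R d L \<theta>"
    unfolding z_def[abs_def] using H by (simp only: d_lincomb H1_add H1_cmult)
  also have "\<dots> = (1 / \<rho>\<^sub>1) *\<^sub>R (\<rho>\<^sub>1 *\<^sub>R sPhi AW)" unfolding AW_eqs dQ by (simp add: scaleR_diff_right scaleR_add_right)
  finally have "d L z = sPhi AW" using pos by simp
  then have pz: "prim L (sPhi AW) = cl L z" by (intro prim_eq zH)
  have "cl L z = (1 / \<rho>\<^sub>1) *\<^sub>R (\<kappa> *\<^sub>R cl L (\<lambda>x. weak_deriv L \<phi> x + \<psi> x) + (- \<beta>) *\<^sub>R cl L Q) + (- m / \<rho>\<^sub>1) *\<^sub>R cl L \<theta>"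
    unfolding z_def[abs_def] using H[THEN H1_L2(1)] by (simp only: cl_lincomb L2_add L2_cmult)
  then have z: "\<rho>\<^sub>1 *\<^sub>R cl L z = \<kappa> *\<^sub>R (d L \<phi> + cl L \<psi>) - \<beta> *\<^sub>R cl L Q - m *\<^sub>R cl L \<theta>"
    using pos mem_L2 by (simp add: scaleR_add_right scaleR_diff_right cl_add cl_d)
  have ib: "d L \<Phi> \<bullet> cl L P = - (cl L \<Phi> \<bullet> cl L \<Phi>)" using integration_by_parts[OF P(1) mem_H1(4)] P by (simp add: inner_commute)
  have "- (m * \<rho>\<^sub>1 * \<rho>\<^sub>3) * (F3 AW W + F3 W AW) = - (m * \<rho>\<^sub>1) * ((\<rho>\<^sub>3 *\<^sub>R sth AW) \<bullet> cl L P) - (m * \<rho>\<^sub>3) * (cl L \<theta> \<bullet> (\<rho>\<^sub>1 *\<^sub>R cl L z))"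
    unfolding F3_def proj_simps pz prim_eq[OF P] by (simp add: algebra_simps)
  also have "\<dots> = - (m\<^sup>2 * \<rho>\<^sub>1) * (norm (cl L \<Phi>))\<^sup>2 + ((- (m * \<rho>\<^sub>1)) * (cl L q \<bullet> cl L \<Phi>) + (m\<^sup>2 * \<rho>\<^sub>1) * (cl L \<Psi> \<bullet> cl L P)
      + (- (m * \<rho>\<^sub>3 * \<kappa>)) * (cl L \<theta> \<bullet> (d L \<phi> + cl L \<psi>)) + (m * \<rho>\<^sub>3 * \<beta>) * (cl L \<theta> \<bullet> cl L Q) + (m\<^sup>2 * \<rho>\<^sub>3) * (cl L \<theta> \<bullet> cl L \<theta>))"
    unfolding AW_eqs z by (simp only: inner_add_left inner_diff_left inner_scaleR_left inner_minus_left ibp(5)[OF P(1)] ib P)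
      (simp add: inner_add_right inner_diff_right power2_norm_eq_inner power2_eq_square[of m] algebra_simps)
  also have "\<dots> \<le> - (m\<^sup>2 * \<rho>\<^sub>1) * (norm (cl L \<Phi>))\<^sup>2 + (\<bar>- (m * \<rho>\<^sub>1)\<bar> * (norm (cl L q) * norm (cl L \<Phi>)) + \<bar>m\<^sup>2 * \<rho>\<^sub>1\<bar> * (norm (cl L \<Psi>) * (2 * L * norm (cl L \<Phi>)))
      + \<bar>- (m * \<rho>\<^sub>3 * \<kappa>)\<bar> * (norm (cl L \<theta>) * (cp * p)) + \<bar>m * \<rho>\<^sub>3 * \<beta>\<bar> * (norm (cl L \<theta>) * (2 * L * (cp * p))) + \<bar>m\<^sup>2 * \<rho>\<^sub>3\<bar> * (norm (cl L \<theta>) * norm (cl L \<theta>)))"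
    by (intro add_left_mono add_mono abs_mult_inner_le pot_W nP nQ order_refl)
  finally show ?thesis using pos by (simp add: power2_eq_square abs_mult algebra_simps)
qed

text \<open>Equipartition: displacements against accelerations give minus the potential energy,
  velocities against velocities the kinetic terms. The latter have the wrong sign and are paid for
  by the other multipliers and the damping of \<open>v\<close>.\<close>

lemma multiplier4:
  "F4 AW W + F4 W AW \<le> - p\<^sup>2 + \<rho> * (norm (cl L v))\<^sup>2 + \<rho>\<^sub>1 * (norm (cl L \<Phi>))\<^sup>2 + \<rho>\<^sub>2 * (norm (cl L \<Psi>))\<^sup>2
      + (2 * \<gamma> * L * cp) * (norm (cl L v) * p) + (wbound g * cp) * (h * p) + (\<bar>m\<bar> * cp) * (norm (cl L \<theta>) * p)"
proof -
  have nu: "norm (cl L u) \<le> 2 * L * (cp * p)"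
    using order_trans[OF poincare_mean0[OF mem(1) pos(1)] mult_left_mono[OF pot_W(1)]] pos by simp
  have "F4 AW W + F4 W AW = (\<rho>\<^sub>1 *\<^sub>R sPhi AW) \<bullet> cl L \<phi> + (\<rho> *\<^sub>R sv AW) \<bullet> cl L u + (\<rho>\<^sub>2 *\<^sub>R sPsi AW) \<bullet> cl L \<psi>
     + \<rho> * (norm (cl L v))\<^sup>2 + \<rho>\<^sub>1 * (norm (cl L \<Phi>))\<^sup>2 + \<rho>\<^sub>2 * (norm (cl L \<Psi>))\<^sup>2"
    unfolding F4_def AW_proj proj_simps by (simp add: power2_norm_eq_inner)
  also have "\<dots> = - p\<^sup>2 + \<rho> * (norm (cl L v))\<^sup>2 + \<rho>\<^sub>1 * (norm (cl L \<Phi>))\<^sup>2 + \<rho>\<^sub>2 * (norm (cl L \<Psi>))\<^sup>2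
      + ((- \<gamma>) * (cl L v \<bullet> cl L u) + (- 1) * (d L (wint L g \<eta>) \<bullet> d L \<psi>) + m * (cl L \<theta> \<bullet> (d L \<phi> + cl L \<psi>)))"
    unfolding AW_eqs pot_W_sq
    by (simp only: inner_add_left inner_diff_left inner_scaleR_left inner_minus_left ibp(1)[OF mem_H1(1)] ibp(2)[OF mem_H1(3)] ibp(3)[OF mem(5)] ibp(4)[OF mem_H1(3)] d_stress)
      (simp add: inner_add_left inner_add_right inner_diff_left inner_diff_right power2_norm_eq_inner inner_commute algebra_simps)
  also have "\<dots> \<le> - p\<^sup>2 + \<rho> * (norm (cl L v))\<^sup>2 + \<rho>\<^sub>1 * (norm (cl L \<Phi>))\<^sup>2 + \<rho>\<^sub>2 * (norm (cl L \<Psi>))\<^sup>2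
      + (\<bar>- \<gamma>\<bar> * (norm (cl L v) * (2 * L * (cp * p))) + \<bar>- 1\<bar> * ((wbound g * h) * (cp * p)) + \<bar>m\<bar> * (norm (cl L \<theta>) * (cp * p)))"
    by (intro add_left_mono add_mono abs_mult_inner_le pot_W nu wint_norms admissible_g mem(9) order_refl)
  finally show ?thesis using pos by (simp add: algebra_simps)
qed

text \<open>The factor 2 comes from the two orders of the symmetric form; for the memory it is
  consumed by \<open>memory_dissipative\<close>, which leaves
  \<open>\<kappa>\<^sub>1\<close>.\<close>

lemma energy_decay: "E AW W + E W AW \<le> - min (2 * \<gamma>) (min (2 * \<sigma>) \<kappa>\<^sub>1) * ((norm (cl L v))\<^sup>2 + (norm (cl L q))\<^sup>2 + h\<^sup>2)"
proof -
  let ?c = "min (2 * \<gamma>) (min (2 * \<sigma>) \<kappa>\<^sub>1)"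
  have "E AW W + E W AW = - (2 * \<gamma>) * (norm (cl L v))\<^sup>2 - (2 * \<sigma>) * (norm (cl L q))\<^sup>2 - 2 * G L \<zeta> \<eta>"
    unfolding E_sym[of AW W] dissipation[unfolded AW_def[symmetric]] by simp
  moreover have "?c * (norm (cl L v))\<^sup>2 \<le> (2 * \<gamma>) * (norm (cl L v))\<^sup>2" by (rule mult_right_mono) auto
  moreover have "?c * (norm (cl L q))\<^sup>2 \<le> (2 * \<sigma>) * (norm (cl L q))\<^sup>2" by (rule mult_right_mono) auto
  moreover have "?c * h\<^sup>2 \<le> 2 * G L \<zeta> \<eta>"
  proof -
    have "?c * h\<^sup>2 \<le> \<kappa>\<^sub>1 * h\<^sup>2" by (rule mult_right_mono) auto
    also have "\<dots> \<le> 2 * G L \<zeta> \<eta>" using memory_dissipative[OF sd mem(14)] by (simp add: G_self[OF mem(9)])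
    finally show ?thesis .
  qed
  ultimately show ?thesis by (simp add: algebra_simps)
qed

end

section \<open>Combination of the multipliers\<close>

lemma Young: fixes k x y :: real shows "k * (x * y) \<le> y\<^sup>2 / 4 + k\<^sup>2 * x\<^sup>2"
  using zero_le_power2[of "y / 2 - k * x"] by (simp add: power2_diff power_mult_distrib power_divide algebra_simps)

text \<open>The weights are fixed in the order \<open>l3\<close>, \<open>l1\<close>, \<open>l2\<close>, so that the errors in \<open>F\<close>, then in \<open>P\<close>, then in \<open>t\<close> are
  absorbed; a large \<open>l0\<close> absorbs what remains in \<open>v\<close>, \<open>q\<close> and \<open>h\<close>.\<close>

lemma combine_multipliers:
  fixes C c0 c1 c2 c3 :: real
  assumes C: "C \<ge> 0" and c: "c0 > 0" "c1 > 0" "c2 > 0" "c3 > 0"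
  obtains l1 l2 l3 K where "\<And>l0 p v F P t q h e i1 i2 i3 i4 :: real. l0 \<ge> K \<Longrightarrow> e \<le> - c0 * (v\<^sup>2 + q\<^sup>2 + h\<^sup>2) \<Longrightarrow>
    i1 \<le> - c1 * P\<^sup>2 + C * (h * p + h\<^sup>2 + h * t + h * P) \<Longrightarrow> i2 \<le> - c2 * t\<^sup>2 + C * (q * t + q\<^sup>2 + q * F + q * P) \<Longrightarrow>
    i3 \<le> - c3 * F\<^sup>2 + C * (q * F + P * F + t * p + t\<^sup>2) \<Longrightarrow> i4 \<le> - p\<^sup>2 + C * (v\<^sup>2 + F\<^sup>2 + P\<^sup>2 + v * p + h * p + t * p) \<Longrightarrow>
    l0 * e + l1 * i1 + l2 * i2 + l3 * i3 + i4 \<le> - (1 / 4) * (p\<^sup>2 + v\<^sup>2 + F\<^sup>2 + P\<^sup>2 + t\<^sup>2 + q\<^sup>2 + h\<^sup>2)"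
proof -
  \<comment> \<open>Each of the three weights has as numerator the coefficients to be absorbed plus
    1; the 1 pays for the two quarters that Young's inequality leaves and for the final
    \<open>1 / 4\<close>.\<close>
  define l3 where "l3 = (C + 1) / c3"
  define k3 where "k3 = l3 * C"
  define k3' where "k3' = k3 + C"
  define l1 where "l1 = (C + k3\<^sup>2 + 1) / c1"
  define l2 where "l2 = (k3 + k3'\<^sup>2 + 1) / c2"
  define k1 where "k1 = l1 * C"
  define k2 where "k2 = l2 * C"
  \<comment> \<open>The coefficients of \<open>v\<^sup>2\<close>, \<open>h\<^sup>2\<close> and
    \<open>q\<^sup>2\<close> that remain after the Young splittings below, plus
    \<open>1 / 4\<close>.\<close>
  define M where "M = C + C\<^sup>2 + k1 + (k1 + C)\<^sup>2 + 2 * k1\<^sup>2 + k2 + 2 * k2\<^sup>2 + (k2 + k3)\<^sup>2 + 1 / 4"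
  have l: "l3 \<ge> 0" "k3 \<ge> 0" "k3' \<ge> 0" using C c by (simp_all add: l3_def k3_def k3'_def)
  then have l': "l1 \<ge> 0" "l2 \<ge> 0" using C c by (simp_all add: l1_def l2_def)
  then have k: "k1 \<ge> 0" "k2 \<ge> 0" using C by (simp_all add: k1_def k2_def)
  have e: "l3 * c3 = C + 1" "l1 * c1 = C + k3\<^sup>2 + 1" "l2 * c2 = k3 + k3'\<^sup>2 + 1"
    using c by (simp_all add: l3_def l1_def l2_def)
  show thesis
  proof (rule that[of "M / c0" l1 l2 l3])
    fix l0 p v F P t q h e' i1 i2 i3 i4 :: real
    assume A: "l0 \<ge> M / c0" "e' \<le> - c0 * (v\<^sup>2 + q\<^sup>2 + h\<^sup>2)"
      "i1 \<le> - c1 * P\<^sup>2 + C * (h * p + h\<^sup>2 + h * t + h * P)" "i2 \<le> - c2 * t\<^sup>2 + C * (q * t + q\<^sup>2 + q * F + q * P)"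
      "i3 \<le> - c3 * F\<^sup>2 + C * (q * F + P * F + t * p + t\<^sup>2)" "i4 \<le> - p\<^sup>2 + C * (v\<^sup>2 + F\<^sup>2 + P\<^sup>2 + v * p + h * p + t * p)"
    have M0: "M \<ge> 0" using C k by (simp add: M_def)
    then have "M / c0 \<ge> 0" using c by simp
    then have l0: "l0 \<ge> 0" using A(1) by linarith
    have "l0 * e' \<le> l0 * (- c0 * (v\<^sup>2 + q\<^sup>2 + h\<^sup>2))" by (rule mult_left_mono[OF A(2) l0])
    also have "\<dots> = - ((l0 * c0) * (v\<^sup>2 + q\<^sup>2 + h\<^sup>2))" by simp
    also have "\<dots> \<le> - (M * (v\<^sup>2 + q\<^sup>2 + h\<^sup>2))" proof -
      have "M \<le> l0 * c0" using A(1) c by (simp add: pos_divide_le_eq)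
      then show ?thesis using mult_right_mono[of M "l0 * c0" "v\<^sup>2 + q\<^sup>2 + h\<^sup>2"] by simp
    qed
    finally have E: "l0 * e' \<le> - (M * v\<^sup>2 + M * q\<^sup>2 + M * h\<^sup>2)" by (simp add: algebra_simps)
    have Mv: "(C + C\<^sup>2 + 1 / 4) * v\<^sup>2 \<le> M * v\<^sup>2" "(k1 + (k1 + C)\<^sup>2 + 2 * k1\<^sup>2 + 1 / 4) * h\<^sup>2 \<le> M * h\<^sup>2"
      "(k2 + 2 * k2\<^sup>2 + (k2 + k3)\<^sup>2 + 1 / 4) * q\<^sup>2 \<le> M * q\<^sup>2"
      using C k by (auto intro!: mult_right_mono simp: M_def)
    have "l1 * i1 \<le> l1 * (- c1 * P\<^sup>2 + C * (h * p + h\<^sup>2 + h * t + h * P))" by (rule mult_left_mono[OF A(3) l'(1)])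
    also have "\<dots> = - (l1 * c1) * P\<^sup>2 + k1 * (h * p) + k1 * h\<^sup>2 + k1 * (h * t) + k1 * (h * P)" by (simp add: k1_def algebra_simps)
    finally have I1: "l1 * i1 \<le> - (C + k3\<^sup>2 + 1) * P\<^sup>2 + k1 * (h * p) + k1 * h\<^sup>2 + k1 * (h * t) + k1 * (h * P)" unfolding e .
    have "l2 * i2 \<le> l2 * (- c2 * t\<^sup>2 + C * (q * t + q\<^sup>2 + q * F + q * P))" by (rule mult_left_mono[OF A(4) l'(2)])
    also have "\<dots> = - (l2 * c2) * t\<^sup>2 + k2 * (q * t) + k2 * q\<^sup>2 + k2 * (q * F) + k2 * (q * P)" by (simp add: k2_def algebra_simps)
    finally have I2: "l2 * i2 \<le> - (k3 + k3'\<^sup>2 + 1) * t\<^sup>2 + k2 * (q * t) + k2 * q\<^sup>2 + k2 * (q * F) + k2 * (q * P)" unfolding e .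
    have "l3 * i3 \<le> l3 * (- c3 * F\<^sup>2 + C * (q * F + P * F + t * p + t\<^sup>2))" by (rule mult_left_mono[OF A(5) l(1)])
    also have "\<dots> = - (l3 * c3) * F\<^sup>2 + k3 * (q * F) + k3 * (P * F) + k3 * (t * p) + k3 * t\<^sup>2" by (simp add: k3_def algebra_simps)
    finally have I3: "l3 * i3 \<le> - (C + 1) * F\<^sup>2 + k3 * (q * F) + k3 * (P * F) + k3 * (t * p) + k3 * t\<^sup>2" unfolding e .
    define n1 n2 n3 n4 n5 n6 where n: "n1 = (k1 + C)\<^sup>2" "n2 = (k2 + k3)\<^sup>2" "n3 = k3'\<^sup>2" "n4 = k3\<^sup>2" "n5 = k1\<^sup>2" "n6 = k2\<^sup>2"
    \<comment> \<open>Exactly three of these products contain \<open>p\<close>, so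
      \<open>- p\<^sup>2\<close> is reduced to \<open>- p\<^sup>2 / 4\<close>, which determines the
      constant of the conclusion.\<close>
    have y: "(k1 + C) * (h * p) \<le> p\<^sup>2 / 4 + n1 * h\<^sup>2" "(k2 + k3) * (q * F) \<le> F\<^sup>2 / 4 + n2 * q\<^sup>2"
      "(k3 + C) * (t * p) \<le> p\<^sup>2 / 4 + n3 * t\<^sup>2" "k3 * (P * F) \<le> F\<^sup>2 / 4 + n4 * P\<^sup>2"
      "k1 * (h * t) \<le> t\<^sup>2 / 4 + n5 * h\<^sup>2" "k1 * (h * P) \<le> P\<^sup>2 / 4 + n5 * h\<^sup>2" "k2 * (q * t) \<le> t\<^sup>2 / 4 + n6 * q\<^sup>2"
      "k2 * (q * P) \<le> P\<^sup>2 / 4 + n6 * q\<^sup>2" "C * (v * p) \<le> p\<^sup>2 / 4 + C\<^sup>2 * v\<^sup>2"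
      unfolding n k3'_def by (rule Young)+
    have "0 \<le> F\<^sup>2" "0 \<le> P\<^sup>2" "0 \<le> t\<^sup>2" by simp_all
    then show "l0 * e' + l1 * i1 + l2 * i2 + l3 * i3 + i4 \<le> - (1 / 4) * (p\<^sup>2 + v\<^sup>2 + F\<^sup>2 + P\<^sup>2 + t\<^sup>2 + q\<^sup>2 + h\<^sup>2)"
      using E Mv[unfolded n[symmetric]] I1[unfolded n[symmetric]] I2[unfolded n[symmetric]] I3 A(6) y
      unfolding distrib_left distrib_right minus_add_distrib mult_minus_left by linarith
  qed
qed

context beam
begin

text \<open>The sum of all coefficients in the error terms, hence an upper bound for each of them,
  since \<open>combine_multipliers\<close> works with a single constant.\<close>

definition "MC \<xi> \<xi>' = (wbound \<xi> * bt * cp + 2 * \<kappa> * L * wbound \<xi> * cp) + wbound \<xi> * wbound g + 2 * \<bar>m\<bar> * L * wbound \<xi> + 2 * \<rho>\<^sub>2 * L * wbound \<xi>'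
  + 2 * \<rho>\<^sub>3 * \<sigma> * L + \<tau> + \<tau> * \<bar>m\<bar> + 2 * \<tau> * \<bar>m\<bar> * L + \<bar>m\<bar> * \<rho>\<^sub>1 + 2 * m\<^sup>2 * \<rho>\<^sub>1 * L + \<bar>m\<bar> * \<rho>\<^sub>3 * (\<kappa> * cp + 2 * \<beta> * L * cp) + \<rho>\<^sub>3 * m\<^sup>2
  + \<rho> + \<rho>\<^sub>1 + \<rho>\<^sub>2 + 2 * \<gamma> * L * cp + wbound g * cp + \<bar>m\<bar> * cp"

lemma MC_terms:
  shows "0 \<le> wbound \<xi> * bt * cp + 2 * \<kappa> * L * wbound \<xi> * cp" "0 \<le> wbound \<xi> * wbound g" "0 \<le> 2 * \<bar>m\<bar> * L * wbound \<xi>"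
    "0 \<le> 2 * \<rho>\<^sub>2 * L * wbound \<xi>'" "0 \<le> 2 * \<rho>\<^sub>3 * \<sigma> * L" "0 \<le> \<tau>" "0 \<le> \<tau> * \<bar>m\<bar>" "0 \<le> 2 * \<tau> * \<bar>m\<bar> * L"
    "0 \<le> \<bar>m\<bar> * \<rho>\<^sub>1" "0 \<le> 2 * m\<^sup>2 * \<rho>\<^sub>1 * L" "0 \<le> \<bar>m\<bar> * \<rho>\<^sub>3 * (\<kappa> * cp + 2 * \<beta> * L * cp)" "0 \<le> \<rho>\<^sub>3 * m\<^sup>2"
    "0 \<le> \<rho>" "0 \<le> \<rho>\<^sub>1" "0 \<le> \<rho>\<^sub>2" "0 \<le> 2 * \<gamma> * L * cp" "0 \<le> wbound g * cp" "0 \<le> \<bar>m\<bar> * cp"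
  using pos b_tilde cp_nonneg wbound_nonneg
  by (auto intro!: add_nonneg_nonneg mult_nonneg_nonneg simp: less_imp_le)

lemma MC:
  "wbound \<xi> * bt * cp + 2 * \<kappa> * L * wbound \<xi> * cp \<le> MC \<xi> \<xi>'" "wbound \<xi> * wbound g \<le> MC \<xi> \<xi>'" "2 * \<bar>m\<bar> * L * wbound \<xi> \<le> MC \<xi> \<xi>'"
  "2 * \<rho>\<^sub>2 * L * wbound \<xi>' \<le> MC \<xi> \<xi>'" "2 * \<rho>\<^sub>3 * \<sigma> * L \<le> MC \<xi> \<xi>'" "\<tau> \<le> MC \<xi> \<xi>'" "\<tau> * \<bar>m\<bar> \<le> MC \<xi> \<xi>'" "2 * \<tau> * \<bar>m\<bar> * L \<le> MC \<xi> \<xi>'"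
  "\<bar>m\<bar> * \<rho>\<^sub>1 \<le> MC \<xi> \<xi>'" "2 * m\<^sup>2 * \<rho>\<^sub>1 * L \<le> MC \<xi> \<xi>'" "\<bar>m\<bar> * \<rho>\<^sub>3 * (\<kappa> * cp + 2 * \<beta> * L * cp) \<le> MC \<xi> \<xi>'" "\<rho>\<^sub>3 * m\<^sup>2 \<le> MC \<xi> \<xi>'"
  "\<rho> \<le> MC \<xi> \<xi>'" "\<rho>\<^sub>1 \<le> MC \<xi> \<xi>'" "\<rho>\<^sub>2 \<le> MC \<xi> \<xi>'" "2 * \<gamma> * L * cp \<le> MC \<xi> \<xi>'" "wbound g * cp \<le> MC \<xi> \<xi>'" "\<bar>m\<bar> * cp \<le> MC \<xi> \<xi>'"
  "0 \<le> MC \<xi> \<xi>'"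
  using MC_terms(1-3)[of \<xi>] MC_terms(4)[of \<xi>'] MC_terms(5-) unfolding MC_def by - linarith+

end

lemma (in beam_dom) multipliers:
  assumes tf: "(\<lambda>s. of_real (\<xi> s)) \<in> test_J" and \<xi>: "integrable halfline \<xi>"
    and \<xi>': "\<And>s. (\<xi> has_real_derivative \<xi>' s) (at s)"
  defines "nv \<equiv> norm (cl L v)" and "nF \<equiv> norm (cl L \<Phi>)" and "nP \<equiv> norm (cl L \<Psi>)" and "nt \<equiv> norm (cl L \<theta>)" and "nq \<equiv> norm (cl L q)"
  shows "- \<rho>\<^sub>2 * (F1 \<xi> AW W + F1 \<xi> W AW) \<le> - (\<rho>\<^sub>2 * (LINT s|halfline. \<xi> s)) * nP\<^sup>2 + MC \<xi> \<xi>' * (h * p + h\<^sup>2 + h * nt + h * nP)"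
    "- (\<rho>\<^sub>3 * \<tau>) * (F2 AW W + F2 W AW) \<le> - \<rho>\<^sub>3 * nt\<^sup>2 + MC \<xi> \<xi>' * (nq * nt + nq\<^sup>2 + nq * nF + nq * nP)"
    "- (m * \<rho>\<^sub>1 * \<rho>\<^sub>3) * (F3 AW W + F3 W AW) \<le> - (m\<^sup>2 * \<rho>\<^sub>1) * nF\<^sup>2 + MC \<xi> \<xi>' * (nq * nF + nP * nF + nt * p + nt\<^sup>2)"
    "F4 AW W + F4 W AW \<le> - p\<^sup>2 + MC \<xi> \<xi>' * (nv\<^sup>2 + nF\<^sup>2 + nP\<^sup>2 + nv * p + h * p + nt * p)"
proof -
  have nn: "0 \<le> h" "0 \<le> p" "0 \<le> nv" "0 \<le> nF" "0 \<le> nP" "0 \<le> nt" "0 \<le> nq"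
    by (auto simp: L2g_norm_nonneg pot_nonneg nv_def nF_def nP_def nt_def nq_def)
  have x: "0 \<le> h * p" "0 \<le> h\<^sup>2" "0 \<le> h * nt" "0 \<le> h * nP" "0 \<le> nq * nt" "0 \<le> nq\<^sup>2" "0 \<le> nq * nF" "0 \<le> nq * nP"
     "0 \<le> nP * nF" "0 \<le> nt * p" "0 \<le> nt\<^sup>2" "0 \<le> nv\<^sup>2" "0 \<le> nF\<^sup>2" "0 \<le> nP\<^sup>2" "0 \<le> nv * p"
    using nn by simp_all
  note r = mult_right_mono
  note M = MC[where \<xi> = \<xi> and \<xi>' = \<xi>']
  show "- \<rho>\<^sub>2 * (F1 \<xi> AW W + F1 \<xi> W AW) \<le> - (\<rho>\<^sub>2 * (LINT s|halfline. \<xi> s)) * nP\<^sup>2 + MC \<xi> \<xi>' * (h * p + h\<^sup>2 + h * nt + h * nP)"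
    using multiplier1[OF tf \<xi> \<xi>', folded nt_def nP_def] r[OF M(1) x(1)] r[OF M(2) x(2)] r[OF M(3) x(3)] r[OF M(4) x(4)]
    unfolding distrib_left by (simp only: mult_minus_left)
  show "- (\<rho>\<^sub>3 * \<tau>) * (F2 AW W + F2 W AW) \<le> - \<rho>\<^sub>3 * nt\<^sup>2 + MC \<xi> \<xi>' * (nq * nt + nq\<^sup>2 + nq * nF + nq * nP)"
    using multiplier2[folded nt_def nP_def nq_def nF_def] r[OF M(5) x(5)] r[OF M(6) x(6)] r[OF M(7) x(7)] r[OF M(8) x(8)]
    unfolding distrib_left by (simp only: mult_minus_left)
  show "- (m * \<rho>\<^sub>1 * \<rho>\<^sub>3) * (F3 AW W + F3 W AW) \<le> - (m\<^sup>2 * \<rho>\<^sub>1) * nF\<^sup>2 + MC \<xi> \<xi>' * (nq * nF + nP * nF + nt * p + nt\<^sup>2)"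
    using multiplier3[folded nt_def nP_def nq_def nF_def] r[OF M(9) x(7)] r[OF M(10) x(9)] r[OF M(11) x(10)] r[OF M(12) x(11)]
    unfolding distrib_left by (simp only: mult_minus_left)
  show "F4 AW W + F4 W AW \<le> - p\<^sup>2 + MC \<xi> \<xi>' * (nv\<^sup>2 + nF\<^sup>2 + nP\<^sup>2 + nv * p + h * p + nt * p)"
    using multiplier4[folded nt_def nP_def nv_def nF_def] r[OF M(13) x(12)] r[OF M(14) x(13)] r[OF M(15) x(14)] r[OF M(16) x(15)] r[OF M(17) x(1)] r[OF M(18) x(10)]
    unfolding distrib_left by linarith
qed

context beam
begin

lemma bform_F1: "admissible \<xi> \<Longrightarrow> bform (F1 \<xi>)"
  unfolding F1_def[abs_def] by (intro bform_inner blm_sPsi blm_wint)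

lemma bform_F2: "bform F2"
  unfolding F2_def[abs_def] by (intro bform_inner blm_sq blm_mprim)

lemma bform_F3: "bform F3"
  unfolding F3_def[abs_def] by (intro bform_inner blm_sth blm_prim)

lemma bform_F4: "bform F4"
  unfolding F4_def[abs_def] by (intro bform_add bform_cmult bform_inner blm_sPhi blm_sphi blm_sv blm_su blm_sPsi blm_spsi)

lemma Lyapunov_form:
  obtains B c where "bform B" "c > 0" "\<And>U. U \<in> X \<Longrightarrow> 1 * (N U)\<^sup>2 \<le> B U U" "\<And>W. W \<in> Dom \<Longrightarrow> B W (A W) + B (A W) W \<le> - c * (N W)\<^sup>2"
proof -
  obtain \<xi> where tf: "(\<lambda>s. of_real (\<xi> s)) \<in> test_J" and \<xi>0: "0 < (LINT s|halfline. \<xi> s)" and \<xi>: "integrable halfline \<xi>"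
    using positive_weight by blast
  define \<xi>1 where "\<xi>1 s = Re (vector_derivative (\<lambda>s. complex_of_real (\<xi> s)) (at s))" for s
  have \<xi>': "(\<xi> has_real_derivative \<xi>1 s) (at s)" for s
    unfolding \<xi>1_def by (rule smooth_of_real_has_deriv[OF test_functions_smooth[OF tf]])
  define c0 where "c0 = min (2 * \<gamma>) (min (2 * \<sigma>) \<kappa>\<^sub>1)"
  have cs: "c0 > 0" "\<rho>\<^sub>2 * (LINT s|halfline. \<xi> s) > 0" "\<rho>\<^sub>3 > 0" "m\<^sup>2 * \<rho>\<^sub>1 > 0" using pos \<xi>0 decay(1) by (simp_all add: c0_def)
  obtain l1 l2 l3 K0 where comb: "\<And>l0 p v F P t q h e i1 i2 i3 i4 :: real. l0 \<ge> K0 \<Longrightarrow> e \<le> - c0 * (v\<^sup>2 + q\<^sup>2 + h\<^sup>2) \<Longrightarrow>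
    i1 \<le> - (\<rho>\<^sub>2 * (LINT s|halfline. \<xi> s)) * P\<^sup>2 + MC \<xi> \<xi>1 * (h * p + h\<^sup>2 + h * t + h * P) \<Longrightarrow> i2 \<le> - \<rho>\<^sub>3 * t\<^sup>2 + MC \<xi> \<xi>1 * (q * t + q\<^sup>2 + q * F + q * P) \<Longrightarrow>
    i3 \<le> - (m\<^sup>2 * \<rho>\<^sub>1) * F\<^sup>2 + MC \<xi> \<xi>1 * (q * F + P * F + t * p + t\<^sup>2) \<Longrightarrow> i4 \<le> - p\<^sup>2 + MC \<xi> \<xi>1 * (v\<^sup>2 + F\<^sup>2 + P\<^sup>2 + v * p + h * p + t * p) \<Longrightarrow>
    l0 * e + l1 * i1 + l2 * i2 + l3 * i3 + i4 \<le> - (1 / 4) * (p\<^sup>2 + v\<^sup>2 + F\<^sup>2 + P\<^sup>2 + t\<^sup>2 + q\<^sup>2 + h\<^sup>2)"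
    by (rule combine_multipliers[OF MC(19)[of \<xi> \<xi>1] cs], rule that)
  define R where "R U V = (l1 * (- \<rho>\<^sub>2)) * F1 \<xi> U V + ((l2 * - (\<rho>\<^sub>3 * \<tau>)) * F2 U V + ((l3 * - (m * \<rho>\<^sub>1 * \<rho>\<^sub>3)) * F3 U V + F4 U V))" for U V
  have R: "bform R" unfolding R_def[abs_def]
    by (intro bform_add bform_cmult bform_F1 bform_F2 bform_F3 bform_F4 admissible_test tf)
  obtain K where K: "K \<ge> 0" "\<And>U V. U \<in> X \<Longrightarrow> V \<in> X \<Longrightarrow> \<bar>R U V\<bar> \<le> K * (N U * N V)" by (rule bform_bound[OF R], rule that)
  \<comment> \<open>\<open>K0\<close> suffices for the decay and \<open>K + 1\<close> for
    positivity: the multipliers are bounded by \<open>K\<close> times the energy, so at least one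
    copy of the energy is left over.\<close>
  define l0 where "l0 = max K0 (K + 1)"
  define B where "B U V = l0 * E U V + R U V" for U V
  \<comment> \<open>The squared norm is at most this sum of weights times the unweighted sum of
    squares; the 1 stands for \<open>pot\<close> and the memory, which enter the energy with weight
    1.\<close>
  define c where "c = 1 / 4 / (1 + \<rho> + \<rho>\<^sub>1 + \<rho>\<^sub>2 + \<rho>\<^sub>3 + \<tau>)"
  show thesis
  proof (rule that[of B c])
    show "bform B" unfolding B_def[abs_def] by (intro bform_add bform_cmult bform_E R)
    show "c > 0" using pos by (simp add: c_def add_pos_pos)
    fix U assume U: "U \<in> X"
    have "(K + 1) * (N U)\<^sup>2 \<le> l0 * (N U)\<^sup>2" by (rule mult_right_mono) (auto simp: l0_def)
    then show "1 * (N U)\<^sup>2 \<le> B U U"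
      unfolding B_def N_sq[OF U, symmetric] using K(2)[OF U U] by (simp add: power2_eq_square algebra_simps)
  next
    fix W assume W: "W \<in> Dom"
    obtain u v \<phi> \<Phi> \<psi> \<Psi> \<theta> q \<eta> where Weq: "W = (u, v, \<phi>, \<Phi>, \<psi>, \<Psi>, \<theta>, q, \<eta>)" by (cases W rule: lincomb_cases)
    interpret D: beam_dom g g' \<kappa>\<^sub>1 L \<rho> \<rho>\<^sub>1 \<rho>\<^sub>2 \<rho>\<^sub>3 \<alpha> \<kappa> b \<tau> \<sigma> \<beta> \<gamma> m u v \<phi> \<Phi> \<psi> \<Psi> \<theta> q \<eta>
      using W by unfold_locales (simp add: Weq)
    note I = D.multipliers[OF tf \<xi> \<xi>']
    have "B (A W) W + B W (A W) = l0 * (E D.AW D.W + E D.W D.AW) + l1 * (- \<rho>\<^sub>2 * (F1 \<xi> D.AW D.W + F1 \<xi> D.W D.AW))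
       + l2 * (- (\<rho>\<^sub>3 * \<tau>) * (F2 D.AW D.W + F2 D.W D.AW)) + l3 * (- (m * \<rho>\<^sub>1 * \<rho>\<^sub>3) * (F3 D.AW D.W + F3 D.W D.AW)) + (F4 D.AW D.W + F4 D.W D.AW)"
      unfolding B_def R_def Weq D.AW_def[symmetric] by (simp add: algebra_simps)
    also have "\<dots> \<le> - (1 / 4) * ((pot W)\<^sup>2 + (norm (cl L v))\<^sup>2 + (norm (cl L \<Phi>))\<^sup>2 + (norm (cl L \<Psi>))\<^sup>2 + (norm (cl L \<theta>))\<^sup>2 + (norm (cl L q))\<^sup>2 + (L2g_norm L g \<eta>)\<^sup>2)"
      unfolding Weq by (rule comb[OF _ D.energy_decay[folded c0_def] I]) (simp add: l0_def)
    also have "\<dots> \<le> - c * (N W)\<^sup>2"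
    proof -
      define s where "s = (pot W)\<^sup>2 + (norm (cl L v))\<^sup>2 + (norm (cl L \<Phi>))\<^sup>2 + (norm (cl L \<Psi>))\<^sup>2 + (norm (cl L \<theta>))\<^sup>2 + (norm (cl L q))\<^sup>2 + (L2g_norm L g \<eta>)\<^sup>2"
      have nn: "0 \<le> (pot W)\<^sup>2" "0 \<le> (norm (cl L v))\<^sup>2" "0 \<le> (norm (cl L \<Phi>))\<^sup>2" "0 \<le> (norm (cl L \<Psi>))\<^sup>2" "0 \<le> (norm (cl L \<theta>))\<^sup>2" "0 \<le> (norm (cl L q))\<^sup>2" "0 \<le> (L2g_norm L g \<eta>)\<^sup>2"
        by simp_all
      have WX: "W \<in> X" using D.W_X Weq by simp
      have "\<rho> * (norm (cl L v))\<^sup>2 \<le> \<rho> * s" "\<rho>\<^sub>1 * (norm (cl L \<Phi>))\<^sup>2 \<le> \<rho>\<^sub>1 * s" "\<rho>\<^sub>2 * (norm (cl L \<Psi>))\<^sup>2 \<le> \<rho>\<^sub>2 * s" "\<rho>\<^sub>3 * (norm (cl L \<theta>))\<^sup>2 \<le> \<rho>\<^sub>3 * s"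
        "\<tau> * (norm (cl L q))\<^sup>2 \<le> \<tau> * s" "(pot W)\<^sup>2 + (L2g_norm L g \<eta>)\<^sup>2 \<le> s"
        using pos nn unfolding s_def by (auto intro!: mult_left_mono simp: less_imp_le)
      moreover have "(N W)\<^sup>2 = (pot W)\<^sup>2 + \<rho> * (norm (cl L v))\<^sup>2 + \<rho>\<^sub>1 * (norm (cl L \<Phi>))\<^sup>2 + \<rho>\<^sub>2 * (norm (cl L \<Psi>))\<^sup>2 + \<rho>\<^sub>3 * (norm (cl L \<theta>))\<^sup>2 + \<tau> * (norm (cl L q))\<^sup>2 + (L2g_norm L g \<eta>)\<^sup>2"
        unfolding N_sq[OF WX] E_self[OF WX] pot_sq by (simp add: Weq proj_simps)
      ultimately have "(N W)\<^sup>2 \<le> (1 + \<rho> + \<rho>\<^sub>1 + \<rho>\<^sub>2 + \<rho>\<^sub>3 + \<tau>) * s" by (simp add: distrib_right)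
      moreover have "1 + \<rho> + \<rho>\<^sub>1 + \<rho>\<^sub>2 + \<rho>\<^sub>3 + \<tau> > 0" using pos by (simp add: add_pos_pos)
      ultimately have "c * (N W)\<^sup>2 \<le> (1 / 4) * s" by (simp add: c_def field_simps)
      then show ?thesis unfolding s_def by simp
    qed
    finally show "B W (A W) + B (A W) W \<le> - c * (N W)\<^sup>2" by (simp add: add.commute)
  qed
qed

lemma A_in_X: "W \<in> Dom \<Longrightarrow> A W \<in> X"
proof -
  assume W: "W \<in> Dom"
  obtain u v \<phi> \<Phi> \<psi> \<Psi> \<theta> q \<eta> where Weq: "W = (u, v, \<phi>, \<Phi>, \<psi>, \<Psi>, \<theta>, q, \<eta>)" by (cases W rule: lincomb_cases)
  interpret D: beam_dom g g' \<kappa>\<^sub>1 L \<rho> \<rho>\<^sub>1 \<rho>\<^sub>2 \<rho>\<^sub>3 \<alpha> \<kappa> b \<tau> \<sigma> \<beta> \<gamma> m u v \<phi> \<Phi> \<psi> \<Psi> \<theta> q \<eta>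
    using W by unfold_locales (simp add: Weq)
  show ?thesis using D.AW_X unfolding D.AW_def Weq .
qed

end

section \<open>Density of the domain\<close>

lemma has_integral_H10_add:
  assumes "has_integral_H10 L F w" "has_integral_H10 L F' w'"
  shows "has_integral_H10 L (\<lambda>s x. F s x + F' s x) (\<lambda>x. w x + w' x)"
proof -
  have F: "strongly_measurable L F" "w \<in> H10 L" and F': "strongly_measurable L F'" "w' \<in> H10 L"
    using assms by (auto simp: has_integral_H10_def)
  note b = has_bochner_integral_add[OF has_integral_H10_bochner[OF assms(1)] has_integral_H10_bochner[OF assms(2)]]
  note sm = strongly_measurable_add[OF F(1) F'(1)]
  have ae: "AE s in halfline. d L (F s) + d L (F' s) = d L (\<lambda>x. F s x + F' s x)"
    using strongly_measurable_AE[OF F(1)] strongly_measurable_AE[OF F'(1)] by eventually_elim (simp add: d_add H10_H1)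
  have "has_bochner_integral halfline (\<lambda>s. d L (\<lambda>x. F s x + F' s x)) (d L w + d L w')"
    using b has_bochner_integralI_AE[OF b strongly_measurable_d[OF sm] ae] by simp
  then show ?thesis
    using F(2) F'(2) by (intro has_integral_H10I[OF sm]) (auto simp: has_bochner_integral_iff d_add H10_H1 intro: H10_add)
qed

text \<open>The scalar \<open>k s\<close> is complex while \<open>d L\<close> is handled as a
  real-linear map, hence the splitting into real multiples of \<open>y\<close> and
  \<open>\<i> * y\<close>, both of which are test functions.\<close>

lemma has_integral_H10_elementary:
  assumes k: "integrable halfline k" and y: "y \<in> test_functions {0<..<L}"
  shows "has_integral_H10 L (\<lambda>s x. k s * y x) (\<lambda>x. (LINT s|halfline. k s) * y x)"
proof -
  have yH: "y \<in> H10 L" "(\<lambda>x. \<i> * y x) \<in> H10 L" using y by (auto intro: test_functions_H10 test_functions_cmult)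
  have split: "(\<lambda>x. c * y x) = (\<lambda>x. of_real (Re c) * y x + of_real (Im c) * (\<i> * y x))" for c
    by (simp add: complex_eq_iff fun_eq_iff)
  have dl: "d L (\<lambda>x. c * y x) = Re c *\<^sub>R d L y + Im c *\<^sub>R d L (\<lambda>x. \<i> * y x)" for c
    unfolding split[of c] using yH by (simp only: d_add d_cmult H1_cmult H10_H1)
  have km: "(\<lambda>s. Re (k s)) \<in> borel_measurable halfline" "(\<lambda>s. Im (k s)) \<in> borel_measurable halfline"
    using borel_measurable_integrable[OF k] by auto
  have sm: "strongly_measurable L (\<lambda>s x. k s * y x)"
  proof -
    have "(\<lambda>s x. k s * y x) = (\<lambda>s x. of_real (Re (k s)) * y x + of_real (Im (k s)) * (\<i> * y x))"
      by (intro ext) (rule fun_cong[OF split])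
    then show ?thesis using strongly_measurable_add[OF strongly_measurable_mult[OF km(1) strongly_measurable_const[OF yH(1)]]
      strongly_measurable_mult[OF km(2) strongly_measurable_const[OF yH(2)]]] by simp
  qed
  have dk: "(\<lambda>s. d L (\<lambda>x. k s * y x)) = (\<lambda>s. Re (k s) *\<^sub>R d L y + Im (k s) *\<^sub>R d L (\<lambda>x. \<i> * y x))" by (intro ext dl)
  show ?thesis
  proof (rule has_integral_H10I[OF sm])
    show "integrable halfline (\<lambda>s. d L (\<lambda>x. k s * y x))" unfolding dk using k by simp
    show "(\<lambda>x. (LINT s|halfline. k s) * y x) \<in> H10 L" using y by (intro test_functions_H10 test_functions_cmult)
    show "d L (\<lambda>x. (LINT s|halfline. k s) * y x) = (LINT s|halfline. d L (\<lambda>x. k s * y x))"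
      unfolding dk dl[of "LINT s|halfline. k s"] using k by simp
  qed
qed

lemma has_s_deriv_add:
  assumes "has_s_deriv L g \<eta> \<zeta>" "has_s_deriv L g \<eta>' \<zeta>'"
    and "(\<lambda>s x. \<eta> s x + \<eta>' s x) \<in> L2g L g" "(\<lambda>s x. \<zeta> s x + \<zeta>' s x) \<in> L2g L g"
  shows "has_s_deriv L g (\<lambda>s x. \<eta> s x + \<eta>' s x) (\<lambda>s x. \<zeta> s x + \<zeta>' s x)"
  unfolding has_s_deriv_def
proof (intro conjI assms(3,4) ballI)
  fix \<phi> assume \<phi>: "\<phi> \<in> test_functions {s. 0 < s \<and> 0 < g s}"
  obtain w where w: "has_integral_H10 L (\<lambda>s x. vector_derivative \<phi> (at s) * \<eta> s x) w" "has_integral_H10 L (\<lambda>s x. \<phi> s * \<zeta> s x) (\<lambda>x. - w x)"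
    using assms(1) \<phi> unfolding has_s_deriv_def by blast
  obtain w' where w': "has_integral_H10 L (\<lambda>s x. vector_derivative \<phi> (at s) * \<eta>' s x) w'" "has_integral_H10 L (\<lambda>s x. \<phi> s * \<zeta>' s x) (\<lambda>x. - w' x)"
    using assms(2) \<phi> unfolding has_s_deriv_def by blast
  show "\<exists>w. has_integral_H10 L (\<lambda>s x. vector_derivative \<phi> (at s) * (\<eta> s x + \<eta>' s x)) w \<and> has_integral_H10 L (\<lambda>s x. \<phi> s * (\<zeta> s x + \<zeta>' s x)) (\<lambda>x. - w x)"
    using has_integral_H10_add[OF w(1) w'(1)] has_integral_H10_add[OF w(2) w'(2)]
    by (intro exI[of _ "\<lambda>x. w x + w' x"]) (simp add: distrib_left)
qed

context kernel
begin

lemma L2g_add: "\<eta> \<in> L2g L g \<Longrightarrow> \<zeta> \<in> L2g L g \<Longrightarrow> (\<lambda>s x. \<eta> s x + \<zeta> s x) \<in> L2g L g"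
  using dg_lincomb(2)[of \<eta> L \<zeta> 1 1] by simp

text \<open>Histories that fit the domain together with any test function in the place of \<psi>.
  Continuity and the value at 0 give the zero trace; the last clause, that the weighted integral has
  the derivative of a test function, gives the H2 regularity of the memory stress.\<close>

definition good :: "real \<Rightarrow> (real \<Rightarrow> real \<Rightarrow> complex) \<Rightarrow> bool" where
  "good L \<eta> \<longleftrightarrow> \<eta> \<in> L2g L g \<and> (\<forall>s. \<eta> s \<in> H10 L) \<and> continuous_on UNIV (\<lambda>s. d L (\<eta> s)) \<and> d L (\<eta> 0) = 0 \<and>
     (\<exists>\<zeta>. has_s_deriv L g \<eta> \<zeta>) \<and> (\<exists>y\<in>test_functions {0<..<L}. d L (wint L g \<eta>) = d L y)"

lemma good_add:
  assumes "good L \<eta>" "good L \<eta>'" shows "good L (\<lambda>s x. \<eta> s x + \<eta>' s x)"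
proof -
  obtain \<zeta> \<zeta>' where \<zeta>: "has_s_deriv L g \<eta> \<zeta>" "has_s_deriv L g \<eta>' \<zeta>'" using assms by (auto simp: good_def)
  obtain y y' where y: "y \<in> test_functions {0<..<L}" "d L (wint L g \<eta>) = d L y" "y' \<in> test_functions {0<..<L}" "d L (wint L g \<eta>') = d L y'"
    using assms by (auto simp: good_def)
  have \<eta>: "\<eta> \<in> L2g L g" "\<eta>' \<in> L2g L g" "\<And>s. \<eta> s \<in> H1 L" "\<And>s. \<eta>' s \<in> H1 L" using assms by (auto simp: good_def H10_H1)
  have "d L (wint L g (\<lambda>s x. \<eta> s x + \<eta>' s x)) = d L (\<lambda>x. y x + y' x)"
    using wint_lincomb[OF admissible_g \<eta>(1,2), of 1 1] y by (simp add: d_add test_functions_H1)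
  moreover have "has_s_deriv L g (\<lambda>s x. \<eta> s x + \<eta>' s x) (\<lambda>s x. \<zeta> s x + \<zeta>' s x)"
    using \<zeta> by (intro has_s_deriv_add L2g_add) (auto simp: has_s_deriv_def)
  ultimately show ?thesis
    using assms y(1,3) \<eta> unfolding good_def
    by (auto simp: d_add L2g_add H10_add intro!: continuous_on_add bexI[of _ "\<lambda>x. y x + y' x"] test_functions_add)
qed

definition sqg :: "(real \<Rightarrow> real) \<Rightarrow> bool" where
  "sqg k \<longleftrightarrow> k \<in> borel_measurable halfline \<and> integrable halfline (\<lambda>s. g s * (k s)\<^sup>2)"

lemma dg_scalar: "y \<in> H10 L \<Longrightarrow> dg L (\<lambda>s x. of_real (k s) * y x) s = (sqrt (g s) * k s) *\<^sub>R d L y"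
  unfolding dg_def by (simp add: d_cmult H1_cmult H10_H1)

lemma L2g_scalar:
  assumes k: "sqg k" and y: "y \<in> H10 L" shows "(\<lambda>s x. of_real (k s) * y x) \<in> L2g L g"
proof -
  have sm: "strongly_measurable L (\<lambda>s x. of_real (sqrt (g s)) * (of_real (k s) * y x))"
    using k by (intro strongly_measurable_mult sqrt_g_measurable strongly_measurable_const y) (simp add: sqg_def)
  have "integrable halfline (\<lambda>s. g s * (k s)\<^sup>2 * (norm (d L y))\<^sup>2)" using k by (simp add: sqg_def)
  moreover have "(norm ((sqrt (g s) * k s) *\<^sub>R d L y))\<^sup>2 = g s * (k s)\<^sup>2 * (norm (d L y))\<^sup>2" if "s \<in> space halfline" for s
    using that g_nonneg[of s] by (simp add: power_mult_distrib halfline_space)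
  ultimately have "integrable halfline (\<lambda>s. (norm ((sqrt (g s) * k s) *\<^sub>R d L y))\<^sup>2)"
    using Bochner_Integration.integrable_cong[OF refl, of halfline] by (metis (no_types, lifting))
  then show ?thesis using sm by (simp add: L2g_iff dg_scalar[OF y])
qed

text \<open>The weight vanishes at \<open>s = 0\<close>, which gives the zero trace, and the
  s-derivative falls on the scalar factor alone, because the derivative of a product of test
  functions integrates to 0.\<close>

lemma good_elementary:
  assumes tf: "(\<lambda>s. of_real (k s)) \<in> test_J" and y: "y \<in> test_functions {0<..<L}"
  shows "sqg k" "good L (\<lambda>s x. of_real (k s) * y x)"
proof -
  let ?P = "{s. 0 < s \<and> 0 < g s}"
  have yH: "y \<in> H10 L" using y by (rule test_functions_H10)
  have sqt: "sqg k \<and> integrable halfline (\<lambda>s. g s * k s)" if tf: "(\<lambda>s. of_real (k s)) \<in> test_functions ?P" for k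
  proof -
    obtain B where B: "\<And>s. cmod (of_real (k s)) \<le> B" "B > 0" using test_functions_bounded[OF tf] by blast
    have km: "k \<in> borel_measurable halfline" using admissible_test[OF tf] by (simp add: admissible_def)
    have "integrable halfline (\<lambda>s. g s * (k s)\<^sup>2)"
    proof (rule Bochner_Integration.integrable_bound)
      show "integrable halfline (\<lambda>s. g s * B\<^sup>2)" using g_integrable by simp
      show "AE s in halfline. norm (g s * (k s)\<^sup>2) \<le> norm (g s * B\<^sup>2)"
        using power_mono[OF B(1), where n = 2] by (auto simp: abs_mult intro!: mult_left_mono)
    qed (use km g_measurable in simp)
    moreover have "integrable halfline (\<lambda>s. g s * k s)"
    proof (rule Bochner_Integration.integrable_bound)
      show "integrable halfline (\<lambda>s. g s * B)" using g_integrable by simp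
      show "AE s in halfline. norm (g s * k s) \<le> norm (g s * B)"
        using B by (auto simp: abs_mult intro!: mult_left_mono)
    qed (use km g_measurable in simp)
    ultimately show ?thesis using km by (simp add: sqg_def)
  qed
  show sk: "sqg k" using sqt[OF tf] by blast
  have sm: "smooth (\<lambda>s. of_real (k s))" by (rule test_functions_smooth[OF tf])
  define k' where "k' s = Re (vector_derivative (\<lambda>s. of_real (k s)) (at s))" for s
  have k': "(k has_real_derivative k' s) (at s)" for s unfolding k'_def by (rule smooth_of_real_has_deriv[OF sm])
  have vd: "((\<lambda>s. complex_of_real (k s)) has_vector_derivative of_real (k' s)) (at s)" for s
    by (rule has_vector_derivative_of_real[OF k'])
  have tf': "(\<lambda>s. of_real (k' s)) \<in> test_functions ?P"
    using test_functions_deriv[OF tf] by (simp add: vector_derivative_at[OF vd])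
  have k0: "k 0 = 0" using test_functions_outside[OF tf, of 0] by simp
  have sd: "has_s_deriv L g (\<lambda>s x. of_real (k s) * y x) (\<lambda>s x. of_real (k' s) * y x)"
    unfolding has_s_deriv_def
  proof (intro conjI ballI L2g_scalar yH sk)
    show "sqg k'" using sqt[OF tf'] by blast
    fix \<phi> assume \<phi>: "\<phi> \<in> test_functions ?P"
    let ?f = "\<lambda>s. vector_derivative \<phi> (at s) * of_real (k s)" and ?h = "\<lambda>s. \<phi> s * of_real (k' s)"
    have i: "integrable lebesgue ?f" "integrable lebesgue ?h"
      using \<phi> tf tf' by (auto intro!: sqint_prod_integrable test_functions_sqint test_functions_deriv)
    have ind: "(\<lambda>s. indicator {0..} s *\<^sub>R ?f s) = ?f" "(\<lambda>s. indicator {0..} s *\<^sub>R ?h s) = ?h"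
      using test_functions_outside[OF \<phi>] test_functions_outside[OF tf] by (force simp: indicator_def fun_eq_iff)+
    have h: "integrable halfline ?f" "integrable halfline ?h" unfolding halfline_integrable ind by (rule i)+
    have eq: "(LINT s|halfline. ?f s) = (LINT s|lebesgue. ?f s)" "(LINT s|halfline. ?h s) = (LINT s|lebesgue. ?h s)"
      unfolding halfline_integral ind by simp_all
    have pd: "((\<lambda>s. \<phi> s * of_real (k s)) has_vector_derivative (?h s + ?f s)) (at s)" for s
      using has_vector_derivative_mult[OF smooth_has_deriv[OF test_functions_smooth[OF \<phi>]] vd] by (simp add: algebra_simps)
    have "(\<lambda>s. \<phi> s * of_real (k s)) \<in> test_functions ?P"
      using test_functions_mult_smooth[OF sm \<phi>] by (simp add: mult.commute)
    from test_functions_integral_deriv(1)[OF this] have "(LINT s|lebesgue. ?h s) = - (LINT s|lebesgue. ?f s)"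
      using i by (simp add: vector_derivative_at[OF pd] add_eq_0_iff)
    then have w: "(LINT s|halfline. ?h s) = - (LINT s|halfline. ?f s)" unfolding eq .
    show "\<exists>w. has_integral_H10 L (\<lambda>s x. vector_derivative \<phi> (at s) * (of_real (k s) * y x)) w \<and>
        has_integral_H10 L (\<lambda>s x. \<phi> s * (of_real (k' s) * y x)) (\<lambda>x. - w x)"
      using has_integral_H10_elementary[OF h(1) y] has_integral_H10_elementary[OF h(2) y] unfolding w
      by (intro exI[of _ "\<lambda>x. (LINT s|halfline. ?f s) * y x"]) (simp add: mult.assoc)
  qed
  have "d L (wint L g (\<lambda>s x. of_real (k s) * y x)) = (LINT s|halfline. (g s / sqrt (g s)) *\<^sub>R (sqrt (g s) * k s) *\<^sub>R d L y)"
    unfolding wint(2)[OF admissible_g L2g_scalar[OF sk yH]] dg_scalar[OF yH] ..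
  also have "\<dots> = (LINT s|halfline. (g s * k s) *\<^sub>R d L y)"
    by (rule Bochner_Integration.integral_cong) (use g_nonneg in \<open>auto simp: halfline_space real_div_sqrt\<close>)
  also have "\<dots> = d L (\<lambda>x. of_real (LINT s|halfline. g s * k s) * y x)"
    using sqt[OF tf] yH by (simp add: d_cmult H10_H1)
  finally have st: "\<exists>z\<in>test_functions {0<..<L}. d L (wint L g (\<lambda>s x. of_real (k s) * y x)) = d L z"
    using test_functions_cmult[OF y] by blast
  have kc: "continuous_on UNIV k" using k' by (intro continuous_at_imp_continuous_on) (auto intro: DERIV_isCont)
  have "continuous_on UNIV (\<lambda>s. d L (\<lambda>x. of_real (k s) * y x))"
    using yH by (simp add: d_cmult H10_H1 continuous_on_scaleR[OF kc])
  then show "good L (\<lambda>s x. of_real (k s) * y x)"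
    using sd st yH k0 L2g_scalar[OF sk yH] unfolding good_def by (auto simp: d_zero intro: H10_cmult)
qed

text \<open>The squared distance in \<open>L2g\<close>; for a closure argument the triangle
  inequality for squares, with factor 2, is enough.\<close>

definition Q :: "real \<Rightarrow> (real \<Rightarrow> real \<Rightarrow> complex) \<Rightarrow> (real \<Rightarrow> real \<Rightarrow> complex) \<Rightarrow> real" where
  "Q L \<eta> \<zeta> = (LINT s|halfline. (norm (dg L \<eta> s - dg L \<zeta> s))\<^sup>2)"

lemma Q_integrable:
  assumes "\<eta> \<in> L2g L g" "\<zeta> \<in> L2g L g" shows "integrable halfline (\<lambda>s. (norm (dg L \<eta> s - dg L \<zeta> s))\<^sup>2)"
proof (rule Bochner_Integration.integrable_bound)
  show "integrable halfline (\<lambda>s. 2 * (norm (dg L \<eta> s))\<^sup>2 + 2 * (norm (dg L \<zeta> s))\<^sup>2)"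
    using dg_sq_integrable assms by auto
  show "AE s in halfline. norm ((norm (dg L \<eta> s - dg L \<zeta> s))\<^sup>2) \<le> norm (2 * (norm (dg L \<eta> s))\<^sup>2 + 2 * (norm (dg L \<zeta> s))\<^sup>2)"
    using norm_add_sq_le[of "dg L \<eta> s" "- dg L \<zeta> s" for s] by (intro AE_I2) simp
qed (use dg_measurable assms in measurable)

lemma Q_triangle:
  assumes "\<eta> \<in> L2g L g" "\<zeta> \<in> L2g L g" "\<xi> \<in> L2g L g" shows "Q L \<eta> \<xi> \<le> 2 * Q L \<eta> \<zeta> + 2 * Q L \<zeta> \<xi>"
proof -
  have "Q L \<eta> \<xi> \<le> (LINT s|halfline. 2 * (norm (dg L \<eta> s - dg L \<zeta> s))\<^sup>2 + 2 * (norm (dg L \<zeta> s - dg L \<xi> s))\<^sup>2)"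
    unfolding Q_def using Q_integrable assms norm_add_sq_le[of "dg L \<eta> s - dg L \<zeta> s" "dg L \<zeta> s - dg L \<xi> s" for s]
    by (intro integral_mono) auto
  then show ?thesis using Q_integrable assms by (simp add: Q_def)
qed

lemma Q_add:
  assumes "\<eta> \<in> L2g L g" "\<zeta> \<in> L2g L g" "\<eta>' \<in> L2g L g" "\<zeta>' \<in> L2g L g"
  shows "Q L (\<lambda>s x. \<eta> s x + \<eta>' s x) (\<lambda>s x. \<zeta> s x + \<zeta>' s x) \<le> 2 * Q L \<eta> \<zeta> + 2 * Q L \<eta>' \<zeta>'"
proof -
  have ae: "AE s in halfline. (norm (dg L (\<lambda>s x. \<eta> s x + \<eta>' s x) s - dg L (\<lambda>s x. \<zeta> s x + \<zeta>' s x) s))\<^sup>2 \<le>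
      2 * (norm (dg L \<eta> s - dg L \<zeta> s))\<^sup>2 + 2 * (norm (dg L \<eta>' s - dg L \<zeta>' s))\<^sup>2"
    using dg_lincomb(1)[OF assms(1,3), of 1 1] dg_lincomb(1)[OF assms(2,4), of 1 1]
  proof eventually_elim
    case (elim s)
    show ?case using elim norm_add_sq_le[of "dg L \<eta> s - dg L \<zeta> s" "dg L \<eta>' s - dg L \<zeta>' s"] by (simp add: algebra_simps)
  qed
  have "Q L (\<lambda>s x. \<eta> s x + \<eta>' s x) (\<lambda>s x. \<zeta> s x + \<zeta>' s x) \<le>
      (LINT s|halfline. 2 * (norm (dg L \<eta> s - dg L \<zeta> s))\<^sup>2 + 2 * (norm (dg L \<eta>' s - dg L \<zeta>' s))\<^sup>2)"
    unfolding Q_def using Q_integrable assms L2g_add ae by (intro integral_mono_AE) auto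
  then show ?thesis using Q_integrable assms by (simp add: Q_def)
qed

definition goodC :: "real \<Rightarrow> (real \<Rightarrow> real \<Rightarrow> complex) set" where
  "goodC L = {\<eta> \<in> L2g L g. \<forall>e>0. \<exists>\<zeta>. good L \<zeta> \<and> Q L \<eta> \<zeta> < e}"

lemma goodC_limit:
  assumes \<eta>: "\<eta> \<in> L2g L g" and z: "\<And>n::nat. \<zeta> n \<in> goodC L" and lim: "(\<lambda>n. Q L \<eta> (\<zeta> n)) \<longlonglongrightarrow> 0"
  shows "\<eta> \<in> goodC L"
  unfolding goodC_def
proof (intro CollectI conjI \<eta> allI impI)
  fix e :: real assume "e > 0"
  then have e: "e / 4 > 0" by simp
  obtain n where n: "Q L \<eta> (\<zeta> n) < e / 4" using order_tendstoD(2)[OF lim e] by (auto simp: eventually_sequentially)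
  obtain \<xi> where \<xi>: "good L \<xi>" "Q L (\<zeta> n) \<xi> < e / 4" using z[of n] e unfolding goodC_def by blast
  have "Q L \<eta> \<xi> < e" using Q_triangle[OF \<eta>, of "\<zeta> n" \<xi>] n \<xi> z[of n] by (auto simp: goodC_def good_def)
  then show "\<exists>\<zeta>. good L \<zeta> \<and> Q L \<eta> \<zeta> < e" using \<xi> by blast
qed

lemma goodC_add:
  assumes "\<eta> \<in> goodC L" "\<eta>' \<in> goodC L" shows "(\<lambda>s x. \<eta> s x + \<eta>' s x) \<in> goodC L"
  unfolding goodC_def
proof (intro CollectI conjI allI impI)
  show "(\<lambda>s x. \<eta> s x + \<eta>' s x) \<in> L2g L g" using assms by (auto simp: goodC_def intro: L2g_add)
  fix e :: real assume "e > 0"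
  then have e: "e / 4 > 0" by simp
  obtain \<zeta> where \<zeta>: "good L \<zeta>" "Q L \<eta> \<zeta> < e / 4" using assms(1) e unfolding goodC_def by blast
  obtain \<zeta>' where \<zeta>': "good L \<zeta>'" "Q L \<eta>' \<zeta>' < e / 4" using assms(2) e unfolding goodC_def by blast
  show "\<exists>\<zeta>. good L \<zeta> \<and> Q L (\<lambda>s x. \<eta> s x + \<eta>' s x) \<zeta> < e"
    using Q_add[of \<eta> L \<zeta> \<eta>' \<zeta>'] good_add[OF \<zeta>(1) \<zeta>'(1)] \<zeta> \<zeta>' assms
    by (intro exI[of _ "\<lambda>s x. \<zeta> s x + \<zeta>' s x"]) (auto simp: goodC_def good_def)
qed

lemma good_goodC: assumes "good L \<eta>" shows "\<eta> \<in> goodC L"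
proof -
  have "Q L \<eta> \<eta> = 0" by (simp add: Q_def)
  then show ?thesis using assms unfolding goodC_def by (auto simp: good_def)
qed

end

lemma AE_halfline_nonzero: "AE s in halfline. s \<noteq> 0"
proof -
  have "{0::real} \<in> null_sets lebesgue" by (intro null_sets_completionI finite_imp_null_set_lborel) simp
  then have "AE s in lebesgue. s \<notin> {0::real}" by (rule AE_not_in)
  then show ?thesis by (subst AE_restrict_space_iff) auto
qed

context kernel
begin

lemma Q_scalar:
  assumes "y \<in> H10 L"
  shows "Q L (\<lambda>s x. of_real (k s) * y x) (\<lambda>s x. of_real (k' s) * y x) = (LINT s|halfline. g s * (k s - k' s)\<^sup>2) * (norm (d L y))\<^sup>2"
proof -
  have "Q L (\<lambda>s x. of_real (k s) * y x) (\<lambda>s x. of_real (k' s) * y x) = (LINT s|halfline. g s * (k s - k' s)\<^sup>2 * (norm (d L y))\<^sup>2)"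
    unfolding Q_def
  proof (rule Bochner_Integration.integral_cong[OF refl])
    fix s assume "s \<in> space halfline"
    then have "g s \<ge> 0" using g_nonneg by (simp add: halfline_space)
    then show "(norm (dg L (\<lambda>s x. of_real (k s) * y x) s - dg L (\<lambda>s x. of_real (k' s) * y x) s))\<^sup>2 = g s * (k s - k' s)\<^sup>2 * (norm (d L y))\<^sup>2"
      unfolding dg_scalar[OF assms] by (simp add: power_mult_distrib right_diff_distrib[symmetric] flip: scaleR_diff_left)
  qed
  then show ?thesis by simp
qed

text \<open>On (0,b) the weight lies between the positive numbers \<open>g b\<close> and
  \<open>g 0\<close>, so the weighted and the plain L2 norms are equivalent there and the density of
  test functions carries over.\<close>

lemma goodC_interval:
  assumes k: "sqg k" and y: "y \<in> test_functions {0<..<L}" and b: "b \<in> J" and supp: "\<And>s. s \<notin> {0<..<b} \<Longrightarrow> k s = 0"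
  shows "(\<lambda>s x. of_real (k s) * y x) \<in> goodC L"
proof -
  have yH: "y \<in> H10 L" using y by (rule test_functions_H10)
  have gb: "g b > 0" "b \<ge> 0" using b by (auto simp: J_def)
  let ?f = "\<lambda>s. complex_of_real (k s)"
  have ind: "(\<lambda>s. indicator {0..} s *\<^sub>R k s) = k" using supp by (force simp: indicator_def fun_eq_iff)
  have km: "k \<in> borel_measurable lebesgue"
    using k unfolding sqg_def halfline_measurable ind by blast
  have "integrable lebesgue (\<lambda>s. (cmod (?f s))\<^sup>2)"
  proof (rule Bochner_Integration.integrable_bound)
    show "integrable lebesgue (\<lambda>s. (1 / g b) * (indicator {0..} s *\<^sub>R (g s * (k s)\<^sup>2)))"
      using k by (intro integrable_mult_right) (simp add: sqg_def halfline_integrable)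
    show "AE s in lebesgue. norm ((cmod (?f s))\<^sup>2) \<le> norm ((1 / g b) * (indicator {0..} s *\<^sub>R (g s * (k s)\<^sup>2)))"
    proof (rule AE_I2)
      fix s
      show "norm ((cmod (?f s))\<^sup>2) \<le> norm ((1 / g b) * (indicator {0..} s *\<^sub>R (g s * (k s)\<^sup>2)))"
      proof (cases "s \<in> {0<..<b}")
        case True
        then have "g b * (k s)\<^sup>2 \<le> g s * (k s)\<^sup>2" using g_antimono[of s b] by (intro mult_right_mono) auto
        then show ?thesis using True gb by (simp add: field_simps abs_mult g_nonneg)
      qed (simp add: supp)
    qed
  qed (use km in measurable)
  then have sf: "sqint ?f" using km by (simp add: sqint_def)
  obtain \<phi> where \<phi>: "\<And>n::nat. \<phi> n \<in> test_functions {0<..<b}" "(\<lambda>n. cls (\<phi> n)) \<longlonglongrightarrow> res 0 b (cls ?f)"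
    using test_functions_sequence by blast
  have "(\<lambda>s. indicator {0<..<b} s *\<^sub>R ?f s) = ?f" using supp by (force simp: indicator_def fun_eq_iff)
  then have lim: "(\<lambda>n. cls (\<phi> n)) \<longlonglongrightarrow> cls ?f" using \<phi>(2) res_cls[OF sf, of 0 b] by simp
  define \<xi> where "\<xi> n s = Re (\<phi> n s)" for n s
  have sub: "{0<..<b} \<subseteq> {s. 0 < s \<and> 0 < g s}" using J_down[OF b] by (force simp: J_def)
  have tf: "(\<lambda>s. of_real (\<xi> n s)) \<in> test_J" for n
    using test_functions_mono[OF sub] test_functions_Re[OF \<phi>(1)[of n]] unfolding \<xi>_def by blast
  have Qle: "Q L (\<lambda>s x. of_real (k s) * y x) (\<lambda>s x. of_real (\<xi> n s) * y x) \<le> g 0 * (norm (d L y))\<^sup>2 * (norm (cls (\<phi> n) - cls ?f))\<^sup>2" for n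
  proof -
    have s: "sqint (\<lambda>s. \<phi> n s - ?f s)" by (intro sqint_diff sf test_functions_sqint[OF \<phi>(1)])
    then have i: "integrable lebesgue (\<lambda>s. g 0 * (cmod (\<phi> n s - ?f s))\<^sup>2)" by (simp add: sqint_def)
    have "(LINT s|halfline. g s * (k s - \<xi> n s)\<^sup>2) \<le> (LINT s|lebesgue. g 0 * (cmod (\<phi> n s - ?f s))\<^sup>2)"
      unfolding halfline_integral
    proof (rule integral_mono')
      fix s
      show "indicator {0..} s *\<^sub>R (g s * (k s - \<xi> n s)\<^sup>2) \<le> g 0 * (cmod (\<phi> n s - ?f s))\<^sup>2"
      proof (cases "s \<ge> 0")
        case True
        have "\<bar>k s - \<xi> n s\<bar> \<le> cmod (\<phi> n s - ?f s)" using abs_Re_le_cmod[of "\<phi> n s - ?f s"] by (simp add: \<xi>_def)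
        then have "(k s - \<xi> n s)\<^sup>2 \<le> (cmod (\<phi> n s - ?f s))\<^sup>2" by (metis abs_ge_zero power2_abs power_mono)
        then show ?thesis using True g_antimono[of 0 s] g_nonneg[of s] by (auto intro!: mult_mono)
      qed (use g0_pos in simp)
    qed (use i g0_pos in auto)
    also have "\<dots> = g 0 * (norm (cls (\<phi> n) - cls ?f))\<^sup>2"
      using norm_cls[OF s] cls_diff[OF test_functions_sqint[OF \<phi>(1)] sf] by simp
    finally have "(LINT s|halfline. g s * (k s - \<xi> n s)\<^sup>2) \<le> g 0 * (norm (cls (\<phi> n) - cls ?f))\<^sup>2" .
    from mult_right_mono[OF this, of "(norm (d L y))\<^sup>2"] show ?thesis
      unfolding Q_scalar[OF yH] by (simp add: mult_ac)
  qed
  have "(\<lambda>n. g 0 * (norm (d L y))\<^sup>2 * (norm (cls (\<phi> n) - cls ?f))\<^sup>2) \<longlonglongrightarrow> g 0 * (norm (d L y))\<^sup>2 * (norm (cls ?f - cls ?f))\<^sup>2"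
    by (intro tendsto_intros lim)
  then have l0: "(\<lambda>n. g 0 * (norm (d L y))\<^sup>2 * (norm (cls (\<phi> n) - cls ?f))\<^sup>2) \<longlonglongrightarrow> 0" by simp
  show ?thesis
  proof (rule goodC_limit[OF L2g_scalar[OF k yH] good_goodC[OF good_elementary(2)[OF tf y]]])
    show "(\<lambda>n. Q L (\<lambda>s x. of_real (k s) * y x) (\<lambda>s x. of_real (\<xi> n s) * y x)) \<longlonglongrightarrow> 0"
      by (rule tendsto_sandwich[OF _ _ tendsto_const l0]) (use Qle in \<open>auto simp: Q_def intro!: always_eventually\<close>)
  qed
qed

text \<open>The scalar factor is cut at points \<open>b n\<close> exhausting \<open>J\<close>; the
  error tends to 0 by dominated convergence, since the weight vanishes outside
  \<open>J\<close>.\<close>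

lemma goodC_scalar_test:
  assumes k: "sqg k" and y: "y \<in> test_functions {0<..<L}"
  shows "(\<lambda>s x. of_real (k s) * y x) \<in> goodC L"
proof -
  have yH: "y \<in> H10 L" using y by (rule test_functions_H10)
  obtain b where b: "\<And>n. b n \<in> J" "\<And>t. t \<in> J \<Longrightarrow> \<forall>\<^sub>F n in sequentially. t < b n" using J_exhaustion by blast
  define k' where "k' n s = indicator {0<..<b n} s * k s" for n s
  have km: "k \<in> borel_measurable halfline" and ki: "integrable halfline (\<lambda>s. g s * (k s)\<^sup>2)" using k by (auto simp: sqg_def)
  have k'm: "k' n \<in> borel_measurable halfline" for n
    unfolding k'_def[abs_def] by (intro borel_measurable_times km measurable_restrict_space1 measurable_completion) simp
  have k'i: "sqg (k' n)" for n
    unfolding sqg_def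
  proof (intro conjI k'm Bochner_Integration.integrable_bound[OF ki])
    show "AE s in halfline. norm (g s * (k' n s)\<^sup>2) \<le> norm (g s * (k s)\<^sup>2)" by (auto simp: k'_def indicator_def)
  qed (use k'm g_measurable in simp)
  have in_C: "(\<lambda>s x. of_real (k' n s) * y x) \<in> goodC L" for n
    by (intro goodC_interval[OF k'i y b(1)[of n]]) (auto simp: k'_def)
  have "(\<lambda>n. LINT s|halfline. g s * (k s - k' n s)\<^sup>2) \<longlonglongrightarrow> (LINT s|halfline. 0)"
  proof (rule integral_dominated_convergence)
    show "AE s in halfline. norm (g s * (k s - k' n s)\<^sup>2) \<le> g s * (k s)\<^sup>2" for n
      using AE_halfline_pos by eventually_elim (auto simp: k'_def g_nonneg abs_mult indicator_def)
    show "AE s in halfline. (\<lambda>n. g s * (k s - k' n s)\<^sup>2) \<longlonglongrightarrow> 0"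
      using AE_halfline_pos AE_halfline_nonzero
    proof eventually_elim
      case (elim s)
      show ?case
      proof (cases "g s = 0")
        case False
        then have gs: "g s > 0" using g_nonneg[of s] elim by simp
        then have "\<forall>\<^sub>F n in sequentially. 0 = g s * (k s - k' n s)\<^sup>2"
          using elim by (intro eventually_mono[OF b(2)]) (auto simp: J_def k'_def)
        then show ?thesis by (rule Lim_transform_eventually[OF tendsto_const])
      qed simp
    qed
  qed (use ki km k'm g_measurable in simp_all)
  then have "(\<lambda>n. (LINT s|halfline. g s * (k s - k' n s)\<^sup>2) * (norm (d L y))\<^sup>2) \<longlonglongrightarrow> 0 * (norm (d L y))\<^sup>2"
    by (intro tendsto_mult tendsto_const) simp
  then show ?thesis
    using goodC_limit[OF L2g_scalar[OF k yH] in_C] by (simp add: Q_scalar[OF yH])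
qed

lemma goodC_scalar:
  assumes k: "sqg k" and y: "y \<in> H10 L" shows "(\<lambda>s x. of_real (k s) * y x) \<in> goodC L"
proof -
  obtain z where z: "\<And>n::nat. z n \<in> test_functions {0<..<L}" "(\<lambda>n. d L (z n)) \<longlonglongrightarrow> d L y"
    using H10_sequence[OF y] by metis
  have zH: "z n \<in> H10 L" for n using z(1) by (rule test_functions_H10)
  have "Q L (\<lambda>s x. of_real (k s) * y x) (\<lambda>s x. of_real (k s) * z n x) = (LINT s|halfline. g s * (k s)\<^sup>2 * (norm (d L y - d L (z n)))\<^sup>2)" for n
    unfolding Q_def
  proof (rule Bochner_Integration.integral_cong[OF refl])
    fix s assume "s \<in> space halfline"
    then have "g s \<ge> 0" using g_nonneg by (simp add: halfline_space)
    then show "(norm (dg L (\<lambda>s x. of_real (k s) * y x) s - dg L (\<lambda>s x. of_real (k s) * z n x) s))\<^sup>2 = g s * (k s)\<^sup>2 * (norm (d L y - d L (z n)))\<^sup>2"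
      unfolding dg_scalar[OF y] dg_scalar[OF zH] by (simp add: power_mult_distrib flip: scaleR_diff_right)
  qed
  then have Qe: "Q L (\<lambda>s x. of_real (k s) * y x) (\<lambda>s x. of_real (k s) * z n x) = (LINT s|halfline. g s * (k s)\<^sup>2) * (norm (d L y - d L (z n)))\<^sup>2" for n
    by simp
  have "(\<lambda>n. (LINT s|halfline. g s * (k s)\<^sup>2) * (norm (d L y - d L (z n)))\<^sup>2) \<longlonglongrightarrow> (LINT s|halfline. g s * (k s)\<^sup>2) * (norm (d L y - d L y))\<^sup>2"
    by (intro tendsto_intros z(2))
  then show ?thesis
    by (intro goodC_limit[OF L2g_scalar[OF k y] goodC_scalar_test[OF k z(1)]]) (simp add: Qe)
qed

lemma goodC_sum:
  assumes "finite Y" "\<And>y. y \<in> Y \<Longrightarrow> sqg (k y)" "\<And>y. y \<in> Y \<Longrightarrow> y \<in> H10 L"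
  shows "(\<lambda>s x. \<Sum>y\<in>Y. of_real (k y s) * y x) \<in> goodC L"
  using assms
proof (induction Y rule: finite_induct)
  case empty
  have "sqg (\<lambda>s. 0)" by (simp add: sqg_def)
  from goodC_scalar[OF this H10_zero] show ?case by simp
next
  case (insert y Y)
  then show ?case using goodC_add[OF goodC_scalar[of "k y" y]] by simp
qed

text \<open>Simple approximants of \<open>sqrt g \<eta>\<close> are divided by \<open>sqrt g\<close>
  again. The result is a finite sum of scalar functions of \<open>s\<close> times fixed elements of
  \<open>H10 L\<close>, to which \<open>goodC_sum\<close> applies.\<close>

lemma goodC_eq: assumes \<eta>: "\<eta> \<in> L2g L g" shows "\<eta> \<in> goodC L"
proof -
  obtain S where S: "simple_approx L (\<lambda>s x. of_real (sqrt (g s)) * \<eta> s x) S"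
    "\<And>n s. norm (d L (S n s)) \<le> 2 * norm (dg L \<eta> s)" "\<And>n s. S n s \<noteq> (\<lambda>x. 0) \<Longrightarrow> d L (S n s) \<noteq> 0"
    using truncated_approx[OF L2g_sm[OF \<eta>]] unfolding dg_def by blast
  have sf: "simple_function halfline (S n)" and SH: "s \<ge> 0 \<Longrightarrow> S n s \<in> H10 L" for n s using S(1) by (auto simp: simple_approx_def)
  have lim: "AE s in halfline. (\<lambda>n. d L (S n s)) \<longlonglongrightarrow> dg L \<eta> s" using S(1) by (simp add: simple_approx_def dg_def)
  \<comment> \<open>Values of norm 0 are dropped. For each remaining \<open>y\<close> the truncation
    bound gives \<open>(norm (d L y))\<^sup>2 \<le> 4 * (norm (dg L \<eta> s))\<^sup>2\<close> on
    its level set, which makes the scalar factor square-integrable with weight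
    \<open>g\<close>.\<close>
  define Y where "Y n = {y \<in> S n ` {0..}. d L y \<noteq> 0}" for n
  define k where "k n y s = (if S n s = y then 1 / sqrt (g s) else 0)" for n y s
  have Y: "finite (Y n)" "y \<in> Y n \<Longrightarrow> y \<in> H10 L" for n y
    using simple_functionD(1)[OF sf[of n]] SH by (auto simp: Y_def)
  have sk: "sqg (k n y)" if y: "y \<in> Y n" for n y
  proof -
    have dy: "d L y \<noteq> 0" using y by (simp add: Y_def)
    have km: "k n y \<in> borel_measurable halfline"
    proof -
      have "{s \<in> space halfline. S n s = y} \<in> sets halfline"
        using simple_functionD(2)[OF sf[of n], of "{y}"] by (simp add: vimage_def Int_def conj_commute)
      then show ?thesis unfolding k_def using sqrt_g_measurable by (intro measurable_If) auto
    qed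
    have "integrable halfline (\<lambda>s. g s * (k n y s)\<^sup>2)"
    proof (rule Bochner_Integration.integrable_bound)
      show "integrable halfline (\<lambda>s. (4 / (norm (d L y))\<^sup>2) * (norm (dg L \<eta> s))\<^sup>2)" using dg_sq_integrable[OF \<eta>] by simp
      have le: "(norm (d L y))\<^sup>2 \<le> 4 * (norm (dg L \<eta> s))\<^sup>2" if "S n s = y" for s
        using power_mono[OF S(2)[of n s], where n = 2] that by (simp add: power_mult_distrib)
      show "AE s in halfline. norm (g s * (k n y s)\<^sup>2) \<le> norm ((4 / (norm (d L y))\<^sup>2) * (norm (dg L \<eta> s))\<^sup>2)"
        using AE_halfline_pos
      proof eventually_elim
        case (elim s)
        have "g s * (1 / sqrt (g s))\<^sup>2 \<le> 1" using g_nonneg[OF elim] by (simp add: power_divide)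
        then show ?case using le[of s] dy g_nonneg[OF elim] by (auto simp: k_def field_simps abs_mult)
      qed
    qed (use km g_measurable in simp)
    then show ?thesis using km by (simp add: sqg_def)
  qed
  define e where "e n s x = (\<Sum>y\<in>Y n. of_real (k n y s) * y x)" for n s x
  have eC: "e n \<in> goodC L" for n unfolding e_def[abs_def] by (rule goodC_sum[OF Y(1) sk Y(2)])
  have de: "dg L (e n) s = d L (S n s)" if s: "s \<ge> 0" for n s
  proof -
    have "dg L (e n) s = d L (\<lambda>x. \<Sum>y\<in>Y n. of_real (sqrt (g s)) * (of_real (k n y s) * y x))"
      unfolding dg_def e_def by (simp add: sum_distrib_left)
    also have "\<dots> = (\<Sum>y\<in>Y n. dg L (\<lambda>s x. of_real (k n y s) * y x) s)"
      unfolding dg_def by (rule d_sum(2)[OF Y(1)]) (intro H10_cmult Y(2))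
    also have "\<dots> = (\<Sum>y\<in>Y n. (sqrt (g s) * k n y s) *\<^sub>R d L y)" using Y(2) by (intro sum.cong refl dg_scalar)
    also have "\<dots> = (\<Sum>y\<in>Y n. if y = S n s then d L (S n s) else 0)"
    proof (rule sum.cong[OF refl])
      fix y assume y: "y \<in> Y n"
      \<comment> \<open>Division by \<open>sqrt (g s)\<close> is undone only where
        \<open>g s\<close> is nonzero; at the other points truncation forces \<open>S n s\<close> to
        have norm 0, which excludes it from \<open>Y n\<close>.\<close>
      have "g s \<noteq> 0" if "y = S n s"
      proof
        assume "g s = 0"
        then have "d L (S n s) = 0" using S(2)[of n s] by (simp add: dg_zero)
        then show False using y that by (simp add: Y_def)
      qed
      then show "(sqrt (g s) * k n y s) *\<^sub>R d L y = (if y = S n s then d L (S n s) else 0)" by (auto simp: k_def)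
    qed
    also have "\<dots> = d L (S n s)" using Y(1) s by (auto simp: Y_def)
    finally show ?thesis .
  qed
  have ae: "AE s in halfline. (norm (dg L \<eta> s - dg L (e n) s))\<^sup>2 = (norm (dg L \<eta> s - d L (S n s)))\<^sup>2" for n
    using AE_halfline_pos by eventually_elim (simp add: de)
  have "(\<lambda>n. Q L \<eta> (e n)) \<longlonglongrightarrow> (LINT s|halfline. 0)"
    unfolding Q_def
  proof (rule integral_dominated_convergence)
    \<comment> \<open>The factor is 10 = 2 + 2 * 4: the inequality for the square of a difference,
      combined with the truncation bound with factor 4 for squares.\<close>
    show "integrable halfline (\<lambda>s. 10 * (norm (dg L \<eta> s))\<^sup>2)" using dg_sq_integrable[OF \<eta>] by simp
    show "AE s in halfline. norm ((norm (dg L \<eta> s - dg L (e n) s))\<^sup>2) \<le> 10 * (norm (dg L \<eta> s))\<^sup>2" for n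
      using ae[of n]
    proof eventually_elim
      case (elim s)
      have "(norm (d L (S n s)))\<^sup>2 \<le> 4 * (norm (dg L \<eta> s))\<^sup>2"
        using power_mono[OF S(2)[of n s], where n = 2] by (simp add: power_mult_distrib)
      then show ?case using elim norm_add_sq_le[of "dg L \<eta> s" "- d L (S n s)"] by simp
    qed
    show "AE s in halfline. (\<lambda>n. (norm (dg L \<eta> s - dg L (e n) s))\<^sup>2) \<longlonglongrightarrow> 0"
      using lim AE_halfline_pos
    proof eventually_elim
      case (elim s)
      have "(\<lambda>n. (norm (dg L \<eta> s - d L (S n s)))\<^sup>2) \<longlonglongrightarrow> (norm (dg L \<eta> s - dg L \<eta> s))\<^sup>2"
        by (intro tendsto_intros elim)
      then show ?case using elim by (simp add: de)
    qed
    show "(\<lambda>s. (norm (dg L \<eta> s - dg L (e n) s))\<^sup>2) \<in> borel_measurable halfline" for n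
      using borel_measurable_integrable[OF Q_integrable[OF \<eta>, of "e n"]] eC by (auto simp: goodC_def)
  qed simp
  then show ?thesis by (intro goodC_limit[OF \<eta> eC]) simp
qed

lemma L2g_sequence:
  assumes \<eta>: "\<eta> \<in> L2g L g"
  obtains \<zeta> where "\<And>n::nat. good L (\<zeta> n)" "(\<lambda>n. Q L \<eta> (\<zeta> n)) \<longlonglongrightarrow> 0"
proof -
  have "\<exists>\<zeta>. good L \<zeta> \<and> Q L \<eta> \<zeta> < 1 / real (Suc n)" for n
    using goodC_eq[OF \<eta>] unfolding goodC_def by (auto simp del: of_nat_Suc)
  then obtain \<zeta> where \<zeta>: "\<And>n. good L (\<zeta> n)" "\<And>n. Q L \<eta> (\<zeta> n) < 1 / real (Suc n)" by metis
  have "(\<lambda>n. Q L \<eta> (\<zeta> n)) \<longlonglongrightarrow> 0"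
    by (rule tendsto_sandwich[OF _ _ tendsto_const LIMSEQ_inverse_real_of_nat])
      (use \<zeta>(2) in \<open>auto simp: Q_def inverse_eq_divide intro!: always_eventually less_imp_le simp del: of_nat_Suc\<close>)
  then show thesis using that \<zeta>(1) by blast
qed

end

section \<open>Approximation of the other components and density\<close>

lemma H1_cong: "f \<in> H1 L \<Longrightarrow> g \<in> L2 L \<Longrightarrow> cl L f = cl L g \<Longrightarrow> g \<in> H1 L"
  by (rule H1I[of L g "weak_deriv L f"]) (use H1_has_weak_deriv[of f L] in \<open>simp add: has_weak_deriv_iff\<close>)

text \<open>The derivative is approximated by test functions and mean-zero primitives are taken:
  their derivatives then lie in \<open>H10 L\<close>, as the domain requires of \<open>u\<close> and
  \<phi>, and Poincare's inequality gives convergence of the functions themselves.\<close>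

lemma H1_mean0_sequence:
  assumes u: "u \<in> H1_mean0 L" and L: "L > 0"
  obtains r where "\<And>n::nat. r n \<in> H1_mean0 L" "\<And>n. weak_deriv L (r n) \<in> H10 L"
    "(\<lambda>n. d L (r n)) \<longlonglongrightarrow> d L u" "(\<lambda>n. cl L (r n)) \<longlonglongrightarrow> cl L u"
proof -
  have uH: "u \<in> H1 L" using u by (simp add: H1_mean0_def)
  obtain y where y: "\<And>n::nat. y n \<in> test_functions {0<..<L}" "(\<lambda>n. cls (y n)) \<longlonglongrightarrow> d L u"
    using test_functions_sequence[of 0 L "d L u"] res_d[OF uH] by metis
  have "\<forall>n. \<exists>r. r \<in> H1_mean0 L \<and> has_weak_deriv L r (y n)" using mean0_primitive[OF y(1) L] by metis
  then obtain r where r: "\<And>n. r n \<in> H1_mean0 L" "\<And>n. has_weak_deriv L (r n) (y n)" by metis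
  have rH: "r n \<in> H1 L" for n using r(1) by (simp add: H1_mean0_def)
  have dr: "d L (r n) = cl L (y n)" for n by (rule d_eq[OF r(2)])
  have "weak_deriv L (r n) \<in> H10 L" for n
  proof -
    have e: "cl L (y n) = cl L (weak_deriv L (r n))" using dr[of n] by (simp add: d_def)
    show ?thesis
      by (rule H10_cong[OF test_functions_H10[OF y(1)] H1_cong[OF test_functions_H1[OF y(1)] H1_L2(2)[OF rH] e] e])
  qed
  moreover have lim: "(\<lambda>n. d L (r n)) \<longlonglongrightarrow> d L u" using y by (simp add: dr cl_test_function)
  moreover have "(\<lambda>n. cl L (r n)) \<longlonglongrightarrow> cl L u"
  proof (rule LIM_zero_cancel, rule Lim_null_comparison)
    have "norm (cl L (r n) - cl L u) \<le> 2 * L * norm (d L (r n) - d L u)" for n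
      using poincare_mean0[OF H1_mean0_diff[OF r(1)[of n] u] L] rH uH by (simp add: cl_diff d_diff H1_L2)
    then show "\<forall>\<^sub>F n in sequentially. norm (cl L (r n) - cl L u) \<le> 2 * L * norm (d L (r n) - d L u)" by simp
    have "(\<lambda>n. 2 * L * norm (d L (r n) - d L u)) \<longlonglongrightarrow> 2 * L * norm (d L u - d L u)" by (intro tendsto_intros lim)
    then show "(\<lambda>n. 2 * L * norm (d L (r n) - d L u)) \<longlonglongrightarrow> 0" by simp
  qed
  ultimately show thesis using that r(1) by blast
qed

lemma H1_mean0_test_sequence:
  assumes "v \<in> L2_mean0 L" "L > 0"
  obtains y where "\<And>n::nat. y n \<in> H1_mean0 L" "(\<lambda>n. cl L (y n)) \<longlonglongrightarrow> cl L v"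
proof -
  obtain y where y: "\<And>n::nat. y n \<in> test_functions {0<..<L}" "\<And>n. (LINT x|lebesgue. y n x) = 0" "(\<lambda>n. cl L (y n)) \<longlonglongrightarrow> cl L v"
    using L2_mean0_sequence[OF assms] by metis
  have "y n \<in> H1_mean0 L" for n
    using y(2) test_functions_H1[OF y(1)] test_functions_L2[OF y(1)]
    by (simp add: H1_mean0_def L2_mean0_iff L2_integral indicator_test_function[OF y(1)])
  then show thesis using that y(3) by blast
qed

lemma H10_test_sequence:
  assumes "f \<in> L2 L"
  obtains y where "\<And>n::nat. y n \<in> H10 L" "(\<lambda>n. cl L (y n)) \<longlonglongrightarrow> cl L f"
proof -
  obtain y where y: "\<And>n::nat. y n \<in> test_functions {0<..<L}" "(\<lambda>n. cls (y n)) \<longlonglongrightarrow> cl L f"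
    using test_functions_sequence[of 0 L "cl L f"] res_cl[OF assms] by metis
  then show thesis using that[of y] by (auto simp: cl_test_function intro: test_functions_H10)
qed

lemma (in kernel) L2g_norm_diff:
  assumes "\<eta> \<in> L2g L g" "\<zeta> \<in> L2g L g"
  shows "(L2g_norm L g (\<lambda>s x. of_real 1 * \<eta> s x + of_real (- 1) * \<zeta> s x))\<^sup>2 = Q L \<eta> \<zeta>"
proof -
  let ?\<xi> = "\<lambda>s x. of_real 1 * \<eta> s x + of_real (- 1) * \<zeta> s x"
  note l = dg_lincomb[OF assms, of 1 "- 1"]
  have "AE s in halfline. (norm (dg L ?\<xi> s))\<^sup>2 = (norm (dg L \<eta> s - dg L \<zeta> s))\<^sup>2" using l(1) by eventually_elim simp
  then show ?thesis
    unfolding L2g_norm_eq[OF l(2)] Q_def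
    by (intro integral_cong_AE) (use dg_measurable[OF l(2)] dg_measurable[OF assms(1)] dg_measurable[OF assms(2)] in measurable)
qed

lemma (in kernel) good_trace: assumes "good L \<eta>" shows "zero_initial_trace L g \<eta>"
proof -
  have H: "\<eta> s \<in> H10 L" for s using assms by (simp add: good_def)
  have lim: "((\<lambda>r. norm (d L (\<eta> r) - d L (\<eta> s))) \<longlongrightarrow> 0) (at s within S)" for s S
  proof -
    have "((\<lambda>r. d L (\<eta> r)) \<longlongrightarrow> d L (\<eta> s)) (at s within S)"
      using assms by (auto simp: good_def continuous_on_def intro: tendsto_within_subset)
    then have "((\<lambda>r. norm (d L (\<eta> r) - d L (\<eta> s))) \<longlongrightarrow> norm (d L (\<eta> s) - d L (\<eta> s))) (at s within S)" by (intro tendsto_intros)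
    then show ?thesis by simp
  qed
  have hn: "H10_norm L (\<lambda>x. \<eta> r x - \<eta> s x) = norm (d L (\<eta> r) - d L (\<eta> s))" for r s by (rule H10_norm_diff[OF H H])
  have h0: "H10_norm L (\<eta> 0) = 0" using assms by (simp add: good_def H10_norm_eq H10_H1)
  show ?thesis
    unfolding zero_initial_trace_def Let_def by (rule exI[of _ \<eta>], unfold hn) (simp add: H lim h0)
qed

context beam
begin

text \<open>Only the sum of the two parts has to be regular: its derivative class is that of the
  derivative of a test function \<open>z\<close>, so the chosen weak derivative agrees with a smooth
  function and lies in \<open>H1 L\<close>.\<close>

lemma good_stress:
  assumes \<psi>: "\<psi> \<in> test_functions {0<..<L}" and \<eta>: "good L \<eta>" shows "memory_stress L b g \<psi> \<eta> \<in> H2 L"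
proof -
  obtain y where y: "y \<in> test_functions {0<..<L}" "d L (wint L g \<eta>) = d L y" and \<eta>L: "\<eta> \<in> L2g L g" using \<eta> by (auto simp: good_def)
  let ?s = "memory_stress L b g \<psi> \<eta>"
  define z where "z x = of_real bt * \<psi> x + y x" for x
  have s: "?s = (\<lambda>x. of_real bt * \<psi> x + wint L g \<eta> x)" by (simp add: memory_stress_def wint_def fun_eq_iff)
  have z: "z \<in> test_functions {0<..<L}" unfolding z_def[abs_def] by (intro test_functions_add test_functions_cmult \<psi> y)
  note H = test_functions_H1[OF \<psi>] test_functions_H1[OF y(1)] H10_H1[OF wint(1)[OF admissible_g \<eta>L]]
  have sH: "?s \<in> H1 L" unfolding s by (intro H1_add H1_cmult H)
  have "d L ?s = d L z" unfolding s z_def[abs_def] using H y(2) by (simp only: d_add d_cmult H1_cmult)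
  also have "\<dots> = cl L (\<lambda>x. vector_derivative z (at x))" by (rule d_eq[OF has_weak_deriv_smooth[OF test_functions_smooth[OF z]]])
  finally have "cl L (\<lambda>x. vector_derivative z (at x)) = cl L (weak_deriv L ?s)" by (simp add: d_def)
  then have "weak_deriv L ?s \<in> H1 L"
    by (rule H1_cong[OF test_functions_H1[OF test_functions_deriv[OF z]] H1_L2(2)[OF sH]])
  then show ?thesis using sH by (simp add: H2_def)
qed

text \<open>The components can be approximated independently. The one condition that couples two of
  them, the H2 regularity of the memory stress, holds for every test function \<psi> with every
  \<open>good\<close> \<eta>.\<close>

lemma domain_dense:
  assumes U: "U \<in> X" and e: "e > 0" shows "\<exists>W\<in>Dom. state_dist N U W < e"
proof -
  obtain u v \<phi> \<Phi> \<psi> \<Psi> \<theta> q \<eta> where Ueq: "U = (u, v, \<phi>, \<Phi>, \<psi>, \<Psi>, \<theta>, q, \<eta>)" by (cases U rule: lincomb_cases)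
  have m: "u \<in> H1_mean0 L" "v \<in> L2_mean0 L" "\<phi> \<in> H1_mean0 L" "\<Phi> \<in> L2_mean0 L" "\<psi> \<in> H10 L" "\<Psi> \<in> L2 L" "\<theta> \<in> L2 L" "q \<in> L2 L" "\<eta> \<in> L2g L g"
    using U by (simp_all add: Ueq X_iff)
  obtain u' where u': "\<And>n::nat. u' n \<in> H1_mean0 L" "\<And>n. weak_deriv L (u' n) \<in> H10 L" "(\<lambda>n. d L (u' n)) \<longlonglongrightarrow> d L u" "(\<lambda>n. cl L (u' n)) \<longlonglongrightarrow> cl L u"
    using H1_mean0_sequence[OF m(1) pos(1)] by metis
  obtain \<phi>' where \<phi>': "\<And>n::nat. \<phi>' n \<in> H1_mean0 L" "\<And>n. weak_deriv L (\<phi>' n) \<in> H10 L" "(\<lambda>n. d L (\<phi>' n)) \<longlonglongrightarrow> d L \<phi>" "(\<lambda>n. cl L (\<phi>' n)) \<longlonglongrightarrow> cl L \<phi>"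
    using H1_mean0_sequence[OF m(3) pos(1)] by metis
  obtain v' where v': "\<And>n::nat. v' n \<in> H1_mean0 L" "(\<lambda>n. cl L (v' n)) \<longlonglongrightarrow> cl L v" using H1_mean0_test_sequence[OF m(2) pos(1)] by metis
  obtain \<Phi>' where \<Phi>': "\<And>n::nat. \<Phi>' n \<in> H1_mean0 L" "(\<lambda>n. cl L (\<Phi>' n)) \<longlonglongrightarrow> cl L \<Phi>" using H1_mean0_test_sequence[OF m(4) pos(1)] by metis
  obtain \<psi>' where \<psi>': "\<And>n::nat. \<psi>' n \<in> test_functions {0<..<L}" "(\<lambda>n. cl L (\<psi>' n)) \<longlonglongrightarrow> cl L \<psi>" "(\<lambda>n. d L (\<psi>' n)) \<longlonglongrightarrow> d L \<psi>"
    using H10_sequence[OF m(5)] by metis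
  obtain \<Psi>' where \<Psi>': "\<And>n::nat. \<Psi>' n \<in> H10 L" "(\<lambda>n. cl L (\<Psi>' n)) \<longlonglongrightarrow> cl L \<Psi>" using H10_test_sequence[OF m(6)] by metis
  obtain \<theta>' where \<theta>': "\<And>n::nat. \<theta>' n \<in> H10 L" "(\<lambda>n. cl L (\<theta>' n)) \<longlonglongrightarrow> cl L \<theta>" using H10_test_sequence[OF m(7)] by metis
  obtain q' where q': "\<And>n::nat. q' n \<in> H10 L" "(\<lambda>n. cl L (q' n)) \<longlonglongrightarrow> cl L q" using H10_test_sequence[OF m(8)] by metis
  obtain \<eta>' where \<eta>': "\<And>n::nat. good L (\<eta>' n)" "(\<lambda>n. Q L \<eta> (\<eta>' n)) \<longlonglongrightarrow> 0" using L2g_sequence[OF m(9)] by metis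
  define W where "W n = (u' n, v' n, \<phi>' n, \<Phi>' n, \<psi>' n, \<Psi>' n, \<theta>' n, q' n, \<eta>' n)" for n
  have \<eta>'L: "\<eta>' n \<in> L2g L g" "\<exists>\<zeta>. has_s_deriv L g (\<eta>' n) \<zeta>" for n using \<eta>'(1)[of n] by (auto simp: good_def)
  have WX: "W n \<in> X" for n
    unfolding W_def X_iff using u' v' \<phi>' \<Phi>' \<psi>' \<Psi>' \<theta>' q' \<eta>'L H1_L2(1)[OF H10_H1[OF \<Psi>'(1)]] H1_L2(1)[OF H10_H1[OF \<theta>'(1)]] H1_L2(1)[OF H10_H1[OF q'(1)]]
    by (auto intro: mem_simps test_functions_H10)
  have WD: "W n \<in> Dom" for n
    using WX[of n] u' v' \<phi>' \<Phi>' \<Psi>' \<theta>' H10_H1[OF q'(1)] \<eta>'L good_trace[OF \<eta>'(1)] good_stress[OF \<psi>'(1) \<eta>'(1)]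
    unfolding W_def dom_A2_def by simp
  define D where "D n = lincomb (of_real 1) U (of_real (- 1)) (W n)" for n
  have DX: "D n \<in> X" for n unfolding D_def by (rule X_lincomb[OF U WX])
  have sD: "state_dist N U (W n) = N (D n)" for n unfolding state_dist_def D_def by simp
  have N2: "(\<lambda>n. (N (D n))\<^sup>2) = (\<lambda>n. \<rho> * (norm (cl L v - cl L (v' n)))\<^sup>2 + \<alpha> * (norm (d L u - d L (u' n)))\<^sup>2 + \<rho>\<^sub>1 * (norm (cl L \<Phi> - cl L (\<Phi>' n)))\<^sup>2
      + \<rho>\<^sub>2 * (norm (cl L \<Psi> - cl L (\<Psi>' n)))\<^sup>2 + bt * (norm (d L \<psi> - d L (\<psi>' n)))\<^sup>2
      + \<beta> * (norm (cl L \<phi> - cl L (\<phi>' n) - (cl L u - cl L (u' n))))\<^sup>2 + \<kappa> * (norm (d L \<phi> - d L (\<phi>' n) + (cl L \<psi> - cl L (\<psi>' n))))\<^sup>2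
      + \<rho>\<^sub>3 * (norm (cl L \<theta> - cl L (\<theta>' n)))\<^sup>2 + \<tau> * (norm (cl L q - cl L (q' n)))\<^sup>2 + Q L \<eta> (\<eta>' n))"
    unfolding N_sq[OF DX] E_self[OF DX] unfolding D_def proj_lincomb[OF U WX] unfolding Ueq W_def proj_simps L2g_norm_diff[OF m(9) \<eta>'L(1)] by simp
  have "(\<lambda>n. (N (D n))\<^sup>2) \<longlonglongrightarrow> \<rho> * (norm (cl L v - cl L v))\<^sup>2 + \<alpha> * (norm (d L u - d L u))\<^sup>2 + \<rho>\<^sub>1 * (norm (cl L \<Phi> - cl L \<Phi>))\<^sup>2
      + \<rho>\<^sub>2 * (norm (cl L \<Psi> - cl L \<Psi>))\<^sup>2 + bt * (norm (d L \<psi> - d L \<psi>))\<^sup>2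
      + \<beta> * (norm (cl L \<phi> - cl L \<phi> - (cl L u - cl L u)))\<^sup>2 + \<kappa> * (norm (d L \<phi> - d L \<phi> + (cl L \<psi> - cl L \<psi>)))\<^sup>2
      + \<rho>\<^sub>3 * (norm (cl L \<theta> - cl L \<theta>))\<^sup>2 + \<tau> * (norm (cl L q - cl L q))\<^sup>2 + 0"
    unfolding N2 by (intro tendsto_intros u' v' \<phi>' \<Phi>' \<psi>' \<Psi>' \<theta>' q' \<eta>')
  then have l0: "(\<lambda>n. (N (D n))\<^sup>2) \<longlonglongrightarrow> 0" by simp
  have "\<forall>\<^sub>F n in sequentially. (N (D n))\<^sup>2 < e\<^sup>2" by (rule order_tendstoD(2)[OF l0]) (use e in simp)
  then obtain n where "(N (D n))\<^sup>2 < e\<^sup>2" by (auto simp: eventually_sequentially)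
  then have "state_dist N U (W n) < e" unfolding sD by (rule power2_less_imp_less) (use e in simp)
  then show ?thesis using WD by blast
qed

lemma stability:
  assumes T: "C0_semigroup X N T" and gen: "is_generator X N T Dom A"
  shows "\<exists>M \<omega>. M > 0 \<and> \<omega> > 0 \<and> (\<forall>t\<ge>0. operator_norm X N (T t) \<le> M * exp (- \<omega> * t))"
proof -
  obtain B c where B: "bform B" and c: "c > 0" and k: "\<And>U. U \<in> X \<Longrightarrow> 1 * (N U)\<^sup>2 \<le> B U U"
    and dec: "\<And>W. W \<in> Dom \<Longrightarrow> B W (A W) + B (A W) W \<le> - c * (N W)\<^sup>2"
    by (rule Lyapunov_form, rule that)
  obtain K where K: "\<And>U V. U \<in> X \<Longrightarrow> V \<in> X \<Longrightarrow> \<bar>B U V\<bar> \<le> K * (N U * N V)" by (rule bform_bound[OF B], rule that)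
  interpret Y: lyapunov_form X N T B Dom A 1 c
  proof unfold_locales
    show "\<exists>K. \<forall>U\<in>X. \<forall>V\<in>X. \<bar>B U V\<bar> \<le> K * (N U * N V)" using K by blast
    show "Dom \<subseteq> X" by (auto simp: dom_A2_def)
    show "\<And>U. U \<in> X \<Longrightarrow> 1 * (N U)\<^sup>2 \<le> B U U" by (rule k)
    show "\<And>W. W \<in> Dom \<Longrightarrow> B W (A W) + B (A W) W \<le> - c * (N W)\<^sup>2" by (rule dec)
  qed (simp_all add: T gen bform_left[OF B] bform_right[OF B] A_in_X domain_dense c)
  have "(\<lambda>x. 0, \<lambda>x. 0, \<lambda>x. 0, \<lambda>x. 0, \<lambda>x. 0, \<lambda>x. 0, \<lambda>x. 0, \<lambda>x. 0, \<lambda>s x. 0) \<in> X"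
    using L2g_const(1)[OF H10_zero] by (simp add: X_iff H1_mean0_def L2_mean0_iff L2_zero H10_zero H10_H1)
  then have "X \<noteq> {}" by blast
  then show ?thesis by (rule Y.exponential_stability)
qed

end

theorem theorem3p3:
  fixes L \<rho> \<rho>\<^sub>1 \<rho>\<^sub>2 \<rho>\<^sub>3 \<alpha> \<kappa> b \<tau> \<sigma> \<beta> \<gamma> m \<kappa>\<^sub>1 :: real
    and g g' :: "real \<Rightarrow> real"
    and T :: "real \<Rightarrow> state \<Rightarrow> state"
  defines "X \<equiv> energy_space L g"
    and "N \<equiv> energy_norm L \<rho> \<rho>\<^sub>1 \<rho>\<^sub>2 \<rho>\<^sub>3 \<alpha> \<kappa> b \<tau> \<beta> g"
  assumes "L > 0" "\<rho> > 0" "\<rho>\<^sub>1 > 0" "\<rho>\<^sub>2 > 0" "\<rho>\<^sub>3 > 0" "\<alpha> > 0" "\<kappa> > 0" "b > 0"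
    and "\<tau> > 0" "\<sigma> > 0" "\<beta> > 0" "\<gamma> > 0" "m \<noteq> 0"
    and g_integrable: "integrable halfline g"
    and g_C1: "\<And>s. s \<ge> 0 \<Longrightarrow> (g has_real_derivative g' s) (at s within {0..})"
              "continuous_on {0..} g'"
    and g_nonneg: "\<And>s. s \<ge> 0 \<Longrightarrow> g s \<ge> 0"
    and g_nontrivial: "\<exists>s\<ge>0. g s \<noteq> 0"
    and b_tilde: "b - kernel_mass g > 0"
    and g_decay: "\<kappa>\<^sub>1 > 0" "\<And>s. s \<ge> 0 \<Longrightarrow> g' s \<le> - \<kappa>\<^sub>1 * g s"
    and semigroup: "C0_semigroup X N T"
    and generator: "is_generator X N T (dom_A2 L b g) (A2 L \<rho> \<rho>\<^sub>1 \<rho>\<^sub>2 \<rho>\<^sub>3 \<alpha> \<kappa> b \<tau> \<sigma> \<beta> \<gamma> m g)"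
  shows "\<exists>M \<omega>. M > 0 \<and> \<omega> > 0 \<and> (\<forall>t\<ge>0. operator_norm X N (T t) \<le> M * exp (- \<omega> * t))"
proof -
  interpret beam g g' \<kappa>\<^sub>1 L \<rho> \<rho>\<^sub>1 \<rho>\<^sub>2 \<rho>\<^sub>3 \<alpha> \<kappa> b \<tau> \<sigma> \<beta> \<gamma> m
    by unfold_locales (use assms in auto)
  show ?thesis
    using stability[of T] semigroup generator unfolding X_def N_def by blast
qed

end
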